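(* Let $\Lambda_0$ be the weak fan functional constructed (from the relativised constructible hierarchy) in the context, and let $G$ be a total, hyperarithmetical functional of type 2. Then for every $k$, $\Lambda_0(G,k)$ is a finite list of hyperarithmetical functions. Indeed, there is a partial functional $\Lambda^-\subseteq\Lambda_0$ that is computable in $\exists^2$ and that terminates on all total $G$ computable in $\exists^2$.
   Context: The metatheory is $\textsf{ZFC}$; "computable" means Kleene S1–S9 computable. $\exists^2:\mathbb{N}^{\mathbb{N}}\to\{0,1\}$ satisfies $\exists^2(f)=0$ iff $(\exists n)(f(n)=0)$. A function $f:\mathbb{N}\to\mathbb{N}$ is hyperarithmetical if its graph is (lightface) $\Delta^1_1$ (equivalently $f$ is computable in $\exists^2$); a total functional $G$ of type 2 (from $\mathbb{N}^{\mathbb{N}}$ to $\mathbb{N}$) is hyperarithmetical if the relation $G(f)=n$ is (lightface) $\Delta^1_1$ (equivalently $G$ is computable in $\exists^2$). For $f\in2^{\mathbb{N}}$, $\overline{f}N=\langle f(0),\dots,f(N-1)\rangle$, $C_\sigma$ is the set of $g\in2^{\mathbb{N}}$ extending the finite binary sequence $\sigma$, and $\mathbf{m}$ is the coin-toss measure on $2^{\mathbb{N}}$. For a type 2 functional $G$, $L_\alpha[G]$ is level $\alpha$ of Gödel's constructible hierarchy relativised to $G$, where a symbol for the functional $G$ is added to the language of set theory (interpreted at level $\alpha$ as $G$ restricted to the functions in $L_\alpha[G]$). The functional $\Lambda_0$ is defined as follows: given $G$ and $k$, find the least ordinal $\alpha$ such that $\mathbf{m}\big(\bigcup_{f\in L_\alpha[G]\cap2^{\mathbb{N}}}C_{\overline{f}G(f)}\big)>1-\frac{1}{2^k}$,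 and then use the canonical $G$-definable well-ordering of $L_\alpha[G]$ to select a finite list $\Lambda_0(G,k)$ of such $f$'s for which the union of the corresponding neighbourhoods $C_{\overline{f}G(f)}$ still has measure $>1-\frac1{2^k}$. (Thus $\Lambda_0$ is a weak fan functional: $\mathbf{m}\big(\bigcup_{g\in\Lambda_0(G,k)}C_{\overline{g}G(g)}\big)\geq1-2^{-k}$ for all $G,k$.) *)

theory Defs
  imports
    "HOL-Probability.Probability"
    "HOL-Library.Countable_Set_Type"
    "HOL-Library.Nat_Bijection"
begin

type_synonym type1 = "nat \<Rightarrow> nat"
type_synonym type2 = "type1 \<Rightarrow> nat"

section \<open>Kleene computability\<close>

text \<open>
  Kleene's schemes S1--S9 for arguments of types 0, 1 and 2, where
  \<open>Kleene e as fs Fs c\<close> means \<open>{e}(as, fs, Fs) \<simeq> c\<close>.  Arguments are grouped by type, in the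
  manner of Kleene; S6 permutes the arguments of one type.  Kleene's indices also record
  the signature of the argument list.  Here the lists carry it, except in S9, where the
  index says which initial parts of the three lists are passed on.
\<close>

inductive Kleene :: "nat \<Rightarrow> nat list \<Rightarrow> type1 list \<Rightarrow> type2 list \<Rightarrow> nat \<Rightarrow> bool" where
  S1: "Kleene (list_encode [1]) (x # as) fs Fs (Suc x)"
| S2: "Kleene (list_encode [2, q]) as fs Fs q"
| S3: "Kleene (list_encode [3]) (x # as) fs Fs x"
| S4: "Kleene h as fs Fs b \<Longrightarrow> Kleene g (b # as) fs Fs c
        \<Longrightarrow> Kleene (list_encode [4, g, h]) as fs Fs c"
| S5_zero: "Kleene g as fs Fs c
        \<Longrightarrow> Kleene (list_encode [5, g, h]) (0 # as) fs Fs c"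
| S5_Suc: "Kleene (list_encode [5, g, h]) (x # as) fs Fs b \<Longrightarrow> Kleene h (x # b # as) fs Fs c
        \<Longrightarrow> Kleene (list_encode [5, g, h]) (Suc x # as) fs Fs c"
| S6_0: "k < length as \<Longrightarrow> Kleene g (as ! k # take k as @ drop (Suc k) as) fs Fs c
        \<Longrightarrow> Kleene (list_encode [6, 0, k, g]) as fs Fs c"
| S6_1: "k < length fs \<Longrightarrow> Kleene g as (fs ! k # take k fs @ drop (Suc k) fs) Fs c
        \<Longrightarrow> Kleene (list_encode [6, 1, k, g]) as fs Fs c"
| S6_2: "k < length Fs \<Longrightarrow> Kleene g as fs (Fs ! k # take k Fs @ drop (Suc k) Fs) c
        \<Longrightarrow> Kleene (list_encode [6, 2, k, g]) as fs Fs c"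
| S7: "Kleene (list_encode [7]) (x # as) (f # fs) Fs (f x)"
| S8: "(\<And>x. Kleene h (x # as) fs (F # Fs) (u x))
        \<Longrightarrow> Kleene (list_encode [8, h]) as fs (F # Fs) (F u)"
| S9: "p \<le> length as \<Longrightarrow> q \<le> length fs \<Longrightarrow> r \<le> length Fs
        \<Longrightarrow> Kleene e (take p as) (take q fs) (take r Fs) c
        \<Longrightarrow> Kleene (list_encode [9, p, q, r]) (e # as) fs Fs c"

definition E2 :: type2 where
  "E2 f = (if \<exists>n. f n = 0 then 0 else 1)"

definition type2_computable_in_E2 :: "type2 \<Rightarrow> bool" where
  "type2_computable_in_E2 G \<longleftrightarrow> (\<exists>e. \<forall>f. Kleene e [] [f] [E2] (G f))"

text \<open>A finite list of functions as a single object of type 1: its length, then its entries.\<close>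

definition code_list :: "type1 list \<Rightarrow> type1" where
  "code_list fs n = (case n of 0 \<Rightarrow> length fs
     | Suc m \<Rightarrow> (let (i, j) = prod_decode m in if i < length fs then (fs ! i) j else 0))"

text \<open>
  A partial functional is computable in \<open>E2\<close> if one index computes its value where it is
  defined and diverges (for some argument of the type 1 value) where it is not.
\<close>

definition partial_computable_in_E2 :: "(type2 \<Rightarrow> nat \<Rightarrow> type1 list option) \<Rightarrow> bool" where
  "partial_computable_in_E2 \<Phi> \<longleftrightarrow> (\<exists>e. \<forall>G k.
     (case \<Phi> G k of
        Some fs \<Rightarrow> \<forall>n. Kleene e [n, k] [] [E2, G] (code_list fs n)
      | None \<Rightarrow> \<exists>n. \<nexists>c. Kleene e [n, k] [] [E2, G] c))"

section \<open>Lightface analytical relations\<close>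

text \<open>Formulas of arithmetic with function variables; number quantifiers use de Bruijn indices.\<close>

datatype ar_term = NVar nat | Zero | Succ ar_term | Plus ar_term ar_term
  | Times ar_term ar_term | FApp nat ar_term

datatype ar_form = ArEq ar_term ar_term | ArNot ar_form | ArAnd ar_form ar_form | ArAll ar_form

primrec ar_eval :: "nat list \<Rightarrow> type1 list \<Rightarrow> ar_term \<Rightarrow> nat" where
  "ar_eval ns fs (NVar i) = ns ! i"
| "ar_eval ns fs Zero = 0"
| "ar_eval ns fs (Succ t) = Suc (ar_eval ns fs t)"
| "ar_eval ns fs (Plus s t) = ar_eval ns fs s + ar_eval ns fs t"
| "ar_eval ns fs (Times s t) = ar_eval ns fs s * ar_eval ns fs t"
| "ar_eval ns fs (FApp i t) = (fs ! i) (ar_eval ns fs t)"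

primrec ar_sat :: "ar_form \<Rightarrow> nat list \<Rightarrow> type1 list \<Rightarrow> bool" where
  "ar_sat (ArEq s t) ns fs \<longleftrightarrow> ar_eval ns fs s = ar_eval ns fs t"
| "ar_sat (ArNot \<phi>) ns fs \<longleftrightarrow> \<not> ar_sat \<phi> ns fs"
| "ar_sat (ArAnd \<phi> \<psi>) ns fs \<longleftrightarrow> ar_sat \<phi> ns fs \<and> ar_sat \<psi> ns fs"
| "ar_sat (ArAll \<phi>) ns fs \<longleftrightarrow> (\<forall>n. ar_sat \<phi> (n # ns) fs)"

primrec ar_term_ok :: "nat \<Rightarrow> nat \<Rightarrow> ar_term \<Rightarrow> bool" where
  "ar_term_ok a b (NVar i) \<longleftrightarrow> i < a"
| "ar_term_ok a b Zero \<longleftrightarrow> True"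
| "ar_term_ok a b (Succ t) \<longleftrightarrow> ar_term_ok a b t"
| "ar_term_ok a b (Plus s t) \<longleftrightarrow> ar_term_ok a b s \<and> ar_term_ok a b t"
| "ar_term_ok a b (Times s t) \<longleftrightarrow> ar_term_ok a b s \<and> ar_term_ok a b t"
| "ar_term_ok a b (FApp i t) \<longleftrightarrow> i < b \<and> ar_term_ok a b t"

text \<open>At most the first \<open>a\<close> number variables and the first \<open>b\<close> function variables are free.\<close>

primrec ar_form_ok :: "ar_form \<Rightarrow> nat \<Rightarrow> nat \<Rightarrow> bool" where
  "ar_form_ok (ArEq s t) a b \<longleftrightarrow> ar_term_ok a b s \<and> ar_term_ok a b t"
| "ar_form_ok (ArNot \<phi>) a b \<longleftrightarrow> ar_form_ok \<phi> a b"
| "ar_form_ok (ArAnd \<phi> \<psi>) a b \<longleftrightarrow> ar_form_ok \<phi> a b \<and> ar_form_ok \<psi> a b"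
| "ar_form_ok (ArAll \<phi>) a b \<longleftrightarrow> ar_form_ok \<phi> (Suc a) b"

text \<open>Relations on \<open>\<nat>\<^sup>a \<times> (\<nat>\<^sup>\<nat>)\<^sup>b\<close>, given on lists of lengths \<open>a\<close> and \<open>b\<close>.\<close>

definition Sigma11 :: "nat \<Rightarrow> nat \<Rightarrow> (nat list \<Rightarrow> type1 list \<Rightarrow> bool) \<Rightarrow> bool" where
  "Sigma11 a b R \<longleftrightarrow> (\<exists>\<phi>. ar_form_ok \<phi> a (Suc b) \<and>
     (\<forall>ns fs. length ns = a \<longrightarrow> length fs = b \<longrightarrow>
        (R ns fs \<longleftrightarrow> (\<exists>h. ar_sat \<phi> ns (h # fs)))))"

definition Pi11 :: "nat \<Rightarrow> nat \<Rightarrow> (nat list \<Rightarrow> type1 list \<Rightarrow> bool) \<Rightarrow> bool" where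
  "Pi11 a b R \<longleftrightarrow> Sigma11 a b (\<lambda>ns fs. \<not> R ns fs)"

definition Delta11 :: "nat \<Rightarrow> nat \<Rightarrow> (nat list \<Rightarrow> type1 list \<Rightarrow> bool) \<Rightarrow> bool" where
  "Delta11 a b R \<longleftrightarrow> Sigma11 a b R \<and> Pi11 a b R"

definition hyperarithmetical :: "type1 \<Rightarrow> bool" where
  "hyperarithmetical f \<longleftrightarrow> Delta11 2 0 (\<lambda>ns fs. f (ns ! 0) = ns ! 1)"

definition hyperarithmetical2 :: "type2 \<Rightarrow> bool" where
  "hyperarithmetical2 G \<longleftrightarrow> Delta11 1 1 (\<lambda>ns fs. G (fs ! 0) = ns ! 0)"

section \<open>Neighbourhoods and the coin-toss measure\<close>

definition cantor :: "type1 set" where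
  "cantor = {f. \<forall>n. f n \<in> {0, 1}}"

definition initial :: "type1 \<Rightarrow> nat \<Rightarrow> nat list" where
  "initial f N = map f [0..<N]"

definition cylinder :: "nat list \<Rightarrow> type1 set" where
  "cylinder \<sigma> = {g \<in> cantor. initial g (length \<sigma>) = \<sigma>}"

definition coin_toss :: "type1 measure" where
  "coin_toss = (\<Pi>\<^sub>M n\<in>UNIV. uniform_count_measure {0, 1})"

definition covered :: "type2 \<Rightarrow> type1 set \<Rightarrow> type1 set" where
  "covered G A = (\<Union>f\<in>A. cylinder (initial f (G f)))"

section \<open>The constructible hierarchy relative to a functional of type 2\<close>

text \<open>
  The hereditarily countable sets.  They contain all countable ordinals and all \<open>L\<^sub>\<alpha>[G]\<close>
  with \<open>\<alpha>\<close> countable.  This suffices for \<open>\<Lambda>\<^sub>0\<close>: by condensation every element of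
  \<open>2\<^sup>\<nat>\<close> that is in some \<open>L\<^sub>\<alpha>[G]\<close> is in one with \<open>\<alpha>\<close> countable (the transitive collapse
  does not move functions on \<open>\<nat>\<close>, and so respects \<open>G\<close>), and finitely many neighbourhoods
  are enough to exceed the bound \<open>1 - 2\<^sup>-\<^sup>k\<close>; hence the least ordinal in the definition
  of \<open>\<Lambda>\<^sub>0\<close> is countable.
\<close>

datatype hset = HSet (members: "hset cset")

definition elts :: "hset \<Rightarrow> hset set" where
  "elts x = rcset (members x)"

definition ordinal :: "hset \<Rightarrow> bool" where
  "ordinal \<alpha> \<longleftrightarrow> (\<forall>\<beta>\<in>elts \<alpha>. elts \<beta> \<subseteq> elts \<alpha> \<and> (\<forall>\<gamma>\<in>elts \<beta>. elts \<gamma> \<subseteq> elts \<beta>))"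

primrec hnat :: "nat \<Rightarrow> hset" where
  "hnat 0 = HSet cempty"
| "hnat (Suc n) = HSet (cinsert (hnat n) (members (hnat n)))"

definition hpair :: "hset \<Rightarrow> hset \<Rightarrow> hset" where
  "hpair x y = HSet (cinsert (HSet (csingle x)) (csingle (HSet (cinsert x (csingle y)))))"

definition hfun :: "type1 \<Rightarrow> hset" where
  "hfun f = HSet (acset (range (\<lambda>n. hpair (hnat n) (hnat (f n)))))"

text \<open>
  The language of set theory with a symbol for \<open>G\<close>: \<open>StG i j\<close> stands for \<open>G(v\<^sub>i) = v\<^sub>j\<close>,
  so the symbol denotes the (graph of the) restriction of \<open>G\<close> to the functions in the
  structure.
\<close>

datatype st_form = StMem nat nat | StEq nat nat | StG nat nat
  | StNot st_form | StAnd st_form st_form | StAll st_form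

primrec st_sat :: "type2 \<Rightarrow> hset set \<Rightarrow> st_form \<Rightarrow> hset list \<Rightarrow> bool" where
  "st_sat G M (StMem i j) xs \<longleftrightarrow> xs ! i \<in> elts (xs ! j)"
| "st_sat G M (StEq i j) xs \<longleftrightarrow> xs ! i = xs ! j"
| "st_sat G M (StG i j) xs \<longleftrightarrow> (\<exists>f. xs ! i = hfun f \<and> xs ! j = hnat (G f))"
| "st_sat G M (StNot \<phi>) xs \<longleftrightarrow> \<not> st_sat G M \<phi> xs"
| "st_sat G M (StAnd \<phi> \<psi>) xs \<longleftrightarrow> st_sat G M \<phi> xs \<and> st_sat G M \<psi> xs"
| "st_sat G M (StAll \<phi>) xs \<longleftrightarrow> (\<forall>x\<in>M. st_sat G M \<phi> (x # xs))"

primrec st_form_ok :: "st_form \<Rightarrow> nat \<Rightarrow> bool" where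
  "st_form_ok (StMem i j) a \<longleftrightarrow> i < a \<and> j < a"
| "st_form_ok (StEq i j) a \<longleftrightarrow> i < a \<and> j < a"
| "st_form_ok (StG i j) a \<longleftrightarrow> i < a \<and> j < a"
| "st_form_ok (StNot \<phi>) a \<longleftrightarrow> st_form_ok \<phi> a"
| "st_form_ok (StAnd \<phi> \<psi>) a \<longleftrightarrow> st_form_ok \<phi> a \<and> st_form_ok \<psi> a"
| "st_form_ok (StAll \<phi>) a \<longleftrightarrow> st_form_ok \<phi> (Suc a)"

primrec goedel :: "st_form \<Rightarrow> nat" where
  "goedel (StMem i j) = list_encode [0, i, j]"
| "goedel (StEq i j) = list_encode [1, i, j]"
| "goedel (StG i j) = list_encode [2, i, j]"
| "goedel (StNot \<phi>) = list_encode [3, goedel \<phi>]"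
| "goedel (StAnd \<phi> \<psi>) = list_encode [4, goedel \<phi>, goedel \<psi>]"
| "goedel (StAll \<phi>) = list_encode [5, goedel \<phi>]"

definition defined_by :: "type2 \<Rightarrow> hset set \<Rightarrow> st_form \<Rightarrow> hset list \<Rightarrow> hset \<Rightarrow> bool" where
  "defined_by G M \<phi> ps x \<longleftrightarrow> set ps \<subseteq> M \<and> st_form_ok \<phi> (Suc (length ps)) \<and>
     elts x = {y \<in> M. st_sat G M \<phi> (y # ps)}"

definition Def :: "type2 \<Rightarrow> hset set \<Rightarrow> hset set" where
  "Def G M = {x. \<exists>\<phi> ps. defined_by G M \<phi> ps x}"

text \<open>
  \<open>L\<^sub>\<alpha>[G]\<close> is the union of \<open>Def G (L\<^sub>\<beta>[G])\<close> over all \<open>\<beta> < \<alpha>\<close>, which covers zero,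
  successor and limit stages.
\<close>

primrec L :: "type2 \<Rightarrow> hset \<Rightarrow> hset set" where
  "L G (HSet A) = \<Union> (Def G ` rcset (cimage (L G) A))"

text \<open>
  The canonical well-ordering (strict): sets are ordered by the stage \<open>\<beta>\<close> with
  \<open>x \<in> L\<^sub>\<beta>\<^sub>+\<^sub>1[G] - L\<^sub>\<beta>[G]\<close>, and within a stage by their least definition over \<open>L\<^sub>\<beta>[G]\<close>.
  Definitions are compared by the Goedel number of the formula, then by the tuple of
  parameters (by length, then lexicographically, in the ordering \<open>r\<close> of \<open>L\<^sub>\<beta>[G]\<close>).
\<close>

definition earlier_definition :: "type2 \<Rightarrow> hset set \<Rightarrow> hset rel \<Rightarrow> hset \<Rightarrow> hset \<Rightarrow> bool" where
  "earlier_definition G M r x y \<longleftrightarrow>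
     (\<exists>\<phi> ps. defined_by G M \<phi> ps x \<and> (\<forall>\<psi> qs. defined_by G M \<psi> qs y \<longrightarrow>
        ((goedel \<phi>, ps), (goedel \<psi>, qs)) \<in> less_than <*lex*> lenlex r))"

definition next_order :: "type2 \<Rightarrow> hset set \<Rightarrow> hset rel \<Rightarrow> hset rel" where
  "next_order G M r = {(x, y). y \<in> Def G M - M \<and>
     (x \<in> M \<or> x \<in> Def G M - M \<and> earlier_definition G M r x y)}"

primrec L_order :: "type2 \<Rightarrow> hset \<Rightarrow> hset rel" where
  "L_order G (HSet A) =
     (\<Union>(M, r) \<in> rcset (cimage (\<lambda>\<beta>. (L G \<beta>, L_order G \<beta>)) A). next_order G M r)"

lemma L_eq: "L G \<alpha> = (\<Union>\<beta>\<in>elts \<alpha>. Def G (L G \<beta>))"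
  by (cases \<alpha>) (simp add: elts_def cimage.rep_eq)

lemma L_order_eq: "L_order G \<alpha> = (\<Union>\<beta>\<in>elts \<alpha>. next_order G (L G \<beta>) (L_order G \<beta>))"
  by (cases \<alpha>) (simp add: elts_def cimage.rep_eq)

section \<open>The functional\<close>

definition binary_functions :: "type2 \<Rightarrow> hset \<Rightarrow> type1 set" where
  "binary_functions G \<alpha> = {f \<in> cantor. hfun f \<in> L G \<alpha>}"

definition large :: "type2 \<Rightarrow> nat \<Rightarrow> type1 set \<Rightarrow> bool" where
  "large G k A \<longleftrightarrow> measure coin_toss (covered G A) > 1 - 1 / 2 ^ k"

definition stage :: "type2 \<Rightarrow> nat \<Rightarrow> hset" where
  "stage G k = (THE \<alpha>. ordinal \<alpha> \<and> large G k (binary_functions G \<alpha>) \<and>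
     (\<forall>\<beta>\<in>elts \<alpha>. \<not> large G k (binary_functions G \<beta>)))"

text \<open>
  The list selected is the first suitable one in the well-ordering that the canonical
  well-ordering induces on finite lists (by length, then lexicographically).
\<close>

definition suitable :: "type2 \<Rightarrow> nat \<Rightarrow> type1 list \<Rightarrow> bool" where
  "suitable G k fs \<longleftrightarrow> set fs \<subseteq> binary_functions G (stage G k) \<and> large G k (set fs)"

definition Lambda0 :: "type2 \<Rightarrow> nat \<Rightarrow> type1 list" where
  "Lambda0 G k = (THE fs. suitable G k fs \<and>
     (\<forall>gs. suitable G k gs \<longrightarrow> gs = fs \<or>
        (fs, gs) \<in> lenlex (inv_image (L_order G (stage G k)) hfun)))"

end

theory Submission
  imports Defs
begin

text \<open>
  Let \<open>G\<close> be \<open>\<Delta>\<^sup>1\<^sub>1\<close>.  The attempts to witness \<open>G f \<noteq> n\<close> form a tree that is well-founded iff \<open>G f = n\<close>, and pairing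
  them with the attempts to witness \<open>G f = n\<close> gives a single arithmetical well-founded relation \<open>B\<close> that bounds
  all these ranks.  The measures of the sets of \<open>f\<close> with a bound on the rank are computed by arithmetical
  recursion along \<open>B\<close>, and a compactness argument selects, arithmetically in this recursion, members of
  every set \<open>{f. G f = n}\<close> of positive measure.  Hence the level of the constructible hierarchy at the
  rank of some arithmetical well-founded relation already contains a large set of functions.

  A program with \<open>E2\<close> and \<open>G\<close> handles ordinals as notations, programs that enumerate subtrees, and elements
  of a level as names, on which truth is decided by recursion on the notation.  It must find a large notation
  without being able to decide well-foundedness.  It therefore searches the trees of all
  arithmetical relations simultaneously: the notation built from the results for all tuples of children is
  compared with the roots, and trees shown to be too low to be large are dropped.  The recursion is
  along a tree that is well-founded and large, so it converges to a large notation.  To be correct on every \<open>G\<close> on which it converges, the program finally checks that the notation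
  found is well-founded, descends to the least large level and selects the list there.

  Conversely, the set of computations relative to \<open>E2\<close> and a \<open>\<Delta>\<^sup>1\<^sub>1\<close> functional is the least set closed under
  the schemes, and total functions computable in these are \<open>\<Delta>\<^sup>1\<^sub>1\<close>, because any single-valued closed set may be
  used in place of the least one.
\<close>

section \<open>Arithmetical operators on functions, the common language of everything that
  follows\<close>

section \<open>Arithmetical functionals\<close>

text \<open>The program is given \<open>G\<close> as an oracle only. It has no index of
  \<open>G\<close>, so it cannot know which arithmetical relation is high enough, yet one program
  must serve all \<open>G\<close>. The search is governed by an invariant (\<open>VV\<close>): the
  result for a tuple is large, or it bounds the rank of some node of the tuple without bounding the
  root of that tree. For the empty tuple the second alternative is void. That one of the trees works
  combines two classical facts: bounding for \<open>Delta11\<close> sets, and the basis theorem of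
  Sacks and Tanaka, by which sets such as \<open>{f. G f = n}\<close> have hyperarithmetical members
  when their measure is positive. All comparisons of rank are made by simulation, without ordinals
  as values; the recursion for the measures is therefore a recursion on numbers that a level of the
  hierarchy can carry out. Arithmetical operators take the place of recursive ones throughout,
  because \<open>E2\<close> evaluates number quantifiers.\<close>

abbreviation pr :: "nat \<Rightarrow> nat \<Rightarrow> nat" where
  "pr x y \<equiv> prod_encode (x, y)"

syntax "_pr" :: "nat \<Rightarrow> tuple_args \<Rightarrow> nat" ("<|_,/ _|>")
translations
  "<|x, y|>" \<rightleftharpoons> "CONST pr x y"
  "_pr x (_tuple_args y z)" \<rightleftharpoons> "_pr x (_tuple_arg (_pr y z))"

definition pfst :: "nat \<Rightarrow> nat" where "pfst x = fst (prod_decode x)"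
definition psnd :: "nat \<Rightarrow> nat" where "psnd x = snd (prod_decode x)"

lemma pfst_pr [simp]: "pfst <|x, y|> = x" and psnd_pr [simp]: "psnd <|x, y|> = y"
  by (simp_all add: pfst_def psnd_def)

lemma pr_pfst_psnd [simp]: "<|pfst x, psnd x|> = x"
  by (simp add: pfst_def psnd_def)

lemma pfst_0 [simp]: "pfst 0 = 0" and psnd_0 [simp]: "psnd 0 = 0"
  by (simp_all add: pfst_def psnd_def prod_decode_def prod_decode_aux.simps)

text \<open>Unbounded search made total by the default 0. As a scheme it yields number quantifiers,
  which is why the class below consists of arithmetical rather than recursive operators.\<close>

definition mu :: "(nat \<Rightarrow> bool) \<Rightarrow> nat" where
  "mu P = (if \<exists>n. P n then LEAST n. P n else 0)"

lemma mu_works: "P n \<Longrightarrow> P (mu P)"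
  by (auto simp: mu_def intro: LeastI)

lemma mu_eq: "P n \<Longrightarrow> (\<And>m. P m \<Longrightarrow> m = n) \<Longrightarrow> mu P = n"
  by (metis mu_works)

lemma mu_least: "P n \<Longrightarrow> mu P \<le> n"
  by (auto simp: mu_def intro: Least_le)

text \<open>The reals arithmetical in \<open>h\<close>, uniformly; the number arguments are coded by one number.\<close>

inductive ar :: "(type1 \<Rightarrow> nat \<Rightarrow> nat) \<Rightarrow> bool" where
  id: "ar (\<lambda>h x. x)"
| zero: "ar (\<lambda>h x. 0)"
| suc: "ar (\<lambda>h x. Suc x)"
| pfst: "ar (\<lambda>h x. pfst x)"
| psnd: "ar (\<lambda>h x. psnd x)"
| orc: "ar (\<lambda>h x. h x)"
| comp: "ar F \<Longrightarrow> ar G \<Longrightarrow> ar (\<lambda>h x. F h (G h x))"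
| pair: "ar F \<Longrightarrow> ar G \<Longrightarrow> ar (\<lambda>h x. <|F h x, G h x|>)"
| rec: "ar A \<Longrightarrow> ar S \<Longrightarrow>
    ar (\<lambda>h x. rec_nat (A h (psnd x)) (\<lambda>i r. S h <|i, r, psnd x|>) (pfst x))"
| least: "ar F \<Longrightarrow> ar (\<lambda>h x. mu (\<lambda>n. F h <|n, x|> = 0))"

definition arp :: "(type1 \<Rightarrow> nat \<Rightarrow> bool) \<Rightarrow> bool" where
  "arp P \<longleftrightarrow> ar (\<lambda>h x. if P h x then 0 else 1)"

named_theorems ar_intros

lemma ar_id' [ar_intros]: "ar (\<lambda>h x. x)"
  by (rule ar.id)

lemma ar_const [ar_intros]: "ar (\<lambda>h x. c)"
proof (induction c)
  case (Suc c)
  show ?case using ar.comp[OF ar.suc Suc] .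
qed (rule ar.zero)

lemma ar_Suc [ar_intros]: "ar A \<Longrightarrow> ar (\<lambda>h x. Suc (A h x))"
  by (rule ar.comp[OF ar.suc])

lemma ar_pfst [ar_intros]: "ar A \<Longrightarrow> ar (\<lambda>h x. pfst (A h x))"
  by (rule ar.comp[OF ar.pfst])

lemma ar_psnd [ar_intros]: "ar A \<Longrightarrow> ar (\<lambda>h x. psnd (A h x))"
  by (rule ar.comp[OF ar.psnd])

lemma ar_orc [ar_intros]: "ar A \<Longrightarrow> ar (\<lambda>h x. h (A h x))"
  by (rule ar.comp[OF ar.orc])

lemma ar_pr [ar_intros]: "ar A \<Longrightarrow> ar B \<Longrightarrow> ar (\<lambda>h x. <|A h x, B h x|>)"
  by (rule ar.pair)

text \<open>The step premise is uncurried: the bound variables \<open>i\<close> and \<open>r\<close>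
  are read off the coded argument, so that \<open>intro ar_intros\<close> can descend under a
  binder. The later rules for binding constructs have the same form.\<close>

lemma ar_rec [ar_intros]:
  assumes "ar N" "ar A" "ar (\<lambda>h x. S (pfst x) (pfst (psnd x)) h (psnd (psnd x)))"
  shows "ar (\<lambda>h x. rec_nat (A h x) (\<lambda>i r. S i r h x) (N h x))"
  using ar.comp[OF ar.rec[OF assms(2,3)] ar.pair[OF assms(1) ar.id]] by simp

lemma arp_comp: "arp P \<Longrightarrow> ar A \<Longrightarrow> arp (\<lambda>h x. P h (A h x))"
  unfolding arp_def by (drule (1) ar.comp)

lemma ar_mu [ar_intros]:
  assumes "arp (\<lambda>h x. P (pfst x) h (psnd x))"
  shows "ar (\<lambda>h x. mu (\<lambda>n. P n h x))"
proof -
  have *: "(if b then 0 else 1 :: nat) = 0 \<longleftrightarrow> b" for b by simp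
  show ?thesis using ar.least[OF assms[unfolded arp_def]] by (simp only: * pfst_pr psnd_pr)
qed

text \<open>Recursion with the truth value as its length: zero steps leave \<open>A\<close>, one
  step overwrites it by \<open>B\<close>.\<close>

lemma ar_If [ar_intros]:
  assumes "arp P" "ar A" "ar B"
  shows "ar (\<lambda>h x. if P h x then A h x else B h x)"
proof -
  have "ar (\<lambda>h x. rec_nat (A h x) (\<lambda>i r. B h x) (if P h x then 0 else 1))"
    by (rule ar_rec[OF assms(1)[unfolded arp_def] assms(2)]) (rule ar.comp[OF assms(3)], intro ar_intros)
  moreover have "rec_nat (A h x) (\<lambda>i r. B h x) (if P h x then 0 else 1)
      = (if P h x then A h x else B h x)" for h x by simp
  ultimately show ?thesis by simp
qed

lemma ar_pred: "ar A \<Longrightarrow> ar (\<lambda>h x. A h x - 1)"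
proof -
  assume "ar A"
  then have "ar (\<lambda>h x. rec_nat 0 (\<lambda>i r. i) (A h x))"
    by (intro ar_intros)
  moreover have "rec_nat 0 (\<lambda>i r. i) n = n - 1" for n :: nat
    by (cases n) auto
  ultimately show ?thesis by simp
qed

lemma ar_minus [ar_intros]:
  assumes "ar A" "ar B"
  shows "ar (\<lambda>h x. A h x - B h x)"
proof -
  have *: "rec_nat a (\<lambda>i r. r - 1) b = a - b" for a b :: nat
    by (induction b) auto
  have "ar (\<lambda>h x. rec_nat (A h x) (\<lambda>i r. r - 1) (B h x))"
    by (intro ar_intros assms ar_pred)
  then show ?thesis by (simp only: *)
qed

lemma ar_plus [ar_intros]:
  assumes "ar A" "ar B"
  shows "ar (\<lambda>h x. A h x + B h x)"
proof -
  have *: "rec_nat a (\<lambda>i r. Suc r) b = a + b" for a b :: nat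
    by (induction b) auto
  have "ar (\<lambda>h x. rec_nat (A h x) (\<lambda>i r. Suc r) (B h x))"
    by (intro ar_intros assms)
  then show ?thesis by (simp only: *)
qed

lemma ar_times [ar_intros]:
  assumes "ar A" "ar B"
  shows "ar (\<lambda>h x. A h x * B h x)"
proof -
  have *: "rec_nat 0 (\<lambda>i r. r + a) b = a * b" for a b :: nat
    by (induction b) auto
  have "ar (\<lambda>h x. rec_nat 0 (\<lambda>i r. r + A h x) (B h x))"
    by (intro ar_intros assms ar.comp[OF assms(1)])
  then show ?thesis by (simp only: *)
qed

lemma ar_power [ar_intros]:
  assumes "ar A" "ar B"
  shows "ar (\<lambda>h x. A h x ^ B h x)"
proof -
  have *: "rec_nat 1 (\<lambda>i r. r * a) b = a ^ b" for a b :: nat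
    by (induction b) auto
  have "ar (\<lambda>h x. rec_nat 1 (\<lambda>i r. r * A h x) (B h x))"
    by (intro ar_intros assms ar.comp[OF assms(1)])
  then show ?thesis by (simp only: *)
qed

lemma arpI: "ar F \<Longrightarrow> (\<And>h x. P h x \<longleftrightarrow> F h x = 0) \<Longrightarrow> arp P"
proof -
  assume F: "ar F" and P: "\<And>h x. P h x \<longleftrightarrow> F h x = 0"
  have *: "rec_nat 0 (\<lambda>i r. 1) n = (if n = 0 then 0 else 1)" for n :: nat
    by (cases n) auto
  have "ar (\<lambda>h x. rec_nat 0 (\<lambda>i r. 1) (F h x))"
    by (intro ar_intros F)
  then show "arp P" by (simp only: arp_def * P)
qed

lemma arp_ar: "arp P \<Longrightarrow> ar (\<lambda>h x. if P h x then 0 else 1)"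
  by (simp add: arp_def)

lemma arp_eq [ar_intros]: "ar A \<Longrightarrow> ar B \<Longrightarrow> arp (\<lambda>h x. A h x = B h x)"
  by (rule arpI[where F = "\<lambda>h x. (A h x - B h x) + (B h x - A h x)"]) (intro ar_intros, auto)

lemma arp_le [ar_intros]: "ar A \<Longrightarrow> ar B \<Longrightarrow> arp (\<lambda>h x. A h x \<le> B h x)"
  by (rule arpI[where F = "\<lambda>h x. A h x - B h x"]) (intro ar_intros, auto)

lemma arp_less [ar_intros]: "ar A \<Longrightarrow> ar B \<Longrightarrow> arp (\<lambda>h x. A h x < B h x)"
  by (rule arpI[where F = "\<lambda>h x. Suc (A h x) - B h x"]) (intro ar_intros, auto)

lemma arp_not [ar_intros]: "arp P \<Longrightarrow> arp (\<lambda>h x. \<not> P h x)"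
  by (rule arpI[where F = "\<lambda>h x. if P h x then 1 else 0"]) (intro ar_intros, auto)

lemma arp_conj [ar_intros]: "arp P \<Longrightarrow> arp Q \<Longrightarrow> arp (\<lambda>h x. P h x \<and> Q h x)"
  by (rule arpI[where F = "\<lambda>h x. (if P h x then 0 else 1) + (if Q h x then 0 else 1)"])
    (intro ar_intros, auto)

lemma arp_disj [ar_intros]: "arp P \<Longrightarrow> arp Q \<Longrightarrow> arp (\<lambda>h x. P h x \<or> Q h x)"
  by (rule arpI[where F = "\<lambda>h x. if P h x then 0 else if Q h x then 0 else 1"])
    (intro ar_intros, auto)

lemma arp_imp [ar_intros]: "arp P \<Longrightarrow> arp Q \<Longrightarrow> arp (\<lambda>h x. P h x \<longrightarrow> Q h x)"
  by (rule arpI[where F = "\<lambda>h x. if P h x then if Q h x then 0 else 1 else 0"])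
    (intro ar_intros, auto)

lemma arp_If [ar_intros]:
  "arp P \<Longrightarrow> arp Q \<Longrightarrow> arp R \<Longrightarrow> arp (\<lambda>h x. if P h x then Q h x else R h x)"
  by (rule arpI[where F = "\<lambda>h x. if P h x then if Q h x then 0 else 1 else if R h x then 0 else 1"])
    (intro ar_intros, auto)

lemma arp_ex [ar_intros]:
  assumes "arp (\<lambda>h x. P (pfst x) h (psnd x))"
  shows "arp (\<lambda>h x. \<exists>n. P n h x)"
proof (rule arpI)
  show "ar (\<lambda>h x. (\<lambda>h x. if P (pfst x) h (psnd x) then 0 else 1) h <|mu (\<lambda>n. P n h x), x|>)"
    by (rule ar.comp[OF assms[unfolded arp_def]]) (intro ar_intros assms)
qed (auto intro: mu_works)

lemma arp_all [ar_intros]: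
  assumes "arp (\<lambda>h x. P (pfst x) h (psnd x))"
  shows "arp (\<lambda>h x. \<forall>n. P n h x)"
  using arp_not[OF arp_ex[OF arp_not[OF assms]]] by simp

lemma ar_max [ar_intros]: "ar A \<Longrightarrow> ar B \<Longrightarrow> ar (\<lambda>h x. max (A h x) (B h x))"
  unfolding max_def by (intro ar_intros)

lemma ar_div [ar_intros]:
  assumes "ar A" "ar B"
  shows "ar (\<lambda>h x. A h x div B h x)"
proof -
  \<comment> \<open>The disjunct \<open>b = 0\<close> makes the search return 0, the value of
    division by zero.\<close>
  have *: "mu (\<lambda>q. b = 0 \<or> a < Suc q * b) = a div b" for a b :: nat
  proof (cases "b = 0")
    case True
    then show ?thesis using mu_least[of "\<lambda>q. b = 0 \<or> a < Suc q * b" 0] by simp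
  next
    case False
    have 1: "a < Suc (a div b) * b"
      using False by (simp add: dividend_less_div_times)
    then have "a < Suc (mu (\<lambda>q. b = 0 \<or> a < Suc q * b)) * b"
      using mu_works[of "\<lambda>q. b = 0 \<or> a < Suc q * b" "a div b"] False by auto
    then have "a div b \<le> mu (\<lambda>q. b = 0 \<or> a < Suc q * b)"
      using False by (metis div_less_iff_less_mult less_Suc_eq_le neq0_conv)
    then show ?thesis
      using mu_least[of "\<lambda>q. b = 0 \<or> a < Suc q * b" "a div b"] 1 by simp
  qed
  have "ar (\<lambda>h x. mu (\<lambda>q. B h x = 0 \<or> A h x < Suc q * B h x))"
    by (intro ar_intros ar.comp[OF assms(1)] ar.comp[OF assms(2)])
  then show ?thesis by (simp only: *)
qed

lemma ar_mod [ar_intros]: "ar A \<Longrightarrow> ar B \<Longrightarrow> ar (\<lambda>h x. A h x mod B h x)"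
  unfolding minus_mult_div_eq_mod[symmetric] by (intro ar_intros)

lemma ar_sum [ar_intros]:
  assumes "ar N" "ar (\<lambda>h x. f (pfst x) h (psnd x))"
  shows "ar (\<lambda>h x. \<Sum>i<N h x. f i h x)"
proof -
  have *: "rec_nat 0 (\<lambda>i r. r + g i) n = (\<Sum>i<n. g i)" for g :: "nat \<Rightarrow> nat" and n
    by (induction n) auto
  have "ar (\<lambda>h x. rec_nat 0 (\<lambda>i r. r + f i h x) (N h x))"
    by (intro ar_intros assms) (rule ar.comp[OF assms(2), of "\<lambda>h x. <|pfst x, psnd (psnd x)|>", simplified], intro ar_intros)
  then show ?thesis by (simp only: *)
qed

lemma ar_card [ar_intros]:
  assumes "ar N" "arp (\<lambda>h x. P (pfst x) h (psnd x))"
  shows "ar (\<lambda>h x. card {i. i < N h x \<and> P i h x})"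
proof -
  have "(\<Sum>i<n. if Q i then 1 else 0) = card {i. i < n \<and> Q i}" for Q and n :: nat
    by (simp add: sum.If_cases) (metis (no_types, lifting) Collect_cong Collect_conj_eq lessThan_def)
  then show ?thesis
    using ar_sum[OF assms(1), of "\<lambda>i h x. if P i h x then 1 else 0"] ar_If[OF assms(2) ar_const ar_const]
    by simp
qed

text \<open>The substituted operator \<open>U\<close> has a parameter that must survive the changes
  of argument in composition, recursion and search. It is carried as the second component of the
  argument throughout the induction.\<close>

lemma ar_subst_aux: "ar F \<Longrightarrow> ar U \<Longrightarrow> ar (\<lambda>h x. F (\<lambda>y. U h <|y, psnd x|>) (pfst x))"
proof (induction rule: ar.induct)
  case (comp F G)
  show ?case
    using ar.comp[OF comp.IH(1)[OF comp.prems] ar.pair[OF comp.IH(2)[OF comp.prems] ar.psnd]] by simp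
next
  case (rec A S)
  let ?U = "\<lambda>h x y. U h <|y, psnd x|>"
  have "ar (\<lambda>h x. A (?U h x) (psnd (pfst x)))"
    by (rule ar.comp[OF rec.IH(1)[OF rec.prems], of "\<lambda>h x. <|psnd (pfst x), psnd x|>", simplified]) (intro ar_intros)
  moreover have "ar (\<lambda>h x. S (?U h (psnd (psnd x))) <|pfst x, pfst (psnd x), psnd (pfst (psnd (psnd x)))|>)"
    by (rule ar.comp[OF rec.IH(2)[OF rec.prems],
        of "\<lambda>h x. <|<|pfst x, pfst (psnd x), psnd (pfst (psnd (psnd x)))|>, psnd (psnd (psnd x))|>", simplified])
      (intro ar_intros)
  ultimately show ?case
    by (intro ar_intros)
next
  case (least F)
  have "ar (\<lambda>h x. F (\<lambda>y. U h <|y, psnd (psnd x)|>) <|pfst x, pfst (psnd x)|>)"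
    by (rule ar.comp[OF least.IH[OF least.prems], of "\<lambda>h x. <|<|pfst x, pfst (psnd x)|>, psnd (psnd x)|>", simplified])
      (intro ar_intros)
  then show ?case by (intro ar_intros)
next
  case orc
  have "ar (\<lambda>h x. U h <|pfst x, psnd x|>)"
    by (rule ar.comp[OF orc]) (intro ar_intros)
  then show ?case by simp
qed (auto intro!: ar_intros)

lemma ar_subst:
  assumes "ar F" "ar (\<lambda>h x. U (pfst x) h (psnd x))" "ar A"
  shows "ar (\<lambda>h x. F (\<lambda>y. U y h x) (A h x))"
  using ar.comp[OF ar_subst_aux[OF assms(1,2)] ar.pair[OF assms(3) ar.id]] by simp

lemma arp_subst:
  assumes "arp P" "ar (\<lambda>h x. U (pfst x) h (psnd x))" "ar A"
  shows "arp (\<lambda>h x. P (\<lambda>y. U y h x) (A h x))"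
  using ar_subst[OF assms(1)[unfolded arp_def] assms(2,3)] by (simp add: arp_def)

subsection \<open>Coded lists\<close>

text \<open>Truncated subtraction and \<open>pfst 0 = psnd 0 = 0\<close> give the empty list the
  head 0 and itself as tail, so \<open>lnth\<close> is 0 beyond the end of a list.\<close>

definition lhd :: "nat \<Rightarrow> nat" where "lhd l = pfst (l - 1)"
definition ltl :: "nat \<Rightarrow> nat" where "ltl l = psnd (l - 1)"
definition lnth :: "nat \<Rightarrow> nat \<Rightarrow> nat" where "lnth l i = lhd ((ltl ^^ i) l)"
definition llen :: "nat \<Rightarrow> nat" where "llen l = length (list_decode l)"

lemma list_decode_ltl: "list_decode (ltl l) = tl (list_decode l)"
  by (cases l) (simp_all add: ltl_def psnd_def psnd_0[unfolded psnd_def] split: prod.split)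

lemma ltl_funpow: "(ltl ^^ i) l = list_encode (drop i (list_decode l))"
  by (induction i arbitrary: l)
    (simp_all del: funpow.simps add: funpow_Suc_right list_decode_ltl drop_Suc funpow_0)

lemma lnth_eq: "lnth l i = (if i < llen l then list_decode l ! i else 0)"
proof (cases "i < llen l")
  case True
  then have "drop i (list_decode l) = list_decode l ! i # drop (Suc i) (list_decode l)"
    by (simp add: llen_def Cons_nth_drop_Suc)
  then show ?thesis using True by (simp add: lnth_def ltl_funpow lhd_def)
qed (simp add: lnth_def ltl_funpow lhd_def llen_def)

lemma lnth_list_encode [simp]: "i < length xs \<Longrightarrow> lnth (list_encode xs) i = xs ! i"
  by (simp add: lnth_eq llen_def)

lemma llen_list_encode [simp]: "llen (list_encode xs) = length xs"
  by (simp add: llen_def)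

lemma llen_mu: "llen l = mu (\<lambda>i. (ltl ^^ i) l = 0)"
proof -
  have *: "(ltl ^^ i) l = 0 \<longleftrightarrow> llen l \<le> i" for i
    by (metis drop_eq_Nil list_decode_inverse list_encode.simps(1) list_encode_inverse llen_def ltl_funpow)
  show ?thesis
    using mu_works[of "\<lambda>i. llen l \<le> i" "llen l"] mu_least[of "\<lambda>i. llen l \<le> i" "llen l"]
    by (simp add: *)
qed

lemma list_code_eqI: "llen l = llen l' \<Longrightarrow> (\<And>i. i < llen l \<Longrightarrow> lnth l i = lnth l' i) \<Longrightarrow> l = l'"
  by (metis (no_types, lifting) list_decode_inverse llen_def lnth_eq nth_equalityI)

lemma list_encode_map_lnth: "list_encode (map (lnth l) [0..<llen l]) = l"
  by (rule list_code_eqI) auto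

lemma list_decode_map_lnth: "list_decode l = map (lnth l) [0..<llen l]"
  by (metis list_encode_inverse list_encode_map_lnth)

lemma lnth_beyond: "llen l \<le> i \<Longrightarrow> lnth l i = 0"
  by (simp add: lnth_eq)

lemma ar_ltl_funpow:
  assumes "ar A" "ar B"
  shows "ar (\<lambda>h x. (ltl ^^ A h x) (B h x))"
proof -
  have *: "rec_nat l (\<lambda>i r. psnd (r - 1)) n = (ltl ^^ n) l" for l n
    by (induction n) (auto simp: ltl_def)
  have "ar (\<lambda>h x. rec_nat (B h x) (\<lambda>i r. psnd (r - 1)) (A h x))"
    by (intro ar_intros assms)
  then show ?thesis by (simp only: *)
qed

lemma ar_lnth [ar_intros]: "ar A \<Longrightarrow> ar B \<Longrightarrow> ar (\<lambda>h x. lnth (A h x) (B h x))"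
  unfolding lnth_def lhd_def by (intro ar_intros ar_ltl_funpow)

lemma ar_llen [ar_intros]: "ar A \<Longrightarrow> ar (\<lambda>h x. llen (A h x))"
  unfolding llen_mu by (intro ar_intros ar_ltl_funpow) (rule ar.comp, auto intro: ar_intros)

lemma ar_list_encode_map [ar_intros]:
  assumes "ar N" "ar (\<lambda>h x. f (pfst x) h (psnd x))"
  shows "ar (\<lambda>h x. list_encode (map (\<lambda>i. f i h x) [0..<N h x]))"
proof -
  \<comment> \<open>The code is the only number with the right length and entries, so a search finds
    it.\<close>
  have *: "list_encode (map g [0..<n]) = mu (\<lambda>l. llen l = n \<and> (\<forall>i. i < n \<longrightarrow> lnth l i = g i))" for g n
    by (rule mu_eq[symmetric]) (auto intro: list_code_eqI)
  show ?thesis unfolding *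
    by (intro ar_intros ar.comp[OF assms(1), of "\<lambda>h x. psnd x"] ar.comp[OF assms(1), of "\<lambda>h x. psnd (psnd x)"]
      ar.comp[OF assms(2), of "\<lambda>h x. <|pfst x, psnd (psnd x)|>", simplified])
qed

section \<open>Functions computable from \<open>E2\<close> and a \<open>Delta11\<close> functional
  are \<open>Delta11\<close>\<close>

section \<open>Analytical relations\<close>

definition ArImp :: "ar_form \<Rightarrow> ar_form \<Rightarrow> ar_form" where "ArImp \<phi> \<psi> = ArNot (ArAnd \<phi> (ArNot \<psi>))"
definition ArEx :: "ar_form \<Rightarrow> ar_form" where "ArEx \<phi> = ArNot (ArAll (ArNot \<phi>))"
text \<open>Cantor pairing halves \<open>(s + t) * (s + t + 1)\<close>; the equation is doubled to
  stay within plus and times.\<close>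

definition ArPr :: "ar_term \<Rightarrow> ar_term \<Rightarrow> ar_term \<Rightarrow> ar_form" where
  "ArPr s t u = ArEq (Plus u u) (Plus (Times (Plus s t) (Succ (Plus s t))) (Plus s s))"

lemma ar_sat_ArImp [simp]: "ar_sat (ArImp \<phi> \<psi>) ns fs \<longleftrightarrow> (ar_sat \<phi> ns fs \<longrightarrow> ar_sat \<psi> ns fs)"
  and ar_form_ok_ArImp [simp]: "ar_form_ok (ArImp \<phi> \<psi>) a b \<longleftrightarrow> ar_form_ok \<phi> a b \<and> ar_form_ok \<psi> a b"
  and ar_sat_ArEx [simp]: "ar_sat (ArEx \<phi>) ns fs \<longleftrightarrow> (\<exists>n. ar_sat \<phi> (n # ns) fs)"
  and ar_form_ok_ArEx [simp]: "ar_form_ok (ArEx \<phi>) a b \<longleftrightarrow> ar_form_ok \<phi> (Suc a) b"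
  by (auto simp: ArImp_def ArEx_def)

lemma ar_form_ok_ArPr [simp]:
  "ar_form_ok (ArPr s t u) a b \<longleftrightarrow> ar_term_ok a b s \<and> ar_term_ok a b t \<and> ar_term_ok a b u"
  by (auto simp: ArPr_def)

lemma ar_sat_ArPr [simp]:
  "ar_sat (ArPr s t u) ns fs \<longleftrightarrow> ar_eval ns fs u = <|ar_eval ns fs s, ar_eval ns fs t|>"
proof -
  have "2 * triangle n = n * Suc n" for n
    unfolding triangle_def by (rule dvd_mult_div_cancel) simp
  then have "2 * <|x, y|> = (x + y) * Suc (x + y) + 2 * x" for x y
    by (simp add: prod_encode_def)
  then have "u + u = (x + y) * Suc (x + y) + (x + x) \<longleftrightarrow> u = <|x, y|>" for u x y
    by (metis mult_2 mult_cancel1 zero_neq_numeral)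
  then show ?thesis by (simp add: ArPr_def)
qed

primrec ar_num :: "nat \<Rightarrow> ar_term" where
  "ar_num 0 = Zero"
| "ar_num (Suc n) = Succ (ar_num n)"

lemma ar_num [simp]: "ar_eval ns fs (ar_num n) = n" "ar_term_ok a b (ar_num n)"
  by (induction n) auto

text \<open>The function variable \<open>i\<close> is replaced by \<open>\<lambda>y. f (m * y + d)\<close> for the variable \<open>f\<close> with number \<open>j\<close>.\<close>

primrec tsub :: "(nat \<Rightarrow> nat \<times> nat \<times> nat) \<Rightarrow> ar_term \<Rightarrow> ar_term" where
  "tsub \<sigma> (NVar i) = NVar i"
| "tsub \<sigma> Zero = Zero"
| "tsub \<sigma> (Succ t) = Succ (tsub \<sigma> t)"
| "tsub \<sigma> (Plus s t) = Plus (tsub \<sigma> s) (tsub \<sigma> t)"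
| "tsub \<sigma> (Times s t) = Times (tsub \<sigma> s) (tsub \<sigma> t)"
| "tsub \<sigma> (FApp i t) = (case \<sigma> i of (j, m, d) \<Rightarrow> FApp j (Plus (Times (ar_num m) (tsub \<sigma> t)) (ar_num d)))"

primrec fsub :: "(nat \<Rightarrow> nat \<times> nat \<times> nat) \<Rightarrow> ar_form \<Rightarrow> ar_form" where
  "fsub \<sigma> (ArEq s t) = ArEq (tsub \<sigma> s) (tsub \<sigma> t)"
| "fsub \<sigma> (ArNot \<phi>) = ArNot (fsub \<sigma> \<phi>)"
| "fsub \<sigma> (ArAnd \<phi> \<psi>) = ArAnd (fsub \<sigma> \<phi>) (fsub \<sigma> \<psi>)"
| "fsub \<sigma> (ArAll \<phi>) = ArAll (fsub \<sigma> \<phi>)"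

lemma ar_eval_tsub:
  "(\<And>i y. i < b \<Longrightarrow> (fs' ! i) y = (case \<sigma> i of (j, m, d) \<Rightarrow> (fs ! j) (m * y + d))) \<Longrightarrow>
    ar_term_ok a b t \<Longrightarrow> ar_eval ns fs (tsub \<sigma> t) = ar_eval ns fs' t"
  by (induction t) (auto split: prod.splits)

lemma ar_sat_fsub:
  "(\<And>i y. i < b \<Longrightarrow> (fs' ! i) y = (case \<sigma> i of (j, m, d) \<Rightarrow> (fs ! j) (m * y + d))) \<Longrightarrow>
    ar_form_ok \<phi> a b \<Longrightarrow> ar_sat (fsub \<sigma> \<phi>) ns fs = ar_sat \<phi> ns fs'"
proof (induction \<phi> arbitrary: a ns)
  case (ArEq s t)
  then have "ar_eval ns fs (tsub \<sigma> s) = ar_eval ns fs' s" "ar_eval ns fs (tsub \<sigma> t) = ar_eval ns fs' t"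
    by (auto intro!: ar_eval_tsub[of b _ _ _ a])
  then show ?case by simp
qed auto

lemma ar_term_ok_tsub:
  "(\<And>i. i < b \<Longrightarrow> fst (\<sigma> i) < b') \<Longrightarrow> ar_term_ok a b t \<Longrightarrow> ar_term_ok a b' (tsub \<sigma> t)"
  by (induction t) (auto split: prod.splits, metis fst_conv)

lemma ar_form_ok_fsub:
  "(\<And>i. i < b \<Longrightarrow> fst (\<sigma> i) < b') \<Longrightarrow> ar_form_ok \<phi> a b \<Longrightarrow> ar_form_ok (fsub \<sigma> \<phi>) a b'"
  by (induction \<phi> arbitrary: a) (auto intro: ar_term_ok_tsub)

lemma ar_eval_cong:
  "ar_term_ok a b t \<Longrightarrow> (\<And>i. i < a \<Longrightarrow> ns ! i = ns' ! i) \<Longrightarrow> ar_eval ns fs t = ar_eval ns' fs t"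
  by (induction t) auto

lemma ar_sat_cong:
  "ar_form_ok \<phi> a b \<Longrightarrow> (\<And>i. i < a \<Longrightarrow> ns ! i = ns' ! i) \<Longrightarrow> ar_sat \<phi> ns fs = ar_sat \<phi> ns' fs"
proof (induction \<phi> arbitrary: a ns ns')
  case (ArEq s t)
  then show ?case using ar_eval_cong[of a b _ ns ns'] by simp
next
  case (ArAll \<phi>)
  have "ar_sat \<phi> (n # ns) fs = ar_sat \<phi> (n # ns') fs" for n
    by (rule ArAll.IH[of "Suc a"]) (use ArAll.prems in \<open>auto simp: nth_Cons split: nat.split\<close>)
  then show ?case by simp
next
  case (ArAnd \<phi> \<psi>)
  have "ar_sat \<phi> ns fs = ar_sat \<phi> ns' fs"
    by (rule ArAnd.IH(1)[of a]) (use ArAnd.prems in auto)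
  moreover have "ar_sat \<psi> ns fs = ar_sat \<psi> ns' fs"
    by (rule ArAnd.IH(2)[of a]) (use ArAnd.prems in auto)
  ultimately show ?case by simp
next
  case (ArNot \<phi>)
  have "ar_sat \<phi> ns fs = ar_sat \<phi> ns' fs"
    by (rule ArNot.IH[of a]) (use ArNot.prems in auto)
  then show ?case by simp
qed

lemma ar_term_ok_mono: "ar_term_ok a b t \<Longrightarrow> a \<le> a' \<Longrightarrow> ar_term_ok a' b t"
  by (induction t) auto

lemma ar_form_ok_mono: "ar_form_ok \<phi> a b \<Longrightarrow> a \<le> a' \<Longrightarrow> ar_form_ok \<phi> a' b"
  by (induction \<phi> arbitrary: a a') (auto intro: ar_term_ok_mono)

text \<open>A \<open>Sigma11\<close> relation with any number of function witnesses and without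
  number arguments. Conjunctions and names for intermediate functions only lengthen the list of
  witnesses; it is merged into one witness at the very end.\<close>

definition sg :: "nat \<Rightarrow> (type1 list \<Rightarrow> bool) \<Rightarrow> bool" where
  "sg b R \<longleftrightarrow> (\<exists>m \<phi>. ar_form_ok \<phi> 0 (m + b) \<and>
    (\<forall>fs. length fs = b \<longrightarrow> (R fs \<longleftrightarrow> (\<exists>hs. length hs = m \<and> ar_sat \<phi> [] (hs @ fs)))))"

lemma sg_ar: "ar_form_ok \<phi> 0 b \<Longrightarrow> (\<And>fs. length fs = b \<Longrightarrow> R fs \<longleftrightarrow> ar_sat \<phi> [] fs) \<Longrightarrow> sg b R"
  unfolding sg_def by (intro exI[of _ 0] exI[of _ \<phi>]) auto

lemma sg_conj:
  assumes "sg b R" "sg b S"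
  shows "sg b (\<lambda>fs. R fs \<and> S fs)"
proof -
  obtain m \<phi> where 1: "ar_form_ok \<phi> 0 (m + b)"
    "\<And>fs. length fs = b \<Longrightarrow> R fs \<longleftrightarrow> (\<exists>hs. length hs = m \<and> ar_sat \<phi> [] (hs @ fs))"
    using assms(1) unfolding sg_def by blast
  obtain k \<psi> where 2: "ar_form_ok \<psi> 0 (k + b)"
    "\<And>fs. length fs = b \<Longrightarrow> S fs \<longleftrightarrow> (\<exists>hs. length hs = k \<and> ar_sat \<psi> [] (hs @ fs))"
    using assms(2) unfolding sg_def by blast
  define \<sigma> where "\<sigma> i = (if i < m then i else i + k, 1 :: nat, 0 :: nat)" for i
  define \<tau> where "\<tau> i = (i + m, 1 :: nat, 0 :: nat)" for i
  let ?\<theta> = "ArAnd (fsub \<sigma> \<phi>) (fsub \<tau> \<psi>)"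
  have ok: "ar_form_ok ?\<theta> 0 ((m + k) + b)"
    by (auto intro!: ar_form_ok_fsub[OF _ 1(1)] ar_form_ok_fsub[OF _ 2(1)] simp: \<sigma>_def \<tau>_def)
  have A: "ar_sat (fsub \<sigma> \<phi>) [] (hs @ hs' @ fs) = ar_sat \<phi> [] (hs @ fs)"
    if "length hs = m" "length hs' = k" for hs hs' fs
    by (rule ar_sat_fsub[OF _ 1(1)]) (use that in \<open>auto simp: \<sigma>_def nth_append\<close>)
  have B: "ar_sat (fsub \<tau> \<psi>) [] (hs @ hs' @ fs) = ar_sat \<psi> [] (hs' @ fs)"
    if "length hs = m" "length hs' = k" for hs hs' fs
    by (rule ar_sat_fsub[OF _ 2(1)]) (use that in \<open>auto simp: \<tau>_def nth_append\<close>)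
  have "(R fs \<and> S fs) \<longleftrightarrow> (\<exists>hs. length hs = m + k \<and> ar_sat ?\<theta> [] (hs @ fs))" if len: "length fs = b" for fs
  proof
    assume "R fs \<and> S fs"
    then obtain hs hs' where "length hs = m" "ar_sat \<phi> [] (hs @ fs)" "length hs' = k" "ar_sat \<psi> [] (hs' @ fs)"
      using 1(2)[OF len] 2(2)[OF len] by blast
    then show "\<exists>hs. length hs = m + k \<and> ar_sat ?\<theta> [] (hs @ fs)"
      using A B by (intro exI[of _ "hs @ hs'"]) auto
  next
    assume "\<exists>hs. length hs = m + k \<and> ar_sat ?\<theta> [] (hs @ fs)"
    then obtain hs where hs: "length hs = m + k" "ar_sat ?\<theta> [] (hs @ fs)" by blast
    obtain hs1 hs2 where *: "hs = hs1 @ hs2" "length hs1 = m" "length hs2 = k"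
      using hs(1) by (metis append_take_drop_id length_append add_left_cancel length_take min_absorb2 le_add1)
    then have "ar_sat \<phi> [] (hs1 @ fs)" "ar_sat \<psi> [] (hs2 @ fs)"
      using hs A[OF *(2,3), of fs] B[OF *(2,3), of fs] by auto
    then show "R fs \<and> S fs" using 1(2)[OF len] 2(2)[OF len] * by blast
  qed
  then show ?thesis unfolding sg_def using ok by blast
qed

lemma sg_ex:
  assumes "sg (Suc b) S" "\<And>fs. length fs = b \<Longrightarrow> R fs \<longleftrightarrow> (\<exists>g. S (g # fs))"
  shows "sg b R"
proof -
  obtain m \<phi> where 1: "ar_form_ok \<phi> 0 (m + Suc b)"
    "\<And>fs. length fs = Suc b \<Longrightarrow> S fs \<longleftrightarrow> (\<exists>hs. length hs = m \<and> ar_sat \<phi> [] (hs @ fs))"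
    using assms(1) unfolding sg_def by blast
  have "R fs \<longleftrightarrow> (\<exists>hs. length hs = Suc m \<and> ar_sat \<phi> [] (hs @ fs))" if len: "length fs = b" for fs
  proof
    assume "R fs"
    then obtain g hs where "length hs = m" "ar_sat \<phi> [] (hs @ g # fs)"
      using 1(2)[of "_ # fs"] assms(2)[OF len] len by (metis length_Cons)
    then show "\<exists>hs. length hs = Suc m \<and> ar_sat \<phi> [] (hs @ fs)"
      by (intro exI[of _ "hs @ [g]"]) auto
  next
    assume "\<exists>hs. length hs = Suc m \<and> ar_sat \<phi> [] (hs @ fs)"
    then obtain hs where hs: "length hs = Suc m" "ar_sat \<phi> [] (hs @ fs)" by blast
    then obtain hs' g where "hs = hs' @ [g]" "length hs' = m"
      by (metis length_Suc_conv_rev)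
    then have "S (g # fs)"
      using hs 1(2)[of "g # fs"] len by auto
    then show "R fs" using assms(2)[OF len] by blast
  qed
  moreover have "ar_form_ok \<phi> 0 (Suc m + b)" using 1(1) by simp
  ultimately show ?thesis unfolding sg_def by blast
qed

lemma sg_ren:
  assumes "sg b R" "length ks = b" "set ks \<subseteq> {..<b'}"
  shows "sg b' (\<lambda>fs. R (map ((!) fs) ks))"
proof -
  obtain m \<phi> where 1: "ar_form_ok \<phi> 0 (m + b)"
    "\<And>fs. length fs = b \<Longrightarrow> R fs \<longleftrightarrow> (\<exists>hs. length hs = m \<and> ar_sat \<phi> [] (hs @ fs))"
    using assms(1) unfolding sg_def by blast
  define \<sigma> where "\<sigma> i = (if i < m then i else m + ks ! (i - m), 1 :: nat, 0 :: nat)" for i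
  have ks: "ks ! i < b'" if "i < b" for i
    using assms(2,3) that by (metis lessThan_iff nth_mem subsetD)
  have ok: "ar_form_ok (fsub \<sigma> \<phi>) 0 (m + b')"
    by (rule ar_form_ok_fsub[OF _ 1(1)]) (auto simp: \<sigma>_def intro!: ks)
  have A: "ar_sat (fsub \<sigma> \<phi>) [] (hs @ fs) = ar_sat \<phi> [] (hs @ map ((!) fs) ks)"
    if "length hs = m" for hs fs
    by (rule ar_sat_fsub[OF _ 1(1)]) (use that assms(2) in \<open>auto simp: \<sigma>_def nth_append\<close>)
  show ?thesis unfolding sg_def
    by (rule exI[of _ m], rule exI[of _ "fsub \<sigma> \<phi>"]) (use ok A 1(2) assms(2) in auto)
qed

text \<open>The order \<open>n < v\<close> is written as \<open>n + Suc d = v\<close> because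
  \<open>ar_form\<close> has no order symbol; the right-hand side can then be copied as a
  formula.\<close>

lemma mu_char: "v = mu P \<longleftrightarrow> ((\<forall>n. \<not> P n) \<longrightarrow> v = 0) \<and> ((\<exists>n. P n) \<longrightarrow> P v \<and> (\<forall>n d. n + Suc d = v \<longrightarrow> \<not> P n))"
proof
  assume "v = mu P"
  then show "((\<forall>n. \<not> P n) \<longrightarrow> v = 0) \<and> ((\<exists>n. P n) \<longrightarrow> P v \<and> (\<forall>n d. n + Suc d = v \<longrightarrow> \<not> P n))"
    using mu_works[of P] mu_least[of P] by (fastforce simp: mu_def)
next
  assume *: "((\<forall>n. \<not> P n) \<longrightarrow> v = 0) \<and> ((\<exists>n. P n) \<longrightarrow> P v \<and> (\<forall>n d. n + Suc d = v \<longrightarrow> \<not> P n))"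
  show "v = mu P"
  proof (cases "\<exists>n. P n")
    case True
    then have "P v" "P (mu P)" "mu P \<le> v" using * mu_works[of P] mu_least[of P] by auto
    then show ?thesis using * True by (metis add_Suc_right le_neq_implies_less less_imp_Suc_add)
  qed (use * in \<open>auto simp: mu_def\<close>)
qed

lemma pr_ext: "(\<And>i y. f <|i, y|> = g <|i, y|>) \<Longrightarrow> f = g"
  by (rule ext) (metis pr_pfst_psnd)

lemma sg_graph:
  assumes "sg 2 (\<lambda>fs. fs ! 0 = F (fs ! 1))" "i < b" "j < b"
  shows "sg b (\<lambda>fs. fs ! i = F (fs ! j))"
  using sg_ren[OF assms(1), of "[i, j]" b] assms(2,3) by simp

text \<open>The functions computed by the parts of \<open>F\<close> are guessed by existential
  quantifiers. A recursion or a search is then checked by its defining equations, which are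
  arithmetical and determine the guess.\<close>

lemma sg_ar_functional: "ar F \<Longrightarrow> sg 2 (\<lambda>fs. fs ! 0 = F (fs ! 1))"
proof (induction rule: ar.induct)
  case id
  show ?case by (rule sg_ar[of "ArAll (ArEq (FApp 0 (NVar 0)) (NVar 0))"]) (auto simp: fun_eq_iff)
next
  case zero
  show ?case by (rule sg_ar[of "ArAll (ArEq (FApp 0 (NVar 0)) Zero)"]) (auto simp: fun_eq_iff)
next
  case suc
  show ?case by (rule sg_ar[of "ArAll (ArEq (FApp 0 (NVar 0)) (Succ (NVar 0)))"]) (auto simp: fun_eq_iff)
next
  case pfst
  show ?case
    by (rule sg_ar[of "ArAll (ArAll (ArAll (ArImp (ArPr (NVar 1) (NVar 0) (NVar 2)) (ArEq (FApp 0 (NVar 2)) (NVar 1)))))"])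
      (auto simp: fun_eq_iff, metis pr_pfst_psnd)
next
  case psnd
  show ?case
    by (rule sg_ar[of "ArAll (ArAll (ArAll (ArImp (ArPr (NVar 1) (NVar 0) (NVar 2)) (ArEq (FApp 0 (NVar 2)) (NVar 0)))))"])
      (auto simp: fun_eq_iff, metis pr_pfst_psnd)
next
  case orc
  show ?case by (rule sg_ar[of "ArAll (ArEq (FApp 0 (NVar 0)) (FApp 1 (NVar 0)))"]) (auto simp: fun_eq_iff)
next
  case (comp F G)
  have 1: "sg 4 (\<lambda>fs. \<forall>x. (fs ! 2) x = (fs ! 1) ((fs ! 0) x))"
    by (rule sg_ar[of "ArAll (ArEq (FApp 2 (NVar 0)) (FApp 1 (FApp 0 (NVar 0))))"]) auto
  have "sg 4 (\<lambda>fs. fs ! 0 = G (fs ! 3) \<and> fs ! 1 = F (fs ! 3) \<and> (\<forall>x. (fs ! 2) x = (fs ! 1) ((fs ! 0) x)))"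
    by (rule sg_conj[OF sg_graph[OF comp.IH(2)] sg_conj[OF sg_graph[OF comp.IH(1)] 1]]) auto
  then have "sg 3 (\<lambda>fs. fs ! 0 = F (fs ! 2) \<and> (\<forall>x. (fs ! 1) x = (fs ! 0) (G (fs ! 2) x)))"
    by (intro sg_ex[where b = 3, simplified]) (auto simp: numeral_eq_Suc)
  then show ?case
    by (intro sg_ex[where b = 2, simplified]) (auto simp: numeral_eq_Suc fun_eq_iff)
next
  case (pair F G)
  have 1: "sg 4 (\<lambda>fs. \<forall>x. (fs ! 2) x = <|(fs ! 1) x, (fs ! 0) x|>)"
    by (rule sg_ar[of "ArAll (ArPr (FApp 1 (NVar 0)) (FApp 0 (NVar 0)) (FApp 2 (NVar 0)))"]) auto
  have "sg 4 (\<lambda>fs. fs ! 0 = G (fs ! 3) \<and> fs ! 1 = F (fs ! 3) \<and> (\<forall>x. (fs ! 2) x = <|(fs ! 1) x, (fs ! 0) x|>))"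
    by (rule sg_conj[OF sg_graph[OF pair.IH(2)] sg_conj[OF sg_graph[OF pair.IH(1)] 1]]) auto
  then have "sg 3 (\<lambda>fs. fs ! 0 = F (fs ! 2) \<and> (\<forall>x. (fs ! 1) x = <|(fs ! 0) x, G (fs ! 2) x|>))"
    by (intro sg_ex[where b = 3, simplified]) (auto simp: numeral_eq_Suc)
  then show ?case
    by (intro sg_ex[where b = 2, simplified]) (auto simp: numeral_eq_Suc fun_eq_iff)
next
  case (rec A S)
  let ?R = "\<lambda>w a s :: type1. (\<forall>y. w <|0, y|> = a y) \<and> (\<forall>i y. w <|Suc i, y|> = s <|i, w <|i, y|>, y|>)"
  have R: "w = (\<lambda>x. rec_nat (a (psnd x)) (\<lambda>i r. s <|i, r, psnd x|>) (pfst x)) \<longleftrightarrow> ?R w a s"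
    (is "w = ?w \<longleftrightarrow> _") for w a s :: type1
  proof
    assume *: "?R w a s"
    show "w = ?w"
    proof (rule pr_ext)
      show "w <|i, y|> = ?w <|i, y|>" for i y
        using * by (induction i) auto
    qed
  qed auto
  have 1: "sg 4 (\<lambda>fs. ?R (fs ! 2) (fs ! 1) (fs ! 0))"
    by (rule sg_ar[of "ArAnd (ArAll (ArAll (ArImp (ArPr Zero (NVar 1) (NVar 0))
          (ArEq (FApp 2 (NVar 0)) (FApp 1 (NVar 1))))))
        (ArAll (ArAll (ArAll (ArAll (ArAll (ArAll
          (ArImp (ArPr (NVar 5) (NVar 4) (NVar 3)) (ArImp (ArPr (Succ (NVar 5)) (NVar 4) (NVar 2))
            (ArImp (ArPr (FApp 2 (NVar 3)) (NVar 4) (NVar 1)) (ArImp (ArPr (NVar 5) (NVar 1) (NVar 0))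
              (ArEq (FApp 2 (NVar 2)) (FApp 0 (NVar 0)))))))))))))"])
      (auto simp: numeral_eq_Suc)
  have "sg 4 (\<lambda>fs. fs ! 0 = S (fs ! 3) \<and> fs ! 1 = A (fs ! 3) \<and> ?R (fs ! 2) (fs ! 1) (fs ! 0))"
    by (rule sg_conj[OF sg_graph[OF rec.IH(2)] sg_conj[OF sg_graph[OF rec.IH(1)] 1]]) auto
  then have "sg 3 (\<lambda>fs. fs ! 0 = A (fs ! 2) \<and> ?R (fs ! 1) (fs ! 0) (S (fs ! 2)))"
    by (intro sg_ex[where b = 3, simplified]) (auto simp: numeral_eq_Suc)
  then have "sg 2 (\<lambda>fs. ?R (fs ! 0) (A (fs ! 1)) (S (fs ! 1)))"
    by (intro sg_ex[where b = 2, simplified]) (auto simp: numeral_eq_Suc)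
  then show ?case by (simp only: R)
next
  case (least F)
  let ?R = "\<lambda>w f :: type1. \<forall>x. ((\<forall>n. f <|n, x|> \<noteq> 0) \<longrightarrow> w x = 0) \<and>
    ((\<exists>n. f <|n, x|> = 0) \<longrightarrow> f <|w x, x|> = 0 \<and> (\<forall>n d. n + Suc d = w x \<longrightarrow> f <|n, x|> \<noteq> 0))"
  have R: "w = (\<lambda>x. mu (\<lambda>n. f <|n, x|> = 0)) \<longleftrightarrow> ?R w f" for w f :: type1
    by (simp only: fun_eq_iff mu_char)
  have 1: "sg 3 (\<lambda>fs. ?R (fs ! 1) (fs ! 0))"
    by (rule sg_ar[of "ArAll (ArAnd
        (ArImp (ArAll (ArAll (ArImp (ArPr (NVar 1) (NVar 2) (NVar 0)) (ArNot (ArEq (FApp 0 (NVar 0)) Zero)))))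
          (ArEq (FApp 1 (NVar 0)) Zero))
        (ArImp (ArEx (ArEx (ArAnd (ArPr (NVar 1) (NVar 2) (NVar 0)) (ArEq (FApp 0 (NVar 0)) Zero))))
          (ArAnd (ArAll (ArImp (ArPr (FApp 1 (NVar 1)) (NVar 1) (NVar 0)) (ArEq (FApp 0 (NVar 0)) Zero)))
            (ArAll (ArAll (ArAll (ArImp (ArPr (NVar 2) (NVar 3) (NVar 0))
              (ArImp (ArEq (Plus (NVar 2) (Succ (NVar 1))) (FApp 1 (NVar 3)))
                (ArNot (ArEq (FApp 0 (NVar 0)) Zero))))))))))"])
      (auto simp: numeral_eq_Suc)
  have "sg 3 (\<lambda>fs. fs ! 0 = F (fs ! 2) \<and> ?R (fs ! 1) (fs ! 0))"
    by (rule sg_conj[OF sg_graph[OF least.IH] 1]) auto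
  from sg_ex[where b = 2, simplified, OF this]
  have "sg 2 (\<lambda>fs. ?R (fs ! 0) (F (fs ! 1)))"
    by (simp add: numeral_eq_Suc)
  then show ?case by (simp only: R)
qed

text \<open>Interleaving: the \<open>i\<close>-th witness is one function restricted to the residue
  class of \<open>i\<close> modulo \<open>m\<close>. This is the purpose of the affine substitutions
  in \<open>tsub\<close>.\<close>

lemma collapse_witnesses:
  assumes "ar_form_ok \<phi> a (m + b)"
  obtains \<psi> where "ar_form_ok \<psi> a (Suc b)"
    "\<And>ns fs. length fs = b \<Longrightarrow> (\<exists>hs. length hs = m \<and> ar_sat \<phi> ns (hs @ fs)) \<longleftrightarrow> (\<exists>h. ar_sat \<psi> ns (h # fs))"
proof
  define \<sigma> where "\<sigma> i = (if i < m then (0, m, i) else (Suc (i - m), 1 :: nat, 0 :: nat))" for i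
  show "ar_form_ok (fsub \<sigma> \<phi>) a (Suc b)"
    by (rule ar_form_ok_fsub[OF _ assms]) (auto simp: \<sigma>_def)
  fix ns and fs :: "type1 list" assume fs: "length fs = b"
  show "(\<exists>hs. length hs = m \<and> ar_sat \<phi> ns (hs @ fs)) \<longleftrightarrow> (\<exists>h. ar_sat (fsub \<sigma> \<phi>) ns (h # fs))"
  proof
    assume "\<exists>hs. length hs = m \<and> ar_sat \<phi> ns (hs @ fs)"
    then obtain hs where hs: "length hs = m" "ar_sat \<phi> ns (hs @ fs)" by auto
    define h where "h z = (hs ! (z mod m)) (z div m)" for z
    have "ar_sat (fsub \<sigma> \<phi>) ns (h # fs) = ar_sat \<phi> ns (hs @ fs)"
      by (rule ar_sat_fsub[OF _ assms]) (use hs in \<open>auto simp: \<sigma>_def h_def nth_append\<close>)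
    then show "\<exists>h. ar_sat (fsub \<sigma> \<phi>) ns (h # fs)" using hs by auto
  next
    assume "\<exists>h. ar_sat (fsub \<sigma> \<phi>) ns (h # fs)"
    then obtain h where h: "ar_sat (fsub \<sigma> \<phi>) ns (h # fs)" by auto
    define hs where "hs = map (\<lambda>i y. h (m * y + i)) [0..<m]"
    have "ar_sat (fsub \<sigma> \<phi>) ns (h # fs) = ar_sat \<phi> ns (hs @ fs)"
      by (rule ar_sat_fsub[OF _ assms]) (auto simp: \<sigma>_def hs_def nth_append)
    then show "\<exists>hs. length hs = m \<and> ar_sat \<phi> ns (hs @ fs)" using h by (auto simp: hs_def intro!: exI[of _ hs])
  qed
qed

text \<open>Number arguments enter only here. They occur in an arithmetical condition on the
  function \<open>w\<close>, all of whose values have been guessed at once.\<close>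

lemma Sigma11_sg:
  assumes sg: "sg (Suc b) S" and \<theta>: "ar_form_ok \<theta> a 1"
    and R: "\<And>ns fs. length ns = a \<Longrightarrow> length fs = b \<Longrightarrow> R ns fs \<longleftrightarrow> (\<exists>w. S (w # fs) \<and> ar_sat \<theta> ns [w])"
  shows "Sigma11 a b R"
proof -
  obtain m \<phi> where 1: "ar_form_ok \<phi> 0 (m + Suc b)"
    "\<And>fs. length fs = Suc b \<Longrightarrow> S fs \<longleftrightarrow> (\<exists>hs. length hs = m \<and> ar_sat \<phi> [] (hs @ fs))"
    using sg unfolding sg_def by blast
  define \<sigma> where "\<sigma> i = (m + i, 1 :: nat, 0 :: nat)" for i
  have \<theta>': "ar_sat (fsub \<sigma> \<theta>) ns (hs @ w # fs) = ar_sat \<theta> ns [w]" if "length hs = m" for ns hs w fs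
    by (rule ar_sat_fsub[OF _ \<theta>]) (use that in \<open>auto simp: \<sigma>_def nth_append\<close>)
  let ?\<chi> = "ArAnd \<phi> (fsub \<sigma> \<theta>)"
  have ok: "ar_form_ok ?\<chi> a (Suc m + b)"
    using ar_form_ok_mono[OF 1(1)] ar_form_ok_fsub[OF _ \<theta>, of \<sigma> "Suc m + b"] by (simp add: \<sigma>_def)
  obtain \<psi> where \<psi>: "ar_form_ok \<psi> a (Suc b)"
    "\<And>ns fs. length fs = b \<Longrightarrow> (\<exists>hs. length hs = Suc m \<and> ar_sat ?\<chi> ns (hs @ fs)) \<longleftrightarrow> (\<exists>h. ar_sat \<psi> ns (h # fs))"
    using collapse_witnesses[OF ok] by blast
  have "R ns fs \<longleftrightarrow> (\<exists>h. ar_sat \<psi> ns (h # fs))" if "length ns = a" "length fs = b" for ns fs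
  proof -
    have "R ns fs \<longleftrightarrow> (\<exists>w hs. length hs = m \<and> ar_sat \<phi> [] (hs @ w # fs) \<and> ar_sat \<theta> ns [w])"
      using R[OF that] 1(2) that by auto
    also have "\<dots> \<longleftrightarrow> (\<exists>w hs. length hs = m \<and> ar_sat ?\<chi> ns (hs @ w # fs))"
    proof -
      have "(ar_sat \<phi> [] (hs @ w # fs) \<and> ar_sat \<theta> ns [w]) = ar_sat ?\<chi> ns (hs @ w # fs)"
        if "length hs = m" for w hs
        using \<theta>'[OF that] ar_sat_cong[OF 1(1), of ns "[]"] by simp
      then show ?thesis by blast
    qed
    also have "\<dots> \<longleftrightarrow> (\<exists>hs. length hs = Suc m \<and> ar_sat ?\<chi> ns (hs @ fs))"
    proof
      assume "\<exists>hs. length hs = Suc m \<and> ar_sat ?\<chi> ns (hs @ fs)"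
      then obtain hs where hs: "length hs = Suc m" "ar_sat ?\<chi> ns (hs @ fs)" by blast
      moreover have "hs @ fs = butlast hs @ last hs # fs"
        using hs by (metis append.assoc append_Cons append_Nil append_butlast_last_id length_0_conv nat.distinct(1))
      ultimately show "\<exists>w hs. length hs = m \<and> ar_sat ?\<chi> ns (hs @ w # fs)"
        by (metis length_butlast diff_Suc_1)
    next
      assume "\<exists>w hs. length hs = m \<and> ar_sat ?\<chi> ns (hs @ w # fs)"
      then obtain w hs where "length hs = m" "ar_sat ?\<chi> ns (hs @ w # fs)" by blast
      then show "\<exists>hs. length hs = Suc m \<and> ar_sat ?\<chi> ns (hs @ fs)"
        by (intro exI[of _ "hs @ [w]"]) auto
    qed
    finally show ?thesis using \<psi>(2)[OF that(2)] by simp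
  qed
  then show ?thesis unfolding Sigma11_def using \<psi>(1) by blast
qed

text \<open>The witness is column 0 and every other column is the function argument, so no column is
  left unspecified and a join is determined by the two functions.\<close>

definition jn :: "type1 \<Rightarrow> type1 \<Rightarrow> type1" where
  "jn h f z = (if pfst z = 0 then h (psnd z) else f (psnd z))"

lemma jn_simps [simp]: "jn h f <|0, y|> = h y" "jn h f <|Suc i, y|> = f y"
  by (simp_all add: jn_def)

lemma Sigma11_functions:
  assumes "arp P"
  shows "Sigma11 2 0 (\<lambda>ns fs. \<exists>h. P h <|ns ! 0, ns ! 1|>)"
proof -
  let ?F = "\<lambda>h x. if P h x then 0 else 1"
  have "sg 2 (\<lambda>fs. fs ! 0 = ?F (fs ! 1))"
    by (rule sg_ar_functional[OF arp_ar[OF assms]])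
  then have "sg 2 (\<lambda>fs. fs ! 1 = ?F (fs ! 0))" by (rule sg_graph) auto
  then have sg: "sg (Suc 0) (\<lambda>fs. \<exists>h. fs ! 0 = ?F h)"
    by (intro sg_ex[where b = "Suc 0"]) (auto simp: numeral_2_eq_2)
  show ?thesis
    by (rule Sigma11_sg[OF sg, where \<theta> = "ArAll (ArImp (ArPr (NVar 1) (NVar 2) (NVar 0)) (ArEq (FApp 0 (NVar 0)) Zero))"])
      (auto simp: numeral_eq_Suc split: if_splits)
qed

lemma Sigma11_functionals:
  assumes "arp P"
  shows "Sigma11 1 1 (\<lambda>ns fs. \<exists>h. P (jn h (fs ! 0)) (ns ! 0))"
proof -
  let ?F = "\<lambda>h x. if P h x then 0 else 1"
  have 1: "sg 2 (\<lambda>fs. fs ! 0 = ?F (fs ! 1))"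
    by (rule sg_ar_functional[OF arp_ar[OF assms]])
  have jn: "H = jn h f \<longleftrightarrow> (\<forall>y. H <|0, y|> = h y) \<and> (\<forall>i y. H <|Suc i, y|> = f y)" for H h f
  proof
    assume *: "(\<forall>y. H <|0, y|> = h y) \<and> (\<forall>i y. H <|Suc i, y|> = f y)"
    show "H = jn h f"
    proof (rule pr_ext)
      show "H <|i, y|> = jn h f <|i, y|>" for i y
        using * by (cases i) auto
    qed
  qed auto
  have 2: "sg 4 (\<lambda>fs. fs ! 1 = jn (fs ! 0) (fs ! 3))"
    unfolding jn
    by (rule sg_ar[of "ArAnd (ArAll (ArAll (ArImp (ArPr Zero (NVar 1) (NVar 0)) (ArEq (FApp 1 (NVar 0)) (FApp 0 (NVar 1))))))
       (ArAll (ArAll (ArAll (ArImp (ArPr (Succ (NVar 1)) (NVar 2) (NVar 0)) (ArEq (FApp 1 (NVar 0)) (FApp 3 (NVar 2)))))))"])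
      (auto simp: numeral_eq_Suc)
  have "sg 4 (\<lambda>fs. fs ! 2 = ?F (fs ! 1) \<and> fs ! 1 = jn (fs ! 0) (fs ! 3))"
    by (rule sg_conj[OF sg_graph[OF 1] 2]) auto
  then have "sg 3 (\<lambda>fs. \<exists>h. fs ! 1 = ?F (fs ! 0) \<and> fs ! 0 = jn h (fs ! 2))"
    by (intro sg_ex[where b = 3, simplified]) (auto simp: numeral_eq_Suc)
  then have sg: "sg (Suc 1) (\<lambda>fs. \<exists>h. fs ! 0 = ?F (jn h (fs ! 1)))"
    by (intro sg_ex[where b = "Suc 1"]) (auto simp: numeral_eq_Suc, blast)
  show ?thesis
    by (rule Sigma11_sg[OF sg, where \<theta> = "ArEq (FApp 0 (NVar 0)) Zero"])
      (auto split: if_splits)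
qed

text \<open>One number holds the values of all number variables. Passing under a quantifier pairs
  the new value in front, in accordance with de Bruijn indices.\<close>

definition env :: "nat \<Rightarrow> nat \<Rightarrow> nat list" where
  "env a x = map (\<lambda>i. pfst ((psnd ^^ i) x)) [0..<a]"

lemma env_Suc: "env (Suc a) x = pfst x # env a (psnd x)"
  unfolding env_def by (simp del: upt_Suc funpow.simps add: upt_conv_Cons map_Suc_upt[symmetric] comp_def funpow_Suc_right)

lemma ar_eval_ar:
  assumes fs: "\<And>i. i < b \<Longrightarrow> ar (\<lambda>H x. (fs H ! i) x)"
  shows "ar_term_ok a b t \<Longrightarrow> ar (\<lambda>H x. ar_eval (env a x) (fs H) t)"
proof (induction t)
  case (NVar i)
  have "ar (\<lambda>H x. (psnd ^^ i) x)" for i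
    by (induction i) (auto intro: ar_intros)
  then show ?case using NVar by (auto simp: env_def intro: ar_intros)
next
  case (FApp i t)
  then show ?case by (auto intro!: ar.comp[OF fs])
qed (auto intro!: ar_intros)

lemma ar_sat_arp:
  assumes fs: "\<And>i. i < b \<Longrightarrow> ar (\<lambda>H x. (fs H ! i) x)"
  shows "ar_form_ok \<phi> a b \<Longrightarrow> arp (\<lambda>H x. ar_sat \<phi> (env a x) (fs H))"
proof (induction \<phi> arbitrary: a)
  case (ArEq s t)
  then show ?case by (auto intro!: ar_intros ar_eval_ar[OF fs])
next
  case (ArAll \<phi>)
  have "arp (\<lambda>H x. ar_sat \<phi> (pfst x # env a (psnd x)) (fs H))"
    using ArAll.IH[of "Suc a"] ArAll.prems by (simp add: env_Suc)
  then show ?case by (auto intro!: ar_intros)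
qed (auto intro!: ar_intros)

lemma hyperarithmetical2_arp:
  assumes "hyperarithmetical2 G"
  obtains P where "arp P" "\<And>f n. G f = n \<longleftrightarrow> (\<exists>h. P (jn h f) n)"
proof -
  obtain \<phi> where \<phi>: "ar_form_ok \<phi> 1 2" "\<And>f n. G f = n \<longleftrightarrow> (\<exists>h. ar_sat \<phi> [n] [h, f])"
    using assms unfolding hyperarithmetical2_def Delta11_def Sigma11_def
    by (auto simp: numeral_2_eq_2) (metis length_Cons list.size(3) nth_Cons_0)
  let ?fs = "\<lambda>H. [\<lambda>y. H <|0, y|>, \<lambda>y. H <|1, y|>] :: type1 list"
  have "arp (\<lambda>H x. ar_sat \<phi> (env 1 x) (?fs H))"
    by (rule ar_sat_arp[OF _ \<phi>(1)]) (auto simp: less_2_cases_iff intro!: ar_intros)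
  from arp_comp[OF this, of "\<lambda>h x. <|x, 0|>"]
  have "arp (\<lambda>H x. ar_sat \<phi> [x] (?fs H))"
    by (simp add: env_def ar_intros)
  then show ?thesis
    by (rule that) (use \<phi>(2) jn_simps(2)[of _ _ 0] in simp)
qed

section \<open>The graph of Kleene computability\<close>

lemma list_encode_eq_iff [simp]: "list_encode xs = list_encode ys \<longleftrightarrow> xs = ys"
  by (rule list_encode_eq)

inductive_cases Kleene_E: "Kleene e as fs Fs c"

lemma Kleene_deterministic: "Kleene e as fs Fs c \<Longrightarrow> Kleene e as fs Fs c' \<Longrightarrow> c = c'"
proof (induction arbitrary: c' rule: Kleene.induct)
  case (S8 h as fs F Fs u)
  from S8.prems obtain u' where u': "\<And>x. Kleene h (x # as) fs (F # Fs) (u' x)" "c' = F u'"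
    by (cases rule: Kleene.cases) (auto simp del: list_encode.simps)
  have "u = u'" using S8.IH u'(1) by (intro ext) blast
  then show ?case using u' by simp
next
  case (S4 h as fs Fs b g c)
  from S4.prems show ?case
    by (cases rule: Kleene.cases) (use S4.IH in \<open>auto simp del: list_encode.simps\<close>)
next
  case (S5_Suc g h x as fs Fs b c)
  from S5_Suc.prems show ?case
    by (cases rule: Kleene.cases) (use S5_Suc.IH in \<open>auto simp del: list_encode.simps\<close>)
qed (erule Kleene.cases; simp del: list_encode.simps)+

definition fsof :: "type1 \<Rightarrow> nat \<Rightarrow> type1 list" where
  "fsof f i = (if i = 0 then [] else [f])"

text \<open>Starting from \<open>[E2, G]\<close>, the schemes S6 and S9 lead to these five lists
  only, where every \<open>j\<close> from 4 on codes the empty one. The functionals of a computation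
  can thus be given by a number.\<close>

definition Fsof :: "type2 \<Rightarrow> nat \<Rightarrow> type2 list" where
  "Fsof G j = (if j = 0 then [E2, G] else if j = 1 then [G, E2] else if j = 2 then [E2]
     else if j = 3 then [G] else [])"

abbreviation comp_code :: "nat \<Rightarrow> nat \<Rightarrow> nat \<Rightarrow> nat \<Rightarrow> nat \<Rightarrow> nat" where
  "comp_code e a i j c \<equiv> <|e, a, i, j, c|>"

definition code_perm :: "nat \<Rightarrow> nat \<Rightarrow> nat" where
  "code_perm k a = Suc <|lnth a k,
     list_encode (map (\<lambda>m. if m < k then lnth a m else lnth a (Suc m)) [0..<llen a - 1])|>"

definition code_take :: "nat \<Rightarrow> nat \<Rightarrow> nat" where
  "code_take p a = list_encode (map (\<lambda>m. lnth a m) [0..<p])"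

lemma code_perm: "k < length as \<Longrightarrow>
    code_perm k (list_encode as) = list_encode (as ! k # take k as @ drop (Suc k) as)"
  by (auto simp: code_perm_def intro!: nth_equalityI simp: nth_append min_def)

lemma code_take: "p \<le> length as \<Longrightarrow> code_take p (list_encode as) = list_encode (take p as)"
  by (auto simp: code_take_def intro!: nth_equalityI)

lemma code_perm': "k < llen a \<Longrightarrow>
    list_decode (code_perm k a) = (list_decode a) ! k # take k (list_decode a) @ drop (Suc k) (list_decode a)"
  using code_perm[of k "list_decode a"] by (simp del: list_encode.simps add: llen_def)

lemma code_take': "p \<le> llen a \<Longrightarrow> list_decode (code_take p a) = take p (list_decode a)"
  using code_take[of p "list_decode a"] by (simp add: llen_def)

definition Flen :: "nat \<Rightarrow> nat" where
  "Flen j = (if j < 2 then 2 else if j < 4 then 1 else 0)"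

definition Ftake :: "nat \<Rightarrow> nat \<Rightarrow> nat" where
  "Ftake r j = (if r = 0 then 4 else if r = 1 then (if j < 2 then j + 2 else j) else j)"

lemma length_Fsof [simp]: "length (Fsof G j) = Flen j"
  by (auto simp: Fsof_def Flen_def)

lemma take_Fsof: "r \<le> Flen j \<Longrightarrow> take r (Fsof G j) = Fsof G (Ftake r j)"
  by (auto simp: Fsof_def Flen_def Ftake_def split: if_splits)

lemma Fsof_perm:
  "j < 4 \<Longrightarrow> Fsof G j ! 0 # take 0 (Fsof G j) @ drop (Suc 0) (Fsof G j) = Fsof G j"
  "j < 2 \<Longrightarrow> Fsof G j ! 1 # take 1 (Fsof G j) @ drop (Suc 1) (Fsof G j) = Fsof G (1 - j)"
  by (auto simp: Fsof_def less_2_cases_iff split: if_splits)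

text \<open>
  \<open>X\<close> is a single-valued set of computations closed under all schemes except S8 for \<open>G\<close>.
  Single-valuedness makes the function to which S8 applies \<open>G\<close> arithmetical in \<open>X\<close>.
\<close>

definition kclosed :: "type1 \<Rightarrow> type1 \<Rightarrow> bool" where
  "kclosed X f \<longleftrightarrow>
    (\<forall>e a i j c c'. X (comp_code e a i j c) = 0 \<longrightarrow> X (comp_code e a i j c') = 0 \<longrightarrow> c = c') \<and>
    (\<forall>x a i j. X (comp_code (list_encode [1]) (Suc <|x, a|>) i j (Suc x)) = 0) \<and>
    (\<forall>q a i j. X (comp_code (list_encode [2, q]) a i j q) = 0) \<and>
    (\<forall>x a i j. X (comp_code (list_encode [3]) (Suc <|x, a|>) i j x) = 0) \<and>
    (\<forall>g h a i j b c. X (comp_code h a i j b) = 0 \<longrightarrow> X (comp_code g (Suc <|b, a|>) i j c) = 0 \<longrightarrow>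
       X (comp_code (list_encode [4, g, h]) a i j c) = 0) \<and>
    (\<forall>g h a i j c. X (comp_code g a i j c) = 0 \<longrightarrow>
       X (comp_code (list_encode [5, g, h]) (Suc <|0, a|>) i j c) = 0) \<and>
    (\<forall>g h x a i j b c. X (comp_code (list_encode [5, g, h]) (Suc <|x, a|>) i j b) = 0 \<longrightarrow>
       X (comp_code h (Suc <|x, Suc <|b, a|>|>) i j c) = 0 \<longrightarrow>
       X (comp_code (list_encode [5, g, h]) (Suc <|Suc x, a|>) i j c) = 0) \<and>
    (\<forall>k g a i j c. k < llen a \<longrightarrow> X (comp_code g (code_perm k a) i j c) = 0 \<longrightarrow>
       X (comp_code (list_encode [6, 0, k, g]) a i j c) = 0) \<and>
    (\<forall>g a i j c. i \<noteq> 0 \<longrightarrow> X (comp_code g a i j c) = 0 \<longrightarrow>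
       X (comp_code (list_encode [6, 1, 0, g]) a i j c) = 0) \<and>
    (\<forall>g a i j c. j < 4 \<longrightarrow> X (comp_code g a i j c) = 0 \<longrightarrow>
       X (comp_code (list_encode [6, 2, 0, g]) a i j c) = 0) \<and>
    (\<forall>g a i j c. j < 2 \<longrightarrow> X (comp_code g a i (1 - j) c) = 0 \<longrightarrow>
       X (comp_code (list_encode [6, 2, 1, g]) a i j c) = 0) \<and>
    (\<forall>x a i j. i \<noteq> 0 \<longrightarrow> X (comp_code (list_encode [7]) (Suc <|x, a|>) i j (f x)) = 0) \<and>
    (\<forall>h a i j. (j = 0 \<or> j = 2) \<longrightarrow> (\<forall>x. \<exists>v. X (comp_code h (Suc <|x, a|>) i j v) = 0) \<longrightarrow>
       X (comp_code (list_encode [8, h]) a i j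
         (if \<exists>x. X (comp_code h (Suc <|x, a|>) i j 0) = 0 then 0 else 1)) = 0) \<and>
    (\<forall>p q r e a i j c. p \<le> llen a \<longrightarrow> q \<le> (if i = 0 then 0 else 1) \<longrightarrow> r \<le> Flen j \<longrightarrow>
       X (comp_code e (code_take p a) q (Ftake r j) c) = 0 \<longrightarrow>
       X (comp_code (list_encode [9, p, q, r]) (Suc <|e, a|>) i j c) = 0)"

definition kclosed_G :: "type1 \<Rightarrow> type2 \<Rightarrow> bool" where
  "kclosed_G X G \<longleftrightarrow> (\<forall>h a i j. (j = 1 \<or> j = 3) \<longrightarrow> (\<forall>x. \<exists>v. X (comp_code h (Suc <|x, a|>) i j v) = 0) \<longrightarrow>
       X (comp_code (list_encode [8, h]) a i j (G (\<lambda>x. mu (\<lambda>v. X (comp_code h (Suc <|x, a|>) i j v) = 0)))) = 0)"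

lemmas kcl_1 = kclosed_def[THEN iffD1, THEN conjunct2]
lemmas kcl_2 = kcl_1[THEN conjunct2]
lemmas kcl_3 = kcl_2[THEN conjunct2]
lemmas kcl_4 = kcl_3[THEN conjunct2]
lemmas kcl_5 = kcl_4[THEN conjunct2]
lemmas kcl_6 = kcl_5[THEN conjunct2]
lemmas kcl_7 = kcl_6[THEN conjunct2]
lemmas kcl_8 = kcl_7[THEN conjunct2]
lemmas kcl_9 = kcl_8[THEN conjunct2]
lemmas kcl_10 = kcl_9[THEN conjunct2]
lemmas kcl_11 = kcl_10[THEN conjunct2]
lemmas kcl_12 = kcl_11[THEN conjunct2]
lemmas kcl_13 = kcl_12[THEN conjunct2]
lemmas kclosed_sv = kclosed_def[THEN iffD1, THEN conjunct1, rule_format]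
lemmas kclosed_S1 = kcl_1[THEN conjunct1, rule_format]
lemmas kclosed_S2 = kcl_2[THEN conjunct1, rule_format]
lemmas kclosed_S3 = kcl_3[THEN conjunct1, rule_format]
lemmas kclosed_S4 = kcl_4[THEN conjunct1, rule_format]
lemmas kclosed_S5_zero = kcl_5[THEN conjunct1, rule_format]
lemmas kclosed_S5_Suc = kcl_6[THEN conjunct1, rule_format]
lemmas kclosed_S6_0 = kcl_7[THEN conjunct1, rule_format]
lemmas kclosed_S6_1 = kcl_8[THEN conjunct1, rule_format]
lemmas kclosed_S6_20 = kcl_9[THEN conjunct1, rule_format]
lemmas kclosed_S6_21 = kcl_10[THEN conjunct1, rule_format]
lemmas kclosed_S7 = kcl_11[THEN conjunct1, rule_format]
lemmas kclosed_S8 = kcl_12[THEN conjunct1, rule_format]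
lemmas kclosed_S9 = kcl_13[rule_format]

text \<open>Leastness of the set of computations. At S8 single-valuedness identifies the function
  that \<open>X\<close> presents with the function actually computed.\<close>

lemma kclosed_Kleene:
  assumes X: "kclosed X f" "kclosed_G X G"
  shows "Kleene e as fs Fs c \<Longrightarrow> fs = fsof f i \<Longrightarrow> Fs = Fsof G j \<Longrightarrow>
    X (comp_code e (list_encode as) i j c) = 0"
proof (induction arbitrary: i j rule: Kleene.induct)
  case (S1 x as fs Fs)
  show ?case unfolding list_encode.simps(2)[of x as] by (rule kclosed_S1[OF X(1)])
next
  case (S2 q as fs Fs)
  show ?case by (rule kclosed_S2[OF X(1)])
next
  case (S3 x as fs Fs)
  show ?case unfolding list_encode.simps(2)[of x as] by (rule kclosed_S3[OF X(1)])
next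
  case (S4 h as fs Fs b g c)
  show ?case
    by (rule kclosed_S4[OF X(1) S4.IH(1)[OF S4.prems] S4.IH(2)[OF S4.prems, unfolded list_encode.simps(2)]])
next
  case (S5_zero g as fs Fs c h)
  show ?case
    unfolding list_encode.simps(2)[of 0 as] by (rule kclosed_S5_zero[OF X(1) S5_zero.IH[OF S5_zero.prems]])
next
  case (S5_Suc g h x as fs Fs b c)
  show ?case
    unfolding list_encode.simps(2)[of "Suc x" as]
    by (rule kclosed_S5_Suc[OF X(1) S5_Suc.IH(1)[OF S5_Suc.prems, unfolded list_encode.simps(2)[of x as]]
      S5_Suc.IH(2)[OF S5_Suc.prems, unfolded list_encode.simps(2)]])
next
  case (S6_0 k as g fs Fs c)
  show ?case
    by (rule kclosed_S6_0[OF X(1)]) (use S6_0.hyps S6_0.IH[OF S6_0.prems] code_perm[of k as] in simp_all)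
next
  case (S6_1 k fs g as Fs c)
  then have k: "k = 0" "i \<noteq> 0" by (auto simp: fsof_def split: if_splits)
  with S6_1.IH[of i j] S6_1.prems have "X (comp_code g (list_encode as) i j c) = 0"
    by (auto simp: fsof_def)
  then show ?case unfolding k(1) by (rule kclosed_S6_1[OF X(1) k(2)])
next
  case (S6_2 k Fs g as fs c)
  consider "k = 0" "j < 4" | "k = 1" "j < 2"
    using S6_2.hyps(1) S6_2.prems by (auto simp: Flen_def less_2_cases_iff split: if_splits)
  then show ?case
  proof cases
    case 1
    then have "Fs ! k # take k Fs @ drop (Suc k) Fs = Fsof G j"
      using S6_2.prems by (simp only: Fsof_perm)
    from S6_2.IH[OF S6_2.prems(1) this] show ?thesis unfolding 1(1) by (rule kclosed_S6_20[OF X(1) 1(2)])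
  next
    case 2
    then have "Fs ! k # take k Fs @ drop (Suc k) Fs = Fsof G (1 - j)"
      using S6_2.prems by (simp only: Fsof_perm)
    from S6_2.IH[OF S6_2.prems(1) this] show ?thesis unfolding 2(1) by (rule kclosed_S6_21[OF X(1) 2(2)])
  qed
next
  case (S7 x as f' fs Fs)
  then have i: "i \<noteq> 0" "f' = f" by (auto simp: fsof_def split: if_splits)
  show ?case unfolding i(2) list_encode.simps(2)[of x as] by (rule kclosed_S7[OF X(1) i(1)])
next
  case (S8 h as fs F Fs u)
  have u: "X (comp_code h (Suc <|x, list_encode as|>) i j (u x)) = 0" for x
    using S8.IH[of i j x] S8.prems by simp
  have sv: "X (comp_code h (Suc <|x, list_encode as|>) i j v) = 0 \<longleftrightarrow> v = u x" for x v
    using u kclosed_sv[OF X(1) _ u] by auto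
  have ex: "\<exists>v. X (comp_code h (Suc <|x, list_encode as|>) i j v) = 0" for x
    using u by blast
  have "j < 4" using S8.prems by (auto simp: Fsof_def split: if_splits)
  then consider "j = 0 \<or> j = 2" | "j = 1 \<or> j = 3" by fastforce
  then show ?case
  proof cases
    case 1
    then have "F = E2" using S8.prems by (auto simp: Fsof_def)
    moreover have "(if \<exists>x. X (comp_code h (Suc <|x, list_encode as|>) i j 0) = 0 then 0 else 1) = E2 u"
      by (simp only: sv eq_commute[of 0] E2_def)
    ultimately show ?thesis using kclosed_S8[OF X(1) 1, of h "list_encode as" i, OF ex] by (simp only:)
  next
    case 2
    then have "F = G" using S8.prems by (auto simp: Fsof_def split: if_splits)
    moreover have "mu (\<lambda>v. v = u x) = u x" for x by (rule mu_eq) auto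
    ultimately show ?thesis
      using X(2)[unfolded kclosed_G_def, rule_format, OF 2, of h "list_encode as" i, OF ex]
      by (simp only: sv)
  qed
next
  case (S9 p as q fs r Fs e c)
  have 1: "X (comp_code e (list_encode (take p as)) q (Ftake r j) c) = 0"
    using S9.prems S9.hyps by (intro S9.IH) (auto simp: take_Fsof, auto simp: fsof_def split: if_splits)
  have 2: "q \<le> (if i = 0 then 0 else 1)" "r \<le> Flen j"
    using S9.prems S9.hyps by (auto simp: fsof_def split: if_splits)
  show ?case unfolding list_encode.simps(2)[of e as]
    by (rule kclosed_S9[OF X(1) _ 2]) (use 1 S9.hyps code_take[of p as] in simp_all)
qed

definition Kleene_set :: "type1 \<Rightarrow> type2 \<Rightarrow> type1" where
  "Kleene_set f G z = (if Kleene (pfst z) (list_decode (pfst (psnd z))) (fsof f (pfst (psnd (psnd z))))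
     (Fsof G (pfst (psnd (psnd (psnd z))))) (psnd (psnd (psnd (psnd z)))) then 0 else 1)"

lemma Kleene_set: "Kleene_set f G (comp_code e a i j c) = 0 \<longleftrightarrow> Kleene e (list_decode a) (fsof f i) (Fsof G j) c"
  by (simp add: Kleene_set_def)

lemma list_decode_Cons: "list_decode (Suc <|x, a|>) = x # list_decode a"
  by simp

lemma kclosed_Kleene_set: "kclosed (Kleene_set f G) f" "kclosed_G (Kleene_set f G) G"
proof -
  have E2: "Kleene (list_encode [8, h]) as fs (E2 # Fs) (if \<exists>x. Kleene h (x # as) fs (E2 # Fs) 0 then 0 else 1)"
    if ex: "\<forall>x. \<exists>v. Kleene h (x # as) fs (E2 # Fs) v" for h as fs Fs
  proof -
    obtain u where u: "\<And>x. Kleene h (x # as) fs (E2 # Fs) (u x)" using ex by metis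
    then have "E2 u = (if \<exists>x. Kleene h (x # as) fs (E2 # Fs) 0 then 0 else 1)"
      unfolding E2_def by (metis Kleene_deterministic)
    then show ?thesis using S8[OF u] by simp
  qed
  show "kclosed (Kleene_set f G) f"
    unfolding kclosed_def Kleene_set list_decode_Cons
    apply (intro conjI allI impI)
                  apply (erule (1) Kleene_deterministic)
                 apply (rule S1)
                apply (rule S2)
               apply (rule S3)
              apply (erule (1) S4)
             apply (erule S5_zero)
            apply (erule (1) S5_Suc)
           apply (rule S6_0; simp add: llen_def code_perm'[unfolded llen_def])
          apply (rule S6_1; simp add: fsof_def)
         apply (rule S6_2; simp add: Fsof_perm[simplified] Flen_def)
        apply (rule S6_2; auto simp: Fsof_def less_2_cases_iff Flen_def)
       apply (simp add: fsof_def del: list_encode.simps; rule S7)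
    subgoal premises prems for h a i j
    proof -
      obtain Fs where "Fsof G j = E2 # Fs" using prems(1) by (auto simp: Fsof_def)
      then show ?thesis using E2[of h "list_decode a" "fsof f i" Fs] prems(2) by (simp del: list_encode.simps)
    qed
    subgoal premises prems for p q r e a i j c
    proof (rule S9)
      show "Kleene e (take p (list_decode a)) (take q (fsof f i)) (take r (Fsof G j)) c"
        using prems by (auto simp: code_take' take_Fsof fsof_def split: if_splits)
    qed (use prems in \<open>auto simp: llen_def fsof_def split: if_splits\<close>)
    done
  show "kclosed_G (Kleene_set f G) G"
    unfolding kclosed_G_def Kleene_set list_decode_Cons
  proof (intro allI impI)
    fix h a i j assume j: "j = 1 \<or> j = 3" and ex: "\<forall>x. \<exists>v. Kleene h (x # list_decode a) (fsof f i) (Fsof G j) v"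
    obtain Fs where Fs: "Fsof G j = G # Fs" using j by (auto simp: Fsof_def)
    obtain u where u: "\<And>x. Kleene h (x # list_decode a) (fsof f i) (Fsof G j) (u x)" using ex by metis
    have "mu (\<lambda>v. Kleene h (x # list_decode a) (fsof f i) (Fsof G j) v) = u x" for x
      by (rule mu_eq, rule u, rule Kleene_deterministic, assumption, rule u)
    then show "Kleene (list_encode [8, h]) (list_decode a) (fsof f i) (Fsof G j)
        (G (\<lambda>x. mu (\<lambda>v. Kleene h (x # list_decode a) (fsof f i) (Fsof G j) v)))"
      using S8[OF u[unfolded Fs]] Fs by (simp del: list_encode.simps)
  qed
qed

definition kcol :: "type1 \<Rightarrow> type1" where "kcol H z = H <|0, 0, z|>"

text \<open>Column 0 of the oracle is a witness, column 1 the function argument. The witness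
  contains the closed set \<open>X\<close> and, for each instance of S8 with \<open>G\<close>, a
  further witness that \<open>P\<close> accepts. The value of \<open>G\<close> at the function read
  off \<open>X\<close> is thus asserted through the existential form of \<open>G f = n\<close>, and
  the whole condition stays arithmetical.\<close>

definition kwit :: "(type1 \<Rightarrow> nat \<Rightarrow> bool) \<Rightarrow> type1 \<Rightarrow> bool" where
  "kwit P H \<longleftrightarrow> kclosed (\<lambda>z. H <|0, 0, z|>) (\<lambda>y. H <|1, y|>) \<and>
     (\<forall>h a i j. (j = 1 \<or> j = 3) \<longrightarrow> (\<forall>x. \<exists>v. H <|0, 0, comp_code h (Suc <|x, a|>) i j v|> = 0) \<longrightarrow>
       (\<exists>c. P (\<lambda>w. if pfst w = 0 then H <|0, 1, <|h, a, i, j|>, psnd w|>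
           else mu (\<lambda>v. H <|0, 0, comp_code h (Suc <|psnd w, a|>) i j v|> = 0)) c \<and>
         H <|0, 0, comp_code (list_encode [8, h]) a i j c|> = 0))"

lemma ar_code_perm [ar_intros]: "ar A \<Longrightarrow> ar B \<Longrightarrow> ar (\<lambda>h x. code_perm (A h x) (B h x))"
  unfolding code_perm_def by (intro ar_intros) (auto intro!: ar_intros intro: ar.comp)

lemma ar_code_take [ar_intros]: "ar A \<Longrightarrow> ar B \<Longrightarrow> ar (\<lambda>h x. code_take (A h x) (B h x))"
  unfolding code_take_def by (intro ar_intros) (auto intro!: ar_intros intro: ar.comp)

lemma arp_kwit:
  assumes P: "arp P"
  shows "arp (\<lambda>H x. kwit P H)"
  unfolding kwit_def kclosed_def list_encode.simps Flen_def Ftake_def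
  by (intro ar_intros arp_subst[OF P])

text \<open>The true set of computations gives a witness. Every other witness agrees with it on
  convergent computations, although it may hold spurious values for divergent ones.\<close>

lemma kwit_correct:
  assumes P: "\<And>f n. G f = n \<longleftrightarrow> (\<exists>h. P (jn h f) n)"
    and K: "Kleene e as (fsof f i) (Fsof G j) c"
  shows "\<exists>h. kwit P (jn h f) \<and> jn h f <|0, 0, comp_code e (list_encode as) i j c|> = 0"
    and "kwit P (jn h f) \<Longrightarrow> jn h f <|0, 0, comp_code e (list_encode as) i j c'|> = 0 \<longleftrightarrow> c' = c"
proof -
  let ?X = "Kleene_set f G"
  \<comment> \<open>For each instance of S8, the function to which \<open>G\<close> is applied
    there; \<open>Y\<close> then chooses witnesses for the values.\<close>
  define u where "u z = (\<lambda>x. mu (\<lambda>v. ?X (comp_code (pfst z) (Suc <|x, pfst (psnd z)|>)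
      (pfst (psnd (psnd z))) (psnd (psnd (psnd z))) v) = 0))" for z
  have "\<forall>z. \<exists>y. P (jn y (u z)) (G (u z))" using P by blast
  then obtain Y where Y: "\<And>z. P (jn (Y z) (u z)) (G (u z))" by metis
  define h where "h w = (if pfst w = 0 then ?X (psnd w) else Y (pfst (psnd w)) (psnd (psnd w)))" for w
  have "kwit P (jn h f)"
    unfolding kwit_def
  proof (intro conjI allI impI)
    show "kclosed (\<lambda>z. jn h f <|0, 0, z|>) (\<lambda>y. jn h f <|1, y|>)"
      using kclosed_Kleene_set(1)[of f G] jn_simps(2)[of h f 0] by (simp add: h_def)
  next
    fix g a i j assume j: "j = 1 \<or> j = 3"
      and ex: "\<forall>x. \<exists>v. jn h f <|0, 0, comp_code g (Suc <|x, a|>) i j v|> = 0"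
    let ?z = "<|g, a, i, j|>"
    have 1: "(\<lambda>w. if pfst w = 0 then jn h f <|0, 1, ?z, psnd w|>
        else mu (\<lambda>v. jn h f <|0, 0, comp_code g (Suc <|psnd w, a|>) i j v|> = 0)) = jn (Y ?z) (u ?z)"
      by (rule ext) (simp add: jn_def h_def u_def)
    have "?X (comp_code (list_encode [8, g]) a i j (G (u ?z))) = 0"
    proof -
      have "\<forall>x. \<exists>v. ?X (comp_code g (Suc <|x, a|>) i j v) = 0" using ex by (simp add: h_def)
      from kclosed_Kleene_set(2)[of f G, unfolded kclosed_G_def, rule_format, OF j, OF this[rule_format]]
      show ?thesis unfolding u_def pfst_pr psnd_pr .
    qed
    then show "\<exists>c. P (\<lambda>w. if pfst w = 0 then jn h f <|0, 1, ?z, psnd w|>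
        else mu (\<lambda>v. jn h f <|0, 0, comp_code g (Suc <|psnd w, a|>) i j v|> = 0)) c \<and>
      jn h f <|0, 0, comp_code (list_encode [8, g]) a i j c|> = 0"
      unfolding 1 using Y by (intro exI[of _ "G (u ?z)"]) (simp add: h_def)
  qed
  moreover have "?X (comp_code e (list_encode as) i j c) = 0"
    using K by (simp only: Kleene_set list_encode_inverse)
  ultimately show "\<exists>h. kwit P (jn h f) \<and> jn h f <|0, 0, comp_code e (list_encode as) i j c|> = 0"
    by (auto simp: h_def intro!: exI[of _ h])
next
  assume w: "kwit P (jn h f)"
  let ?X = "\<lambda>z. jn h f <|0, 0, z|>"
  have X: "kclosed ?X f"
    using w jn_simps(2)[of h f 0] unfolding kwit_def by simp
  have XG: "kclosed_G ?X G"
    unfolding kclosed_G_def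
  proof (intro allI impI)
    fix g a i j assume j: "j = 1 \<or> j = 3"
      and ex: "\<forall>x. \<exists>v. ?X (comp_code g (Suc <|x, a|>) i j v) = 0"
    let ?u = "\<lambda>x. mu (\<lambda>v. ?X (comp_code g (Suc <|x, a|>) i j v) = 0)"
    obtain c where c: "P (\<lambda>w. if pfst w = 0 then jn h f <|0, 1, <|g, a, i, j|>, psnd w|>
        else mu (\<lambda>v. jn h f <|0, 0, comp_code g (Suc <|psnd w, a|>) i j v|> = 0)) c"
      "?X (comp_code (list_encode [8, g]) a i j c) = 0"
      using w j ex unfolding kwit_def by blast
    have "(\<lambda>w. if pfst w = 0 then jn h f <|0, 1, <|g, a, i, j|>, psnd w|>
        else mu (\<lambda>v. jn h f <|0, 0, comp_code g (Suc <|psnd w, a|>) i j v|> = 0))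
      = jn (\<lambda>y. jn h f <|0, 1, <|g, a, i, j|>, y|>) ?u"
      by (rule ext) (simp add: jn_def)
    with c(1) have "P (jn (\<lambda>y. jn h f <|0, 1, <|g, a, i, j|>, y|>) ?u) c" by (simp only:)
    then have "G ?u = c" using P[of ?u c] by blast
    then show "?X (comp_code (list_encode [8, g]) a i j (G ?u)) = 0" using c(2) by simp
  qed
  have "?X (comp_code e (list_encode as) i j c) = 0"
    by (rule kclosed_Kleene[OF X XG K]) auto
  then show "?X (comp_code e (list_encode as) i j c') = 0 \<longleftrightarrow> c' = c"
    using kclosed_sv[OF X, of e "list_encode as" i j c' c] by auto
qed

text \<open>Some witness exists and all witnesses agree on the computation in question. Hence
  \<open>g n = m\<close> and its negation can both be expressed as the existence of a witness with a
  certain entry.\<close>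

theorem hyperarithmetical_if_computable:
  assumes G: "hyperarithmetical2 G" and K: "\<And>n. Kleene e (n # as) [] [E2, G] (g n)"
  shows "hyperarithmetical g"
proof -
  obtain P where P: "arp P" "\<And>f n. G f = n \<longleftrightarrow> (\<exists>h. P (jn h f) n)"
    using hyperarithmetical2_arp[OF G] by blast
  let ?Q = "\<lambda>h. kwit P (jn h (\<lambda>x. 0))"
  let ?X = "\<lambda>h n m. h <|0, comp_code e (Suc <|n, list_encode as|>) 0 0 m|>"
  have K': "Kleene e (n # as) (fsof (\<lambda>x. 0) 0) (Fsof G 0) (g n)" for n
    using K by (simp add: fsof_def Fsof_def)
  note kw = kwit_correct[OF P(2) K', simplified]
  have Q: "arp (\<lambda>h x. ?Q h)"
    unfolding jn_def[abs_def] by (intro arp_subst[OF arp_kwit[OF P(1)] _ ar_id'] ar_intros)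
  have 1: "g n = m \<longleftrightarrow> (\<exists>h. ?Q h \<and> ?X h n m = 0)" for n m
    by (metis kw)
  have 2: "g n \<noteq> m \<longleftrightarrow> (\<exists>h. ?Q h \<and> ?X h n m \<noteq> 0)" for n m
    by (metis kw)
  have "arp (\<lambda>h x. ?Q h \<and> ?X h (pfst x) (psnd x) = 0)"
    by (intro ar_intros Q)
  from Sigma11_functions[OF this] have "Sigma11 2 0 (\<lambda>ns fs. g (ns ! 0) = ns ! 1)"
    by (simp only: 1 pfst_pr psnd_pr)
  moreover have "arp (\<lambda>h x. ?Q h \<and> ?X h (pfst x) (psnd x) \<noteq> 0)"
    by (intro ar_intros Q)
  from Sigma11_functions[OF this] have "Sigma11 2 0 (\<lambda>ns fs. g (ns ! 0) \<noteq> ns ! 1)"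
    by (simp only: 2 pfst_pr psnd_pr)
  ultimately show ?thesis
    unfolding hyperarithmetical_def Delta11_def Pi11_def by simp
qed

theorem hyperarithmetical2_if_computable:
  assumes "type2_computable_in_E2 G"
  shows "hyperarithmetical2 G"
proof -
  obtain e where e: "\<And>f. Kleene e [] [f] [E2] (G f)"
    using assms unfolding type2_computable_in_E2_def by blast
  define P :: "type1 \<Rightarrow> nat \<Rightarrow> bool" where "P = (\<lambda>H n. n = 0)"
  \<comment> \<open>A dummy second functional: \<open>Fsof G0 2\<close> is \<open>[E2]\<close>, the
    list with which \<open>e\<close> computes.\<close>
  define G0 :: type2 where "G0 = (\<lambda>f. 0)"
  have P: "arp P" "\<And>f n. G0 f = n \<longleftrightarrow> (\<exists>h. P (jn h f) n)"
    by (auto simp: P_def G0_def intro!: ar_intros)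
  define Q where "Q h f = kwit P (jn h f)" for h f
  define X where "X h m \<longleftrightarrow> h <|0, comp_code e 0 1 2 m|> = 0" for h :: type1 and m
  have K': "Kleene e [] (fsof f 1) (Fsof G0 2) (G f)" for f
    using e by (simp add: fsof_def Fsof_def)
  have Q0: "\<exists>h. Q h f" for f
    using kwit_correct(1)[OF P(2) K'] unfolding Q_def by blast
  have X: "X h m \<longleftrightarrow> G f = m" if "Q h f" for h f m
    using kwit_correct(2)[OF P(2) K' that[unfolded Q_def], of m] unfolding X_def by auto
  have "G f = m \<longleftrightarrow> (\<exists>h. Q h f \<and> X h m)" for f m
    using Q0[of f] X by blast
  then have 1: "G f = m \<longleftrightarrow> (\<exists>h. kwit P (jn h f) \<and> h <|0, comp_code e 0 1 2 m|> = 0)" for f m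
    unfolding Q_def X_def .
  have "G f \<noteq> m \<longleftrightarrow> (\<exists>h. Q h f \<and> \<not> X h m)" for f m
    using Q0[of f] X by blast
  then have 2: "G f \<noteq> m \<longleftrightarrow> (\<exists>h. kwit P (jn h f) \<and> h <|0, comp_code e 0 1 2 m|> \<noteq> 0)" for f m
    unfolding Q_def X_def .
  have "arp (\<lambda>H x. kwit P H \<and> H <|0, 0, comp_code e 0 1 2 x|> = 0)"
    by (intro ar_intros arp_kwit P)
  from Sigma11_functionals[OF this] have "Sigma11 1 1 (\<lambda>ns fs. G (fs ! 0) = ns ! 0)"
    by (simp only: 1 jn_simps)
  moreover have "arp (\<lambda>H x. kwit P H \<and> H <|0, 0, comp_code e 0 1 2 x|> \<noteq> 0)"
    by (intro ar_intros arp_kwit P)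
  from Sigma11_functionals[OF this] have "Sigma11 1 1 (\<lambda>ns fs. G (fs ! 0) \<noteq> ns ! 0)"
    by (simp only: 2 jn_simps)
  ultimately show ?thesis
    unfolding hyperarithmetical2_def Delta11_def Pi11_def by simp
qed

section \<open>Ranks, measures and selection for a \<open>Delta11\<close> functional\<close>

section \<open>Normal form of hyperarithmetical functionals\<close>

lemma pr_mono: "x \<le> x' \<Longrightarrow> y \<le> y' \<Longrightarrow> <|x, y|> \<le> <|x', y'|>"
proof -
  assume *: "x \<le> x'" "y \<le> y'"
  have "triangle m \<le> triangle n" if "m \<le> n" for m n
    using that by (induction rule: dec_induct) auto
  then show ?thesis using * by (simp add: prod_encode_def add_mono)
qed

definition j3 :: "type1 \<Rightarrow> type1 \<Rightarrow> type1 \<Rightarrow> type1" where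
  "j3 g h f w = (if pfst w = 0 then g (psnd w) else if pfst w = 1 then h (psnd w) else f (psnd w))"

text \<open>\<open>\<mu>\<close> bounds the arguments at which the columns of the oracle are used, both by \<open>P\<close> and by \<open>\<mu>\<close>.\<close>

definition modulus :: "(type1 \<Rightarrow> nat \<Rightarrow> bool) \<Rightarrow> (type1 \<Rightarrow> nat \<Rightarrow> nat) \<Rightarrow> bool" where
  "modulus P \<mu> \<longleftrightarrow> (\<forall>J J' z. (\<forall>i y. y < \<mu> J z \<longrightarrow> J <|i, y|> = J' <|i, y|>) \<longrightarrow> \<mu> J' z = \<mu> J z \<and> P J' z = P J z)"

lemma modulusI:
  "(\<And>J J' z. (\<And>i y. y < \<mu> J z \<Longrightarrow> J <|i, y|> = J' <|i, y|>) \<Longrightarrow> \<mu> J' z = \<mu> J z \<and> P J' z = P J z) \<Longrightarrow> modulus P \<mu>"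
  unfolding modulus_def by blast

lemma modulusD:
  "modulus P \<mu> \<Longrightarrow> (\<And>i y. y < \<mu> J z \<Longrightarrow> J <|i, y|> = J' <|i, y|>) \<Longrightarrow> \<mu> J' z = \<mu> J z \<and> P J' z = P J z"
  unfolding modulus_def by blast

text \<open>Skolem normal form: \<open>g\<close> collects the Skolem functions, and the matrix
  \<open>P\<close> uses only finitely many values of the oracle. Finite use is what later turns the
  relation into a tree; \<open>P\<close> itself may be arithmetical.\<close>

definition nf :: "(type1 \<Rightarrow> type1 \<Rightarrow> nat \<Rightarrow> bool) \<Rightarrow> bool" where
  "nf R \<longleftrightarrow> (\<exists>P \<mu>. arp P \<and> ar \<mu> \<and> modulus P \<mu> \<and>
     (\<forall>h f e. R h f e \<longleftrightarrow> (\<exists>g. \<forall>x. P (j3 g h f) <|x, e|>)))"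

text \<open>Countable choice: column \<open>n\<close> of the new \<open>g\<close> serves the
  instance \<open>n\<close>. The new modulus has to bound the codes \<open><|n, y|>\<close> at which
  that column is stored.\<close>

lemma nf_all:
  assumes "nf R"
  shows "nf (\<lambda>h f e. \<forall>n. R h f <|n, e|>)"
proof -
  obtain P \<mu> where P: "arp P" "ar \<mu>" "modulus P \<mu>"
    and R: "\<And>h f e. R h f e \<longleftrightarrow> (\<exists>g. \<forall>x. P (j3 g h f) <|x, e|>)"
    using assms unfolding nf_def by blast
  define col where "col n J w = (if pfst w = 0 then J <|0, n, psnd w|> else J w)" for n and J :: type1 and w
  define Q where "Q J z = P (\<lambda>w. col (pfst (pfst z)) J w) <|psnd (pfst z), pfst (pfst z), psnd z|>" for J z
  define \<nu> where "\<nu> J z = Suc <|pfst (pfst z), \<mu> (\<lambda>w. col (pfst (pfst z)) J w) <|psnd (pfst z), pfst (pfst z), psnd z|>|>" for J z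
  have "arp Q" unfolding Q_def[abs_def] col_def by (intro arp_subst[OF P(1)] ar_intros)
  moreover have "ar \<nu>" unfolding \<nu>_def[abs_def] col_def by (intro ar_subst[OF P(2)] ar_intros)
  moreover have "modulus Q \<nu>"
  proof (rule modulusI)
    fix J J' z assume *: "\<And>i y. y < \<nu> J z \<Longrightarrow> J <|i, y|> = J' <|i, y|>"
    let ?n = "pfst (pfst z)" and ?z = "<|psnd (pfst z), pfst (pfst z), psnd z|>"
    have "col ?n J <|i, y|> = col ?n J' <|i, y|>" if "y < \<mu> (\<lambda>w. col ?n J w) ?z" for i y
    proof -
      have "<|?n, y|> < \<nu> J z" using that pr_mono[of ?n ?n y] by (simp add: \<nu>_def less_Suc_eq_le)
      moreover have "y \<le> <|?n, y|>" by (rule le_prod_encode_2)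
      ultimately show ?thesis using * by (simp add: col_def)
    qed
    from modulusD[OF P(3), of "\<lambda>w. col ?n J w" ?z "\<lambda>w. col ?n J' w", OF this]
    show "\<nu> J' z = \<nu> J z \<and> Q J' z = Q J z" by (simp add: \<nu>_def Q_def)
  qed
  moreover have "(\<forall>n. R h f <|n, e|>) \<longleftrightarrow> (\<exists>g. \<forall>x. Q (j3 g h f) <|x, e|>)" for h f e
  proof -
    have c: "(\<lambda>w. col n (j3 g h f) w) = j3 (\<lambda>y. g <|n, y|>) h f" for n g
      by (rule ext) (simp add: col_def j3_def)
    have "(\<exists>g. \<forall>x. Q (j3 g h f) <|x, e|>) \<longleftrightarrow> (\<exists>g. \<forall>n x. P (j3 (\<lambda>y. g <|n, y|>) h f) <|x, n, e|>)"
      unfolding Q_def pfst_pr psnd_pr c by (metis pfst_pr psnd_pr)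
    also have "\<dots> \<longleftrightarrow> (\<forall>n. \<exists>g. \<forall>x. P (j3 g h f) <|x, n, e|>)"
    proof
      assume "\<forall>n. \<exists>g. \<forall>x. P (j3 g h f) <|x, n, e|>"
      then obtain g where g: "\<And>n x. P (j3 (g n) h f) <|x, n, e|>" by metis
      then show "\<exists>g. \<forall>n x. P (j3 (\<lambda>y. g <|n, y|>) h f) <|x, n, e|>"
        by (intro exI[of _ "\<lambda>w. g (pfst w) (psnd w)"]) simp
    qed blast
    finally show ?thesis using R by simp
  qed
  ultimately show ?thesis unfolding nf_def by blast
qed

text \<open>The number is stored as \<open>g 0\<close>, and the remaining Skolem information is
  shifted by one.\<close>

lemma nf_ex:
  assumes "nf R"
  shows "nf (\<lambda>h f e. \<exists>n. R h f <|n, e|>)"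
proof -
  obtain P \<mu> where P: "arp P" "ar \<mu>" "modulus P \<mu>"
    and R: "\<And>h f e. R h f e \<longleftrightarrow> (\<exists>g. \<forall>x. P (j3 g h f) <|x, e|>)"
    using assms unfolding nf_def by blast
  define col where "col J w = (if pfst w = 0 then J <|0, Suc (psnd w)|> else J w)" for J :: type1 and w
  define Q where "Q J z = P (\<lambda>w. col J w) <|pfst z, J <|0, 0|>, psnd z|>" for J z
  define \<nu> where "\<nu> J z = Suc (Suc (\<mu> (\<lambda>w. col J w) <|pfst z, J <|0, 0|>, psnd z|>))" for J z
  have "arp Q" unfolding Q_def[abs_def] col_def by (intro arp_subst[OF P(1)] ar_intros)
  moreover have "ar \<nu>" unfolding \<nu>_def[abs_def] col_def by (intro ar_Suc ar_subst[OF P(2)] ar_intros)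
  moreover have "modulus Q \<nu>"
  proof (rule modulusI)
    fix J J' z assume *: "\<And>i y. y < \<nu> J z \<Longrightarrow> J <|i, y|> = J' <|i, y|>"
    let ?z = "<|pfst z, J <|0, 0|>, psnd z|>"
    have 0: "J <|0, 0|> = J' <|0, 0|>" by (rule *) (simp add: \<nu>_def)
    have "col J <|i, y|> = col J' <|i, y|>" if "y < \<mu> (\<lambda>w. col J w) ?z" for i y
      using that * by (simp add: col_def \<nu>_def)
    from modulusD[OF P(3), of "\<lambda>w. col J w" ?z "\<lambda>w. col J' w", OF this]
    show "\<nu> J' z = \<nu> J z \<and> Q J' z = Q J z" by (simp add: \<nu>_def Q_def 0)
  qed
  moreover have "(\<exists>n. R h f <|n, e|>) \<longleftrightarrow> (\<exists>g. \<forall>x. Q (j3 g h f) <|x, e|>)" for h f e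
  proof -
    have c: "(\<lambda>w. col (j3 g h f) w) = j3 (\<lambda>y. g (Suc y)) h f" for g
      by (rule ext) (simp add: col_def j3_def)
    have 0: "j3 g h f <|0, 0|> = g 0" for g by (simp add: j3_def)
    have "(\<exists>g. \<forall>x. Q (j3 g h f) <|x, e|>) \<longleftrightarrow> (\<exists>g. \<forall>x. P (j3 (\<lambda>y. g (Suc y)) h f) <|x, g 0, e|>)"
      unfolding Q_def pfst_pr psnd_pr c 0 ..
    also have "\<dots> \<longleftrightarrow> (\<exists>n g. \<forall>x. P (j3 g h f) <|x, n, e|>)"
    proof
      assume "\<exists>n g. \<forall>x. P (j3 g h f) <|x, n, e|>"
      then obtain n g where "\<And>x. P (j3 g h f) <|x, n, e|>" by blast
      then show "\<exists>g. \<forall>x. P (j3 (\<lambda>y. g (Suc y)) h f) <|x, g 0, e|>"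
        by (intro exI[of _ "case_nat n g"]) simp
    qed blast
    finally show ?thesis using R by simp
  qed
  ultimately show ?thesis unfolding nf_def by blast
qed

text \<open>With the tag \<open>pfst e\<close> under a quantifier this gives conjunction and
  disjunction, so connectives reduce to quantifiers.\<close>

lemma nf_if:
  assumes "nf R" "nf S"
  shows "nf (\<lambda>h f e. if pfst e = 0 then R h f (psnd e) else S h f (psnd e))"
proof -
  obtain P \<mu> where P: "arp P" "ar \<mu>" "modulus P \<mu>"
    and R: "\<And>h f e. R h f e \<longleftrightarrow> (\<exists>g. \<forall>x. P (j3 g h f) <|x, e|>)"
    using assms(1) unfolding nf_def by blast
  obtain P' \<mu>' where P': "arp P'" "ar \<mu>'" "modulus P' \<mu>'"
    and S: "\<And>h f e. S h f e \<longleftrightarrow> (\<exists>g. \<forall>x. P' (j3 g h f) <|x, e|>)"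
    using assms(2) unfolding nf_def by blast
  let ?z = "\<lambda>z. <|pfst z, psnd (psnd z)|>"
  define Q where "Q J z = (if pfst (psnd z) = 0 then P J (?z z) else P' J (?z z))" for J z
  define \<nu> where "\<nu> J z = (if pfst (psnd z) = 0 then \<mu> J (?z z) else \<mu>' J (?z z))" for J z
  have "arp Q" unfolding Q_def[abs_def] by (intro ar_intros arp_comp[OF P(1)] arp_comp[OF P'(1)])
  moreover have "ar \<nu>" unfolding \<nu>_def[abs_def] by (intro ar_If ar.comp[OF P(2)] ar.comp[OF P'(2)] ar_intros)
  moreover have "modulus Q \<nu>"
  proof (rule modulusI)
    fix J J' z assume *: "\<And>i y. y < \<nu> J z \<Longrightarrow> J <|i, y|> = J' <|i, y|>"
    show "\<nu> J' z = \<nu> J z \<and> Q J' z = Q J z"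
    proof (cases "pfst (psnd z) = 0")
      case True
      with modulusD[OF P(3), of J "?z z" J'] * show ?thesis by (simp add: Q_def \<nu>_def)
    next
      case False
      with modulusD[OF P'(3), of J "?z z" J'] * show ?thesis by (simp add: Q_def \<nu>_def)
    qed
  qed
  moreover have "(if pfst e = 0 then R h f (psnd e) else S h f (psnd e)) \<longleftrightarrow> (\<exists>g. \<forall>x. Q (j3 g h f) <|x, e|>)" for h f e
    unfolding Q_def pfst_pr psnd_pr R S by (cases "pfst e = 0") simp_all
  ultimately show ?thesis unfolding nf_def by blast
qed

lemma nf_conj:
  assumes "nf R" "nf S"
  shows "nf (\<lambda>h f e. R h f e \<and> S h f e)"
proof -
  have "(\<forall>n. if pfst <|n, e|> = 0 then R h f (psnd <|n, e|>) else S h f (psnd <|n, e|>)) \<longleftrightarrow> R h f e \<and> S h f e"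
    for h f e by (auto intro: exI[of _ 0] exI[of _ 1])
  with nf_all[OF nf_if[OF assms]] show ?thesis by simp
qed

lemma nf_disj:
  assumes "nf R" "nf S"
  shows "nf (\<lambda>h f e. R h f e \<or> S h f e)"
proof -
  have "(\<exists>n. if pfst <|n, e|> = 0 then R h f (psnd <|n, e|>) else S h f (psnd <|n, e|>)) \<longleftrightarrow> R h f e \<or> S h f e"
    for h f e by (auto intro: exI[of _ 0] exI[of _ 1])
  with nf_ex[OF nf_if[OF assms]] show ?thesis by simp
qed

primrec ar_use :: "nat list \<Rightarrow> type1 list \<Rightarrow> ar_term \<Rightarrow> nat" where
  "ar_use ns fs (NVar i) = 0"
| "ar_use ns fs Zero = 0"
| "ar_use ns fs (Succ t) = ar_use ns fs t"
| "ar_use ns fs (Plus s t) = max (ar_use ns fs s) (ar_use ns fs t)"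
| "ar_use ns fs (Times s t) = max (ar_use ns fs s) (ar_use ns fs t)"
| "ar_use ns fs (FApp i t) = max (ar_use ns fs t) (Suc (ar_eval ns fs t))"

lemma ar_use_modulus:
  "ar_term_ok a b t \<Longrightarrow> (\<And>i y. i < b \<Longrightarrow> y < ar_use ns fs t \<Longrightarrow> (fs ! i) y = (fs' ! i) y) \<Longrightarrow>
    ar_eval ns fs' t = ar_eval ns fs t \<and> ar_use ns fs' t = ar_use ns fs t"
  by (induction t) auto

lemma ar_use_ar:
  assumes fs: "\<And>i. i < b \<Longrightarrow> ar (\<lambda>H x. (fs H ! i) x)"
  shows "ar_term_ok a b t \<Longrightarrow> ar (\<lambda>H x. ar_use (env a x) (fs H) t)"
proof (induction t)
  case (FApp i t)
  then show ?case by (auto intro!: ar_intros ar_eval_ar[OF fs])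
qed (auto intro!: ar_intros)

abbreviation cols12 :: "type1 \<Rightarrow> type1 list" where
  "cols12 J \<equiv> [\<lambda>y. J <|Suc 0, y|>, \<lambda>y. J <|2, y|>]"

lemma ar_cols12: "i < 2 \<Longrightarrow> ar (\<lambda>J x. (cols12 J ! i) x)"
  by (auto simp: less_2_cases_iff intro!: ar_intros)

lemma cols12_j3 [simp]: "cols12 (j3 g h f) = [h, f]"
  by (simp add: j3_def)

lemma nf_atomic:
  assumes ok: "ar_term_ok a 2 s" "ar_term_ok a 2 t" and S: "arp (\<lambda>h z. S (pfst z) (psnd z))"
  shows "nf (\<lambda>h f e. S (ar_eval (env a e) [h, f] s) (ar_eval (env a e) [h, f] t))"
proof -
  let ?ev = "\<lambda>t J z. ar_eval (env a (psnd z)) (cols12 J) t"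
  let ?us = "\<lambda>t J z. ar_use (env a (psnd z)) (cols12 J) t"
  let ?P = "\<lambda>J z. S (?ev s J z) (?ev t J z)"
  let ?\<mu> = "\<lambda>J z. max (?us s J z) (?us t J z)"
  have ev: "ar (\<lambda>H x. ar_eval (env a x) (cols12 H) t)" and us: "ar (\<lambda>H x. ar_use (env a x) (cols12 H) t)"
    if "ar_term_ok a 2 t" for t
    using ar_eval_ar[of 2 cols12] ar_use_ar[of 2 cols12] ar_cols12 that by blast+
  have "ar (\<lambda>J z. <|?ev s J z, ?ev t J z|>)"
    by (intro ar.pair ar.comp[OF ev[OF ok(1)] ar.psnd] ar.comp[OF ev[OF ok(2)] ar.psnd])
  from arp_comp[OF S this] have "arp ?P"
    by (simp only: pfst_pr psnd_pr)
  moreover have "ar ?\<mu>"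
    by (intro ar_max ar.comp[OF us[OF ok(1)] ar.psnd] ar.comp[OF us[OF ok(2)] ar.psnd])
  moreover have "modulus ?P ?\<mu>"
  proof (rule modulusI)
    fix J J' z assume *: "\<And>i y. y < ?\<mu> J z \<Longrightarrow> J <|i, y|> = J' <|i, y|>"
    have c: "(cols12 J ! i) y = (cols12 J' ! i) y" if "i < 2" "y < ?\<mu> J z" for i y
      using that(1) *[OF that(2), of "Suc 0"] *[OF that(2), of 2] by (auto simp: less_2_cases_iff)
    have "?ev s J' z = ?ev s J z \<and> ?us s J' z = ?us s J z"
      by (rule ar_use_modulus[OF ok(1)], rule c) (simp_all only: less_max_iff_disj simp_thms)
    moreover have "?ev t J' z = ?ev t J z \<and> ?us t J' z = ?us t J z"
      by (rule ar_use_modulus[OF ok(2)], rule c) (simp_all only: less_max_iff_disj simp_thms)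
    ultimately show "?\<mu> J' z = ?\<mu> J z \<and> ?P J' z = ?P J z" by (simp only:)
  qed
  ultimately show ?thesis
    unfolding nf_def by (intro exI[of _ ?P] exI[of _ ?\<mu>]) simp
qed

text \<open>Proving the claim for the negation along with it takes the place of a negation normal
  form.\<close>

lemma nf_formula:
  "ar_form_ok \<phi> a 2 \<Longrightarrow> nf (\<lambda>h f e. ar_sat \<phi> (env a e) [h, f]) \<and> nf (\<lambda>h f e. \<not> ar_sat \<phi> (env a e) [h, f])"
proof (induction \<phi> arbitrary: a)
  case (ArEq s t)
  have "arp (\<lambda>h z. pfst z = psnd z)" "arp (\<lambda>h z. pfst z \<noteq> psnd z)" by (intro ar_intros)+
  with ArEq show ?case
    using nf_atomic[of a s t "(=)"] nf_atomic[of a s t "(\<noteq>)"] by auto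
next
  case (ArAnd \<phi> \<psi>)
  then have 1: "nf (\<lambda>h f e. ar_sat \<phi> (env a e) [h, f])" "nf (\<lambda>h f e. \<not> ar_sat \<phi> (env a e) [h, f])"
    and 2: "nf (\<lambda>h f e. ar_sat \<psi> (env a e) [h, f])" "nf (\<lambda>h f e. \<not> ar_sat \<psi> (env a e) [h, f])" by auto
  show ?case
    unfolding ar_sat.simps de_Morgan_conj using nf_conj[OF 1(1) 2(1)] nf_disj[OF 1(2) 2(2)] ..
next
  case (ArAll \<phi>)
  have 1: "nf (\<lambda>h f e. ar_sat \<phi> (env (Suc a) e) [h, f])" "nf (\<lambda>h f e. \<not> ar_sat \<phi> (env (Suc a) e) [h, f])"
    using ArAll.IH[of "Suc a"] ArAll.prems by simp_all
  show ?case
    using nf_all[OF 1(1)] nf_ex[OF 1(2)] by (simp add: env_Suc)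
qed auto

abbreviation ini :: "type1 \<Rightarrow> nat \<Rightarrow> nat" where
  "ini u l \<equiv> list_encode (map u [0..<l])"

text \<open>For fixed \<open>n\<close> the pairs of sequences of equal length that satisfy
  \<open>K\<close> form a tree, and the witnesses \<open>u\<close> for \<open>f\<close> are its
  branches over \<open>f\<close>.\<close>

definition consistent :: "(nat \<Rightarrow> nat \<Rightarrow> nat \<Rightarrow> bool) \<Rightarrow> bool" where
  "consistent K \<longleftrightarrow> arp (\<lambda>h x. K (pfst x) (pfst (psnd x)) (psnd (psnd x))) \<and>
     (\<forall>n u v l l'. l' \<le> l \<longrightarrow> K n (ini u l) (ini v l) \<longrightarrow> K n (ini u l') (ini v l'))"

text \<open>\<open>K\<close> says that no instance of the matrix whose use fits into the given
  sequences is refuted. Every instance fits eventually, so a branch satisfies all of them. The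
  entries of \<open>u\<close> pair the Skolem function \<open>g\<close> with the witness
  \<open>h\<close>.\<close>

lemma nf_consistent:
  assumes "nf R"
  obtains K where "consistent K" "\<And>f e. (\<exists>h. R h f e) \<longleftrightarrow> (\<exists>u. \<forall>l. K e (ini u l) (ini f l))"
proof -
  obtain P \<mu> where P: "arp P" "ar \<mu>" "modulus P \<mu>"
    and R: "\<And>h f e. R h f e \<longleftrightarrow> (\<exists>g. \<forall>x. P (j3 g h f) <|x, e|>)"
    using assms unfolding nf_def by blast
  define J where "J s t w = (if pfst w = 0 then pfst (lnth s (psnd w)) else if pfst w = 1 then psnd (lnth s (psnd w))
    else lnth t (psnd w))" for s t w
  define K where "K e s t \<longleftrightarrow> (\<forall>x. \<mu> (\<lambda>w. J s t w) <|x, e|> \<le> llen s \<longrightarrow> P (\<lambda>w. J s t w) <|x, e|>)" for e s t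
  let ?J = "\<lambda>u f. j3 (\<lambda>y. pfst (u y)) (\<lambda>y. psnd (u y)) f"
  have J: "J (ini u l) (ini f l) <|i, y|> = ?J u f <|i, y|>" if "y < l" for u f l i y
    using that by (simp add: J_def j3_def)
  have K_iff: "K e (ini u l) (ini f l) \<longleftrightarrow> (\<forall>x. \<mu> (?J u f) <|x, e|> \<le> l \<longrightarrow> P (?J u f) <|x, e|>)" for e u l f
  proof -
    have eq: "(\<mu> (\<lambda>w. J (ini u l) (ini f l) w) <|x, e|> \<le> l \<longrightarrow> P (\<lambda>w. J (ini u l) (ini f l) w) <|x, e|>)
      \<longleftrightarrow> (\<mu> (?J u f) <|x, e|> \<le> l \<longrightarrow> P (?J u f) <|x, e|>)" (is "(?a \<le> l \<longrightarrow> ?A) \<longleftrightarrow> (?b \<le> l \<longrightarrow> ?B)") for x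
    proof (cases "?a \<le> l \<or> ?b \<le> l")
      case True
      then have "?a = ?b \<and> ?A = ?B"
      proof
        assume "?a \<le> l"
        then have "?b = ?a \<and> ?B = ?A" by (intro modulusD[OF P(3)] J) simp
        then show ?thesis by simp
      next
        assume "?b \<le> l"
        then show "?a = ?b \<and> ?A = ?B" by (intro modulusD[OF P(3)] J[symmetric]) simp
      qed
      then show ?thesis by simp
    qed auto
    show ?thesis
      unfolding K_def llen_list_encode length_map length_upt diff_zero by (rule iff_allI) (rule eq)
  qed
  have "arp (\<lambda>h x. K (pfst x) (pfst (psnd x)) (psnd (psnd x)))"
    unfolding K_def J_def by (intro arp_all arp_imp arp_subst[OF P(1)] arp_le ar_subst[OF P(2)] ar_intros)
  then have "consistent K" unfolding consistent_def K_iff using order_trans by blast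
  moreover have "(\<exists>h. R h f e) \<longleftrightarrow> (\<exists>u. \<forall>l. K e (ini u l) (ini f l))" for f e
  proof -
    have "(\<exists>u. \<forall>l. K e (ini u l) (ini f l)) \<longleftrightarrow> (\<exists>u. \<forall>x. P (?J u f) <|x, e|>)"
      unfolding K_iff by blast
    also have "\<dots> \<longleftrightarrow> (\<exists>h g. \<forall>x. P (j3 g h f) <|x, e|>)"
    proof
      assume "\<exists>h g. \<forall>x. P (j3 g h f) <|x, e|>"
      then obtain h g where "\<forall>x. P (j3 g h f) <|x, e|>" by blast
      then show "\<exists>u. \<forall>x. P (?J u f) <|x, e|>" by (intro exI[of _ "\<lambda>y. <|g y, h y|>"]) simp
    qed blast
    finally show ?thesis using R by simp
  qed
  ultimately show ?thesis using that by blast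
qed

lemma Sigma11_consistent:
  assumes "Sigma11 1 1 (\<lambda>ns fs. R (fs ! 0) (ns ! 0))"
  shows "\<exists>K. consistent K \<and> (\<forall>f n. R f n \<longleftrightarrow> (\<exists>u. \<forall>l. K n (ini u l) (ini f l)))"
proof -
  obtain \<phi> where \<phi>: "ar_form_ok \<phi> 1 2" "\<And>ns fs. length ns = 1 \<Longrightarrow> length fs = 1 \<Longrightarrow>
      R (fs ! 0) (ns ! 0) \<longleftrightarrow> (\<exists>h. ar_sat \<phi> ns (h # fs))"
    using assms unfolding Sigma11_def by (auto simp: numeral_2_eq_2)
  have R: "R f n \<longleftrightarrow> (\<exists>h. ar_sat \<phi> [n] [h, f])" for f n
    using \<phi>(2)[of "[n]" "[f]"] by simp
  obtain K where K: "consistent K"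
    "\<And>f e. (\<exists>h. ar_sat \<phi> (env 1 e) [h, f]) \<longleftrightarrow> (\<exists>u. \<forall>l. K e (ini u l) (ini f l))"
    using nf_consistent[of "\<lambda>h f e. ar_sat \<phi> (env 1 e) [h, f]"] nf_formula[OF \<phi>(1)] by blast
  show ?thesis
  proof (intro exI conjI allI)
    show "consistent (\<lambda>n. K <|n, 0|>)"
      unfolding consistent_def
    proof (intro conjI)
      have "ar (\<lambda>h x. <|<|pfst x, 0|>, psnd x|>)" by (intro ar_intros)
      from arp_comp[OF conjunct1[OF K(1)[unfolded consistent_def]] this]
      show "arp (\<lambda>h x. K <|pfst x, 0|> (pfst (psnd x)) (psnd (psnd x)))" by (simp only: pfst_pr psnd_pr)
    qed (use K(1) in \<open>unfold consistent_def, blast\<close>)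
    show "R f n \<longleftrightarrow> (\<exists>u. \<forall>l. K <|n, 0|> (ini u l) (ini f l))" for f n
      using K(2)[of "<|n, 0|>" f] R by (simp add: env_def)
  qed
qed

theorem hyperarithmetical2_consistent:
  assumes "hyperarithmetical2 G"
  obtains K K' where "consistent K" "consistent K'"
    "\<And>f n. G f = n \<longleftrightarrow> (\<exists>u. \<forall>l. K n (ini u l) (ini f l))"
    "\<And>f n. G f \<noteq> n \<longleftrightarrow> (\<exists>u. \<forall>l. K' n (ini u l) (ini f l))"
proof -
  have 1: "Sigma11 1 1 (\<lambda>ns fs. G (fs ! 0) = ns ! 0)" "Sigma11 1 1 (\<lambda>ns fs. G (fs ! 0) \<noteq> ns ! 0)"
    using assms unfolding hyperarithmetical2_def Delta11_def Pi11_def by auto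
  obtain K where K: "consistent K" "\<And>f n. G f = n \<longleftrightarrow> (\<exists>u. \<forall>l. K n (ini u l) (ini f l))"
    using Sigma11_consistent[of "\<lambda>f n. G f = n", OF 1(1)] by (elim exE conjE) simp
  obtain K' where K': "consistent K'" "\<And>f n. G f \<noteq> n \<longleftrightarrow> (\<exists>u. \<forall>l. K' n (ini u l) (ini f l))"
    using Sigma11_consistent[of "\<lambda>f n. G f \<noteq> n", OF 1(2)] by (elim exE conjE) simp
  show ?thesis by (rule that[OF K(1) K'(1) K(2) K'(2)])
qed

section \<open>Coin tossing\<close>

abbreviation bit_at :: "nat \<Rightarrow> nat \<Rightarrow> nat" where
  "bit_at t i \<equiv> t div 2 ^ i mod 2"

lemma space_coin_toss [simp]: "space coin_toss = cantor"
  by (auto simp: coin_toss_def space_PiM cantor_def space_uniform_count_measure PiE_def) (metis less_numeral_extra(3))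

interpretation coin: prob_space coin_toss
  unfolding coin_toss_def
  by (intro prob_space_PiM prob_space_uniform_count_measure) auto

lemma bits_sum: "t < 2 ^ len \<Longrightarrow> (\<Sum>i<len. bit_at t i * 2 ^ i) = t"
proof (induction len arbitrary: t)
  case (Suc len)
  have "(\<Sum>i<Suc len. bit_at t i * 2 ^ i) = t mod 2 + (\<Sum>i<len. bit_at (t div 2) i * 2 ^ i) * 2"
    by (subst sum.lessThan_Suc_shift) (simp add: sum_distrib_left div_mult2_eq mult.assoc mult.commute mult.left_commute)
  also have "\<dots> = t" using Suc.IH[of "t div 2"] Suc.prems by simp
  finally show ?case .
qed simp

lemma sum_bits:
  assumes "\<And>i. i < len \<Longrightarrow> f i \<in> {0, 1 :: nat}"
  shows "(\<Sum>i<len. f i * 2 ^ i) < 2 ^ len \<and> (\<forall>i<len. bit_at (\<Sum>i<len. f i * 2 ^ i) i = f i)"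
  using assms
proof (induction len arbitrary: f)
  case (Suc len)
  let ?s = "\<Sum>i<len. f (Suc i) * 2 ^ i"
  have s: "(\<Sum>i<Suc len. f i * 2 ^ i) = f 0 + ?s * 2"
    by (subst sum.lessThan_Suc_shift) (simp add: sum_distrib_left mult.assoc mult.commute mult.left_commute)
  have IH: "?s < 2 ^ len" "\<forall>i<len. bit_at ?s i = f (Suc i)"
    using Suc.IH[of "\<lambda>i. f (Suc i)"] Suc.prems by auto
  have f0: "f 0 < 2" using Suc.prems[of 0] by auto
  then have "bit_at (f 0 + ?s * 2) i = f i" if "i < Suc len" for i
    using IH(2) that by (cases i) (auto simp: div_mult2_eq)
  moreover have "f 0 + ?s * 2 < 2 ^ Suc len" using f0 IH(1) by simp
  ultimately show ?case unfolding s by blast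
qed simp

definition bit_cylinder :: "nat \<Rightarrow> nat \<Rightarrow> type1 set" where
  "bit_cylinder len t = {f \<in> cantor. \<forall>i<len. f i = bit_at t i}"

lemma measure_bit_cylinder: "bit_cylinder len t \<in> sets coin_toss \<and> measure coin_toss (bit_cylinder len t) = 1 / 2 ^ len"
proof -
  let ?M = "\<lambda>_::nat. uniform_count_measure {0, 1 :: nat}"
  interpret P: product_prob_space ?M UNIV
    by (intro product_prob_spaceI prob_space_uniform_count_measure) auto
  have eq: "bit_cylinder len t = prod_emb UNIV ?M {..<len} (Pi\<^sub>E {..<len} (\<lambda>i. {bit_at t i}))"
    by (rule set_eqI) (auto simp: bit_cylinder_def prod_emb_iff cantor_def space_uniform_count_measure PiE_iff)
  have "emeasure (PiM UNIV ?M) (prod_emb UNIV ?M {..<len} (Pi\<^sub>E {..<len} (\<lambda>i. {bit_at t i})))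
     = (\<Prod>i<len. emeasure (?M i) {bit_at t i})"
    by (rule P.emeasure_PiM_emb) (auto simp: sets_uniform_count_measure)
  also have "\<dots> = (\<Prod>i<len. ennreal (1 / 2))"
  proof (intro prod.cong refl)
    fix i
    have "bit_at t i \<in> {0, 1}" by auto
    then show "emeasure (?M i) {bit_at t i} = ennreal (1 / 2)"
      by (subst emeasure_uniform_count_measure) auto
  qed
  also have "\<dots> = ennreal (1 / 2 ^ len)"
  proof -
    have "ennreal (1 / 2) ^ len = ennreal ((1 / 2) ^ len)" by (rule ennreal_power) simp
    then show ?thesis by (simp only: prod_constant card_lessThan power_one_over)
  qed
  finally have "emeasure coin_toss (bit_cylinder len t) = ennreal (1 / 2 ^ len)"
    unfolding coin_toss_def eq .
  moreover have "bit_cylinder len t \<in> sets coin_toss"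
    unfolding eq coin_toss_def by (rule sets_PiM_I) (auto simp: sets_uniform_count_measure)
  ultimately show ?thesis by (simp add: measure_def)
qed

lemma in_bit_cylinder_unique:
  assumes "f \<in> cantor"
  shows "\<exists>!t. t < 2 ^ len \<and> f \<in> bit_cylinder len t"
proof (rule ex_ex1I)
  let ?t = "\<Sum>i<len. f i * 2 ^ i"
  have "?t < 2 ^ len \<and> (\<forall>i<len. bit_at ?t i = f i)"
    by (rule sum_bits) (use assms in \<open>auto simp: cantor_def\<close>)
  then show "\<exists>t. t < 2 ^ len \<and> f \<in> bit_cylinder len t"
    using assms unfolding bit_cylinder_def by (intro exI[of _ ?t]) simp
next
  fix t t' assume *: "t < 2 ^ len \<and> f \<in> bit_cylinder len t" "t' < 2 ^ len \<and> f \<in> bit_cylinder len t'"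
  have "bit_at t i = bit_at t' i" if "i < len" for i
  proof -
    have "f i = bit_at t i" "f i = bit_at t' i" using * that unfolding bit_cylinder_def by blast+
    then show ?thesis by simp
  qed
  then have "(\<Sum>i<len. bit_at t i * 2 ^ i) = (\<Sum>i<len. bit_at t' i * 2 ^ i)"
    by (intro sum.cong) simp_all
  then show "t = t'" using bits_sum[of t len] bits_sum[of t' len] * by simp
qed

text \<open>The numbers below \<open>2 ^ len\<close> code the binary sequences of length
  \<open>len\<close>. Counting them keeps the measures of clopen sets within arithmetic.\<close>

lemma measure_clopen:
  assumes Q: "\<And>f g. (\<And>i. i < len \<Longrightarrow> f i = g i) \<Longrightarrow> Q f = Q g"
  shows "{f \<in> cantor. Q f} \<in> sets coin_toss"
    and "measure coin_toss {f \<in> cantor. Q f} = card {t. t < 2 ^ len \<and> Q (bit_at t)} / 2 ^ len"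
proof -
  let ?T = "{t. t < 2 ^ len \<and> Q (bit_at t)}"
  have fin: "finite ?T" by simp
  have "{f \<in> cantor. Q f} = (\<Union>t\<in>?T. bit_cylinder len t)"
  proof (intro equalityI subsetI)
    fix f assume f: "f \<in> {f \<in> cantor. Q f}"
    then obtain t where t: "t < 2 ^ len" "f \<in> bit_cylinder len t" using in_bit_cylinder_unique by blast
    then have "Q f = Q (bit_at t)" by (intro Q) (auto simp: bit_cylinder_def)
    then show "f \<in> (\<Union>t\<in>?T. bit_cylinder len t)" using f t by auto
  next
    fix f assume "f \<in> (\<Union>t\<in>?T. bit_cylinder len t)"
    then obtain t where t: "Q (bit_at t)" "f \<in> bit_cylinder len t" by blast
    then have "Q f = Q (bit_at t)" by (intro Q) (auto simp: bit_cylinder_def)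
    then show "f \<in> {f \<in> cantor. Q f}" using t by (auto simp: bit_cylinder_def)
  qed
  moreover have "disjoint_family_on (bit_cylinder len) ?T"
    using in_bit_cylinder_unique unfolding disjoint_family_on_def bit_cylinder_def by blast
  ultimately show "{f \<in> cantor. Q f} \<in> sets coin_toss"
    and "measure coin_toss {f \<in> cantor. Q f} = card ?T / 2 ^ len"
    using measure_bit_cylinder coin.finite_measure_finite_Union[OF fin, of "bit_cylinder len"]
    by (auto simp: image_subset_iff)
qed

section \<open>Ranked trees\<close>

definition snoc :: "nat \<Rightarrow> nat \<Rightarrow> nat" where
  "snoc s m = list_encode (map (\<lambda>i. if i < llen s then lnth s i else m) [0..<Suc (llen s)])"

lemma ar_snoc [ar_intros]: "ar A \<Longrightarrow> ar B \<Longrightarrow> ar (\<lambda>h x. snoc (A h x) (B h x))"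
  unfolding snoc_def by (intro ar_intros) (auto intro!: ar_intros intro: ar.comp)

lemma llen_snoc [simp]: "llen (snoc s m) = Suc (llen s)"
  by (simp add: snoc_def)

lemma lnth_snoc: "lnth (snoc s m) i = (if i < llen s then lnth s i else if i = llen s then m else 0)"
  by (cases "i < Suc (llen s)") (auto simp: snoc_def lnth_beyond simp del: upt_Suc)

lemma llen_code_take [simp]: "llen (code_take p a) = p"
  by (simp add: code_take_def)

lemma lnth_code_take [simp]: "i < p \<Longrightarrow> lnth (code_take p a) i = lnth a i"
  by (simp add: code_take_def)

lemma snoc_code_take: "llen s = Suc l \<Longrightarrow> snoc (code_take l s) (lnth s l) = s"
  by (rule list_code_eqI) (auto simp: lnth_snoc less_Suc_eq)

lemma ini_Suc: "ini u (Suc l) = snoc (ini u l) (u l)"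
  by (rule list_code_eqI) (auto simp: lnth_snoc less_Suc_eq simp del: upt_Suc)

lemma code_take_ini [simp]: "l \<le> l' \<Longrightarrow> code_take l (ini u l') = ini u l"
  by (rule list_code_eqI) auto

lemma ini_lnth: "ini (lnth s) (llen s) = s"
  by (rule list_encode_map_lnth)

lemma llen_0 [simp]: "llen 0 = 0"
  by (simp add: llen_def)

lemma llen_eq_0: "llen s = 0 \<longleftrightarrow> s = 0"
  by (metis ini_lnth list.simps(8) list_encode.simps(1) llen_0 upt_0)

text \<open>A measure is represented by the dyadic rationals strictly below it, that is, by a set of
  numbers.\<close>

definition dy :: "nat \<Rightarrow> real" where
  "dy q = real (pfst q) / 2 ^ psnd q"

lemma dy_less: "dy q < dy q' \<longleftrightarrow> pfst q * 2 ^ psnd q' < pfst q' * 2 ^ psnd q"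
proof -
  have "dy q < dy q' \<longleftrightarrow> real (pfst q) * 2 ^ psnd q' < real (pfst q') * 2 ^ psnd q"
    by (simp add: dy_def divide_simps)
  also have "\<dots> \<longleftrightarrow> real (pfst q * 2 ^ psnd q') < real (pfst q' * 2 ^ psnd q)" by simp
  finally show ?thesis by (simp only: of_nat_less_iff)
qed

lemma dy_dense:
  assumes "0 \<le> a" "a < (b :: real)"
  obtains q where "a < dy q" "dy q < b"
proof -
  obtain k where k: "(1 / 2) ^ k < b - a"
    using real_arch_pow_inv[of "b - a" "1 / 2"] assms by auto
  define i where "i = nat (\<lfloor>a * 2 ^ k\<rfloor> + 1)"
  have i: "real i = \<lfloor>a * 2 ^ k\<rfloor> + 1" using assms by (simp add: i_def)
  have "a * 2 ^ k < real i" "real i \<le> a * 2 ^ k + 1" unfolding i by linarith+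
  then have "a < real i / 2 ^ k" "real i / 2 ^ k \<le> a + (1 / 2) ^ k"
    by (auto simp: field_simps power_divide)
  then show ?thesis using k that[of "<|i, k|>"] by (simp add: dy_def)
qed

definition add_eps :: "nat \<Rightarrow> nat \<Rightarrow> nat" where
  "add_eps q e = <|pfst q * 2 ^ e + 2 ^ psnd q, psnd q + e|>"

lemma dy_add_eps: "dy (add_eps q e) = dy q + 1 / 2 ^ e"
  by (simp add: dy_def add_eps_def field_simps power_add)

lemma dy_nonneg: "0 \<le> dy q"
  by (simp add: dy_def)

locale ranked_trees =
  fixes G :: type2 and KA KB :: "nat \<Rightarrow> nat \<Rightarrow> nat \<Rightarrow> bool"
  assumes cA: "consistent KA" and cB: "consistent KB"
    and GA: "\<And>f n. G f = n \<longleftrightarrow> (\<exists>u. \<forall>l. KA n (ini u l) (ini f l))"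
    and GB: "\<And>f n. G f \<noteq> n \<longleftrightarrow> (\<exists>u. \<forall>l. KB n (ini u l) (ini f l))"
begin

lemma prefixA: "KA n (ini u l) (ini v l) \<Longrightarrow> l' \<le> l \<Longrightarrow> KA n (ini u l') (ini v l')"
  using cA unfolding consistent_def by blast

lemma prefixB: "KB n (ini u l) (ini v l) \<Longrightarrow> l' \<le> l \<Longrightarrow> KB n (ini u l') (ini v l')"
  using cB unfolding consistent_def by blast

lemma arp_KA [ar_intros]: "ar A \<Longrightarrow> ar B \<Longrightarrow> ar C \<Longrightarrow> arp (\<lambda>h x. KA (A h x) (B h x) (C h x))"
  using arp_comp[OF conjunct1[OF cA[unfolded consistent_def]] ar_pr[OF _ ar_pr]] by simp

lemma arp_KB [ar_intros]: "ar A \<Longrightarrow> ar B \<Longrightarrow> ar C \<Longrightarrow> arp (\<lambda>h x. KB (A h x) (B h x) (C h x))"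
  using arp_comp[OF conjunct1[OF cB[unfolded consistent_def]] ar_pr[OF _ ar_pr]] by simp

definition T :: "nat \<Rightarrow> type1 \<Rightarrow> nat \<Rightarrow> bool" where
  "T n f s \<longleftrightarrow> KB n s (ini f (llen s))"

lemma T_prefix:
  assumes "T n f (snoc s m)"
  shows "T n f s"
proof -
  have "KB n (ini (lnth (snoc s m)) (Suc (llen s))) (ini f (Suc (llen s)))"
    using assms ini_lnth[of "snoc s m"] by (simp add: T_def)
  from prefixB[OF this, of "llen s"] have "KB n (ini (lnth (snoc s m)) (llen s)) (ini f (llen s))" by simp
  moreover have "ini (lnth (snoc s m)) (llen s) = s"
    by (rule list_code_eqI) (auto simp: lnth_snoc)
  ultimately show ?thesis by (simp add: T_def)
qed

text \<open>
  A node codes finite approximations to a function \<open>f\<close>, to a witness for \<open>G f = n\<close> and to a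
  witness for \<open>G f \<noteq> n\<close>; no branch exists, so the order by extension is well-founded.
\<close>

definition col :: "(nat \<Rightarrow> nat) \<Rightarrow> nat \<Rightarrow> nat" where
  "col \<phi> u = list_encode (map (\<lambda>i. \<phi> (lnth u i)) [0..<llen u])"

definition W :: "nat \<Rightarrow> nat \<Rightarrow> bool" where
  "W n u \<longleftrightarrow> KA n (col (\<lambda>x. pfst (psnd x)) u) (col pfst u) \<and> KB n (col (\<lambda>x. psnd (psnd x)) u) (col pfst u)"

definition extends :: "nat \<Rightarrow> nat \<Rightarrow> bool" where
  "extends u' u \<longleftrightarrow> llen u < llen u' \<and> (\<forall>i. i < llen u \<longrightarrow> lnth u' i = lnth u i)"

text \<open>The trees of nodes for all \<open>n\<close>, side by side, with two additions: 0 lies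
  above everything, and each \<open>n\<close> has a least element \<open>bot_node n\<close>, which
  stands for the rank of an empty tree. Only the smaller of two nodes must satisfy \<open>W\<close>,
  so \<open>node n 0\<close> is a top of its component without any condition.\<close>

definition below :: "nat \<Rightarrow> nat \<Rightarrow> bool" where
  "below z' z \<longleftrightarrow> z' \<noteq> 0 \<and> (z \<noteq> 0 \<longrightarrow> pfst (z' - 1) = pfst (z - 1) \<and> psnd (z - 1) \<noteq> 0 \<and>
     (psnd (z' - 1) = 0 \<or> extends (psnd (z' - 1) - 1) (psnd (z - 1) - 1) \<and> W (pfst (z - 1)) (psnd (z' - 1) - 1)))"

abbreviation bot_node :: "nat \<Rightarrow> nat" where "bot_node n \<equiv> Suc <|n, 0|>"
abbreviation node :: "nat \<Rightarrow> nat \<Rightarrow> nat" where "node n u \<equiv> Suc <|n, Suc u|>"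

lemma node_cases:
  obtains "z = 0" | n where "z = bot_node n" | n u where "z = node n u"
proof (cases z)
  case (Suc w)
  then show ?thesis
    using that(2)[of "pfst w"] that(3)[of "pfst w" "psnd w - 1"] by (cases "psnd w") (metis pr_pfst_psnd diff_Suc_1)+
qed

lemma below_simps [simp]:
  "below z 0 \<longleftrightarrow> z \<noteq> 0"
  "\<not> below z (bot_node n)"
  "below z (node n u) \<longleftrightarrow> z = bot_node n \<or> (\<exists>u'. z = node n u' \<and> extends u' u \<and> W n u')"
  by (cases z rule: node_cases; auto simp: below_def)+

lemma arp_below [ar_intros]: "ar A \<Longrightarrow> ar B \<Longrightarrow> arp (\<lambda>h x. below (A h x) (B h x))"
proof -
  have "arp (\<lambda>h x. below (pfst x) (psnd x))"
    unfolding below_def extends_def W_def col_def by (intro ar_intros)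
  from arp_comp[OF this ar_pr] show "ar A \<Longrightarrow> ar B \<Longrightarrow> arp (\<lambda>h x. below (A h x) (B h x))" by simp
qed

lemma below_trans: "below x y \<Longrightarrow> below y z \<Longrightarrow> below x z"
  by (cases y rule: node_cases; cases z rule: node_cases) (auto simp: extends_def)

lemma col_ini [simp]: "col \<phi> (ini w l) = ini (\<lambda>i. \<phi> (w i)) l"
  by (rule list_code_eqI) (auto simp: col_def)

text \<open>A branch would yield one function \<open>f\<close> together with witnesses for both
  \<open>G f = n\<close> and \<open>G f \<noteq> n\<close>.\<close>

lemma no_branch:
  assumes u: "\<And>i. extends (u (Suc i)) (u i)" and W: "\<And>i. W n (u i)"
  shows False
proof -
  have len: "i \<le> llen (u i)" for i
  proof (induction i)
    case (Suc i)
    then show ?case using u[of i] by (simp add: extends_def)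
  qed simp
  have stable: "lnth (u (i + d)) k = lnth (u i) k \<and> k < llen (u (i + d))" if "k < llen (u i)" for i d k
    using that
  proof (induction d)
    case (Suc d)
    then show ?case using u[of "i + d"] by (simp add: extends_def)
  qed simp
  \<comment> \<open>Entry \<open>k\<close> is read at stage \<open>Suc k\<close>, whose length
    exceeds \<open>k\<close>; by \<open>stable\<close> later stages do not change it.\<close>
  define w where "w k = lnth (u (Suc k)) k" for k
  have w: "u i = ini w (llen (u i))" for i
  proof (rule list_code_eqI)
    fix k assume k: "k < llen (u i)"
    have k': "k < llen (u (Suc k))" using len[of "Suc k"] by simp
    have "lnth (u (i + Suc k)) k = lnth (u i) k" "lnth (u (Suc k + i)) k = lnth (u (Suc k)) k"
      using stable k k' by blast+
    then show "lnth (u i) k = lnth (ini w (llen (u i))) k" using k by (simp add: w_def add.commute)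
  qed simp
  have "KA n (ini (\<lambda>i. pfst (psnd (w i))) l) (ini (\<lambda>i. pfst (w i)) l)"
    and "KB n (ini (\<lambda>i. psnd (psnd (w i))) l) (ini (\<lambda>i. pfst (w i)) l)" for l
  proof -
    have "W n (ini w (llen (u l)))" using W[of l] w by metis
    then show "KA n (ini (\<lambda>i. pfst (psnd (w i))) l) (ini (\<lambda>i. pfst (w i)) l)"
      and "KB n (ini (\<lambda>i. psnd (psnd (w i))) l) (ini (\<lambda>i. pfst (w i)) l)"
      unfolding W_def col_ini using prefixA prefixB len[of l] by blast+
  qed
  then show False using GA GB by blast
qed

lemma wf_below: "wf {(x, y). below x y}"
  unfolding wf_iff_no_infinite_down_chain
proof
  assume "\<exists>c. \<forall>i. (c (Suc i), c i) \<in> {(x, y). below x y}"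
  then obtain c where c: "\<And>i. below (c (Suc i)) (c i)" by auto
  \<comment> \<open>After its first member an infinite descent avoids 0, which lies below nothing,
    and the bottom nodes, below which there is nothing.\<close>
  have nd: "\<exists>n u. c (Suc i) = node n u" for i
    using c[of i] c[of "Suc i"] by (cases "c (Suc i)" rule: node_cases) (auto simp: below_def)
  then obtain n u where nu: "\<And>i. c (Suc i) = node (n i) (u i)" by metis
  have step: "n (Suc i) = n i" "extends (u (Suc i)) (u i)" "W (n i) (u (Suc i))" for i
    using c[of "Suc i"] nu[of i] nu[of "Suc i"] by auto
  have "n i = n 0" for i by (induction i) (use step in auto)
  then show False
    using no_branch[of "\<lambda>i. u (Suc i)" "n 0"] step by metis
qed

text \<open>\<open>rk f s z\<close>: the subtree at \<open>s\<close> of the tree of attempts to witness \<open>G f \<noteq> n\<close> has at most the rank of \<open>z\<close>.\<close>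

inductive rk :: "type1 \<Rightarrow> nat \<Rightarrow> nat \<Rightarrow> bool" where
  bot: "\<not> T n f s \<Longrightarrow> rk f s (bot_node n)"
| node: "(\<And>m. below (c m) (node n u)) \<Longrightarrow> (\<And>m. rk f (snoc s m) (c m)) \<Longrightarrow> rk f s (node n u)"

lemma rk_bot: "rk f s (bot_node n) \<longleftrightarrow> \<not> T n f s"
  by (auto elim: rk.cases intro: rk.bot)

lemma rk_node: "rk f s (node n u) \<longleftrightarrow> (\<forall>m. \<exists>c. below c (node n u) \<and> rk f (snoc s m) c)"
proof
  assume "\<forall>m. \<exists>c. below c (node n u) \<and> rk f (snoc s m) c"
  then obtain c where "\<And>m. below (c m) (node n u) \<and> rk f (snoc s m) (c m)" by metis
  then show "rk f s (node n u)" using rk.node[of c n u f s] by blast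
next
  assume "rk f s (node n u)"
  then show "\<forall>m. \<exists>c. below c (node n u) \<and> rk f (snoc s m) c"
    by (rule rk.cases) (simp_all del: below_simps, blast)
qed

text \<open>Adding \<open>f\<close> and a witness \<open>w\<close> for \<open>G f = n\<close> to
  each attempt \<open>s\<close> embeds the tree of attempts into the order \<open>below\<close>,
  because \<open>f\<close> and \<open>w\<close> are consistent at every length. This is the bounding
  argument: the order does not depend on \<open>f\<close>.\<close>

lemma rk_complete:
  assumes "G f = n"
  shows "rk f 0 (node n 0)"
proof -
  obtain w where w: "\<And>l. KA n (ini w l) (ini f l)" using GA assms by blast
  define nd where "nd s = ini (\<lambda>i. <|f i, w i, lnth s i|>) (llen s)" for s
  have W: "W n (nd s)" if "T n f s" for s
  proof -
    have "ini (\<lambda>i. lnth s i) (llen s) = s" by (rule ini_lnth)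
    then show ?thesis using w[of "llen s"] that by (simp add: W_def nd_def T_def)
  qed
  have ext: "extends (nd (snoc s m)) (nd s)" for s m
    by (auto simp: extends_def nd_def lnth_snoc simp del: upt_Suc)
  have "\<forall>s. z = node n (nd s) \<longrightarrow> rk f s z" for z
    using wf_below
  proof (induction z rule: wf_induct_rule)
    case (less z)
    show ?case
    proof (intro allI impI)
      fix s assume z: "z = node n (nd s)"
      have "\<exists>c. below c z \<and> rk f (snoc s m) c" for m
      proof (cases "T n f (snoc s m)")
        case True
        have "below (node n (nd (snoc s m))) z" using z ext W[OF True] by simp
        then show ?thesis using less by blast
      next
        case False
        then show ?thesis using z by (intro exI[of _ "bot_node n"]) (simp add: rk_bot)
      qed
      then show "rk f s z" unfolding z rk_node by simp
    qed
  qed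
  moreover have "nd 0 = 0" by (simp add: nd_def)
  ultimately show ?thesis by metis
qed

lemma rk_no_branch: "rk f s z \<Longrightarrow> z \<noteq> 0 \<Longrightarrow> s = ini v (llen s) \<Longrightarrow> \<exists>l. \<not> T (pfst (z - 1)) f (ini v l)"
proof (induction rule: rk.induct)
  case (bot n f s)
  then show ?case by (intro exI[of _ "llen s"]) simp
next
  case (node c n u f s)
  let ?m = "v (llen s)"
  have "c ?m \<noteq> 0" "pfst (c ?m - 1) = n" using node.hyps(1)[of ?m] by auto
  moreover have "snoc s ?m = ini v (llen (snoc s ?m))" using node.prems(2) ini_Suc by simp
  ultimately show ?case using node.IH[of ?m] by simp
qed

lemma rk_sound:
  assumes "rk f 0 (node n u)"
  shows "G f = n"
proof (rule ccontr)
  assume "G f \<noteq> n"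
  then obtain v where v: "\<And>l. KB n (ini v l) (ini f l)" using GB by blast
  from rk_no_branch[OF assms, of v] obtain l where "\<not> T n f (ini v l)" by auto
  then show False using v[of l] by (simp add: T_def)
qed

text \<open>Linearity of ranks, expressed through the trees that a node bounds. If every node below
  \<open>z\<close> is matched by one below \<open>z'\<close>, then \<open>z'\<close> bounds at least
  as much. Otherwise, by induction, an unmatched node dominates all nodes below
  \<open>z'\<close>.\<close>

lemma rk_chain:
  assumes "z \<noteq> 0" "z' \<noteq> 0" "pfst (z - 1) = pfst (z' - 1)"
  shows "(\<forall>f s. rk f s z \<longrightarrow> rk f s z') \<or> (\<forall>f s. rk f s z' \<longrightarrow> rk f s z)"
  using wf_below assms
proof (induction z arbitrary: z' rule: wf_induct_rule)
  case (less z)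
  have bot: "rk f s (bot_node n) \<Longrightarrow> rk f s (node n u)" for f s n u
    unfolding rk_bot rk_node using T_prefix by (metis rk_bot below_simps(3))
  show ?case
  proof (cases z rule: node_cases)
    case (2 n)
    then show ?thesis using less.prems bot by (cases z' rule: node_cases) auto
  next
    case (3 n u)
    show ?thesis
    proof (cases z' rule: node_cases)
      case (2 n')
      then show ?thesis using less.prems bot 3 by auto
    next
      case (3 n' u')
      then have z: "z = node n u" "z' = node n u'" using less.prems \<open>z = node n u\<close> by auto
      show ?thesis
      proof (cases "\<forall>c. below c z \<longrightarrow> (\<exists>d. below d z' \<and> (\<forall>f s. rk f s c \<longrightarrow> rk f s d))")
        case True
        then have "\<forall>f s. rk f s z \<longrightarrow> rk f s z'" unfolding z rk_node by blast
        then show ?thesis ..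
      next
        case False
        then obtain c where c: "below c z" "\<And>d. below d z' \<Longrightarrow> \<not> (\<forall>f s. rk f s c \<longrightarrow> rk f s d)" by blast
        have "\<forall>f s. rk f s d \<longrightarrow> rk f s c" if d: "below d z'" for d
        proof -
          have "c \<noteq> 0" "d \<noteq> 0" "pfst (c - 1) = pfst (d - 1)" using c(1) d z by auto
          then show ?thesis using less.IH[of c d] c d by blast
        qed
        then have "\<forall>f s. rk f s z' \<longrightarrow> rk f s z" unfolding z rk_node using c(1)[unfolded z] by (metis z(2))
        then show ?thesis ..
      qed
    qed (use less.prems in auto)
  qed (use less.prems in auto)
qed

lemma ini_cong: "(\<And>i. i < l \<Longrightarrow> f i = g i) \<Longrightarrow> ini f l = ini g l"
  by (rule arg_cong[where f = list_encode]) auto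

lemma rk_measurable: "z \<noteq> 0 \<Longrightarrow> {f \<in> cantor. rk f s z} \<in> sets coin_toss"
  using wf_below
proof (induction z arbitrary: s rule: wf_induct_rule)
  case (less z)
  show ?case
  proof (cases z rule: node_cases)
    case (2 n)
    show ?thesis unfolding 2 rk_bot T_def
    proof (rule measure_clopen(1)[where len = "llen s"])
      fix f g :: type1 assume "\<And>i. i < llen s \<Longrightarrow> f i = g i"
      then have "ini f (llen s) = ini g (llen s)" by (rule ini_cong)
      then show "(\<not> KB n s (ini f (llen s))) = (\<not> KB n s (ini g (llen s)))" by (simp only:)
    qed
  next
    case (3 n u)
    have "{f \<in> space coin_toss. \<forall>m. \<exists>c. below c z \<and> rk f (snoc s m) c} \<in> sets coin_toss"
    proof (intro sets.sets_Collect_countable_All sets.sets_Collect_countable_Ex)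
      fix m c
      show "{f \<in> space coin_toss. below c z \<and> rk f (snoc s m) c} \<in> sets coin_toss"
      proof (cases "below c z")
        case True
        moreover from True have "c \<noteq> 0" by (simp add: below_def)
        ultimately show ?thesis using less.IH[of c "snoc s m"] by simp
      next
        case False
        then show ?thesis by simp
      qed
    qed
    then show ?thesis unfolding 3 rk_node space_coin_toss .
  qed (use less.prems in simp)
qed

text \<open>Finite sets \<open>S\<close> of attempts are considered at once because the measures for
  single children do not determine the measure of the intersection over all children; the measures
  for finite sets of children do, as a limit.\<close>

definition E :: "nat \<Rightarrow> nat \<Rightarrow> type1 set" where
  "E S z = {f \<in> cantor. \<forall>i<llen S. rk f (lnth S i) z}"

abbreviation M :: "nat \<Rightarrow> nat \<Rightarrow> real" where
  "M S z \<equiv> measure coin_toss (E S z)"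

lemma E_measurable: "z \<noteq> 0 \<Longrightarrow> E S z \<in> sets coin_toss"
proof -
  assume z: "z \<noteq> 0"
  have "{f \<in> space coin_toss. \<forall>i. i < llen S \<longrightarrow> rk f (lnth S i) z} \<in> sets coin_toss"
  proof (rule sets.sets_Collect_countable_All)
    fix i show "{f \<in> space coin_toss. i < llen S \<longrightarrow> rk f (lnth S i) z} \<in> sets coin_toss"
      using rk_measurable[OF z, of "lnth S i"] sets.top[of coin_toss] by (cases "i < llen S") simp_all
  qed
  then show ?thesis unfolding E_def by (simp only: space_coin_toss)
qed

lemma E_chain:
  assumes "z \<noteq> 0" "z' \<noteq> 0" "pfst (z - 1) = pfst (z' - 1)"
  shows "E S z \<subseteq> E S z' \<or> E S z' \<subseteq> E S z"
  using rk_chain[OF assms] unfolding E_def by blast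

text \<open>By \<open>E_chain\<close> the sets form a chain, so a nonempty finite union is one of
  them and measures do not add up. Continuity passes the bound to the full union.\<close>

lemma measure_Union_below:
  notes below_simps(3) [simp del]
  assumes r: "\<And>c. below c (node n u) \<Longrightarrow> M S c \<le> r"
  shows "(\<Union>c\<in>{c. below c (node n u)}. E S c) \<in> sets coin_toss"
    and "measure coin_toss (\<Union>c\<in>{c. below c (node n u)}. E S c) \<le> r"
proof -
  let ?B = "{c. below c (node n u)}"
  let ?A = "\<lambda>c. if c \<in> ?B then E S c else {}"
  have nz: "c \<noteq> 0" "pfst (c - 1) = n" if "c \<in> ?B" for c using that by (auto simp: below_simps(3))
  have eq: "(\<Union>c\<in>?B. E S c) = (\<Union>k. \<Union>c<k. ?A c)" by (auto split: if_splits)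
  have meas: "(\<Union>c<k. ?A c) \<in> sets coin_toss" for k
    by (intro sets.finite_UN) (auto simp: E_measurable nz)
  then show "(\<Union>c\<in>?B. E S c) \<in> sets coin_toss" unfolding eq by auto
  have "0 \<le> r" by (rule order_trans[OF measure_nonneg r[of "bot_node n"]]) (simp add: below_simps(3))
  have chain: "(\<Union>c<k. ?A c) = {} \<or> (\<exists>c\<in>?B. (\<Union>c<k. ?A c) = E S c)" for k
  proof (induction k)
    case (Suc k)
    have U: "(\<Union>c<Suc k. ?A c) = ?A k \<union> (\<Union>c<k. ?A c)" by (simp add: lessThan_Suc)
    show ?case
    proof (cases "k \<in> ?B")
      case True
      from Suc show ?thesis
      proof
        assume "\<exists>c\<in>?B. (\<Union>c<k. ?A c) = E S c"
        then obtain c where c: "c \<in> ?B" "(\<Union>c<k. ?A c) = E S c" by blast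
        then show ?thesis using E_chain[of k c S] nz[OF True] nz[OF c(1)] True unfolding U by auto
      qed (use True U in auto)
    next
      case False
      then have "?A k = {}" by (simp del: below_simps)
      then have "(\<Union>c<Suc k. ?A c) = (\<Union>c<k. ?A c)" unfolding U by (simp only: Un_empty_left)
      then show ?thesis using Suc.IH by (simp only:)
    qed
  qed simp
  have "measure coin_toss (\<Union>c<k. ?A c) \<le> r" for k
    using chain[of k] r \<open>0 \<le> r\<close> by auto
  moreover have "(\<lambda>k. measure coin_toss (\<Union>c<k. ?A c)) \<longlonglongrightarrow> measure coin_toss (\<Union>k. \<Union>c<k. ?A c)"
  proof (rule coin.finite_Lim_measure_incseq)
    show "range (\<lambda>k. \<Union>c<k. ?A c) \<subseteq> sets coin_toss" using meas by blast
    show "incseq (\<lambda>k. \<Union>c<k. ?A c)" by (intro incseq_SucI UN_mono) auto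
  qed
  ultimately show "measure coin_toss (\<Union>c\<in>?B. E S c) \<le> r"
    unfolding eq by (intro LIMSEQ_le_const2) auto
qed

definition children :: "nat \<Rightarrow> nat \<Rightarrow> nat" where
  "children S N = list_encode (map (\<lambda>i. snoc (lnth S (i div N)) (i mod N)) [0..<llen S * N])"

lemma all_children:
  "(\<forall>i<llen (children S N). \<phi> (lnth (children S N) i)) \<longleftrightarrow> (\<forall>j<llen S. \<forall>m<N. \<phi> (snoc (lnth S j) m))"
proof -
  have "(\<forall>i<llen (children S N). \<phi> (lnth (children S N) i))
    \<longleftrightarrow> (\<forall>i<llen S * N. \<phi> (snoc (lnth S (i div N)) (i mod N)))"
    by (simp add: children_def)
  also have "\<dots> \<longleftrightarrow> (\<forall>j<llen S. \<forall>m<N. \<phi> (snoc (lnth S j) m))"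
  proof (intro iffI allI impI)
    fix j m assume *: "\<forall>i<llen S * N. \<phi> (snoc (lnth S (i div N)) (i mod N))" "j < llen S" "m < N"
    have "j * N + m < Suc j * N" using *(3) by simp
    also have "\<dots> \<le> llen S * N" using *(2) by (intro mult_right_mono) auto
    finally show "\<phi> (snoc (lnth S j) m)" using *(1)[rule_format, of "j * N + m"] *(3) by simp
  next
    fix i assume *: "\<forall>j<llen S. \<forall>m<N. \<phi> (snoc (lnth S j) m)" "i < llen S * N"
    then have "N > 0" by (cases N) auto
    then show "\<phi> (snoc (lnth S (i div N)) (i mod N))" using * by (auto simp: less_mult_imp_div_less)
  qed
  finally show ?thesis .
qed

text \<open>For finitely many children the individual bounds can be replaced by the largest of them
  in the chain. This moves the choice of the bound outside the quantifier over children, at the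
  price of an intersection over \<open>N\<close>.\<close>

lemma E_node: "E S (node n u) = (\<Inter>N. \<Union>c\<in>{c. below c (node n u)}. E (children S N) c)"
proof (intro equalityI subsetI)
  fix f assume f: "f \<in> E S (node n u)"
  show "f \<in> (\<Inter>N. \<Union>c\<in>{c. below c (node n u)}. E (children S N) c)"
  proof
    fix N :: nat
    define P where "P = {..<llen S} \<times> {..<N}"
    have "\<forall>p\<in>P. \<exists>c. below c (node n u) \<and> rk f (snoc (lnth S (fst p)) (snd p)) c"
      using f unfolding E_def rk_node P_def by auto
    then obtain c where c: "\<And>p. p \<in> P \<Longrightarrow> below (c p) (node n u) \<and> rk f (snoc (lnth S (fst p)) (snd p)) (c p)"
      by metis
    have "\<exists>d. below d (node n u) \<and> (\<forall>p\<in>Q. \<forall>s. rk f s (c p) \<longrightarrow> rk f s d)" if "finite Q" "Q \<subseteq> P" for Q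
      using that
    proof (induction Q rule: finite_induct)
      case empty
      show ?case by (intro exI[of _ "bot_node n"]) simp
    next
      case (insert p Q)
      then obtain d where d: "below d (node n u)" "\<forall>p\<in>Q. \<forall>s. rk f s (c p) \<longrightarrow> rk f s d" by auto
      have "below (c p) (node n u)" using c insert by auto
      moreover have "(\<forall>f s. rk f s (c p) \<longrightarrow> rk f s d) \<or> (\<forall>f s. rk f s d \<longrightarrow> rk f s (c p))"
        by (rule rk_chain) (use d calculation in auto)
      ultimately show ?case using d by (metis insert_iff)
    qed
    from this[of P] obtain d where d: "below d (node n u)" "\<forall>p\<in>P. \<forall>s. rk f s (c p) \<longrightarrow> rk f s d"
      by (auto simp: P_def)
    have "\<forall>j<llen S. \<forall>m<N. rk f (snoc (lnth S j) m) d"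
    proof (intro allI impI)
      fix j m assume "j < llen S" "m < N"
      then have "(j, m) \<in> P" by (simp add: P_def)
      from c[OF this] d(2) this show "rk f (snoc (lnth S j) m) d" by force
    qed
    then have "f \<in> E (children S N) d" using f by (simp add: E_def all_children[of S N "\<lambda>s. rk f s d"])
    then show "f \<in> (\<Union>c\<in>{c. below c (node n u)}. E (children S N) c)" using d(1) by blast
  qed
next
  fix f assume f: "f \<in> (\<Inter>N. \<Union>c\<in>{c. below c (node n u)}. E (children S N) c)"
  have "\<exists>c. below c (node n u) \<and> rk f (snoc (lnth S j) m) c" if "j < llen S" for j m
  proof -
    obtain c where "below c (node n u)" "f \<in> E (children S (Suc m)) c" using f by blast
    then show ?thesis
      using that all_children[of S "Suc m" "\<lambda>s. rk f s c"] unfolding E_def by blast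
  qed
  moreover have "f \<in> cantor" using f unfolding E_def by blast
  ultimately show "f \<in> E S (node n u)" unfolding E_def rk_node by blast
qed

text \<open>The intersection in \<open>E_node\<close> is decreasing and each union in it is over a
  chain, so the measure is an infimum of suprema. The intermediate dyadic \<open>q'\<close> turns
  this into a condition on strict lower bounds, the only information the array keeps.\<close>

lemma M_node:
  assumes "0 \<le> q"
  shows "q < M S (node n u) \<longleftrightarrow> (\<exists>q'. q < dy q' \<and> (\<forall>N. \<exists>c. below c (node n u) \<and> dy q' < M (children S N) c))"
proof -
  let ?U = "\<lambda>N. \<Union>c\<in>{c. below c (node n u)}. E (children S N) c"
  have U: "?U N \<in> sets coin_toss" for N
    by (rule measure_Union_below(1)[of _ _ _ 1]) simp
  have nz: "c \<noteq> 0" if "below c (node n u)" for c using that by auto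
  have dec: "decseq ?U"
  proof (rule decseq_SucI)
    fix N
    have "E (children S (Suc N)) c \<subseteq> E (children S N) c" for c
      using all_children[of S N "\<lambda>s. rk _ s c"] all_children[of S "Suc N" "\<lambda>s. rk _ s c"] unfolding E_def by auto
    then show "?U (Suc N) \<subseteq> ?U N" by blast
  qed
  have lim: "(\<lambda>N. measure coin_toss (?U N)) \<longlonglongrightarrow> M S (node n u)"
    unfolding E_node[of S] by (rule coin.finite_Lim_measure_decseq) (use U dec in auto)
  show ?thesis
  proof
    assume "q < M S (node n u)"
    then obtain q' where q': "q < dy q'" "dy q' < M S (node n u)" using dy_dense assms by blast
    have "\<exists>c. below c (node n u) \<and> dy q' < M (children S N) c" for N
    proof (rule ccontr)
      assume "\<not> ?thesis"
      then have "measure coin_toss (?U N) \<le> dy q'" by (intro measure_Union_below(2)) (meson not_less)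
      moreover have "M S (node n u) \<le> measure coin_toss (?U N)"
        unfolding E_node[of S] by (rule coin.finite_measure_mono) (use U in auto)
      ultimately show False using q' by simp
    qed
    then show "\<exists>q'. q < dy q' \<and> (\<forall>N. \<exists>c. below c (node n u) \<and> dy q' < M (children S N) c)" using q' by blast
  next
    assume "\<exists>q'. q < dy q' \<and> (\<forall>N. \<exists>c. below c (node n u) \<and> dy q' < M (children S N) c)"
    then obtain q' where q': "q < dy q'" "\<And>N. \<exists>c. below c (node n u) \<and> dy q' < M (children S N) c" by blast
    have "dy q' \<le> measure coin_toss (?U N)" for N
    proof -
      obtain c where c: "below c (node n u)" "dy q' < M (children S N) c" using q' by blast
      have "M (children S N) c \<le> measure coin_toss (?U N)"
        by (rule coin.finite_measure_mono) (use c U in auto)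
      then show ?thesis using c by simp
    qed
    then have "dy q' \<le> M S (node n u)" using lim by (intro LIMSEQ_le_const) auto
    then show "q < M S (node n u)" using q' by simp
  qed
qed

definition total_len :: "nat \<Rightarrow> nat" where
  "total_len S = (\<Sum>i<llen S. llen (lnth S i))"

lemma M_bot: "dy q < M S (bot_node n) \<longleftrightarrow> pfst q * 2 ^ total_len S
    < card {t. t < 2 ^ total_len S \<and> (\<forall>i. i < llen S \<longrightarrow> \<not> KB n (lnth S i) (ini (bit_at t) (llen (lnth S i))))} * 2 ^ psnd q"
proof -
  let ?len = "total_len S"
  let ?Q = "\<lambda>f. \<forall>i<llen S. \<not> KB n (lnth S i) (ini f (llen (lnth S i)))"
  have le: "llen (lnth S i) \<le> ?len" if "i < llen S" for i
    unfolding total_len_def by (rule member_le_sum) (use that in auto)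
  have "?Q f = ?Q g" if "\<And>i. i < ?len \<Longrightarrow> f i = g i" for f g
  proof -
    have "ini f (llen (lnth S i)) = ini g (llen (lnth S i))" if "i < llen S" for i
      using \<open>\<And>i. i < ?len \<Longrightarrow> f i = g i\<close> le[OF that] by (intro ini_cong) auto
    then show ?thesis by metis
  qed
  from measure_clopen(2)[of ?len ?Q, OF this]
  have "M S (bot_node n) = card {t. t < 2 ^ ?len \<and> ?Q (bit_at t)} / 2 ^ ?len" (is "_ = real ?c / _")
    by (simp add: E_def rk_bot T_def)
  then have "dy q < M S (bot_node n) \<longleftrightarrow> real (pfst q) * 2 ^ ?len < real ?c * 2 ^ psnd q"
    unfolding dy_def by (simp only:) (simp add: divide_simps)
  also have "\<dots> \<longleftrightarrow> real (pfst q * 2 ^ ?len) < real (?c * 2 ^ psnd q)" by simp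
  finally show ?thesis by (simp only: of_nat_less_iff)
qed

definition M_step :: "type1 \<Rightarrow> nat \<Rightarrow> bool" where
  "M_step h x \<longleftrightarrow> (let z = pfst x; S = pfst (psnd x); q = psnd (psnd x) in
     if psnd (z - 1) = 0 then pfst q * 2 ^ total_len S
       < card {t. t < 2 ^ total_len S \<and>
           (\<forall>i. i < llen S \<longrightarrow> \<not> KB (pfst (z - 1)) (lnth S i) (ini (bit_at t) (llen (lnth S i))))} * 2 ^ psnd q
     else \<exists>q'. pfst q * 2 ^ psnd q' < pfst q' * 2 ^ psnd q \<and>
       (\<forall>N. \<exists>c. below c z \<and> h <|c, children S N, q'|> = 0))"

lemma arp_M_step: "arp M_step"
  unfolding M_step_def[abs_def] Let_def total_len_def children_def by (intro ar_intros)

definition M_array :: type1 where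
  "M_array x = (if pfst x \<noteq> 0 \<and> \<not> dy (psnd (psnd x)) < M (pfst (psnd x)) (pfst x) then 1 else 0)"

text \<open>The step sees the array cut off outside the nodes below \<open>z\<close>, so the
  equation determines the array by well-founded recursion. The guard \<open>below z 0\<close>
  excludes just \<open>z = 0\<close>, where the array is 0.\<close>

lemma M_array_rec:
  "M_array <|z, i|> = (if below z 0 then if M_step (\<lambda>w. if below (pfst w) z then M_array w else 0) <|z, i|> then 0 else 1 else 0)"
proof (cases z rule: node_cases)
  case (2 n)
  then show ?thesis by (simp add: M_array_def M_step_def M_bot)
next
  case (3 n u)
  have "dy (psnd i) < M (pfst i) z \<longleftrightarrow> M_step (\<lambda>w. if below (pfst w) z then M_array w else 0) <|z, i|>"
  proof -
    have "M_array <|c, S, q|> = 0 \<longleftrightarrow> dy q < M S c" if "below c z" for c S q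
      using that 3 by (auto simp: M_array_def)
    then have "(below c z \<and> (if below c z then M_array <|c, S, q|> else 0) = 0) \<longleftrightarrow> (below c z \<and> dy q < M S c)" for c S q
      by auto
    note * = this[unfolded 3]
    show ?thesis
      unfolding 3 M_node[OF dy_nonneg] dy_less M_step_def Let_def pfst_pr psnd_pr * by simp
  qed
  then show ?thesis using 3 by (simp add: M_array_def)
qed (simp add: M_array_def)

end

section \<open>Arithmetical selection in sets of positive measure\<close>

lemma singleton_code [simp]: "llen (Suc <|s, 0|>) = Suc 0" "lnth (Suc <|s, 0|>) 0 = s"
  using llen_list_encode[of "[s]"] lnth_list_encode[of 0 "[s]"] by simp_all

context ranked_trees
begin

text \<open>
  Going down one level in the tree, the measure of the set of functions whose rank at \<open>s\<close> is
  bounded by the chosen node is within \<open>2 ^ -(j + 1 + s)\<close> of the supremum over all nodes below \<open>b\<close>.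
\<close>

definition choose_node :: "nat \<Rightarrow> type1 \<Rightarrow> nat \<Rightarrow> nat \<Rightarrow> nat" where
  "choose_node j h b s = mu (\<lambda>c. below c b \<and> (\<forall>d. below d b \<longrightarrow> (\<forall>q.
     h <|d, Suc <|s, 0|>, add_eps q (j + 1 + s)|> = 0 \<longrightarrow> h <|c, Suc <|s, 0|>, q|> = 0)))"

definition node_at :: "nat \<Rightarrow> nat \<Rightarrow> type1 \<Rightarrow> nat \<Rightarrow> nat" where
  "node_at n j h s = rec_nat (node n 0) (\<lambda>i b. choose_node j h b (code_take (Suc i) s)) (llen s)"

text \<open>A sequence \<open>\<tau>\<close> is rejected as soon as an attempt consistent with it
  has been assigned a bottom node, since there the bound on the rank says that the attempt
  fails.\<close>

definition good :: "nat \<Rightarrow> nat \<Rightarrow> nat \<Rightarrow> type1 \<Rightarrow> nat \<Rightarrow> bool" where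
  "good n j \<sigma> h \<tau> \<longleftrightarrow> (\<forall>i. i < llen \<tau> \<longrightarrow> lnth \<tau> i \<le> 1) \<and>
     (\<forall>i. i < llen \<tau> \<longrightarrow> i < llen \<sigma> \<longrightarrow> lnth \<tau> i = lnth \<sigma> i) \<and>
     (\<forall>s. llen s \<le> llen \<tau> \<longrightarrow> KB n s (code_take (llen s) \<tau>) \<longrightarrow> psnd (node_at n j h s - 1) \<noteq> 0)"

definition extendible :: "nat \<Rightarrow> nat \<Rightarrow> nat \<Rightarrow> type1 \<Rightarrow> nat \<Rightarrow> bool" where
  "extendible n j \<sigma> h \<tau> \<longleftrightarrow> (\<forall>l. \<exists>\<tau>'. llen \<tau>' = llen \<tau> + l \<and> (\<forall>i. i < llen \<tau> \<longrightarrow> lnth \<tau>' i = lnth \<tau> i) \<and>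
     good n j \<sigma> h \<tau>')"

text \<open>The leftmost branch of the binary tree of good sequences, found bit by bit by asking
  whether good extensions of every length exist.\<close>

definition path_to :: "nat \<Rightarrow> nat \<Rightarrow> nat \<Rightarrow> type1 \<Rightarrow> nat \<Rightarrow> nat" where
  "path_to n j \<sigma> h l = rec_nat 0 (\<lambda>i \<tau>. if extendible n j \<sigma> h (snoc \<tau> 0) then snoc \<tau> 0 else snoc \<tau> 1) l"

definition select :: "nat \<Rightarrow> nat \<Rightarrow> nat \<Rightarrow> type1 \<Rightarrow> nat \<Rightarrow> nat" where
  "select n j \<sigma> h l = lnth (path_to n j \<sigma> h (Suc l)) l"

lemma ar_choose_node [ar_intros]: "ar B \<Longrightarrow> ar S \<Longrightarrow> ar (\<lambda>h x. choose_node j h (B h x) (S h x))"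
proof -
  have "ar (\<lambda>h x. choose_node j h (pfst x) (psnd x))"
    unfolding choose_node_def add_eps_def by (intro ar_intros)
  from ar.comp[OF this ar.pair] show "ar B \<Longrightarrow> ar S \<Longrightarrow> ar (\<lambda>h x. choose_node j h (B h x) (S h x))" by simp
qed

lemma ar_node_at [ar_intros]: "ar A \<Longrightarrow> ar (\<lambda>h x. node_at n j h (A h x))"
proof -
  have "ar (\<lambda>h x. node_at n j h x)"
    unfolding node_at_def by (intro ar_intros)
  from ar.comp[OF this] show "ar A \<Longrightarrow> ar (\<lambda>h x. node_at n j h (A h x))" .
qed

lemma ar_select: "ar (select n j \<sigma>)"
proof -
  have "arp (\<lambda>h x. good n j \<sigma> h x)"
    unfolding good_def by (intro ar_intros)
  from arp_comp[OF this] have g: "arp (\<lambda>h x. good n j \<sigma> h (A h x))" if "ar A" for A using that .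
  have "arp (\<lambda>h x. extendible n j \<sigma> h x)"
    unfolding extendible_def by (intro g ar_intros)
  from arp_comp[OF this] have e: "arp (\<lambda>h x. extendible n j \<sigma> h (A h x))" if "ar A" for A using that .
  show ?thesis
    unfolding select_def[abs_def] path_to_def by (intro e ar_intros)
qed

lemma node_at_0 [simp]: "node_at n j h 0 = node n 0"
  by (simp add: node_at_def)

lemma node_at_snoc: "node_at n j h (snoc s m) = choose_node j h (node_at n j h s) (snoc s m)"
proof -
  have take: "code_take (Suc i) (snoc s m) = code_take (Suc i) s" if "i < llen s" for i
    by (rule list_code_eqI) (use that in \<open>auto simp: lnth_snoc\<close>)
  have "k \<le> llen s \<Longrightarrow> rec_nat (node n 0) (\<lambda>i b. choose_node j h b (code_take (Suc i) (snoc s m))) k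
      = rec_nat (node n 0) (\<lambda>i b. choose_node j h b (code_take (Suc i) s)) k" for k
    by (induction k) (auto simp: take)
  moreover have "code_take (Suc (llen s)) (snoc s m) = snoc s m"
    by (rule list_code_eqI) auto
  ultimately show ?thesis by (simp add: node_at_def)
qed

lemma E_singleton: "E (Suc <|s, 0|>) z = {f \<in> cantor. rk f s z}"
  by (simp add: E_def)

lemma M_array_0: "z \<noteq> 0 \<Longrightarrow> M_array <|z, S, q|> = 0 \<longleftrightarrow> dy q < M S z"
  by (simp add: M_array_def)

text \<open>Near-optimality can be tested with strict dyadic lower bounds alone: a node better by
  more than the error would be separated from \<open>c\<close> by some \<open>q\<close>.\<close>

lemma choose_node:
  fixes s j n u
  defines "c \<equiv> choose_node j M_array (node n u) s"
  shows "below c (node n u)"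
    and "below d (node n u) \<Longrightarrow> M (Suc <|s, 0|>) d \<le> M (Suc <|s, 0|>) c + 1 / 2 ^ (j + 1 + s)"
proof -
  let ?b = "node n u" and ?m = "M (Suc <|s, 0|>)" and ?\<epsilon> = "1 / 2 ^ (j + 1 + s) :: real"
  let ?P = "\<lambda>c. below c ?b \<and> (\<forall>d. below d ?b \<longrightarrow> (\<forall>q.
     M_array <|d, Suc <|s, 0|>, add_eps q (j + 1 + s)|> = 0 \<longrightarrow> M_array <|c, Suc <|s, 0|>, q|> = 0))"
  have nz: "d \<noteq> 0" if "below d ?b" for d using that by (simp add: below_def)
  have \<epsilon>: "?\<epsilon> > 0" by simp
  let ?X = "?m ` {d. below d ?b}"
  have bdd: "bdd_above ?X" by (rule bdd_aboveI[of _ 1]) auto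
  have ne: "?X \<noteq> {}" using below_simps(3)[of "bot_node n" n u] by blast
  have "Sup ?X - ?\<epsilon> < Sup ?X" using \<epsilon> by simp
  then obtain c0 where c0: "below c0 ?b" "Sup ?X - ?\<epsilon> < ?m c0"
    using less_cSupD[OF ne] by blast
  have "?P c0"
  proof (intro conjI allI impI)
    fix d q assume d: "below d ?b" and q: "M_array <|d, Suc <|s, 0|>, add_eps q (j + 1 + s)|> = 0"
    have "?m d \<le> Sup ?X" using bdd d by (intro cSup_upper) auto
    then have "dy q < ?m c0"
      using q c0(2) unfolding M_array_0[OF nz[OF d]] dy_add_eps by linarith
    then show "M_array <|c0, Suc <|s, 0|>, q|> = 0" unfolding M_array_0[OF nz[OF c0(1)]] .
  qed (rule c0(1))
  then have P: "?P c" unfolding c_def choose_node_def by (rule mu_works[of ?P c0])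
  then show c: "below c ?b" by blast
  show "?m d \<le> ?m c + ?\<epsilon>" if d: "below d ?b"
  proof (rule ccontr)
    assume "\<not> ?thesis"
    then have "?m c < ?m d - ?\<epsilon>" by simp
    then obtain q where q: "?m c < dy q" "dy q < ?m d - ?\<epsilon>"
      using dy_dense[of "?m c"] measure_nonneg by metis
    have "M_array <|d, Suc <|s, 0|>, add_eps q (j + 1 + s)|> = 0"
      unfolding M_array_0[OF nz[OF d]] dy_add_eps using q(2) by linarith
    then have "M_array <|c, Suc <|s, 0|>, q|> = 0" using P d by blast
    then show False using q(1) unfolding M_array_0[OF nz[OF c]] by simp
  qed
qed

text \<open>A witness for \<open>G f \<noteq> n\<close> would be a branch of attempts consistent
  with \<open>f\<close>. The nodes assigned to them are never bottom nodes and would descend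
  forever.\<close>

lemma good_path_sound:
  assumes "\<And>l. good n j \<sigma> M_array (ini f l)"
  shows "G f = n"
proof (rule ccontr)
  assume "G f \<noteq> n"
  then obtain v where v: "\<And>l. KB n (ini v l) (ini f l)" using GB by blast
  let ?c = "\<lambda>l. node_at n j M_array (ini v l)"
  have nb: "psnd (?c l - 1) \<noteq> 0" for l
    using assms[of l, unfolded good_def, THEN conjunct2, THEN conjunct2, rule_format, of "ini v l"] v[of l] by simp
  have step: "below (?c (Suc l)) (?c l)" if "?c l = node n u" for l u
    using choose_node(1)[of j n u "ini v (Suc l)"] that by (simp only: ini_Suc node_at_snoc)
  have "\<exists>u. ?c l = node n u" for l
  proof (induction l)
    case (Suc l)
    then obtain u where u: "?c l = node n u" by blast
    from step[OF this] show ?case using nb[of "Suc l"] unfolding u by auto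
  qed simp
  then have "(?c (Suc l), ?c l) \<in> {(x, y). below x y}" for l using step by blast
  then have "\<exists>c. \<forall>l. (c (Suc l), c l) \<in> {(x, y). below x y}"
    by (intro exI[of _ ?c] allI)
  with wf_below[unfolded wf_iff_no_infinite_down_chain] show False by (rule notE)
qed

lemma summable_eps: "(\<lambda>s. 1 / 2 ^ (j + 1 + s) :: real) sums (1 / 2 ^ j)"
proof -
  have "(\<lambda>s. (1 / 2 ^ (j + 1)) * (1 / 2 :: real) ^ s) sums ((1 / 2 ^ (j + 1)) * (1 / (1 - 1 / 2)))"
    by (intro sums_mult geometric_sums) simp
  then show ?thesis by (simp add: power_add power_one_over field_simps)
qed

text \<open>\<open>Bad s\<close> contains the functions that respect the bound at the parent of
  \<open>s\<close> but not the one chosen at \<open>s\<close>. The errors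
  \<open>1 / 2 ^ (j + 1 + s)\<close> add up to \<open>1 / 2 ^ j\<close>, less than the measure at
  hand, so some function of the given set avoids every \<open>Bad s\<close> and keeps its bounds
  along the whole tree.\<close>

lemma good_path_exists:
  assumes big: "1 / 2 ^ j < measure coin_toss {f \<in> cantor. (\<forall>i<llen \<sigma>. f i = lnth \<sigma> i) \<and> G f = n}"
  shows "\<exists>f\<in>cantor. \<forall>l. good n j \<sigma> M_array (ini f l)"
proof -
  let ?b = "node_at n j M_array"
  let ?p = "\<lambda>s. code_take (llen s - 1) s"
  define Bad where "Bad s = (if s \<noteq> 0 \<and> (\<exists>u. ?b (?p s) = node n u)
      then {f \<in> cantor. rk f (?p s) (?b (?p s))} - {f \<in> cantor. rk f s (?b s)} else {})" for s
  have Bad: "Bad s \<in> sets coin_toss \<and> measure coin_toss (Bad s) \<le> 1 / 2 ^ (j + 1 + s)" for s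
  proof (cases "s \<noteq> 0 \<and> (\<exists>u. ?b (?p s) = node n u)")
    case True
    then obtain u where u: "?b (?p s) = node n u" by blast
    obtain l where l: "llen s = Suc l" using True llen_eq_0 by (cases "llen s") auto
    have s: "snoc (?p s) (lnth s l) = s" using snoc_code_take[OF l] l by simp
    have bs: "?b s = choose_node j M_array (node n u) s"
      using node_at_snoc[of n j M_array "?p s" "lnth s l"] s u by simp
    note ch = choose_node[where j = j and n = n and u = u and s = s, folded bs]
    have nz: "?b s \<noteq> 0" using ch(1) by (simp add: below_def)
    let ?U = "\<Union>c\<in>{c. below c (node n u)}. E (Suc <|s, 0|>) c"
    have U: "?U \<in> sets coin_toss" "measure coin_toss ?U \<le> M (Suc <|s, 0|>) (?b s) + 1 / 2 ^ (j + 1 + s)"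
      by (rule measure_Union_below[OF ch(2)], assumption)+
    have sub: "E (Suc <|s, 0|>) (?b s) \<subseteq> ?U" using ch(1) by blast
    have mE: "E (Suc <|s, 0|>) (?b s) \<in> sets coin_toss" by (rule E_measurable[OF nz])
    have "{f \<in> cantor. rk f (?p s) (?b (?p s))} \<subseteq> ?U"
    proof
      fix f assume f: "f \<in> {f \<in> cantor. rk f (?p s) (?b (?p s))}"
      then obtain c where "below c (node n u)" "rk f (snoc (?p s) (lnth s l)) c"
        unfolding u rk_node by blast
      then show "f \<in> ?U" using f s unfolding E_singleton by auto
    qed
    then have "Bad s \<subseteq> ?U - E (Suc <|s, 0|>) (?b s)" unfolding Bad_def E_singleton by auto
    then have "measure coin_toss (Bad s) \<le> measure coin_toss (?U - E (Suc <|s, 0|>) (?b s))"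
      by (rule coin.finite_measure_mono) (use U mE in auto)
    also have "\<dots> = measure coin_toss ?U - M (Suc <|s, 0|>) (?b s)"
      by (rule coin.finite_measure_Diff[OF U(1) mE sub])
    also have "\<dots> \<le> 1 / 2 ^ (j + 1 + s)" using U(2) by simp
    finally have "measure coin_toss (Bad s) \<le> 1 / 2 ^ (j + 1 + s)" .
    moreover have "Bad s \<in> sets coin_toss"
      unfolding Bad_def using True rk_measurable[of "?b s" s] rk_measurable[of "node n u" "?p s"] nz u by auto
    ultimately show ?thesis by blast
  qed (auto simp: Bad_def)
  have sB: "summable (\<lambda>s. measure coin_toss (Bad s))"
    by (rule summable_comparison_test'[OF sums_summable[OF summable_eps[of j]], of 0]) (use Bad in simp)
  have "measure coin_toss (\<Union>s. Bad s) \<le> (\<Sum>s. measure coin_toss (Bad s))"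
    by (rule coin.finite_measure_subadditive_countably) (use Bad sB in auto)
  also have "\<dots> \<le> (\<Sum>s. 1 / 2 ^ (j + 1 + s))"
    by (rule suminf_le) (use Bad sB sums_summable[OF summable_eps] in auto)
  also have "\<dots> = 1 / 2 ^ j" using summable_eps by (rule sums_unique[symmetric])
  finally have UB: "measure coin_toss (\<Union>s. Bad s) \<le> 1 / 2 ^ j" .
  have "\<not> {f \<in> cantor. (\<forall>i<llen \<sigma>. f i = lnth \<sigma> i) \<and> G f = n} \<subseteq> (\<Union>s. Bad s)"
  proof
    assume "{f \<in> cantor. (\<forall>i<llen \<sigma>. f i = lnth \<sigma> i) \<and> G f = n} \<subseteq> (\<Union>s. Bad s)"
    then have "measure coin_toss {f \<in> cantor. (\<forall>i<llen \<sigma>. f i = lnth \<sigma> i) \<and> G f = n} \<le> measure coin_toss (\<Union>s. Bad s)"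
      by (rule coin.finite_measure_mono) (use Bad in auto)
    then show False using big UB by simp
  qed
  then obtain f where f: "f \<in> cantor" "\<And>i. i < llen \<sigma> \<Longrightarrow> f i = lnth \<sigma> i" "G f = n" "\<And>s. f \<notin> Bad s" by blast
  have nd: "l = llen s \<Longrightarrow> T n f s \<Longrightarrow> rk f s (?b s) \<and> (\<exists>u. ?b s = node n u)" for l s
  proof (induction l arbitrary: s)
    case 0
    then have "s = 0" using llen_eq_0 by simp
    then show ?case using rk_complete[OF f(3)] by simp
  next
    case (Suc l)
    have s: "snoc (?p s) (lnth s l) = s" using snoc_code_take[of s l] Suc.prems(1)[symmetric] by simp
    then have "T n f (?p s)" using T_prefix[of n f "?p s" "lnth s l"] Suc.prems(2) by simp
    then have IH: "rk f (?p s) (?b (?p s))" "\<exists>u. ?b (?p s) = node n u" using Suc.IH[of "?p s"] Suc.prems(1) by auto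
    have "s \<noteq> 0" using Suc.prems(1) llen_0 by (metis nat.distinct(1))
    with IH(2) have "Bad s = {f \<in> cantor. rk f (?p s) (?b (?p s))} - {f \<in> cantor. rk f s (?b s)}"
      unfolding Bad_def by (intro if_P conjI)
    then have rk: "rk f s (?b s)" using f(1) f(4)[of s] IH(1) by blast
    obtain u where u: "?b (?p s) = node n u" using IH(2) by blast
    have "?b s = choose_node j M_array (node n u) s"
      using node_at_snoc[of n j M_array "?p s" "lnth s l"] s u by simp
    then have "below (?b s) (node n u)" using choose_node(1)[where j = j and n = n and u = u and s = s] by (simp only:)
    then show ?case using rk Suc.prems(2) by (auto simp: rk_bot)
  qed
  have "good n j \<sigma> M_array (ini f l)" for l
    unfolding good_def
  proof (intro conjI allI impI)
    fix i assume "i < llen (ini f l)"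
    moreover have "f i \<in> {0, 1}" using f(1) unfolding cantor_def by blast
    ultimately show "lnth (ini f l) i \<le> 1" by auto
  next
    fix s assume "llen s \<le> llen (ini f l)" "KB n s (code_take (llen s) (ini f l))"
    then have "T n f s" by (simp add: T_def)
    from nd[OF refl this] show "psnd (?b s - 1) \<noteq> 0" by auto
  qed (use f(2) in auto)
  then show ?thesis using f(1) by blast
qed

lemma good_prefix:
  assumes "good n j \<sigma> h \<tau>" "l \<le> llen \<tau>"
  shows "good n j \<sigma> h (code_take l \<tau>)"
proof -
  have "code_take (llen s) (code_take l \<tau>) = code_take (llen s) \<tau>" if "llen s \<le> l" for s
    by (rule list_code_eqI) (use that in auto)
  then show ?thesis using assms unfolding good_def by auto
qed

text \<open>Koenig's lemma for binary sequences: limits on the good extensions through 0 and through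
  1 would, by \<open>good_prefix\<close>, give a limit for the sequence itself.\<close>

lemma extendible_snoc:
  assumes "extendible n j \<sigma> h \<tau>"
  shows "extendible n j \<sigma> h (snoc \<tau> 0) \<or> extendible n j \<sigma> h (snoc \<tau> 1)"
proof (rule ccontr)
  assume *: "\<not> ?thesis"
  let ?Q = "\<lambda>b l \<tau>'. llen \<tau>' = llen (snoc \<tau> b) + l \<and> (\<forall>i. i < llen (snoc \<tau> b) \<longrightarrow> lnth \<tau>' i = lnth (snoc \<tau> b) i) \<and>
     good n j \<sigma> h \<tau>'"
  obtain l0 where l0: "\<And>\<tau>'. \<not> ?Q 0 l0 \<tau>'" using * unfolding extendible_def by blast
  obtain l1 where l1: "\<And>\<tau>'. \<not> ?Q 1 l1 \<tau>'" using * unfolding extendible_def by blast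
  obtain \<tau>' where \<tau>': "llen \<tau>' = llen \<tau> + (Suc (l0 + l1))" "\<And>i. i < llen \<tau> \<Longrightarrow> lnth \<tau>' i = lnth \<tau> i" "good n j \<sigma> h \<tau>'"
    using assms unfolding extendible_def by blast
  have "lnth \<tau>' (llen \<tau>) \<le> 1" using \<tau>'(1,3) unfolding good_def by simp
  then consider "lnth \<tau>' (llen \<tau>) = 0" | "lnth \<tau>' (llen \<tau>) = 1" by linarith
  then show False
  proof cases
    case 1
    then have "lnth (code_take (llen \<tau> + Suc l0) \<tau>') (llen \<tau>) = 0" by simp
    then have "?Q 0 l0 (code_take (llen \<tau> + Suc l0) \<tau>')"
      using \<tau>' good_prefix[OF \<tau>'(3), of "llen \<tau> + Suc l0"] by (auto simp: lnth_snoc less_Suc_eq)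
    then show False using l0 by blast
  next
    case 2
    then have "lnth (code_take (llen \<tau> + Suc l1) \<tau>') (llen \<tau>) = 1" by simp
    then have "?Q 1 l1 (code_take (llen \<tau> + Suc l1) \<tau>')"
      using \<tau>' good_prefix[OF \<tau>'(3), of "llen \<tau> + Suc l1"] by (auto simp: lnth_snoc less_Suc_eq)
    then show False using l1 by blast
  qed
qed

lemma select_good:
  assumes "\<exists>f\<in>cantor. \<forall>l. good n j \<sigma> h (ini f l)"
  shows "good n j \<sigma> h (ini (select n j \<sigma> h) l)"
proof -
  have e: "extendible n j \<sigma> h (path_to n j \<sigma> h l) \<and> llen (path_to n j \<sigma> h l) = l" for l
  proof (induction l)
    case 0
    obtain f where f: "\<And>l. good n j \<sigma> h (ini f l)" using assms by blast
    have "extendible n j \<sigma> h 0"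
      unfolding extendible_def
    proof
      fix l show "\<exists>\<tau>'. llen \<tau>' = llen 0 + l \<and> (\<forall>i. i < llen 0 \<longrightarrow> lnth \<tau>' i = lnth 0 i) \<and> good n j \<sigma> h \<tau>'"
        using f[of l] by (intro exI[of _ "ini f l"]) simp
    qed
    then show ?case by (simp add: path_to_def)
  next
    case (Suc l)
    have "path_to n j \<sigma> h (Suc l) = (if extendible n j \<sigma> h (snoc (path_to n j \<sigma> h l) 0)
        then snoc (path_to n j \<sigma> h l) 0 else snoc (path_to n j \<sigma> h l) 1)"
      by (simp add: path_to_def)
    then show ?case using Suc extendible_snoc[of n j \<sigma> h "path_to n j \<sigma> h l"] by (auto split: if_splits)
  qed
  have step: "path_to n j \<sigma> h (Suc l) = snoc (path_to n j \<sigma> h l) (select n j \<sigma> h l)" for l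
  proof -
    have "path_to n j \<sigma> h (Suc l) = snoc (path_to n j \<sigma> h l) 0 \<or> path_to n j \<sigma> h (Suc l) = snoc (path_to n j \<sigma> h l) 1"
      by (simp add: path_to_def)
    then show ?thesis using e[of l] by (auto simp: select_def lnth_snoc)
  qed
  have p: "path_to n j \<sigma> h l = ini (select n j \<sigma> h) l" for l
  proof (induction l)
    case (Suc l)
    then show ?case using step ini_Suc by simp
  qed (simp add: path_to_def)
  obtain \<tau>' where \<tau>': "llen \<tau>' = l" "\<And>i. i < l \<Longrightarrow> lnth \<tau>' i = lnth (ini (select n j \<sigma> h) l) i"
    "good n j \<sigma> h \<tau>'"
    using e[of l, THEN conjunct1, unfolded p extendible_def, rule_format, of 0] by auto
  have "\<tau>' = ini (select n j \<sigma> h) l"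
    by (rule list_code_eqI) (simp add: \<tau>'(1), simp only: \<tau>'(1,2))
  with \<tau>'(3) show ?thesis by (simp only:)
qed

lemma select_correct:
  assumes "1 / 2 ^ j < measure coin_toss {f \<in> cantor. (\<forall>i<llen \<sigma>. f i = lnth \<sigma> i) \<and> G f = n}"
  shows "select n j \<sigma> M_array \<in> cantor" "G (select n j \<sigma> M_array) = n"
    "i < llen \<sigma> \<Longrightarrow> select n j \<sigma> M_array i = lnth \<sigma> i"
proof -
  let ?f = "select n j \<sigma> M_array"
  have g: "good n j \<sigma> M_array (ini ?f l)" for l
    by (rule select_good[OF good_path_exists[OF assms]])
  then show "G ?f = n" by (rule good_path_sound)
  have "?f i \<le> 1" for i
    using g[of "Suc i", unfolded good_def, THEN conjunct1, rule_format, of i] by (simp del: upt_Suc)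
  then show "?f \<in> cantor" unfolding cantor_def by (auto simp: le_Suc_eq)
  show "i < llen \<sigma> \<Longrightarrow> ?f i = lnth \<sigma> i"
    using g[of "Suc i", unfolded good_def, THEN conjunct2, THEN conjunct1, rule_format, of i] by (simp del: upt_Suc)
qed

lemma G_measurable: "{f \<in> cantor. G f = n} \<in> sets coin_toss"
proof -
  have "{f \<in> cantor. G f = n} = {f \<in> cantor. rk f 0 (node n 0)}"
    using rk_complete rk_sound by blast
  then show ?thesis using rk_measurable by simp
qed

lemma cylinder_initial: "cylinder (initial f n) = {g \<in> cantor. \<forall>i<n. g i = f i}"
  by (auto simp: cylinder_def initial_def)

text \<open>Outside a set of measure less than \<open>1 / 2 ^ k\<close> the values of
  \<open>G\<close> are bounded by some \<open>N\<close>. The rest is divided according to the first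
  \<open>N\<close> bits and the value \<open>n\<close> of \<open>G\<close>. In a piece of positive
  measure a member is selected, and because \<open>n \<le> N\<close> its neighbourhood contains the
  whole piece. The other pieces are finitely many null sets.\<close>

lemma arithmetical_cover:
  "\<exists>F. finite F \<and> (\<forall>\<phi>\<in>F. ar \<phi> \<and> \<phi> M_array \<in> cantor) \<and> large G k ((\<lambda>\<phi>. \<phi> M_array) ` F)"
proof -
  let ?le = "\<lambda>N. {f \<in> cantor. G f \<le> N}"
  have le: "?le N = (\<Union>n\<le>N. {f \<in> cantor. G f = n})" for N by auto
  have mle: "?le N \<in> sets coin_toss" for N unfolding le using G_measurable by blast
  have "(\<lambda>N. measure coin_toss (?le N)) \<longlonglongrightarrow> measure coin_toss (\<Union>N. ?le N)"
    by (rule coin.finite_Lim_measure_incseq) (use mle in \<open>auto simp: incseq_def\<close>)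
  moreover have "(\<Union>N. ?le N) = space coin_toss" by auto
  ultimately have "(\<lambda>N. measure coin_toss (?le N)) \<longlonglongrightarrow> 1" using coin.prob_space by simp
  moreover have "1 - 1 / 2 ^ k < (1 :: real)" by simp
  ultimately have "eventually (\<lambda>N. 1 - 1 / 2 ^ k < measure coin_toss (?le N)) sequentially"
    by (rule order_tendstoD(1))
  then obtain N where N: "1 - 1 / 2 ^ k < measure coin_toss (?le N)"
    by (auto simp: eventually_sequentially)
  define \<sigma> where "\<sigma> t = ini (bit_at t) N" for t
  define A where "A t n = {f \<in> cantor. (\<forall>i<llen (\<sigma> t). f i = lnth (\<sigma> t) i) \<and> G f = n}" for t n
  have A_eq: "A t n = bit_cylinder N t \<inter> {f \<in> cantor. G f = n}" for t n
    by (auto simp: A_def \<sigma>_def bit_cylinder_def)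
  have mA: "A t n \<in> sets coin_toss" for t n
    unfolding A_eq using measure_bit_cylinder G_measurable by blast
  have "\<exists>j. 0 < measure coin_toss (A t n) \<longrightarrow> 1 / 2 ^ j < measure coin_toss (A t n)" for t n
    using real_arch_pow_inv[of "measure coin_toss (A t n)" "1 / 2"] by (auto simp: power_one_over)
  then obtain j where j: "\<And>t n. 0 < measure coin_toss (A t n) \<Longrightarrow> 1 / 2 ^ j t n < measure coin_toss (A t n)"
    by metis
  define I where "I = {(t, n). t < 2 ^ N \<and> n \<le> N \<and> 0 < measure coin_toss (A t n)}"
  define F where "F = (\<lambda>(t, n). select n (j t n) (\<sigma> t)) ` I"
  have "I \<subseteq> {..<2 ^ N} \<times> {..N}" unfolding I_def by auto
  then have fin: "finite F" unfolding F_def using finite_subset by blast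
  have sel: "select n (j t n) (\<sigma> t) M_array \<in> cantor" "G (select n (j t n) (\<sigma> t) M_array) = n"
    "i < N \<Longrightarrow> select n (j t n) (\<sigma> t) M_array i = bit_at t i" if "(t, n) \<in> I" for t n i
    using select_correct[OF j[of t n, unfolded A_def]] that unfolding I_def A_def by (auto simp: \<sigma>_def)
  let ?C = "covered G ((\<lambda>\<phi>. \<phi> M_array) ` F)"
  have C: "?C \<in> sets coin_toss"
    unfolding covered_def
  proof (rule sets.finite_UN)
    fix f assume "f \<in> (\<lambda>\<phi>. \<phi> M_array) ` F"
    show "cylinder (initial f (G f)) \<in> sets coin_toss"
      unfolding cylinder_initial by (rule measure_clopen(1)[of "G f"]) auto
  qed (use fin in simp)
  let ?Z = "\<Union>p\<in>({..<2 ^ N} \<times> {..N}) - I. A (fst p) (snd p)"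
  have Z: "?Z \<in> null_sets coin_toss"
  proof (rule null_sets.finite_UN)
    fix p assume "p \<in> ({..<2 ^ N} \<times> {..N}) - I"
    then have "measure coin_toss (A (fst p) (snd p)) = 0"
      unfolding I_def using measure_nonneg[of coin_toss] by (cases p) (auto simp: order.order_iff_strict)
    then show "A (fst p) (snd p) \<in> null_sets coin_toss"
      using mA by (intro null_setsI) (auto simp: coin.emeasure_eq_measure)
  qed simp
  have "?le N \<subseteq> ?C \<union> ?Z"
  proof
    fix f assume f: "f \<in> ?le N"
    obtain t where t: "t < 2 ^ N" "f \<in> bit_cylinder N t" using f in_bit_cylinder_unique by blast
    show "f \<in> ?C \<union> ?Z"
    proof (cases "(t, G f) \<in> I")
      case True
      let ?g = "select (G f) (j t (G f)) (\<sigma> t)"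
      have "f i = ?g M_array i" if "i < G (?g M_array)" for i
      proof -
        have "i < N" using that f unfolding sel(2)[OF True] by simp
        then show ?thesis using sel(3)[OF True] t(2) unfolding bit_cylinder_def by simp
      qed
      then have "f \<in> cylinder (initial (?g M_array) (G (?g M_array)))"
        using f unfolding cylinder_initial by simp
      moreover have "?g \<in> F" using True unfolding F_def by force
      ultimately show ?thesis unfolding covered_def by blast
    next
      case False
      have "f \<in> A t (G f)" using f t unfolding A_eq by simp
      moreover have "(t, G f) \<in> ({..<2 ^ N} \<times> {..N}) - I" using False f t by simp
      ultimately show ?thesis by force
    qed
  qed
  then have "measure coin_toss (?le N) \<le> measure coin_toss (?C \<union> ?Z)"
    by (rule coin.finite_measure_mono) (use C Z in \<open>auto dest: null_setsD2\<close>)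
  also have "\<dots> = measure coin_toss ?C"
    by (rule measure_Un_null_set[OF C Z])
  finally have "large G k ((\<lambda>\<phi>. \<phi> M_array) ` F)" unfolding large_def using N by simp
  moreover have "\<forall>\<phi>\<in>F. ar \<phi> \<and> \<phi> M_array \<in> cantor" using sel(1) ar_select unfolding F_def by auto
  ultimately show ?thesis using fin by blast
qed

end

text \<open>All that the constructible part has to know: \<open>A\<close> arises by arithmetical
  recursion along \<open>B\<close>, and finitely many functions arithmetical in \<open>A\<close>
  cover enough. Ranks of attempts and their measures no longer occur.\<close>

theorem hyperarithmetical2_cover:
  assumes "hyperarithmetical2 G"
  obtains B St A where "arp (\<lambda>h x. B (pfst x) (psnd x))" "\<And>x y z. B x y \<Longrightarrow> B y z \<Longrightarrow> B x z"
    "wf {(x, y). B x y}" "arp St"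
    "\<And>z i. A <|z, i|> = (if B z 0 then if St (\<lambda>w. if B (pfst w) z then A w else 0) <|z, i|> then 0 else 1 else (0 :: nat))"
    "\<And>k. \<exists>F. finite F \<and> (\<forall>\<phi>\<in>F. ar \<phi> \<and> \<phi> A \<in> cantor) \<and> large G k ((\<lambda>\<phi>. \<phi> A) ` F)"
proof -
  obtain K K' where K: "consistent K" "consistent K'"
    "\<And>f n. G f = n \<longleftrightarrow> (\<exists>u. \<forall>l. K n (ini u l) (ini f l))"
    "\<And>f n. G f \<noteq> n \<longleftrightarrow> (\<exists>u. \<forall>l. K' n (ini u l) (ini f l))"
    using hyperarithmetical2_consistent[OF assms] by metis
  interpret ranked_trees G K K' by unfold_locales (use K in auto)
  show ?thesis
  proof (rule that[of below M_step M_array])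
    show "arp (\<lambda>h x. below (pfst x) (psnd x))" by (intro ar_intros)
  qed (rule below_trans wf_below arp_M_step M_array_rec arithmetical_cover; assumption)+
qed

section \<open>A large level of the hierarchy at the rank of an arithmetical relation\<close>

section \<open>Hereditarily countable sets\<close>

lemma countable_elts [simp]: "countable (elts x)"
  unfolding elts_def using rcset by auto

definition hs :: "hset set \<Rightarrow> hset" where "hs S = HSet (acset S)"

lemma elts_hs [simp]: "countable S \<Longrightarrow> elts (hs S) = S"
  by (simp add: elts_def hs_def)

lemma hset_eqI: "elts x = elts y \<Longrightarrow> x = y"
  by (cases x; cases y) (simp add: elts_def rcset_inject)

lemma elts_induct:
  assumes "\<And>x. (\<And>y. y \<in> elts x \<Longrightarrow> P y) \<Longrightarrow> P x"
  shows "P x"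
proof (rule hset.induct[of P])
  fix A assume "\<And>y. y \<in> rcset A \<Longrightarrow> P y"
  then show "P (HSet A)" by (intro assms[of "HSet A"]) (simp add: elts_def)
qed

lemma not_mem_self [simp]: "x \<notin> elts x"
  by (induction x rule: elts_induct) auto

lemma mem_not_sym: "x \<in> elts y \<Longrightarrow> y \<notin> elts x"
  by (induction x arbitrary: y rule: elts_induct) auto

definition hsuc :: "hset \<Rightarrow> hset" where "hsuc x = HSet (cinsert x (members x))"

lemma elts_hsuc [simp]: "elts (hsuc x) = insert x (elts x)"
  by (simp add: elts_def hsuc_def cinsert.rep_eq)

lemma elts_hnat_0 [simp]: "elts (hnat 0) = {}"
  by (simp add: elts_def bot_cset.rep_eq)

lemma hnat_Suc [simp]: "hnat (Suc n) = hsuc (hnat n)"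
  by (simp add: hsuc_def)

declare hnat.simps [simp del]

lemma elts_hnat: "elts (hnat n) = hnat ` {..<n}"
  by (induction n) (auto simp: lessThan_Suc)

lemma hnat_inj [simp]: "hnat m = hnat n \<longleftrightarrow> m = n"
proof -
  have "hnat m \<noteq> hnat n" if "m < n" for m n
    using that elts_hnat[of n] not_mem_self by (metis imageI lessThan_iff)
  then show ?thesis by (metis nat_neq_iff)
qed

lemma elts_hpair: "elts (hpair x y) = {hs {x}, hs {x, y}}"
proof -
  have "HSet (cinsert u (cinsert v cempty)) = hs {u, v}" for u v
    by (rule hset_eqI) (simp add: elts_def hs_def cinsert.rep_eq bot_cset.rep_eq countable_finite)
  from this[of x x] this[of x y] show ?thesis
    by (simp add: hpair_def) (simp add: elts_def cinsert.rep_eq bot_cset.rep_eq)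
qed

lemma hpair_inj [simp]: "hpair a b = hpair c d \<longleftrightarrow> a = c \<and> b = d"
proof
  assume "hpair a b = hpair c d"
  then have "{hs {a}, hs {a, b}} = {hs {c}, hs {c, d}}" by (metis elts_hpair)
  moreover have "hs {u} = hs {v, w} \<longleftrightarrow> {u} = {v, w}" "hs {v, w} = hs {u} \<longleftrightarrow> {v, w} = {u}" "hs {u} = hs {v} \<longleftrightarrow> u = v"
    "hs {u, u'} = hs {v, w} \<longleftrightarrow> {u, u'} = {v, w}" for u u' v w
    using elts_hs[of "{u}"] elts_hs[of "{v}"] elts_hs[of "{v, w}"] elts_hs[of "{u, u'}"] by (metis countable_finite finite.simps singleton_inject)+
  ultimately show "a = c \<and> b = d" by (auto simp: doubleton_eq_iff)
qed simp

lemma elts_hfun: "elts (hfun f) = range (\<lambda>n. hpair (hnat n) (hnat (f n)))"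
  by (simp add: hfun_def elts_def)

lemma hfun_inj [simp]: "hfun f = hfun g \<longleftrightarrow> f = g"
proof
  assume "hfun f = hfun g"
  then have "range (\<lambda>n. hpair (hnat n) (hnat (f n))) = range (\<lambda>n. hpair (hnat n) (hnat (g n)))"
    by (metis elts_hfun)
  then have "\<exists>m. hpair (hnat n) (hnat (f n)) = hpair (hnat m) (hnat (g m))" for n by blast
  then show "f = g" by auto
qed simp

inductive HF :: "hset \<Rightarrow> bool" where
  HF: "finite (elts x) \<Longrightarrow> (\<And>y. y \<in> elts x \<Longrightarrow> HF y) \<Longrightarrow> HF x"

lemma HF_hsuc: "HF x \<Longrightarrow> HF (hsuc x)"
  by (rule HF) (auto elim: HF.cases)

lemma HF_hnat [simp]: "HF (hnat n)"
  by (induction n) (auto intro: HF HF_hsuc)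

lemma HF_hs: "finite S \<Longrightarrow> (\<And>x. x \<in> S \<Longrightarrow> HF x) \<Longrightarrow> HF (hs S)"
  by (rule HF) (simp_all add: countable_finite)

lemma HF_hpair [simp]: "HF x \<Longrightarrow> HF y \<Longrightarrow> HF (hpair x y)"
  by (rule HF) (auto simp: elts_hpair intro!: HF_hs)

section \<open>Levels of the constructible hierarchy\<close>

lemma ordinal_elt: "ordinal \<alpha> \<Longrightarrow> \<beta> \<in> elts \<alpha> \<Longrightarrow> ordinal \<beta>"
  unfolding ordinal_def by (meson subsetD)

lemma Def_elts: "x \<in> Def G M \<Longrightarrow> elts x \<subseteq> M"
  by (auto simp: Def_def defined_by_def)

text \<open>With \<open>x\<close> as a parameter, the elements of \<open>M\<close> that belong to
  \<open>x\<close> are defined; transitivity of \<open>M\<close> makes these all elements of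
  \<open>x\<close>.\<close>

lemma transitive_Def: "(\<And>x. x \<in> M \<Longrightarrow> elts x \<subseteq> M) \<Longrightarrow> M \<subseteq> Def G M"
proof
  fix x assume M: "\<And>x. x \<in> M \<Longrightarrow> elts x \<subseteq> M" and x: "x \<in> M"
  have "defined_by G M (StMem 0 1) [x] x"
    using M[OF x] x by (auto simp: defined_by_def)
  then show "x \<in> Def G M" by (auto simp: Def_def)
qed

lemma L_transitive_mono: "ordinal \<alpha> \<Longrightarrow> (\<forall>x\<in>L G \<alpha>. elts x \<subseteq> L G \<alpha>) \<and> (\<forall>\<beta>\<in>elts \<alpha>. L G \<beta> \<subseteq> L G \<alpha>)"
proof (induction \<alpha> rule: elts_induct)
  case (1 \<alpha>)
  have mono: "L G \<beta> \<subseteq> L G \<alpha>" if "\<beta> \<in> elts \<alpha>" for \<beta>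
  proof -
    have "L G \<beta> \<subseteq> Def G (L G \<beta>)"
      by (rule transitive_Def) (use 1 that ordinal_elt in blast)
    then show ?thesis using that L_eq[of G \<alpha>] by blast
  qed
  moreover have "elts x \<subseteq> L G \<alpha>" if "x \<in> L G \<alpha>" for x
  proof -
    obtain \<beta> where "\<beta> \<in> elts \<alpha>" "x \<in> Def G (L G \<beta>)" using \<open>x \<in> L G \<alpha>\<close> L_eq[of G \<alpha>] by blast
    then show ?thesis using mono Def_elts by blast
  qed
  ultimately show ?case by blast
qed

lemma L_transitive: "ordinal \<alpha> \<Longrightarrow> x \<in> L G \<alpha> \<Longrightarrow> elts x \<subseteq> L G \<alpha>"
  using L_transitive_mono by blast

lemma L_mono: "ordinal \<alpha> \<Longrightarrow> \<beta> \<in> elts \<alpha> \<Longrightarrow> L G \<beta> \<subseteq> L G \<alpha>"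
  using L_transitive_mono by blast

lemma Def_L: "\<beta> \<in> elts \<alpha> \<Longrightarrow> Def G (L G \<beta>) \<subseteq> L G \<alpha>"
  using L_eq[of G \<alpha>] by blast

lemma L_Def: "ordinal \<alpha> \<Longrightarrow> L G \<alpha> \<subseteq> Def G (L G \<alpha>)"
  by (rule transitive_Def) (rule L_transitive)

lemma ordinal_hnat: "ordinal (hnat n)"
  by (auto simp: ordinal_def elts_hnat)

text \<open>The disjunction of the equations between the variable and each parameter, written with
  negation and conjunction; a contradiction serves as the empty disjunction.\<close>

primrec finite_set_form :: "nat \<Rightarrow> st_form" where
  "finite_set_form 0 = StNot (StEq 0 0)"
| "finite_set_form (Suc k) = StNot (StAnd (StNot (StEq 0 (Suc k))) (StNot (finite_set_form k)))"

lemma finite_set_form_ok: "k < n \<Longrightarrow> st_form_ok (finite_set_form k) n"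
  by (induction k) auto

lemma finite_set_form_sat: "st_sat G M (finite_set_form k) (y # ps) \<longleftrightarrow> (\<exists>i<k. y = ps ! i)"
  by (induction k) (auto simp: less_Suc_eq)

lemma finite_Def: "finite (elts x) \<Longrightarrow> elts x \<subseteq> M \<Longrightarrow> x \<in> Def G M"
proof -
  assume "finite (elts x)" and M: "elts x \<subseteq> M"
  then obtain ps where ps: "set ps = elts x" using finite_list by blast
  have "y \<in> elts x \<longleftrightarrow> (\<exists>i<length ps. y = ps ! i)" for y using ps in_set_conv_nth by metis
  then have "defined_by G M (finite_set_form (length ps)) ps x"
    using M ps by (auto simp: defined_by_def finite_set_form_ok finite_set_form_sat)
  then show ?thesis by (auto simp: Def_def)
qed

lemma HF_L: "HF x \<Longrightarrow> \<exists>n. x \<in> L G (hnat n)"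
proof (induction rule: HF.induct)
  case (HF x)
  then obtain n where n: "\<And>y. y \<in> elts x \<Longrightarrow> y \<in> L G (hnat (n y))" by metis
  have m: "n y < Suc (Max (n ` elts x))" if "y \<in> elts x" for y
    using HF.hyps(1) that by (auto simp: less_Suc_eq_le)
  have "elts x \<subseteq> L G (hnat (Suc (Max (n ` elts x))))"
  proof
    fix y assume y: "y \<in> elts x"
    have "hnat (n y) \<in> elts (hnat (Suc (Max (n ` elts x))))"
      unfolding elts_hnat using m[OF y] by blast
    then show "y \<in> L G (hnat (Suc (Max (n ` elts x))))" using n[OF y] L_mono[OF ordinal_hnat] by blast
  qed
  then have "x \<in> Def G (L G (hnat (Suc (Max (n ` elts x)))))" using HF.hyps(1) finite_Def by blast
  then have "x \<in> L G (hnat (Suc (Suc (Max (n ` elts x)))))" using L_eq[of G "hnat (Suc (Suc (Max (n ` elts x))))"] by auto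
  then show ?case by blast
qed

text \<open>How the pairs follow each other in the order of their codes: along a diagonal, then to
  the start of the next one. This rule makes pairing definable in a level from successor and finite
  sequences.\<close>

lemma prod_decode_Suc:
  "psnd i = 0 \<Longrightarrow> pfst (Suc i) = 0 \<and> psnd (Suc i) = Suc (pfst i)"
  "psnd i = Suc n \<Longrightarrow> pfst (Suc i) = Suc (pfst i) \<and> psnd (Suc i) = n"
proof -
  assume i: "psnd i = 0"
  then have "<|pfst i, 0|> = i" by (metis pr_pfst_psnd)
  then have "<|0, Suc (pfst i)|> = Suc i" by (simp add: prod_encode_def)
  then show "pfst (Suc i) = 0 \<and> psnd (Suc i) = Suc (pfst i)" by (metis pfst_pr psnd_pr)
next
  assume i: "psnd i = Suc n"
  then have "<|pfst i, Suc n|> = i" by (metis pr_pfst_psnd)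
  then have "<|Suc (pfst i), n|> = Suc i" by (simp add: prod_encode_def)
  then show "pfst (Suc i) = Suc (pfst i) \<and> psnd (Suc i) = n" by (metis pfst_pr psnd_pr)
qed

section \<open>Definability over a level\<close>

text \<open>
  \<open>ps\<close> lists the parameters.  A definable relation is given on the list of its arguments, a variable
  as a projection of that list.
\<close>

locale st_level =
  fixes G :: type2 and M :: "hset set" and ps :: "hset list"
  assumes trans: "x \<in> M \<Longrightarrow> elts x \<subseteq> M"
    and HF_M: "HF x \<Longrightarrow> x \<in> M"
    and ps: "set ps \<subseteq> M"
begin

definition vr :: "nat \<Rightarrow> (hset list \<Rightarrow> hset) \<Rightarrow> bool" where
  "vr n x \<longleftrightarrow> (\<exists>i < n + length ps. \<forall>xs. length xs = n \<longrightarrow> x xs = (xs @ ps) ! i)"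

definition sd :: "nat \<Rightarrow> (hset list \<Rightarrow> bool) \<Rightarrow> bool" where
  "sd n P \<longleftrightarrow> (\<exists>\<phi>. st_form_ok \<phi> (n + length ps) \<and>
     (\<forall>xs. length xs = n \<longrightarrow> set xs \<subseteq> M \<longrightarrow> st_sat G M \<phi> (xs @ ps) = P xs))"

named_theorems sd_intros

lemma vr_hd [sd_intros]: "vr (Suc n) (\<lambda>xs. hd xs)"
  unfolding vr_def by (intro exI[of _ 0]) (auto simp: length_Suc_conv)

lemma vr_tl [sd_intros]: "vr n x \<Longrightarrow> vr (Suc n) (\<lambda>xs. x (tl xs))"
proof -
  assume "vr n x"
  then obtain i where "i < n + length ps" "\<And>xs. length xs = n \<Longrightarrow> x xs = (xs @ ps) ! i" unfolding vr_def by blast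
  then show ?thesis unfolding vr_def by (intro exI[of _ "Suc i"]) (auto simp: length_Suc_conv)
qed

lemma vr_const [sd_intros]: "c \<in> set ps \<Longrightarrow> vr n (\<lambda>xs. c)"
proof -
  assume "c \<in> set ps"
  then obtain i where "i < length ps" "ps ! i = c" by (auto simp: in_set_conv_nth)
  then show ?thesis unfolding vr_def by (intro exI[of _ "n + i"]) (auto simp: nth_append)
qed

lemma vr_M: "vr n x \<Longrightarrow> length xs = n \<Longrightarrow> set xs \<subseteq> M \<Longrightarrow> x xs \<in> M"
proof -
  assume "vr n x" and xs: "length xs = n" "set xs \<subseteq> M"
  then obtain i where "i < length (xs @ ps)" "x xs = (xs @ ps) ! i" unfolding vr_def by auto
  then show "x xs \<in> M" using nth_mem[of i "xs @ ps"] xs ps by auto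
qed

lemma sd_cong: "sd n P \<Longrightarrow> (\<And>xs. length xs = n \<Longrightarrow> set xs \<subseteq> M \<Longrightarrow> P xs = Q xs) \<Longrightarrow> sd n Q"
  unfolding sd_def by metis

lemma sd_mem [sd_intros]: "vr n x \<Longrightarrow> vr n y \<Longrightarrow> sd n (\<lambda>xs. x xs \<in> elts (y xs))"
proof -
  assume "vr n x" "vr n y"
  then obtain i j where "i < n + length ps" "\<And>xs. length xs = n \<Longrightarrow> x xs = (xs @ ps) ! i"
    "j < n + length ps" "\<And>xs. length xs = n \<Longrightarrow> y xs = (xs @ ps) ! j" unfolding vr_def by blast
  then show ?thesis unfolding sd_def by (intro exI[of _ "StMem i j"]) simp
qed

lemma sd_eq [sd_intros]: "vr n x \<Longrightarrow> vr n y \<Longrightarrow> sd n (\<lambda>xs. x xs = y xs)"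
proof -
  assume "vr n x" "vr n y"
  then obtain i j where "i < n + length ps" "\<And>xs. length xs = n \<Longrightarrow> x xs = (xs @ ps) ! i"
    "j < n + length ps" "\<And>xs. length xs = n \<Longrightarrow> y xs = (xs @ ps) ! j" unfolding vr_def by blast
  then show ?thesis unfolding sd_def by (intro exI[of _ "StEq i j"]) simp
qed

lemma sd_not [sd_intros]: "sd n P \<Longrightarrow> sd n (\<lambda>xs. \<not> P xs)"
  unfolding sd_def by (metis st_form_ok.simps(4) st_sat.simps(4))

lemma sd_conj [sd_intros]: "sd n P \<Longrightarrow> sd n Q \<Longrightarrow> sd n (\<lambda>xs. P xs \<and> Q xs)"
  unfolding sd_def by (metis st_form_ok.simps(5) st_sat.simps(5))

lemma sd_disj [sd_intros]: "sd n P \<Longrightarrow> sd n Q \<Longrightarrow> sd n (\<lambda>xs. P xs \<or> Q xs)"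
  by (rule sd_cong[OF sd_not[OF sd_conj[OF sd_not sd_not]]]) auto

lemma sd_imp [sd_intros]: "sd n P \<Longrightarrow> sd n Q \<Longrightarrow> sd n (\<lambda>xs. P xs \<longrightarrow> Q xs)"
  by (rule sd_cong[OF sd_not[OF sd_conj[OF _ sd_not]]]) auto

lemma sd_all [sd_intros]:
  assumes "sd (Suc n) (\<lambda>xs. P (tl xs) (hd xs))"
  shows "sd n (\<lambda>xs. \<forall>y\<in>M. P xs y)"
proof -
  obtain \<phi> where \<phi>: "st_form_ok \<phi> (Suc n + length ps)"
    "\<And>xs. length xs = Suc n \<Longrightarrow> set xs \<subseteq> M \<Longrightarrow> st_sat G M \<phi> (xs @ ps) = P (tl xs) (hd xs)"
    using assms unfolding sd_def by blast
  show ?thesis unfolding sd_def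
  proof (intro exI[of _ "StAll \<phi>"] conjI allI impI)
    fix xs assume xs: "length xs = n" "set xs \<subseteq> M"
    have "st_sat G M \<phi> ((y # xs) @ ps) = P xs y" if "y \<in> M" for y
      using \<phi>(2)[of "y # xs"] xs that by simp
    then show "st_sat G M (StAll \<phi>) (xs @ ps) = (\<forall>y\<in>M. P xs y)" by simp
  qed (use \<phi>(1) in simp)
qed

lemma sd_ex [sd_intros]:
  assumes "sd (Suc n) (\<lambda>xs. P (tl xs) (hd xs))"
  shows "sd n (\<lambda>xs. \<exists>y\<in>M. P xs y)"
  by (rule sd_cong[OF sd_not[OF sd_all[OF sd_not[OF assms]]]]) auto

lemma sd_ball [sd_intros]:
  assumes "vr n x" "sd (Suc n) (\<lambda>xs. P (tl xs) (hd xs))"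
  shows "sd n (\<lambda>xs. \<forall>y\<in>elts (x xs). P xs y)"
proof (rule sd_cong)
  show "sd n (\<lambda>xs. \<forall>y\<in>M. y \<in> elts (x xs) \<longrightarrow> P xs y)" by (intro sd_intros assms)
qed (use trans vr_M[OF assms(1)] in blast)

lemma sd_bex [sd_intros]:
  assumes "vr n x" "sd (Suc n) (\<lambda>xs. P (tl xs) (hd xs))"
  shows "sd n (\<lambda>xs. \<exists>y\<in>elts (x xs). P xs y)"
  by (rule sd_cong[OF sd_not[OF sd_ball[OF assms(1) sd_not[OF assms(2)]]]]) auto

lemma sd_singleton [sd_intros]:
  assumes "vr n x" "vr n y"
  shows "sd n (\<lambda>xs. y xs = hs {x xs})"
proof (rule sd_cong)
  show "sd n (\<lambda>xs. x xs \<in> elts (y xs) \<and> (\<forall>z\<in>elts (y xs). z = x xs))" by (intro sd_intros assms)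
  fix xs show "(x xs \<in> elts (y xs) \<and> (\<forall>z\<in>elts (y xs). z = x xs)) = (y xs = hs {x xs})"
    by (auto intro!: hset_eqI)
qed

lemma sd_doubleton [sd_intros]:
  assumes "vr n x" "vr n x'" "vr n y"
  shows "sd n (\<lambda>xs. y xs = hs {x xs, x' xs})"
proof (rule sd_cong)
  show "sd n (\<lambda>xs. x xs \<in> elts (y xs) \<and> x' xs \<in> elts (y xs) \<and> (\<forall>z\<in>elts (y xs). z = x xs \<or> z = x' xs))" by (intro sd_intros assms)
  fix xs show "(x xs \<in> elts (y xs) \<and> x' xs \<in> elts (y xs) \<and> (\<forall>z\<in>elts (y xs). z = x xs \<or> z = x' xs)) = (y xs = hs {x xs, x' xs})"
    by (auto intro!: hset_eqI)
qed

lemma sd_hpair [sd_intros]: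
  assumes "vr n x" "vr n y" "vr n p"
  shows "sd n (\<lambda>xs. p xs = hpair (x xs) (y xs))"
proof (rule sd_cong)
  show "sd n (\<lambda>xs. \<exists>s\<in>elts (p xs). \<exists>d\<in>elts (p xs). s = hs {x xs} \<and> d = hs {x xs, y xs} \<and> (\<forall>z\<in>elts (p xs). z = s \<or> z = d))"
    by (intro sd_intros assms)
  fix xs
  show "(\<exists>s\<in>elts (p xs). \<exists>d\<in>elts (p xs). s = hs {x xs} \<and> d = hs {x xs, y xs} \<and> (\<forall>z\<in>elts (p xs). z = s \<or> z = d))
     = (p xs = hpair (x xs) (y xs))"
  proof
    assume "\<exists>s\<in>elts (p xs). \<exists>d\<in>elts (p xs). s = hs {x xs} \<and> d = hs {x xs, y xs} \<and> (\<forall>z\<in>elts (p xs). z = s \<or> z = d)"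
    then show "p xs = hpair (x xs) (y xs)" by (intro hset_eqI) (auto simp: elts_hpair)
  qed (auto simp: elts_hpair)
qed

lemma sd_hpair_mem [sd_intros]:
  assumes "vr n x" "vr n y" "vr n s"
  shows "sd n (\<lambda>xs. hpair (x xs) (y xs) \<in> elts (s xs))"
proof (rule sd_cong)
  show "sd n (\<lambda>xs. \<exists>p\<in>elts (s xs). p = hpair (x xs) (y xs))" by (intro sd_intros assms)
qed auto

lemma sd_0 [sd_intros]: "vr n x \<Longrightarrow> sd n (\<lambda>xs. x xs = hnat 0)"
proof (rule sd_cong)
  assume x: "vr n x"
  show "sd n (\<lambda>xs. \<forall>z\<in>elts (x xs). z \<in> elts z)" by (intro sd_intros x)
  fix xs show "(\<forall>z\<in>elts (x xs). z \<in> elts z) = (x xs = hnat 0)" by (auto intro!: hset_eqI)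
qed

lemma sd_hsuc [sd_intros]: "vr n x \<Longrightarrow> vr n y \<Longrightarrow> sd n (\<lambda>xs. y xs = hsuc (x xs))"
proof (rule sd_cong)
  assume x: "vr n x" "vr n y"
  show "sd n (\<lambda>xs. x xs \<in> elts (y xs) \<and> (\<forall>z\<in>elts (x xs). z \<in> elts (y xs)) \<and> (\<forall>z\<in>elts (y xs). z = x xs \<or> z \<in> elts (x xs)))"
    by (intro sd_intros x)
  fix xs show "(x xs \<in> elts (y xs) \<and> (\<forall>z\<in>elts (x xs). z \<in> elts (y xs)) \<and> (\<forall>z\<in>elts (y xs). z = x xs \<or> z \<in> elts (x xs)))
     = (y xs = hsuc (x xs))" by (auto intro!: hset_eqI)
qed

text \<open>Well-foundedness of membership does the work of an ordinal condition: by induction, each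
  element of \<open>x\<close> is a numeral, since it is zero or the successor of one of its own
  elements.\<close>

lemma hnat_char: "(\<exists>k. x = hnat k) \<longleftrightarrow>
  (\<forall>y\<in>elts x. \<forall>z\<in>elts y. z \<in> elts x) \<and>
  (\<forall>y\<in>elts x. y = hnat 0 \<or> (\<exists>z\<in>elts y. y = hsuc z)) \<and> (x = hnat 0 \<or> (\<exists>z\<in>elts x. x = hsuc z))" (is "_ \<longleftrightarrow> ?R")
proof
  assume "\<exists>k. x = hnat k"
  then obtain k where k: "x = hnat k" by blast
  have "hnat m = hnat 0 \<or> (\<exists>z\<in>elts (hnat m). hnat m = hsuc z)" for m by (cases m) auto
  then show ?R unfolding k by (auto simp: elts_hnat)
next
  assume R: ?R
  have "y = x \<or> y \<in> elts x \<Longrightarrow> \<exists>k. y = hnat k" for y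
  proof (induction y rule: elts_induct)
    case (1 y)
    then consider "y = hnat 0" | z where "z \<in> elts y" "y = hsuc z" using R by blast
    then show ?case
    proof cases
      case 2
      then have "z \<in> elts x" using R 1 by blast
      then show ?thesis using 1(1)[of z] 2 hnat_Suc by metis
    qed blast
  qed
  then show "\<exists>k. x = hnat k" by blast
qed

lemma sd_nat [sd_intros]: "vr n x \<Longrightarrow> sd n (\<lambda>xs. \<exists>k. x xs = hnat k)"
  unfolding hnat_char by (intro sd_intros)

lemma hnat_M [simp]: "hnat k \<in> M"
  by (rule HF_M) simp

lemma hfun_char: "(\<exists>h. g = hfun h) \<longleftrightarrow>
   (\<forall>p\<in>elts g. \<exists>x\<in>M. \<exists>y\<in>M. (\<exists>k. x = hnat k) \<and> (\<exists>k. y = hnat k) \<and> p = hpair x y) \<and>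
   (\<forall>x\<in>M. (\<exists>k. x = hnat k) \<longrightarrow> (\<exists>y\<in>M. (\<exists>k. y = hnat k) \<and> hpair x y \<in> elts g)) \<and>
   (\<forall>x\<in>M. \<forall>y\<in>M. \<forall>z\<in>M. hpair x y \<in> elts g \<longrightarrow> hpair x z \<in> elts g \<longrightarrow> y = z)" (is "_ \<longleftrightarrow> ?R")
proof
  assume "\<exists>h. g = hfun h"
  then obtain h where h: "g = hfun h" by blast
  have "\<exists>y\<in>M. (\<exists>m. y = hnat m) \<and> hpair (hnat k) y \<in> range (\<lambda>n. hpair (hnat n) (hnat (h n)))" for k
    by (rule bexI[of _ "hnat (h k)"]) auto
  then show ?R unfolding h elts_hfun by (intro conjI) auto
next
  assume R: ?R
  have "\<forall>k. \<exists>m. hpair (hnat k) (hnat m) \<in> elts g"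
  proof
    fix k show "\<exists>m. hpair (hnat k) (hnat m) \<in> elts g" using R hnat_M[of k] by blast
  qed
  from choice[OF this] obtain h where h: "\<And>k. hpair (hnat k) (hnat (h k)) \<in> elts g" by blast
  have "elts g = elts (hfun h)"
    unfolding elts_hfun
  proof (intro equalityI subsetI)
    fix p assume "p \<in> elts g"
    then obtain k m where p: "p = hpair (hnat k) (hnat m)" using conjunct1[OF R] by blast
    have "hpair (hnat k) (hnat m) \<in> elts g" using p \<open>p \<in> elts g\<close> by simp
    then have "hnat m = hnat (h k)"
      using conjunct2[OF conjunct2[OF R], rule_format, OF hnat_M hnat_M hnat_M _ h[of k]] by blast
    then show "p \<in> range (\<lambda>n. hpair (hnat n) (hnat (h n)))" using p by simp
  qed (use h in auto)
  then show "\<exists>h. g = hfun h" using hset_eqI by blast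
qed

lemma sd_real [sd_intros]: "vr n g \<Longrightarrow> sd n (\<lambda>xs. \<exists>h. g xs = hfun h)"
  unfolding hfun_char by (intro sd_intros)

text \<open>Primitive recursion inside the level: \<open>s\<close> is a finite sequence of values,
  given as a set of pairs. For hereditarily finite values such a sequence is itself hereditarily
  finite and so belongs to \<open>M\<close>.\<close>

definition SEQ :: "(hset \<Rightarrow> bool) \<Rightarrow> (hset \<Rightarrow> hset \<Rightarrow> hset \<Rightarrow> bool) \<Rightarrow> hset \<Rightarrow> hset \<Rightarrow> bool" where
  "SEQ Z S N y \<longleftrightarrow> (\<exists>s\<in>M. (\<exists>z\<in>M. \<exists>a\<in>M. z = hnat 0 \<and> Z a \<and> hpair z a \<in> elts s) \<and>
     (\<forall>i\<in>elts N. \<forall>a\<in>M. hpair i a \<in> elts s \<longrightarrow> (\<exists>b\<in>M. \<exists>j\<in>M. j = hsuc i \<and> S i a b \<and> hpair j b \<in> elts s)) \<and>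
     (\<forall>i\<in>M. \<forall>a\<in>M. \<forall>b\<in>M. hpair i a \<in> elts s \<longrightarrow> hpair i b \<in> elts s \<longrightarrow> a = b) \<and> hpair N y \<in> elts s)"

text \<open>Any admissible \<open>s\<close> contains the true values up to \<open>n\<close>, and
  being single-valued it has no other value at \<open>n\<close>. The relation \<open>S\<close> is
  evaluated at the true values only, so only there must it be right.\<close>

lemma SEQ_iff:
  assumes y: "y \<in> M" and Z: "\<And>a. Z a \<longleftrightarrow> a = r 0" and r: "\<And>i. HF (r i)"
    and S: "\<And>i b. S (hnat i) (r i) b \<longleftrightarrow> b = r (Suc i)"
  shows "SEQ Z S (hnat n) y \<longleftrightarrow> y = r n"
proof
  assume "SEQ Z S (hnat n) y"
  then obtain s where s: "\<exists>z\<in>M. \<exists>a\<in>M. z = hnat 0 \<and> Z a \<and> hpair z a \<in> elts s"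
    "\<And>i a. i \<in> elts (hnat n) \<Longrightarrow> a \<in> M \<Longrightarrow> hpair i a \<in> elts s \<Longrightarrow> \<exists>b\<in>M. \<exists>j\<in>M. j = hsuc i \<and> S i a b \<and> hpair j b \<in> elts s"
    "\<And>i a b. i \<in> M \<Longrightarrow> a \<in> M \<Longrightarrow> b \<in> M \<Longrightarrow> hpair i a \<in> elts s \<Longrightarrow> hpair i b \<in> elts s \<Longrightarrow> a = b"
    "hpair (hnat n) y \<in> elts s"
    unfolding SEQ_def by blast
  have "i \<le> n \<Longrightarrow> hpair (hnat i) (r i) \<in> elts s" for i
  proof (induction i)
    case 0
    obtain z a where "z = hnat 0" "Z a" "hpair z a \<in> elts s" using s(1) by blast
    then show ?case by (simp add: Z)
  next
    case (Suc i)
    then have "hnat i \<in> elts (hnat n)" by (auto simp: elts_hnat)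
    from s(2)[OF this HF_M[OF r]] Suc obtain b where "S (hnat i) (r i) b" "hpair (hsuc (hnat i)) b \<in> elts s"
      by auto
    then show ?case using S by simp
  qed
  from this[of n] show "y = r n" using s(3)[of "hnat n" y "r n"] s(4) y HF_M[OF r] by simp
next
  assume y: "y = r n"
  let ?S = "(\<lambda>i. hpair (hnat i) (r i)) ` {..n}"
  have e: "elts (hs ?S) = ?S" by (rule elts_hs) (simp add: countable_finite)
  have "hs ?S \<in> M" by (intro HF_M HF_hs) (auto simp: r)
  then show "SEQ Z S (hnat n) y"
    unfolding SEQ_def
  proof (rule bexI[rotated], intro conjI)
    show "\<exists>z\<in>M. \<exists>a\<in>M. z = hnat 0 \<and> Z a \<and> hpair z a \<in> elts (hs ?S)"
      unfolding e Z by (intro bexI[of _ "hnat 0"] bexI[of _ "r 0"] conjI) (use HF_M[OF r] in auto)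
    show "\<forall>i\<in>elts (hnat n). \<forall>a\<in>M. hpair i a \<in> elts (hs ?S) \<longrightarrow> (\<exists>b\<in>M. \<exists>j\<in>M. j = hsuc i \<and> S i a b \<and> hpair j b \<in> elts (hs ?S))"
    proof (intro ballI impI)
      fix i a assume "i \<in> elts (hnat n)" "hpair i a \<in> elts (hs ?S)"
      then obtain k where k: "k < n" "i = hnat k" "a = r k" unfolding e by (auto simp: elts_hnat)
      have "hpair (hsuc i) (r (Suc k)) \<in> ?S" using k by (auto intro!: image_eqI[of _ _ "Suc k"])
      then show "\<exists>b\<in>M. \<exists>j\<in>M. j = hsuc i \<and> S i a b \<and> hpair j b \<in> elts (hs ?S)"
        unfolding e using k S HF_M[OF r] hnat_M[of "Suc k"] by auto
    qed
    show "\<forall>i\<in>M. \<forall>a\<in>M. \<forall>b\<in>M. hpair i a \<in> elts (hs ?S) \<longrightarrow> hpair i b \<in> elts (hs ?S) \<longrightarrow> a = b"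
      unfolding e by auto
    show "hpair (hnat n) y \<in> elts (hs ?S)" unfolding e y by blast
  qed
qed

definition NP :: "hset \<Rightarrow> hset \<Rightarrow> hset \<Rightarrow> bool" where
  "NP a b c \<longleftrightarrow> (\<exists>m n. a = hnat m \<and> b = hnat n \<and> c = hnat <|m, n|>)"

definition NPQ :: "hset \<Rightarrow> hset \<Rightarrow> hset \<Rightarrow> bool" where
  "NPQ a b c \<longleftrightarrow> (\<exists>k. a = hnat k) \<and> (\<exists>k. b = hnat k) \<and> (\<exists>k. c = hnat k) \<and>
  (\<exists>p\<in>M. p = hpair a b \<and> SEQ (\<lambda>a. \<exists>z\<in>M. z = hnat 0 \<and> a = hpair z z)
    (\<lambda>i a b. \<exists>m\<in>M. \<exists>n\<in>M. \<exists>m'\<in>M. a = hpair m n \<and> m' = hsuc m \<and>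
       (n = hnat 0 \<and> b = hpair n m' \<or> (\<exists>n'\<in>M. n = hsuc n' \<and> b = hpair m' n'))) c p)"

text \<open>The pair with code \<open>c\<close> is reached from the pair of zeros in
  \<open>c\<close> steps of the enumeration described by \<open>prod_decode_Suc\<close>; in this way
  pairing precedes addition and multiplication.\<close>

lemma NP_char: "a \<in> M \<Longrightarrow> b \<in> M \<Longrightarrow> NP a b c \<longleftrightarrow> NPQ a b c"
proof -
  let ?Z = "\<lambda>a. \<exists>z\<in>M. z = hnat 0 \<and> a = hpair z z"
  let ?S = "\<lambda>i a b. \<exists>m\<in>M. \<exists>n\<in>M. \<exists>m'\<in>M. a = hpair m n \<and> m' = hsuc m \<and>
       (n = hnat 0 \<and> b = hpair n m' \<or> (\<exists>n'\<in>M. n = hsuc n' \<and> b = hpair m' n'))"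
  let ?r = "\<lambda>i. hpair (hnat (pfst i)) (hnat (psnd i))"
  have S: "?S (hnat i) (?r i) b \<longleftrightarrow> b = ?r (Suc i)" for i b
  proof (cases "psnd i")
    case 0
    have "hnat 0 \<noteq> hsuc n'" for n' using elts_hnat_0 elts_hsuc by (metis insert_not_empty)
    then show ?thesis using prod_decode_Suc(1)[OF 0] hnat_M[of "Suc (pfst i)"] hnat_M[of "pfst i"] hnat_M[of 0] 0 by auto
  next
    case (Suc n)
    have ne: "hsuc (hnat n) \<noteq> hnat 0" using elts_hnat_0 elts_hsuc by (metis insert_not_empty)
    have inj: "hsuc (hnat n) = hsuc n' \<Longrightarrow> n' = hnat n" for n'
      using elts_hsuc[of "hnat n"] elts_hsuc[of n'] mem_not_sym[of n' "hnat n"] by (metis insertE insertI1)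
    show ?thesis using prod_decode_Suc(2)[OF Suc] hnat_M[of "Suc (pfst i)"] hnat_M[of "pfst i"] hnat_M[of "Suc n"] hnat_M[of n] Suc ne inj
      by auto
  qed
  have Z: "?Z a \<longleftrightarrow> a = ?r 0" for a using hnat_M[of 0] by auto
  have *: "SEQ ?Z ?S (hnat k) p \<longleftrightarrow> p = ?r k" if "p \<in> M" for k p
    by (rule SEQ_iff[where r = ?r, OF that Z _ S]) simp
  assume "a \<in> M" "b \<in> M"
  show ?thesis unfolding NPQ_def
  proof
    assume "NP a b c"
    then obtain m n where mn: "a = hnat m" "b = hnat n" "c = hnat <|m, n|>" unfolding NP_def by blast
    have "hpair a b \<in> M" by (rule HF_M) (simp add: mn)
    then show "(\<exists>k. a = hnat k) \<and> (\<exists>k. b = hnat k) \<and> (\<exists>k. c = hnat k) \<and> (\<exists>p\<in>M. p = hpair a b \<and> SEQ ?Z ?S c p)"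
      using * mn by auto
  next
    assume "(\<exists>k. a = hnat k) \<and> (\<exists>k. b = hnat k) \<and> (\<exists>k. c = hnat k) \<and> (\<exists>p\<in>M. p = hpair a b \<and> SEQ ?Z ?S c p)"
    then obtain m n k p where mn: "a = hnat m" "b = hnat n" "c = hnat k" "p \<in> M" "p = hpair a b" "SEQ ?Z ?S c p" by blast
    then have "p = ?r k" using * by blast
    then have "pfst k = m" "psnd k = n" using mn by simp_all
    then show "NP a b c" unfolding NP_def using mn by auto
  qed
qed

end

context st_level
begin

lemmas sd_eqs = sd_hsuc sd_0 sd_hpair sd_hpair_mem

lemma sd_NP [sd_intros]:
  assumes "vr n a" "vr n b" "vr n c"
  shows "sd n (\<lambda>xs. NP (a xs) (b xs) (c xs))"
proof (rule sd_cong)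
  show "sd n (\<lambda>xs. NPQ (a xs) (b xs) (c xs))" unfolding NPQ_def SEQ_def by (intro sd_eqs sd_intros assms)
qed (simp add: NP_char vr_M[OF assms(1)] vr_M[OF assms(2)])

definition AP :: "(type1 \<Rightarrow> nat \<Rightarrow> nat) \<Rightarrow> hset \<Rightarrow> hset \<Rightarrow> hset \<Rightarrow> bool" where
  "AP F g x y \<longleftrightarrow> (\<exists>h k. g = hfun h \<and> x = hnat k \<and> y = hnat (F h k))"

text \<open>Definability is uniform in the oracle, which is a variable over elements of the level.
  This permits a quantifier over possible oracles in the recursion along \<open>B\<close>.\<close>

lemma sd_AP: "ar F \<Longrightarrow> vr n g \<Longrightarrow> vr n x \<Longrightarrow> vr n y \<Longrightarrow> sd n (\<lambda>xs. AP F (g xs) (x xs) (y xs))"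
proof (induction arbitrary: n g x y rule: ar.induct)
  case id
  have "sd n (\<lambda>xs. (\<exists>h. g xs = hfun h) \<and> (\<exists>k. x xs = hnat k) \<and> y xs = x xs)" by (intro sd_eqs sd_intros id)
  then show ?case by (rule sd_cong) (auto simp: AP_def)
next
  case zero
  have "sd n (\<lambda>xs. (\<exists>h. g xs = hfun h) \<and> (\<exists>k. x xs = hnat k) \<and> y xs = hnat 0)" by (intro sd_eqs sd_intros zero)
  then show ?case by (rule sd_cong) (auto simp: AP_def)
next
  case suc
  have "sd n (\<lambda>xs. (\<exists>h. g xs = hfun h) \<and> (\<exists>k. x xs = hnat k) \<and> y xs = hsuc (x xs))" by (intro sd_eqs sd_intros suc)
  then show ?case by (rule sd_cong) (auto simp: AP_def)
next
  case pfst
  have "sd n (\<lambda>xs. (\<exists>h. g xs = hfun h) \<and> (\<exists>b\<in>M. NP (y xs) b (x xs)))" by (intro sd_eqs sd_intros pfst)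
  then show ?case by (rule sd_cong) (auto simp: AP_def NP_def, metis hnat_M pr_pfst_psnd)
next
  case psnd
  have "sd n (\<lambda>xs. (\<exists>h. g xs = hfun h) \<and> (\<exists>b\<in>M. NP b (y xs) (x xs)))" by (intro sd_eqs sd_intros psnd)
  then show ?case by (rule sd_cong) (auto simp: AP_def NP_def, metis hnat_M pr_pfst_psnd)
next
  case orc
  have "sd n (\<lambda>xs. (\<exists>h. g xs = hfun h) \<and> (\<exists>k. x xs = hnat k) \<and> hpair (x xs) (y xs) \<in> elts (g xs))" by (intro sd_eqs sd_intros orc)
  then show ?case by (rule sd_cong) (auto simp: AP_def elts_hfun)
next
  case (comp F F')
  have "sd n (\<lambda>xs. \<exists>z\<in>M. AP F' (g xs) (x xs) z \<and> AP F (g xs) z (y xs))"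
    by (intro sd_eqs sd_intros comp)
  then show ?case by (rule sd_cong) (auto simp: AP_def)
next
  case (pair F F')
  have "sd n (\<lambda>xs. \<exists>a\<in>M. \<exists>b\<in>M. AP F (g xs) (x xs) a \<and> AP F' (g xs) (x xs) b \<and> NP a b (y xs))"
    by (intro sd_eqs sd_intros pair)
  then show ?case by (rule sd_cong) (auto simp: AP_def NP_def)
next
  case (rec A S)
  let ?Z = "\<lambda>xs e a. AP A (g xs) e a"
  let ?S = "\<lambda>xs e j a b. \<exists>p\<in>M. NP a e p \<and> (\<exists>q\<in>M. NP j p q \<and> AP S (g xs) q b)"
  have "sd n (\<lambda>xs. \<exists>i\<in>M. \<exists>e\<in>M. (\<exists>h. g xs = hfun h) \<and> NP i e (x xs) \<and> SEQ (?Z xs e) (?S xs e) i (y xs))"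
    unfolding SEQ_def by (intro sd_eqs sd_intros rec)
  then show ?case
  proof (rule sd_cong)
    fix xs assume xs: "length xs = n" "set xs \<subseteq> M"
    have y: "y xs \<in> M" using vr_M[OF rec.prems(3) xs] .
    show "(\<exists>i\<in>M. \<exists>e\<in>M. (\<exists>h. g xs = hfun h) \<and> NP i e (x xs) \<and> SEQ (?Z xs e) (?S xs e) i (y xs)) =
      AP (\<lambda>h x. rec_nat (A h (psnd x)) (\<lambda>i r. S h <|i, r, psnd x|>) (pfst x)) (g xs) (x xs) (y xs)" (is "?l = ?r")
    proof -
      have *: "SEQ (?Z xs (hnat k)) (?S xs (hnat k)) (hnat i) (y xs) \<longleftrightarrow> y xs = hnat (rec_nat (A h k) (\<lambda>i r. S h <|i, r, k|>) i)"
        if h: "g xs = hfun h" for h k i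
        by (rule SEQ_iff[where r = "\<lambda>i. hnat (rec_nat (A h k) (\<lambda>i r. S h <|i, r, k|>) i)", OF y])
          (use h in \<open>auto simp: AP_def NP_def\<close>)
      show ?thesis
      proof
        assume ?l
        then obtain h m k where "g xs = hfun h" "x xs = hnat <|m, k|>"
          "SEQ (?Z xs (hnat k)) (?S xs (hnat k)) (hnat m) (y xs)" unfolding NP_def by blast
        then show ?r using *[of h k m] unfolding AP_def by auto
      next
        assume ?r
        then obtain h w where w: "g xs = hfun h" "x xs = hnat w"
          "y xs = hnat (rec_nat (A h (psnd w)) (\<lambda>i r. S h <|i, r, psnd w|>) (pfst w))" unfolding AP_def by blast
        have "NP (hnat (pfst w)) (hnat (psnd w)) (x xs)" unfolding NP_def using w by auto
        then show ?l using w *[OF w(1), of "psnd w" "pfst w"] hnat_M by blast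
      qed
    qed
  qed
next
  case (least F)
  let ?P = "\<lambda>xs m. \<exists>p\<in>M. \<exists>z\<in>M. z = hnat 0 \<and> NP m (x xs) p \<and> AP F (g xs) p z"
  have "sd n (\<lambda>xs. (\<exists>h. g xs = hfun h) \<and> (\<exists>k. x xs = hnat k) \<and> (\<exists>k. y xs = hnat k) \<and>
      ((\<exists>m\<in>M. ?P xs m) \<longrightarrow> ?P xs (y xs) \<and> (\<forall>m\<in>elts (y xs). \<not> ?P xs m)) \<and> ((\<forall>m\<in>M. \<not> ?P xs m) \<longrightarrow> y xs = hnat 0))"
    by (intro sd_eqs sd_intros least)
  then show ?case
  proof (rule sd_cong)
    fix xs assume xs: "length xs = n" "set xs \<subseteq> M"
    have P: "?P xs w \<longleftrightarrow> (\<exists>m. w = hnat m \<and> F h <|m, k|> = 0)" if "g xs = hfun h" "x xs = hnat k" for h k w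
      using that by (auto simp: AP_def NP_def)
    have mu: "m = mu Q \<longleftrightarrow> ((\<exists>n. Q n) \<longrightarrow> Q m \<and> (\<forall>i<m. \<not> Q i)) \<and> ((\<forall>n. \<not> Q n) \<longrightarrow> m = 0)" for m Q
      using mu_char[of m Q] by (metis less_iff_Suc_add add_Suc_right)
    show "((\<exists>h. g xs = hfun h) \<and> (\<exists>k. x xs = hnat k) \<and> (\<exists>k. y xs = hnat k) \<and>
      ((\<exists>m\<in>M. ?P xs m) \<longrightarrow> ?P xs (y xs) \<and> (\<forall>m\<in>elts (y xs). \<not> ?P xs m)) \<and> ((\<forall>m\<in>M. \<not> ?P xs m) \<longrightarrow> y xs = hnat 0))
      = AP (\<lambda>h x. mu (\<lambda>n. F h <|n, x|> = 0)) (g xs) (x xs) (y xs)"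
    proof (cases "\<exists>h k m. g xs = hfun h \<and> x xs = hnat k \<and> y xs = hnat m")
      case True
      then obtain h k m where *: "g xs = hfun h" "x xs = hnat k" "y xs = hnat m" by blast
      have ex: "(\<exists>w\<in>M. ?P xs w) \<longleftrightarrow> (\<exists>i. F h <|i, k|> = 0)" unfolding P[OF *(1,2)] using hnat_M by blast
      have all: "(\<forall>w\<in>elts (hnat m). \<not> ?P xs w) \<longleftrightarrow> (\<forall>i<m. F h <|i, k|> \<noteq> 0)" unfolding P[OF *(1,2)] elts_hnat by auto
      have y: "?P xs (hnat m) \<longleftrightarrow> F h <|m, k|> = 0" unfolding P[OF *(1,2)] by auto
      have neg: "((\<exists>w\<in>A. Q w) \<longleftrightarrow> (\<exists>i. R i)) \<Longrightarrow> ((\<forall>w\<in>A. \<not> Q w) \<longleftrightarrow> (\<forall>i. \<not> R i))" for A :: "hset set" and Q and R :: "nat \<Rightarrow> bool"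
        by blast
      have nex: "(\<forall>w\<in>M. \<not> ?P xs w) \<longleftrightarrow> (\<forall>i. F h <|i, k|> \<noteq> 0)" by (rule neg[OF ex])
      have "AP (\<lambda>h x. mu (\<lambda>n. F h <|n, x|> = 0)) (g xs) (x xs) (y xs) \<longleftrightarrow> m = mu (\<lambda>i. F h <|i, k|> = 0)"
        unfolding AP_def * hfun_inj hnat_inj by blast
      then show ?thesis unfolding *(3) ex all y nex mu[of m] using * by auto
    next
      case False
      then show ?thesis unfolding AP_def by blast
    qed
  qed
qed

lemma Def_I: "sd 1 (\<lambda>xs. P (hd xs)) \<Longrightarrow> elts x = {y \<in> M. P y} \<Longrightarrow> x \<in> Def G M"
proof -
  assume "sd 1 (\<lambda>xs. P (hd xs))" and x: "elts x = {y \<in> M. P y}"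
  then obtain \<phi> where \<phi>: "st_form_ok \<phi> (Suc (length ps))"
    "\<And>xs. length xs = 1 \<Longrightarrow> set xs \<subseteq> M \<Longrightarrow> st_sat G M \<phi> (xs @ ps) = P (hd xs)"
    unfolding sd_def by auto
  have "defined_by G M \<phi> ps x"
    unfolding defined_by_def using ps \<phi>(1) \<phi>(2)[of "[_]"] x by auto
  then show ?thesis unfolding Def_def by blast
qed

lemma hfun_Def:
  assumes "\<And>n x y. vr n x \<Longrightarrow> vr n y \<Longrightarrow> sd n (\<lambda>xs. R (x xs) (y xs))"
    and R: "\<And>x y. R x y \<longleftrightarrow> (\<exists>k. x = hnat k \<and> y = hnat (f k))"
  shows "hfun f \<in> Def G M"
proof (rule Def_I)
  have "sd (Suc 0) (\<lambda>xs. \<exists>x\<in>M. \<exists>y\<in>M. R x y \<and> hd xs = hpair x y)"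
    by (intro sd_eqs sd_intros assms(1))
  then show "sd 1 (\<lambda>xs. \<exists>x\<in>M. \<exists>y\<in>M. R x y \<and> hd xs = hpair x y)" by simp
qed (auto simp: elts_hfun R intro: HF_M)

end

section \<open>Ranks of well-founded relations\<close>

abbreviation acc :: "('a \<times> 'a) set \<Rightarrow> 'a set" where "acc \<equiv> Wellfounded.acc"

text \<open>Restriction to the accessible part makes the recursion legitimate for an arbitrary
  relation, such as the one between codes of trees that need not be well-founded.\<close>

definition hrank :: "('a::countable \<times> 'a) set \<Rightarrow> 'a \<Rightarrow> hset" where
  "hrank r = wfrec {(y, x). (y, x) \<in> r \<and> x \<in> acc r} (\<lambda>f x. hs (\<Union>y\<in>{y. (y, x) \<in> r}. insert (f y) (elts (f y))))"

lemma wf_acc: "wf {(y, x). (y, x) \<in> r \<and> x \<in> acc r}"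
proof (rule wfI_pf)
  fix A :: "'a set" assume A: "A \<subseteq> {(y, x). (y, x) \<in> r \<and> x \<in> acc r} `` A"
  have "x \<in> acc r \<Longrightarrow> x \<notin> A" for x
  proof (induction rule: acc.induct)
    case (accI x)
    then show ?case using A by blast
  qed
  then show "A = {}" using A by blast
qed

lemma hrank:
  fixes r :: "('a::countable \<times> 'a) set"
  assumes "x \<in> acc r"
  shows "elts (hrank r x) = (\<Union>y\<in>{y. (y, x) \<in> r}. insert (hrank r y) (elts (hrank r y)))"
proof -
  have "hrank r x = hs (\<Union>y\<in>{y. (y, x) \<in> r}. insert (hrank r y) (elts (hrank r y)))"
    unfolding hrank_def by (subst wfrec[OF wf_acc]) (use assms in \<open>simp add: cut_apply\<close>)
  then show ?thesis by simp
qed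

lemma acc_down: "x \<in> acc r \<Longrightarrow> (y, x) \<in> r \<Longrightarrow> y \<in> acc r"
  by (rule acc_downward)

lemma ordinal_hrank: "x \<in> acc r \<Longrightarrow> ordinal (hrank r x)"
proof (induction rule: acc.induct)
  case (accI x)
  have x: "x \<in> acc r" using accI by (meson acc.accI)
  have o: "ordinal (hrank r y)" if "(y, x) \<in> r" for y using accI that by blast
  show ?case unfolding ordinal_def
  proof (intro ballI conjI)
    fix \<beta> assume "\<beta> \<in> elts (hrank r x)"
    then obtain y where y: "(y, x) \<in> r" "\<beta> = hrank r y \<or> \<beta> \<in> elts (hrank r y)" unfolding hrank[OF x] by blast
    then show "elts \<beta> \<subseteq> elts (hrank r x)" unfolding hrank[OF x] using o[OF y(1)] unfolding ordinal_def by blast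
    fix \<gamma> assume "\<gamma> \<in> elts \<beta>"
    then show "elts \<gamma> \<subseteq> elts \<beta>" using o[OF y(1)] y(2) unfolding ordinal_def by blast
  qed
qed

text \<open>The ordinals below the rank of a predecessor contribute nothing new, because what is
  definable over an earlier level is an element of every later one.\<close>

lemma L_hrank:
  assumes "x \<in> acc r"
  shows "L G (hrank r x) = (\<Union>y\<in>{y. (y, x) \<in> r}. Def G (L G (hrank r y)))"
proof -
  have "Def G (L G \<beta>) \<subseteq> Def G (L G (hrank r y))" if "(y, x) \<in> r" "\<beta> \<in> elts (hrank r y)" for \<beta> y
    using Def_L[OF that(2), of G] L_Def[OF ordinal_hrank[OF acc_down[OF assms that(1)]], of G] by blast
  then show ?thesis unfolding L_eq[of G "hrank r x"] hrank[OF assms] by blast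
qed

section \<open>Arithmetical ranks suffice\<close>

lemma st_level_L:
  assumes "ordinal \<alpha>" "\<And>n. hnat n \<in> elts \<alpha>" "set ps \<subseteq> L G \<alpha>"
  shows "st_level (L G \<alpha>) ps"
proof
  show "elts x \<subseteq> L G \<alpha>" if "x \<in> L G \<alpha>" for x by (rule L_transitive[OF assms(1) that])
  show "x \<in> L G \<alpha>" if x: "HF x" for x using HF_L[OF x] L_mono[OF assms(1,2)] by blast
  show "set ps \<subseteq> L G \<alpha>" by (rule assms(3))
qed

lemma sets_cylinder: "cylinder s \<in> sets coin_toss"
  unfolding cylinder_def
proof (rule measure_clopen(1)[where len = "length s"])
  fix f g :: type1 assume "\<And>i. i < length s \<Longrightarrow> f i = g i"
  then have "initial f (length s) = initial g (length s)" by (simp add: initial_def)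
  then show "(initial f (length s) = s) = (initial g (length s) = s)" by simp
qed

lemma large_mono:
  assumes "large G k A" "A \<subseteq> B"
  shows "large G k B"
proof -
  have c: "covered G B \<in> sets coin_toss"
  proof -
    have B: "covered G B = (\<Union>s\<in>(\<lambda>f. initial f (G f)) ` B. cylinder s)" by (simp add: covered_def)
    show ?thesis unfolding B by (rule sets.countable_UN'') (rule countableI_type, rule sets_cylinder)
  qed
  have "measure coin_toss (covered G A) \<le> measure coin_toss (covered G B)"
    by (rule coin.finite_measure_mono[OF _ c]) (use assms(2) in \<open>auto simp: covered_def\<close>)
  then show ?thesis using assms(1) unfolding large_def by simp
qed

lemma hyperarithmetical2_stage:
  assumes "hyperarithmetical2 G"
  obtains E and r :: nat where "arp (\<lambda>h x. E (pfst x) (psnd x))" "r \<in> acc {(x, y). E x y}"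
    "\<And>k. large G k (binary_functions G (hrank {(x, y). E x y} r))"
proof (rule hyperarithmetical2_cover[OF assms])
  fix B St A assume B: "arp (\<lambda>h x. B (pfst x) (psnd x))" and tB: "\<And>x y z. B x y \<Longrightarrow> B y z \<Longrightarrow> B x z"
    and wB: "wf {(x, y). B x y}" and St: "arp St"
    and A: "\<And>z i. A <|z, i|> = (if B z 0 then if St (\<lambda>w. if B (pfst w) z then A w else 0) <|z, i|> then 0 else 1 else (0 :: nat))"
    and lar: "\<And>k. \<exists>F. finite F \<and> (\<forall>\<phi>\<in>F. ar \<phi> \<and> \<phi> A \<in> cantor) \<and> large G k ((\<lambda>\<phi>. \<phi> A) ` F)"
  have arB: "ar a \<Longrightarrow> ar c \<Longrightarrow> arp (\<lambda>h x. B (a h x) (c h x))" for a c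
    using arp_comp[OF B ar_pr, of a c] by simp
  \<comment> \<open>Four pieces share the numbers. The multiples of 3 have the ranks 0, 1, 2 and so
    on, and the number 2 has rank omega. The number \<open>3 * b + 1\<close> stands for
    \<open>b\<close> in the order \<open>B\<close>, placed above 2. The numbers 5 and 8 add two
    levels on top: \<open>A\<close> has appeared at the level of 5, and whatever is arithmetical in
    \<open>A\<close> at the level of 8.\<close>
  define E where "E x y \<longleftrightarrow> x mod 3 = 0 \<and> y mod 3 = 0 \<and> x < y \<or> x mod 3 = 0 \<and> y mod 3 \<noteq> 0 \<or>
    x = 2 \<and> y mod 3 = 1 \<or> x mod 3 = 1 \<and> y mod 3 = 1 \<and> B (x div 3) (y div 3) \<or> x mod 3 = 1 \<and> y = 5 \<or> x = 5 \<and> y = 8" for x y :: nat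
  define R where "R = {(x, y). E x y}"
  have RE: "(x, y) \<in> R \<longleftrightarrow> E x y" for x y by (simp add: R_def)
  have ne: "3 * j \<noteq> 5" "3 * j \<noteq> 8" "Suc (3 * j) \<noteq> 5" "Suc (3 * j) \<noteq> 8" "Suc (3 * j) mod 3 = 1" "Suc (3 * j) div 3 = j" for j :: nat
    by presburger+
  have a0: "3 * j \<in> acc R" for j
  proof (induction j rule: less_induct)
    case (less j)
    show ?case
    proof (rule accI)
      fix y assume "(y, 3 * j) \<in> R"
      then have "y mod 3 = 0" "y < 3 * j" using ne unfolding RE E_def by auto
      then have "y = 3 * (y div 3)" "y div 3 < j" by presburger+
      then show "y \<in> acc R" using less by metis
    qed
  qed
  have a0': "x \<in> acc R" if "x mod 3 = 0" for x using a0[of "x div 3"] that mult_div_mod_eq[of 3 x] by simp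
  have a2: "2 \<in> acc R" by (rule accI) (auto simp: RE E_def intro: a0')
  have a1: "Suc (3 * b) \<in> acc R" for b
  proof (induction b rule: wf_induct_rule[OF wB])
    case (1 b)
    show ?case
    proof (rule accI)
      fix y assume "(y, Suc (3 * b)) \<in> R"
      then consider "y mod 3 = 0" | "y = 2" | "y mod 3 = 1" "B (y div 3) b"
        unfolding RE E_def using ne[of b] by auto
      then show "y \<in> acc R"
      proof cases
        case 3
        then have "y = Suc (3 * (y div 3))" by presburger
        then show ?thesis using 1[of "y div 3"] 3 by simp
      qed (use a0' a2 in auto)
    qed
  qed
  have a1': "x \<in> acc R" if "x mod 3 = 1" for x using a1[of "x div 3"] that mult_div_mod_eq[of 3 x] by simp
  have a5: "5 \<in> acc R" by (rule accI) (auto simp: RE E_def intro: a0' a1')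
  have a8: "8 \<in> acc R" by (rule accI) (auto simp: RE E_def intro: a0' a5)
  have fin: "hrank R (3 * j) = hnat j" for j
  proof (induction j rule: less_induct)
    case (less j)
    have e: "{y. (y, 3 * j) \<in> R} = (\<lambda>i. 3 * i) ` {..<j}"
    proof (intro equalityI subsetI)
      fix y assume "y \<in> {y. (y, 3 * j) \<in> R}"
      then have "y mod 3 = 0" "y < 3 * j" using ne[of j] unfolding mem_Collect_eq RE E_def by auto
      then have "y = 3 * (y div 3)" "y div 3 < j" by presburger+
      then show "y \<in> (\<lambda>i. 3 * i) ` {..<j}" by blast
    qed (auto simp: RE E_def)
    have "elts (hrank R (3 * j)) = (\<Union>i<j. insert (hnat i) (elts (hnat i)))"
      unfolding hrank[OF a0] e using less by simp
    also have "\<dots> = elts (hnat j)" unfolding elts_hnat by (auto intro: order.strict_trans)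
    finally show ?case by (rule hset_eqI)
  qed
  have nat: "hnat j \<in> elts (hrank R x)" if "x \<in> acc R" "x mod 3 \<noteq> 0" for x j
  proof -
    have "(3 * j, x) \<in> R" using that by (simp add: RE E_def)
    then show ?thesis unfolding hrank[OF that(1)] by (intro UN_I[of "3 * j"]) (simp_all only: mem_Collect_eq fin insertI1)
  qed
  have lv: "st_level (L G (hrank R x)) ps" if "x \<in> acc R" "x mod 3 \<noteq> 0" "set ps \<subseteq> L G (hrank R x)" for x ps
    by (rule st_level_L[OF ordinal_hrank[OF that(1)] nat[OF that(1,2)] that(3)])
  have up: "Def G (L G (hrank R x)) \<subseteq> L G (hrank R y)" if "E x y" "y \<in> acc R" for x y
    unfolding L_hrank[OF that(2)] RE using that(1) by blast
  \<comment> \<open>Supplies a value for the oracle variable at arguments where the array is cut off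
    and the oracle has no influence.\<close>
  have zero: "hfun (\<lambda>_. 0) \<in> L G (hrank R (Suc (3 * b)))" for b
  proof -
    interpret st_level G "L G (hrank R 2)" "[]" by (rule lv) (use a2 in auto)
    have "hfun (\<lambda>_. 0) \<in> Def G (L G (hrank R 2))"
    proof (rule hfun_Def[where R = "\<lambda>x y. (\<exists>k. x = hnat k) \<and> y = hnat 0"])
      show "sd n (\<lambda>xs. (\<exists>k. x xs = hnat k) \<and> y xs = hnat 0)" if "vr n x" "vr n y" for n x y
        by (intro sd_eqs sd_intros that)
    qed auto
    then show ?thesis using up[of 2, OF _ a1] by (auto simp: RE E_def)
  qed
  \<comment> \<open>\<open>A' b\<close> is the part of the array below \<open>b\<close>.
    \<open>Cor a z\<close> says that \<open>a\<close> obeys the recursion below \<open>z\<close>; by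
    well-foundedness this singles out \<open>A' z\<close> among all functions, so the level can
    recognise it by an arithmetical test.\<close>
  define A' where "A' b w = (if B (pfst w) b then A w else 0)" for b w
  define Cor where "Cor a z \<longleftrightarrow> (\<forall>w. a w = (if B (pfst w) z then if St (\<lambda>v. if B (pfst v) (pfst w) then a v else 0) w then 0 else 1 else (0::nat)))" for a z
  have A'_eq: "A' b w = (if B (pfst w) b then if St (A' (pfst w)) w then 0 else 1 else 0)" if "b = 0 \<or> B b 0" for b w
    using A[of "pfst w" "psnd w"] tB[of "pfst w" b 0] that unfolding A'_def by auto
  have Cor: "Cor a z \<longleftrightarrow> a = A' z" if z: "B z 0" for a z
  proof
    assume "a = A' z"
    moreover have "(\<lambda>v. if B (pfst v) (pfst w) then A' z v else 0) = A' (pfst w)" if "B (pfst w) z" for w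
      unfolding A'_def using tB[OF _ that] by auto
    ultimately show "Cor a z" unfolding Cor_def using A'_eq[of z] z by auto
  next
    assume a: "Cor a z"
    have "\<forall>i. a <|y, i|> = A' z <|y, i|>" for y
    proof (induction y rule: wf_induct_rule[OF wB])
      case (1 y)
      show ?case
      proof
        fix i
        have "(\<lambda>v. if B (pfst v) y then a v else 0) = A' y" if "B y z"
        proof
          fix v
          show "(if B (pfst v) y then a v else 0) = A' y v"
            using 1[of "pfst v", THEN spec[of _ "psnd v"]] tB[OF _ that] by (auto simp: A'_def)
        qed
        then show "a <|y, i|> = A' z <|y, i|>" using a[unfolded Cor_def, rule_format, of "<|y, i|>"] A'_eq[of z "<|y, i|>"] z by simp
      qed
    qed
    then show "a = A' z" by (metis ext pr_pfst_psnd)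
  qed
  have A': "hfun (A' b) \<in> Def G (L G (hrank R (Suc (3 * b))))" if "b = 0 \<or> B b 0" for b
    using that
  proof (induction b rule: wf_induct_rule[OF wB])
    case (1 b)
    define F1 where "F1 h x = (if \<not> B (pfst x) b \<or> Cor h (pfst x) then 0 else 1 :: nat)" for h x
    define F2 where "F2 h x = (if B (pfst x) b then if St h x then 0 else 1 else 0 :: nat)" for h x
    have ar: "ar F1" "ar F2"
      unfolding F1_def[abs_def] F2_def[abs_def] Cor_def by (intro ar_intros arB arp_subst[OF St])+
    interpret st_level G "L G (hrank R (Suc (3 * b)))" "[]" by (rule lv) (use a1[of b] in auto)
    let ?M = "L G (hrank R (Suc (3 * b)))"
    \<comment> \<open>For \<open>pfst k\<close> below \<open>b\<close>, the value at
      \<open>k\<close> is computed from any function of the level that passes the test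
      \<open>Cor\<close> at \<open>pfst k\<close>. By the induction hypothesis
      \<open>A' (pfst k)\<close> is in the level, and no other function passes.\<close>
    show ?case
    proof (rule hfun_Def[where R = "\<lambda>x y. \<exists>g\<in>?M. \<exists>z\<in>?M. z = hnat 0 \<and> AP F1 g x z \<and> AP F2 g x y"])
      show "sd n (\<lambda>xs. \<exists>g\<in>?M. \<exists>z\<in>?M. z = hnat 0 \<and> AP F1 g (x xs) z \<and> AP F2 g (x xs) (y xs))" if "vr n x" "vr n y" for n x y
        by (intro sd_eqs sd_intros sd_AP ar that)
      show "(\<exists>g\<in>?M. \<exists>z\<in>?M. z = hnat 0 \<and> AP F1 g x z \<and> AP F2 g x y) = (\<exists>k. x = hnat k \<and> y = hnat (A' b k))" (is "?l = ?r") for x y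
      proof
        assume ?l
        then obtain h k where h: "hfun h \<in> ?M" "x = hnat k" "F1 h k = 0" "y = hnat (F2 h k)" unfolding AP_def by auto
        have "F2 h k = A' b k"
        proof (cases "B (pfst k) b")
          case True
          then have "B (pfst k) 0" using 1(2) tB by blast
          then have "h = A' (pfst k)" using h(3) True Cor unfolding F1_def by (auto split: if_splits)
          then show ?thesis using A'_eq[OF 1(2), of k] True unfolding F2_def by simp
        qed (simp add: F2_def A'_def)
        then show ?r by (intro exI[of _ k]) (simp add: h)
      next
        assume ?r
        then obtain k where k: "x = hnat k" "y = hnat (A' b k)" by blast
        have "\<exists>h. hfun h \<in> ?M \<and> F1 h k = 0 \<and> F2 h k = A' b k"
        proof (cases "B (pfst k) b")
          case True
          then have k0: "B (pfst k) 0" using 1(2) tB by blast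
          have "hfun (A' (pfst k)) \<in> Def G (L G (hrank R (Suc (3 * pfst k))))" using 1(1) True k0 by blast
          moreover have "E (Suc (3 * pfst k)) (Suc (3 * b))" using True ne unfolding E_def by simp
          ultimately have "hfun (A' (pfst k)) \<in> ?M" using up[OF _ a1] by blast
          then show ?thesis using A'_eq[OF 1(2), of k] True Cor[OF k0] unfolding F1_def F2_def by (intro exI[of _ "A' (pfst k)"]) simp
        qed (use zero[of b] in \<open>auto simp: F1_def F2_def A'_def\<close>)
        then obtain h where h: "hfun h \<in> ?M" "F1 h k = 0" "F2 h k = A' b k" by blast
        have AP: "AP F (hfun h) (hnat k) (hnat (F h k))" for F unfolding AP_def by blast
        show ?l using h AP[of F1] AP[of F2] unfolding k by (intro bexI[of _ "hfun h"] bexI[of _ "hnat 0"]) simp_all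
      qed
    qed
  qed
  have "A = A' 0" using A unfolding A'_def by (metis (no_types, lifting) ext pr_pfst_psnd)
  then have AM: "hfun A \<in> L G (hrank R 5)" using A'[of 0] up[of "Suc 0" 5, OF _ a5] by (auto simp: RE E_def)
  have top: "hfun (\<phi> A) \<in> L G (hrank R 8)" if "ar \<phi>" for \<phi>
  proof -
    interpret st_level G "L G (hrank R 5)" "[hfun A]" by (rule lv) (use a5 AM in auto)
    have "hfun (\<phi> A) \<in> Def G (L G (hrank R 5))"
    proof (rule hfun_Def[where R = "\<lambda>x y. AP \<phi> (hfun A) x y"])
      show "sd n (\<lambda>xs. AP \<phi> (hfun A) (x xs) (y xs))" if "vr n x" "vr n y" for n x y
        by (rule sd_AP[OF \<open>ar \<phi>\<close> vr_const that]) simp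
    qed (auto simp: AP_def)
    then show ?thesis using up[of 5 8, OF _ a8] by (auto simp: RE E_def)
  qed
  show thesis
  proof (rule that)
    show "arp (\<lambda>h x. E (pfst x) (psnd x))" unfolding RE E_def by (intro ar_intros arB)
    show "8 \<in> acc {(x, y). E x y}" using a8 by (simp only: R_def)
    fix k
    obtain F where F: "\<forall>\<phi>\<in>F. ar \<phi> \<and> \<phi> A \<in> cantor" "large G k ((\<lambda>\<phi>. \<phi> A) ` F)" using lar by blast
    show "large G k (binary_functions G (hrank {(x, y). E x y} 8))" unfolding R_def[symmetric]
      by (rule large_mono[OF F(2)]) (use F(1) top in \<open>auto simp: binary_functions_def\<close>)
  qed
qed

section \<open>Programming with the schemes S1--S9\<close>

section \<open>Programs\<close>

text \<open>
  \<open>K1\<close> is computability of a unary partial function with the given functionals, \<open>K\<close> requires in addition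
  that the program ignores further arguments.
\<close>

definition K1 :: "type2 \<Rightarrow> nat \<Rightarrow> nat \<Rightarrow> nat \<Rightarrow> bool" where
  "K1 G e x y \<longleftrightarrow> Kleene e [x] [] [E2, G] y"
definition K :: "type2 \<Rightarrow> nat \<Rightarrow> nat \<Rightarrow> nat \<Rightarrow> bool" where
  "K G e x y \<longleftrightarrow> (\<forall>xs. Kleene e (x # xs) [] [E2, G] y)"
definition K2 :: "type2 \<Rightarrow> nat \<Rightarrow> nat \<Rightarrow> nat \<Rightarrow> nat \<Rightarrow> bool" where
  "K2 G e x x' y \<longleftrightarrow> (\<forall>xs. Kleene e (x # x' # xs) [] [E2, G] y)"

definition "kid = list_encode [3]"
definition "kconst q = list_encode [2, q]"
definition "ksuc = list_encode [1]"
definition "kcomp p g = list_encode [4, p, g]"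
definition "kswap e = list_encode [6, 0, 1, e]"
definition "k2 p f g = kcomp (kcomp p (kswap f)) g"
definition "kpred = list_encode [5, kconst 0, kid]"
definition "kadd = list_encode [5, kid, kswap ksuc]"
definition "ksub = list_encode [5, kid, kswap kpred]"
definition "ktri = list_encode [5, kconst 0, kcomp ksuc kadd]"
text \<open>The number of the diagonal containing the pair coded by \<open>z\<close>. It grows by
  one when the second component is 0; with \<open>r\<close> the current diagonal, that component is
  \<open>triangle (Suc r) - z - 1\<close>.\<close>

definition "kdiag = list_encode [5, kconst 0,
  kcomp (list_encode [5, kswap ksuc, list_encode [6, 0, 3, kid]])
    (kcomp kpred (kcomp (kswap ksub) (kswap (kcomp ktri ksuc))))]"
definition "kpair = kcomp kadd (kcomp ktri kadd)"
definition "kfst = kcomp ksub (kcomp ktri kdiag)"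
definition "ksnd = k2 ksub kfst kdiag"
definition "kapp = list_encode [9, 1, 0, 2]"
text \<open>The condition selects one of two indices, which is then run by S9. Definition by cases
  directly through S5 would require the zero branch to converge even when the other branch is
  taken.\<close>

definition "kif c f g = kcomp kapp (kcomp (list_encode [5, kconst f, kconst g]) c)"
definition "kcall u g = k2 kapp u g"
definition "kE h = list_encode [8, kcomp h kpair]"
text \<open>S8 applies the first functional of the list. The two functionals are therefore exchanged
  before it, and exchanged back for the program \<open>h\<close> inside.\<close>

definition "kG h = list_encode [6, 2, 1, list_encode [8, list_encode [6, 2, 1, kcomp h kpair]]]"

lemma K_K1: "K G e x y \<Longrightarrow> K1 G e x y"
  unfolding K_def K1_def by blast

lemma K1_det: "K1 G e x y \<Longrightarrow> K1 G e x z \<Longrightarrow> z = y"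
  unfolding K1_def using Kleene_deterministic by blast

lemma K_eq: "K G e x v \<Longrightarrow> v = y \<Longrightarrow> K G e x y"
  by simp

lemma Kleene_kcomp: "Kleene g as fs Fs b \<Longrightarrow> Kleene p (b # as) fs Fs c \<Longrightarrow> Kleene (kcomp p g) as fs Fs c"
  unfolding kcomp_def by (rule Kleene.S4)

lemma Kleene_kswap: "Kleene e (b # a # as) fs Fs c \<Longrightarrow> Kleene (kswap e) (a # b # as) fs Fs c"
  unfolding kswap_def by (rule Kleene.S6_0) simp_all

lemma Kleene_kconst: "Kleene (kconst q) as fs Fs q"
  unfolding kconst_def by (rule Kleene.S2)

lemma Kleene_kid: "Kleene kid (x # as) fs Fs x"
  unfolding kid_def by (rule Kleene.S3)

lemma Kleene_ksuc: "Kleene ksuc (x # as) fs Fs (Suc x)"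
  unfolding ksuc_def by (rule Kleene.S1)

lemma Kleene_kpred: "Kleene kpred (x # as) fs Fs (x - 1)"
proof (induction x)
  case 0
  show ?case unfolding kpred_def by (rule Kleene.S5_zero) (simp add: Kleene_kconst)
next
  case (Suc x)
  show ?case unfolding kpred_def diff_Suc_1
    by (rule Kleene.S5_Suc[OF Suc[unfolded kpred_def] Kleene_kid])
qed

lemma Kleene_kadd: "Kleene kadd (a # b # as) fs Fs (a + b)"
proof (induction a)
  case 0
  show ?case unfolding kadd_def by (rule Kleene.S5_zero) (simp add: Kleene_kid)
next
  case (Suc a)
  show ?case unfolding kadd_def add_Suc
    by (rule Kleene.S5_Suc[OF Suc[unfolded kadd_def] Kleene_kswap[OF Kleene_ksuc]])
qed

lemma Kleene_ksub: "Kleene ksub (b # a # as) fs Fs (a - b)"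
proof (induction b)
  case 0
  show ?case unfolding ksub_def by (rule Kleene.S5_zero) (simp add: Kleene_kid)
next
  case (Suc b)
  have "Kleene (kswap kpred) (b # (a - b) # a # as) fs Fs (a - Suc b)"
    using Kleene_kswap[OF Kleene_kpred[of "a - b"]] by simp
  then show ?case unfolding ksub_def by (rule Kleene.S5_Suc[OF Suc[unfolded ksub_def]])
qed

lemma Kleene_ktri: "Kleene ktri (n # as) fs Fs (triangle n)"
proof (induction n)
  case 0
  show ?case unfolding ktri_def by (rule Kleene.S5_zero) (simp add: Kleene_kconst)
next
  case (Suc n)
  have "Kleene (kcomp ksuc kadd) (n # triangle n # as) fs Fs (triangle (Suc n))"
    using Kleene_kcomp[OF Kleene_kadd Kleene_ksuc, of n "triangle n"] by (simp add: add.commute)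
  then show ?case unfolding ktri_def by (rule Kleene.S5_Suc[OF Suc[unfolded ktri_def]])
qed

lemma pr_triangle: "<|m, n|> = triangle (m + n) + m"
  by (simp add: prod_encode_def)

lemma Kleene_kdiag: "Kleene kdiag (z # as) fs Fs (pfst z + psnd z)"
proof (induction z)
  case 0
  have "pfst 0 = 0" "psnd 0 = 0" by (metis add.right_neutral pfst_pr psnd_pr pr_triangle triangle_0)+
  then show ?case unfolding kdiag_def by (intro Kleene.S5_zero) (simp add: Kleene_kconst)
next
  case (Suc z)
  let ?r = "pfst z + psnd z"
  let ?v = "(triangle (Suc ?r) - z) - 1"
  have z: "z = triangle ?r + pfst z" using pr_triangle[of "pfst z" "psnd z"] by simp
  have v: "?v = psnd z" using z by simp
  have s: "pfst (Suc z) + psnd (Suc z) = (if psnd z = 0 then Suc ?r else ?r)"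
    using prod_decode_Suc[of z] by (cases "psnd z") auto
  have 1: "Kleene (kcomp kpred (kcomp (kswap ksub) (kswap (kcomp ktri ksuc)))) (z # ?r # as) fs Fs (psnd z)"
    using Kleene_kcomp[OF Kleene_kcomp[OF Kleene_kswap[OF Kleene_kcomp[OF Kleene_ksuc Kleene_ktri]]
          Kleene_kswap[OF Kleene_ksub]] Kleene_kpred, of z ?r as fs Fs] by (simp only: v)
  have 2: "Kleene (list_encode [5, kswap ksuc, list_encode [6, 0, 3, kid]]) (w # z # ?r # as) fs Fs (if w = 0 then Suc ?r else ?r)" for w
  proof (induction w)
    case 0
    show ?case by (rule Kleene.S5_zero) (simp add: Kleene_kswap Kleene_ksuc)
  next
    case (Suc w)
    have "Kleene (list_encode [6, 0, 3, kid]) (w # b # z # ?r # as) fs Fs ?r" for b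
      by (rule Kleene.S6_0) (simp_all add: Kleene_kid)
    then show ?case using Kleene.S5_Suc[OF Suc] by simp
  qed
  show ?case unfolding kdiag_def s
    by (rule Kleene.S5_Suc[OF Suc[unfolded kdiag_def] Kleene_kcomp[OF 1 2]])
qed

lemma K_kcomp: "K G g x b \<Longrightarrow> K G p b c \<Longrightarrow> K G (kcomp p g) x c"
  unfolding K_def by (blast intro: Kleene_kcomp)

lemma K_k2: "K G f x a \<Longrightarrow> K G g x b \<Longrightarrow> K2 G p a b c \<Longrightarrow> K G (k2 p f g) x c"
  unfolding K_def K2_def k2_def by (blast intro: Kleene_kcomp Kleene_kswap)

lemma K2_kpair: "K2 G kpair a b <|a, b|>"
  unfolding K2_def kpair_def pr_triangle by (blast intro: Kleene_kcomp Kleene_kadd Kleene_ktri)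

lemma K_kdiag: "K G kdiag x (pfst x + psnd x)"
  unfolding K_def by (blast intro: Kleene_kdiag)

lemma K_kfst: "K G kfst x (pfst x)"
proof -
  have "x - triangle (pfst x + psnd x) = pfst x" using pr_triangle[of "pfst x" "psnd x"] by simp
  moreover have "K G kfst x (x - triangle (pfst x + psnd x))"
    unfolding K_def kfst_def by (blast intro: Kleene_kcomp Kleene_kdiag Kleene_ktri Kleene_ksub)
  ultimately show ?thesis by simp
qed

lemma K_ksnd: "K G ksnd x (psnd x)"
proof -
  have "K2 G ksub (pfst x) (pfst x + psnd x) (pfst x + psnd x - pfst x)"
    unfolding K2_def by (blast intro: Kleene_ksub)
  from K_k2[OF K_kfst K_kdiag this] show ?thesis by (simp add: ksnd_def)
qed

definition "kF e = kcomp kfst e"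
definition "kS e = kcomp ksnd e"
definition "kP f g = k2 kpair f g"
definition "kSuc e = kcomp ksuc e"
definition "kPred e = kcomp kpred e"

named_theorems K_intros

lemma K_kid [K_intros]: "K G kid x x"
  unfolding K_def by (blast intro: Kleene_kid)

lemma K_kconst [K_intros]: "K G (kconst q) x q"
  unfolding K_def by (blast intro: Kleene_kconst)

lemma K_kF [K_intros]: "K G e x v \<Longrightarrow> K G (kF e) x (pfst v)"
  unfolding kF_def by (rule K_kcomp[OF _ K_kfst])

lemma K_kS [K_intros]: "K G e x v \<Longrightarrow> K G (kS e) x (psnd v)"
  unfolding kS_def by (rule K_kcomp[OF _ K_ksnd])

lemma K_kP [K_intros]: "K G f x a \<Longrightarrow> K G g x b \<Longrightarrow> K G (kP f g) x <|a, b|>"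
  unfolding kP_def by (rule K_k2[OF _ _ K2_kpair])

lemma K_kSuc [K_intros]: "K G e x v \<Longrightarrow> K G (kSuc e) x (Suc v)"
  unfolding kSuc_def by (rule K_kcomp) (auto simp: K_def intro: Kleene_ksuc)

lemma K_kPred [K_intros]: "K G e x v \<Longrightarrow> K G (kPred e) x (v - 1)"
  unfolding kPred_def by (rule K_kcomp) (use Kleene_kpred in \<open>auto simp: K_def\<close>)

lemma Kleene_kapp: "Kleene e [x] [] [E2, G] y \<Longrightarrow> Kleene kapp (e # x # xs) [] [E2, G] y"
  unfolding kapp_def by (rule Kleene.S9) simp_all

lemma K_kcall: "K G u x e \<Longrightarrow> K G g x a \<Longrightarrow> K1 G e a y \<Longrightarrow> K G (kcall u g) x y"
  unfolding kcall_def by (rule K_k2) (auto simp: K1_def K2_def intro: Kleene_kapp)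

lemma K_kif:
  assumes "K G c x v" "v = 0 \<Longrightarrow> K1 G f x y" "v \<noteq> 0 \<Longrightarrow> K1 G g x y"
  shows "K G (kif c f g) x y"
proof -
  have 1: "Kleene (list_encode [5, kconst f, kconst g]) (v # as) fs Fs (if v = 0 then f else g)" for v as fs Fs
  proof (induction v)
    case 0
    show ?case by (rule Kleene.S5_zero) (simp add: Kleene_kconst)
  next
    case (Suc v)
    show ?case using Kleene.S5_Suc[OF Suc Kleene_kconst] by simp
  qed
  have 2: "K1 G (if v = 0 then f else g) x y" using assms(2,3) by simp
  show ?thesis unfolding K_def kif_def
  proof
    fix xs
    show "Kleene (kcomp kapp (kcomp (list_encode [5, kconst f, kconst g]) c)) (x # xs) [] [E2, G] y"
      by (rule Kleene_kcomp[OF Kleene_kcomp[OF _ 1] Kleene_kapp[OF 2[unfolded K1_def]]])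
        (use assms(1) in \<open>auto simp: K_def\<close>)
  qed
qed

lemma K_kE_value: "(\<And>n. K G h <|n, x|> (u n)) \<Longrightarrow> K G (kE h) x (E2 u)"
  unfolding K_def kE_def
  by (intro allI Kleene.S8 Kleene_kcomp) (use K2_kpair in \<open>auto simp: K2_def\<close>)

lemma K_kG_value: "(\<And>n. K G h <|n, x|> (u n)) \<Longrightarrow> K G (kG h) x (G u)"
proof (unfold K_def kG_def, intro allI)
  fix xs assume h: "\<And>n. \<forall>xs. Kleene h (<|n, x|> # xs) [] [E2, G] (u n)"
  have 1: "Kleene (kcomp h kpair) (n # x # xs) [] [E2, G] (u n)" for n
    by (rule Kleene_kcomp) (use K2_kpair h in \<open>auto simp: K2_def\<close>)
  have 2: "Kleene (list_encode [6, 2, 1, kcomp h kpair]) (n # x # xs) [] [G, E2] (u n)" for n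
    by (rule Kleene.S6_2) (simp_all add: 1)
  have "Kleene (list_encode [8, list_encode [6, 2, 1, kcomp h kpair]]) (x # xs) [] [G, E2] (G u)"
    by (rule Kleene.S8[OF 2])
  then show "Kleene (list_encode [6, 2, 1, list_encode [8, list_encode [6, 2, 1, kcomp h kpair]]]) (x # xs) [] [E2, G] (G u)"
    by (intro Kleene.S6_2) simp_all
qed

text \<open>Truth is coded by zero, as in \<^const>\<open>E2\<close>.\<close>

definition tv :: "bool \<Rightarrow> nat" where "tv b = (if b then 0 else 1)"

lemma tv_0 [simp]: "tv b = 0 \<longleftrightarrow> b" and tv_1 [simp]: "0 < tv b \<longleftrightarrow> \<not> b"
  by (simp_all add: tv_def)

lemma K_ex: "(\<And>n. K G h <|n, x|> (tv (P n))) \<Longrightarrow> K G (kE h) x (tv (\<exists>n. P n))"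
  using K_kE_value[of G h x "\<lambda>n. tv (P n)"] by (simp add: E2_def tv_def[of "\<exists>n. P n"])

definition "knot e = kif e (kconst 1) (kconst 0)"
definition "kand e f = kif e f (kconst 1)"
definition "kall e = knot (kE (knot e))"

lemma K_not: "K G e x (tv P) \<Longrightarrow> K G (knot e) x (tv (\<not> P))"
  unfolding knot_def by (erule K_kif) (auto intro!: K_K1 K_eq[OF K_kconst] simp: tv_def)

lemma K_and: "K G e x (tv P) \<Longrightarrow> (P \<Longrightarrow> K G f x (tv Q)) \<Longrightarrow> K G (kand e f) x (tv (P \<and> Q))"
  proof -
  assume e: "K G e x (tv P)" and f: "P \<Longrightarrow> K G f x (tv Q)"
  show ?thesis unfolding kand_def
    by (rule K_kif[OF e]) (use f in \<open>auto intro!: K_K1 K_eq[OF K_kconst] simp: tv_def[of "_ \<and> _"] tv_def[of False] dest: f\<close>)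
qed

lemma K_all: "(\<And>n. K G h <|n, x|> (tv (P n))) \<Longrightarrow> K G (kall h) x (tv (\<forall>n. P n))"
  using K_not[OF K_ex[OF K_not[of G h "<|_, x|>"]]] unfolding kall_def by fastforce

text \<open>Recursion by self-application: the program receives its own index as the first component
  of its argument and passes it on. The recursive programs below are all called in this
  form.\<close>

definition "kmu_body e = kif (kcomp e (kS kid)) (kF (kS kid))
  (kcall (kF kid) (kP (kF kid) (kP (kSuc (kF (kS kid))) (kS (kS kid)))))"
definition "kmu e = kcomp (kmu_body e) (kP (kconst (kmu_body e)) (kP (kconst 0) kid))"
text \<open>\<open>E2\<close> is asked whether the search will succeed before it is started, so the
  search is total.\<close>

definition "kmut e = kif (kE e) (kmu e) (kconst 0)"

lemma K_kmu:
  assumes f: "\<And>n. K G e <|n, x|> (f n)" and n: "f n = 0" "\<And>m. m < n \<Longrightarrow> f m \<noteq> 0"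
  shows "K G (kmu e) x n"
proof -
  let ?B = "kmu_body e"
  have "m \<le> n \<Longrightarrow> K G ?B <|?B, m, x|> n" for m
  proof (induction m rule: inc_induct)
    case base
    have c: "K G (kcomp e (kS kid)) <|?B, n, x|> (f n)"
      by (rule K_kcomp[OF K_kS[OF K_kid]]) (simp add: f)
    show ?case unfolding kmu_body_def[of e]
      by (rule K_kif[OF c[unfolded kmu_body_def]]) (use n in \<open>auto intro!: K_K1 K_eq[OF K_kF[OF K_kS[OF K_kid]]]\<close>)
  next
    case (step m)
    have c: "K G (kcomp e (kS kid)) <|?B, m, x|> (f m)"
      by (rule K_kcomp[OF K_kS[OF K_kid]]) (simp add: f)
    have "K G (kcall (kF kid) (kP (kF kid) (kP (kSuc (kF (kS kid))) (kS (kS kid))))) <|?B, m, x|> n"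
      by (rule K_kcall, (rule K_intros)+) (use step(3) in \<open>simp add: K_K1\<close>)
    then have "K G (kif (kcomp e (kS kid)) (kF (kS kid))
       (kcall (kF kid) (kP (kF kid) (kP (kSuc (kF (kS kid))) (kS (kS kid)))))) <|?B, m, x|> n"
      by (intro K_kif[OF c]) (use n(2)[of m] step(2) in \<open>auto intro: K_K1\<close>)
    then show ?case by (simp only: kmu_body_def[symmetric])
  qed
  from this[of 0] show ?thesis unfolding kmu_def
    by (intro K_kcomp[OF K_kP[OF K_kconst K_kP[OF K_kconst K_kid]]]) simp
qed

lemma K_kmut:
  assumes "\<And>n. K G e <|n, x|> (f n)"
  shows "K G (kmut e) x (mu (\<lambda>n. f n = 0))"
proof -
  have 1: "K G (kE e) x (tv (\<exists>n. f n = 0))" using K_kE_value[OF assms] by (simp add: E2_def tv_def)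
  show ?thesis unfolding kmut_def
  proof (rule K_kif[OF 1])
    assume "tv (\<exists>n. f n = 0) = 0"
    then have "\<exists>n. f n = 0" by simp
    then have "K G (kmu e) x (mu (\<lambda>n. f n = 0))"
      using mu_works[of "\<lambda>n. f n = 0"] mu_least[of "\<lambda>n. f n = 0"] by (intro K_kmu[OF assms]) (blast, meson leD)
    then show "K1 G (kmu e) x (mu (\<lambda>n. f n = 0))" by (rule K_K1)
  next
    assume "tv (\<exists>n. f n = 0) \<noteq> 0"
    then have "\<nexists>n. f n = 0" by simp
    then have "mu (\<lambda>n. f n = 0) = 0" by (simp only: mu_def if_False)
    then show "K1 G (kconst 0) x (mu (\<lambda>n. f n = 0))" using K_K1[OF K_kconst] by metis
  qed
qed

primrec kcase :: "nat \<Rightarrow> nat list \<Rightarrow> nat" where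
  "kcase t [] = kconst 0"
| "kcase t (p # ps) = kif t p (kcase (kPred t) ps)"

lemma K_kcase:
  "K G t x i \<Longrightarrow> (i < length ps \<Longrightarrow> K1 G (ps ! i) x y) \<Longrightarrow> (length ps \<le> i \<Longrightarrow> y = 0) \<Longrightarrow> K G (kcase t ps) x y"
proof (induction ps arbitrary: t i)
  case Nil
  then show ?case by (simp add: K_kconst)
next
  case (Cons p ps)
  have "i \<noteq> 0 \<Longrightarrow> K G (kcase (kPred t) ps) x y"
    by (rule Cons.IH[OF K_kPred[OF Cons.prems(1)]]) (use Cons.prems(2,3) in \<open>cases i; simp\<close>)+
  then show ?case using Cons.prems(2) by (auto intro!: K_kif[OF Cons.prems(1)] dest: K_K1)
qed

section \<open>A universal program\<close>

text \<open>A number codes a term built from the schemes of \<open>ar\<close>. Evaluation of all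
  codes by one program lets the code vary with the argument, as the enumeration of all arithmetical
  relations demands.\<close>

function uar :: "nat \<Rightarrow> type1 \<Rightarrow> nat \<Rightarrow> nat" where
  "uar c = (let t = pfst c; a = pfst (psnd c); b = psnd (psnd c) in
     if t = 0 then (\<lambda>h x. x) else if t = 1 then (\<lambda>h x. 0) else if t = 2 then (\<lambda>h x. Suc x)
     else if t = 3 then (\<lambda>h x. pfst x) else if t = 4 then (\<lambda>h x. psnd x) else if t = 5 then (\<lambda>h x. h x)
     else if t = 6 then (\<lambda>h x. uar a h (uar b h x)) else if t = 7 then (\<lambda>h x. <|uar a h x, uar b h x|>)
     else if t = 8 then (\<lambda>h x. rec_nat (uar a h (psnd x)) (\<lambda>i r. uar b h <|i, r, psnd x|>) (pfst x))
     else if t = 9 then (\<lambda>h x. mu (\<lambda>n. uar a h <|n, x|> = 0)) else (\<lambda>h x. 0))"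
  by auto

lemma pr_bounds: "pfst c \<noteq> 0 \<Longrightarrow> pfst (psnd c) < c \<and> psnd (psnd c) < c"
proof -
  have tri: "n \<le> triangle n" for n by (induction n) simp_all
  have le: "psnd n \<le> n" "pfst n \<le> n" for n
    using pr_triangle[of "pfst n" "psnd n"] tri[of "pfst n + psnd n"] by simp_all
  assume "pfst c \<noteq> 0"
  then have "psnd c < c" using pr_triangle[of "pfst c" "psnd c"] tri[of "pfst c + psnd c"] by simp
  then show ?thesis using le[of "psnd c"] by linarith
qed

termination
  by (relation "Wellfounded.measure id") (auto simp: pr_bounds)

declare uar.simps [simp del]

lemma ar_uar: "ar F \<Longrightarrow> \<exists>c. uar c = F"
proof (induction rule: ar.induct)
  case (comp F H)
  then obtain a b where "uar a = F" "uar b = H" by blast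
  then have "uar <|6, a, b|> = (\<lambda>h x. F h (H h x))" by (subst uar.simps) simp
  then show ?case by blast
next
  case (pair F H)
  then obtain a b where "uar a = F" "uar b = H" by blast
  then have "uar <|7, a, b|> = (\<lambda>h x. <|F h x, H h x|>)" by (subst uar.simps) simp
  then show ?case by blast
next
  case (rec F H)
  then obtain a b where "uar a = F" "uar b = H" by blast
  then have "uar <|8, a, b|> = (\<lambda>h x. rec_nat (F h (psnd x)) (\<lambda>i r. H h <|i, r, psnd x|>) (pfst x))" by (subst uar.simps) simp
  then show ?case by blast
next
  case (least F)
  then obtain a where "uar a = F" by blast
  then have "uar <|9, a, 0|> = (\<lambda>h x. mu (\<lambda>n. F h <|n, x|> = 0))" by (subst uar.simps) simp
  then show ?case by blast
next
  case id show ?case by (rule exI[of _ "<|0, 0|>"]) (subst uar.simps, simp)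
next
  case zero show ?case by (rule exI[of _ "<|1, 0|>"]) (subst uar.simps, simp)
next
  case suc show ?case by (rule exI[of _ "<|2, 0|>"]) (subst uar.simps, simp)
next
  case pfst show ?case by (rule exI[of _ "<|3, 0|>"]) (subst uar.simps, simp)
next
  case psnd show ?case by (rule exI[of _ "<|4, 0|>"]) (subst uar.simps, simp)
next
  case orc show ?case by (rule exI[of _ "<|5, 0|>"]) (subst uar.simps, simp)
qed

definition "uself b c x = kcall (kF b) (kP (kF b) (kP (kF (kS b)) (kP c x)))"
definition "uC b = kF (kS (kS b))"
definition "uX b = kS (kS (kS b))"
definition "uA b = kF (kS (uC b))"
definition "uB b = kS (kS (uC b))"
definition kU_cases :: "nat list" where "kU_cases = [uX kid, kconst 0, kSuc (uX kid), kF (uX kid), kS (uX kid),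
   kcall (kF (kF (kS kid))) (kP (uX kid) (kS (kF (kS kid)))),
   uself kid (uA kid) (uself kid (uB kid) (uX kid)),
   kP (uself kid (uA kid) (uX kid)) (uself kid (uB kid) (uX kid)),
   kif (kF (uX kid)) (uself kid (uA kid) (kS (uX kid)))
     (uself kid (uB kid) (kP (kPred (kF (uX kid))) (kP (uself kid (uC kid) (kP (kPred (kF (uX kid))) (kS (uX kid)))) (kS (uX kid))))),
   kmut (uself (kS kid) (uA (kS kid)) (kP (kF kid) (uX (kS kid))))]"
definition "kU = kcase (kF (uC kid)) kU_cases"

lemma K_kU_case:
  "K G (kF (uC kid)) w t \<Longrightarrow> (t < 10 \<Longrightarrow> K G (kU_cases ! t) w y) \<Longrightarrow> (10 \<le> t \<Longrightarrow> y = 0) \<Longrightarrow> K G kU w y"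
  unfolding kU_def by (erule K_kcase) (auto intro: K_K1 simp: kU_cases_def)

lemma K_uself:
  assumes "K G b w <|z, oa, q|>" "K G c w c'" "K G x w x'" "K G z <|z, oa, c', x'|> y"
  shows "K G (uself b c x) w y"
  unfolding uself_def
  by (rule K_kcall, (rule K_intros assms)+) (use assms(4) in \<open>simp add: K_K1\<close>)

lemma K_uCX:
  assumes "K G b w <|z, oa, c, x|>"
  shows "K G (uC b) w c" "K G (uX b) w x" "K G (uA b) w (pfst (psnd c))" "K G (uB b) w (psnd (psnd c))"
  unfolding uC_def uX_def uA_def uB_def
  by (rule K_eq, (rule K_intros assms)+, simp)+

text \<open>The oracle is a program \<open>j\<close> with a parameter \<open>a\<close> and may thus
  depend on the current argument. In the case of primitive recursion the call repeats the same code
  with a smaller recursion argument, hence the inner induction.\<close>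

lemma K_kU:
  assumes h: "\<And>n. K1 G j <|n, a|> (h n)"
  shows "K G kU <|kU, <|j, a|>, c, x|> (uar c h x)"
proof (induction c arbitrary: x rule: less_induct)
  case (less c)
  let ?oa = "<|j, a|>" and ?A = "pfst (psnd c)" and ?B = "psnd (psnd c)"
  let ?w = "<|kU, ?oa, c, x|>"
  have IH: "K G kU <|kU, ?oa, ?A, y|> (uar ?A h y)" "K G kU <|kU, ?oa, ?B, y|> (uar ?B h y)" if "pfst c \<noteq> 0" for y
    using less[of ?A] less[of ?B] pr_bounds[OF that] by blast+
  note w = K_uCX[OF K_kid, of G kU ?oa c x]
  have self: "K G (uself kid e e') ?w y" if "K G e ?w c'" "K G e' ?w x'" "K G kU <|kU, ?oa, c', x'|> y" for e e' c' x' y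
    by (rule K_uself[OF K_kid that])
  have t: "K G (kF (uC kid)) ?w (pfst c)" by (intro K_intros w)
  show ?case
  proof (cases "pfst c = 8")
    case True
    have t': "K G (kF (uC kid)) <|kU, ?oa, c, y|> 8" for y
      by (rule K_eq, (rule K_intros K_uCX[OF K_kid])+) (rule True)
    have "K G kU <|kU, ?oa, c, i, e|> (rec_nat (uar ?A h e) (\<lambda>i r. uar ?B h <|i, r, e|>) i)" for i e
    proof (induction i)
      case 0
      note w = K_uCX[OF K_kid, of G kU ?oa c "<|0, e|>"]
      show ?case
      proof (rule K_kU_case[OF t'])
        have "K G (kF (uX kid)) <|kU, ?oa, c, 0, e|> 0" by (rule K_eq, (rule K_intros w)+) simp
        moreover have "K G (uself kid (uA kid) (kS (uX kid))) <|kU, ?oa, c, 0, e|> (uar ?A h e)"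
          by (rule K_uself[OF K_kid], (rule K_intros w)+) (use IH(1)[of e] True in simp)
        ultimately show "K G (kU_cases ! 8) <|kU, ?oa, c, 0, e|> (rec_nat (uar ?A h e) (\<lambda>i r. uar ?B h <|i, r, e|>) 0)"
          by (auto simp: kU_cases_def intro!: K_kif K_K1)
      qed simp
    next
      case (Suc i)
      let ?w = "<|kU, ?oa, c, Suc i, e|>"
      let ?r = "rec_nat (uar ?A h e) (\<lambda>i r. uar ?B h <|i, r, e|>)"
      note w = K_uCX[OF K_kid, of G kU ?oa c "<|Suc i, e|>"]
      have X: "K G (kF (uX kid)) ?w (Suc i)" "K G (kPred (kF (uX kid))) ?w i" "K G (kS (uX kid)) ?w e"
        by (rule K_eq, (rule K_intros w)+, simp)+
      have "K G (uself kid (uC kid) (kP (kPred (kF (uX kid))) (kS (uX kid)))) ?w (?r i)"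
        by (rule K_uself[OF K_kid w(1) K_kP[OF X(2,3)] Suc])
      then have "K G (uself kid (uB kid) (kP (kPred (kF (uX kid))) (kP (uself kid (uC kid) (kP (kPred (kF (uX kid))) (kS (uX kid)))) (kS (uX kid))))) ?w (?r (Suc i))"
        using IH(2)[of "<|i, ?r i, e|>"] True
        by (intro K_uself[OF K_kid w(4) K_kP[OF X(2) K_kP[OF _ X(3)]]]) simp_all
      then have "K G (kU_cases ! 8) ?w (?r (Suc i))"
        by (auto simp: kU_cases_def intro!: K_kif[OF X(1)] K_K1)
      then show ?case by (intro K_kU_case[OF t']) simp_all
    qed
    from this[of "pfst x" "psnd x"] show ?thesis using True by (subst uar.simps) simp
  next
    case False
    have "K G (kU_cases ! pfst c) ?w (uar c h x)" if "pfst c < 10"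
    proof -
      have less_10: "n < 10 \<Longrightarrow> n = 0 \<or> n = 1 \<or> n = 2 \<or> n = 3 \<or> n = 4 \<or> n = 5 \<or> n = 6 \<or> n = 7 \<or> n = 8 \<or> n = 9" for n :: nat
        by presburger
      consider "pfst c = 0" | "pfst c = 1" | "pfst c = 2" | "pfst c = 3" | "pfst c = 4" | "pfst c = 5" | "pfst c = 6"
        | "pfst c = 7" | "pfst c = 9" using False less_10[OF \<open>pfst c < 10\<close>] by argo
      then show ?thesis
      proof cases
        case 1 show ?thesis using w(2) 1 by (subst uar.simps) (simp add: kU_cases_def)
      next
        case 2 show ?thesis using K_kconst 2 by (subst uar.simps) (simp add: kU_cases_def)
      next
        case 3 show ?thesis using K_kSuc[OF w(2)] 3 by (subst uar.simps) (simp add: kU_cases_def)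
      next
        case 4 show ?thesis using K_kF[OF w(2)] 4 by (subst uar.simps) (simp add: kU_cases_def)
      next
        case 5 show ?thesis using K_kS[OF w(2)] 5 by (subst uar.simps) (simp add: kU_cases_def)
      next
        case 6
        have "K G (kcall (kF (kF (kS kid))) (kP (uX kid) (kS (kF (kS kid))))) ?w (h x)"
          by (rule K_kcall, (rule K_intros w)+) (simp add: h)
        then show ?thesis using 6 by (subst uar.simps) (simp add: kU_cases_def)
      next
        case 7
        have "K G (uself kid (uB kid) (uX kid)) ?w (uar ?B h x)" using IH(2) 7 by (intro self[OF w(4) w(2)]) simp
        then have "K G (uself kid (uA kid) (uself kid (uB kid) (uX kid))) ?w (uar ?A h (uar ?B h x))"
          using IH(1) 7 by (intro self[OF w(3)]) simp_all
        then show ?thesis using 7 by (subst uar.simps) (simp add: kU_cases_def)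
      next
        case 8
        have "K G (uself kid (uB kid) (uX kid)) ?w (uar ?B h x)" "K G (uself kid (uA kid) (uX kid)) ?w (uar ?A h x)"
          using IH 8 by (intro self[OF w(4) w(2)] self[OF w(3) w(2)]; simp)+
        then show ?thesis using 8 by (subst uar.simps) (simp add: kU_cases_def K_kP)
      next
        case 9
        have "K G (uself (kS kid) (uA (kS kid)) (kP (kF kid) (uX (kS kid)))) <|n, ?w|> (uar ?A h <|n, x|>)" for n
        proof -
          have b: "K G (kS kid) <|n, ?w|> ?w" "K G (kF kid) <|n, ?w|> n" by (rule K_eq, (rule K_intros)+, simp)+
          show ?thesis using IH(1) 9 by (intro K_uself[OF b(1) K_uCX(3)[OF b(1)] K_kP[OF b(2) K_uCX(2)[OF b(1)]]]) simp
        qed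
        from K_kmut[OF this] show ?thesis using 9 by (subst uar.simps) (simp add: kU_cases_def)
      qed
    qed
    moreover have "uar c h x = 0" if "10 \<le> pfst c" using that by (subst uar.simps) simp
    ultimately show ?thesis by (rule K_kU_case[OF t])
  qed
qed

text \<open>A code of \<open>F\<close> is chosen once and built into the program as a constant;
  \<open>e\<close> is the program that answers the oracle questions.\<close>

definition korc :: "(type1 \<Rightarrow> nat \<Rightarrow> nat) \<Rightarrow> nat \<Rightarrow> nat" where
  "korc F e = kcomp kU (kP (kconst kU) (kP (kP (kconst e) kid) (kP (kconst (SOME c. uar c = F)) kid)))"
definition kar :: "(nat \<Rightarrow> nat) \<Rightarrow> nat" where "kar f = korc (\<lambda>h. f) (kconst 0)"
definition "karp P = kar (\<lambda>x. tv (P x))"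
definition "kat e f = kcomp e (kar f)"
definition "kself u f = kcall (kar u) (kar f)"

lemma K_korc:
  assumes "ar F" "\<And>n. K G e <|n, x|> (h n)"
  shows "K G (korc F e) x (F h x)"
proof -
  have "uar (SOME c. uar c = F) = F" using ar_uar[OF assms(1)] by (rule someI_ex)
  moreover have "K G (korc F e) x (uar (SOME c. uar c = F) h x)"
    unfolding korc_def by (rule K_kcomp, (rule K_intros)+, rule K_kU) (rule K_K1[OF assms(2)])
  ultimately show ?thesis by simp
qed

lemma K_korcp: "arp P \<Longrightarrow> (\<And>n. K G e <|n, x|> (h n)) \<Longrightarrow> K G (korc (\<lambda>h x. tv (P h x)) e) x (tv (P h x))"
  by (rule K_korc) (simp add: arp_def tv_def)

lemma K_kar: "ar (\<lambda>h. f) \<Longrightarrow> K G (kar f) x (f x)"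
  unfolding kar_def by (rule K_korc[where h = "\<lambda>_. 0"]) (simp_all add: K_kconst)

lemma K_karp: "arp (\<lambda>h. P) \<Longrightarrow> K G (karp P) x (tv (P x))"
  unfolding karp_def by (rule K_kar) (simp add: arp_def tv_def)

lemma K_at: "ar (\<lambda>h. f) \<Longrightarrow> K G e (f x) y \<Longrightarrow> K G (kat e f) x y"
  unfolding kat_def by (rule K_kcomp[OF K_kar])

lemma K_self: "ar (\<lambda>h. u) \<Longrightarrow> ar (\<lambda>h. f) \<Longrightarrow> K1 G (u x) (f x) y \<Longrightarrow> K G (kself u f) x y"
  unfolding kself_def by (rule K_kcall[OF K_kar K_kar])

definition "kimp e f = kif e f (kconst 0)"
definition "knz e = kif e (kconst 1) (kconst 0)"

lemma K_imp:
  assumes e: "K G e x (tv P)" and f: "P \<Longrightarrow> K G f x (tv Q)"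
  shows "K G (kimp e f) x (tv (P \<longrightarrow> Q))"
  unfolding kimp_def
  by (rule K_kif[OF e]) (use f in \<open>auto intro!: K_K1 K_eq[OF K_kconst] simp: tv_def[of "_ \<longrightarrow> _"] tv_def[of True] dest: f\<close>)

lemma K_nz: "K G e x v \<Longrightarrow> K G (knz e) x (tv (v \<noteq> 0))"
  unfolding knz_def by (rule K_kif, assumption) (auto intro!: K_K1 K_eq[OF K_kconst] simp: tv_def)

section \<open>Notations for levels, names for their elements, and truth\<close>

section \<open>Ordinal notations\<close>

text \<open>
  A number \<open>x\<close> denotes the tree whose \<open>n\<close>-th subtree is given by the value of the program \<open>pfst x\<close> at
  \<open><|psnd x, n|>\<close>; the value \<open>0\<close> means that there is no such subtree, \<open>Suc c\<close> that it is \<open>c\<close>.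
\<close>

definition ch :: "type2 \<Rightarrow> nat \<Rightarrow> nat \<Rightarrow> nat" where
  "ch G x n = (THE y. K1 G (pfst x) <|psnd x, n|> y)"

definition TC :: "type2 \<Rightarrow> nat \<Rightarrow> bool" where
  "TC G x \<longleftrightarrow> (\<forall>n. K1 G (pfst x) <|psnd x, n|> (ch G x n))"

lemma ch_eq: "K1 G (pfst x) <|psnd x, n|> y \<Longrightarrow> ch G x n = y"
  unfolding ch_def by (rule the_equality) (auto dest: K1_det)

lemma TC_I: "(\<And>n. \<exists>y. K1 G (pfst x) <|psnd x, n|> y) \<Longrightarrow> TC G x"
  unfolding TC_def using ch_eq by metis

inductive ON :: "type2 \<Rightarrow> nat \<Rightarrow> bool" for G where
  ON: "TC G x \<Longrightarrow> (\<And>n c. ch G x n = Suc c \<Longrightarrow> ON G c) \<Longrightarrow> ON G x"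

lemma ON_TC: "ON G x \<Longrightarrow> TC G x" and ON_ch: "ON G x \<Longrightarrow> ch G x n = Suc c \<Longrightarrow> ON G c"
  by (auto elim: ON.cases)

definition chr :: "type2 \<Rightarrow> (nat \<times> nat) set" where
  "chr G = {(c, x). \<exists>n. ch G x n = Suc c}"

definition ho :: "type2 \<Rightarrow> nat \<Rightarrow> hset" where "ho G = hrank (chr G)"
definition LN :: "type2 \<Rightarrow> nat \<Rightarrow> hset set" where "LN G x = L G (ho G x)"

lemma ON_acc: "ON G x \<Longrightarrow> x \<in> acc (chr G)"
  by (induction rule: ON.induct) (auto intro: accI simp: chr_def)

lemma elts_ho: "ON G x \<Longrightarrow> elts (ho G x) = (\<Union>c\<in>{c. \<exists>n. ch G x n = Suc c}. insert (ho G c) (elts (ho G c)))"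
  unfolding ho_def by (subst hrank[OF ON_acc]) (auto simp: chr_def)

lemma ordinal_ho: "ON G x \<Longrightarrow> ordinal (ho G x)"
  unfolding ho_def by (rule ordinal_hrank[OF ON_acc])

lemma LN_eq: "ON G x \<Longrightarrow> LN G x = (\<Union>c\<in>{c. \<exists>n. ch G x n = Suc c}. Def G (LN G c))"
  unfolding ho_def LN_def by (subst L_hrank[OF ON_acc]) (auto simp: chr_def)

lemma LN_ch: "ON G x \<Longrightarrow> ch G x n = Suc c \<Longrightarrow> LN G c \<subseteq> LN G x"
  unfolding LN_def by (rule L_mono[OF ordinal_ho]) (auto simp: elts_ho)

text \<open>Hereditary totality: all subtrees can be computed, but branches may be infinite. The
  trees entering the search have this property before anything is known about their
  well-foundedness.\<close>

coinductive HT :: "type2 \<Rightarrow> nat \<Rightarrow> bool" for G where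
  HT: "TC G x \<Longrightarrow> (\<And>n c. ch G x n = Suc c \<Longrightarrow> HT G c) \<Longrightarrow> HT G x"

lemma HT_TC: "HT G x \<Longrightarrow> TC G x" and HT_ch: "HT G x \<Longrightarrow> ch G x n = Suc c \<Longrightarrow> HT G c"
  by (auto elim: HT.cases)

text \<open>Comparison of ranks by simulation. It makes sense when only \<open>y\<close> is known to
  be well-founded: it is then decidable by recursion on \<open>y\<close> and, if it holds for a
  hereditarily total \<open>x\<close>, makes \<open>x\<close> well-founded too.\<close>

inductive le :: "type2 \<Rightarrow> nat \<Rightarrow> nat \<Rightarrow> bool" for G where
  le: "(\<And>n c. ch G x n = Suc c \<Longrightarrow> \<exists>m d. ch G y m = Suc d \<and> le G c d) \<Longrightarrow> le G x y"

lemma le_iff: "le G x y \<longleftrightarrow> (\<forall>n. ch G x n \<noteq> 0 \<longrightarrow> (\<exists>m. ch G y m \<noteq> 0 \<and> le G (ch G x n - 1) (ch G y m - 1)))"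
proof
  assume "le G x y"
  then show "\<forall>n. ch G x n \<noteq> 0 \<longrightarrow> (\<exists>m. ch G y m \<noteq> 0 \<and> le G (ch G x n - 1) (ch G y m - 1))"
  proof cases
    case le
    show ?thesis
    proof (intro allI impI)
      fix n assume "ch G x n \<noteq> 0"
      then obtain c where c: "ch G x n = Suc c" by (cases "ch G x n") auto
      then obtain m d where "ch G y m = Suc d" "le G c d" using le by blast
      then show "\<exists>m. ch G y m \<noteq> 0 \<and> le G (ch G x n - 1) (ch G y m - 1)" using c by (intro exI[of _ m]) simp
    qed
  qed
next
  assume r: "\<forall>n. ch G x n \<noteq> 0 \<longrightarrow> (\<exists>m. ch G y m \<noteq> 0 \<and> le G (ch G x n - 1) (ch G y m - 1))"
  show "le G x y"
  proof (rule le)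
    fix n c assume c: "ch G x n = Suc c"
    then obtain m where "ch G y m \<noteq> 0" "le G c (ch G y m - 1)" using r[rule_format, of n] by auto
    then show "\<exists>m d. ch G y m = Suc d \<and> le G c d" by (intro exI[of _ m] exI[of _ "ch G y m - 1"]) simp
  qed
qed

lemma ordinal_trichotomy: "ordinal \<alpha> \<Longrightarrow> ordinal \<beta> \<Longrightarrow> \<alpha> = \<beta> \<or> \<alpha> \<in> elts \<beta> \<or> \<beta> \<in> elts \<alpha>"
proof (induction \<alpha> arbitrary: \<beta> rule: elts_induct)
  case (1 \<alpha>)
  note IH = this(1) and \<alpha> = this(2)
  from \<open>ordinal \<beta>\<close> show ?case
  proof (induction \<beta> rule: elts_induct)
    case (1 \<beta>)
    note IH' = this(1) and \<beta> = this(2)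
    show ?case
    proof (rule ccontr)
      assume n: "\<not> (\<alpha> = \<beta> \<or> \<alpha> \<in> elts \<beta> \<or> \<beta> \<in> elts \<alpha>)"
      have "\<gamma> \<in> elts \<beta>" if "\<gamma> \<in> elts \<alpha>" for \<gamma>
        using IH[OF that ordinal_elt[OF \<alpha> that] \<beta>] n that \<alpha> unfolding ordinal_def by blast
      moreover have "\<gamma> \<in> elts \<alpha>" if "\<gamma> \<in> elts \<beta>" for \<gamma>
        using IH'[OF that ordinal_elt[OF \<beta> that]] n that \<beta> unfolding ordinal_def by blast
      ultimately have "\<alpha> = \<beta>" by (intro hset_eqI) blast
      then show False using n by blast
    qed
  qed
qed

lemma L_subset: "ordinal \<alpha> \<Longrightarrow> ordinal \<beta> \<Longrightarrow> elts \<alpha> \<subseteq> elts \<beta> \<Longrightarrow> L G \<alpha> \<subseteq> L G \<beta>"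
  using ordinal_trichotomy[of \<alpha> \<beta>] L_mono[of \<beta> \<alpha> G] not_mem_self by blast

lemma le_O: "le G x y \<Longrightarrow> ON G y \<Longrightarrow> HT G x \<Longrightarrow> ON G x \<and> elts (ho G x) \<subseteq> elts (ho G y)"
proof (induction rule: le.induct)
  case (le x y)
  have *: "ON G c \<and> insert (ho G c) (elts (ho G c)) \<subseteq> elts (ho G y)" if c: "ch G x n = Suc c" for n c
  proof -
    obtain m d where d: "ch G y m = Suc d" "ON G d \<Longrightarrow> HT G c \<Longrightarrow> ON G c \<and> elts (ho G c) \<subseteq> elts (ho G d)"
      using le.IH[OF c] by blast
    have 1: "ON G c" "elts (ho G c) \<subseteq> elts (ho G d)" "ON G d"
      using d(2) ON_ch[OF le.prems(1) d(1)] HT_ch[OF le.prems(2) c] by blast+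
    have 2: "insert (ho G d) (elts (ho G d)) \<subseteq> elts (ho G y)" unfolding elts_ho[OF le.prems(1)] using d(1) by blast
    have "ho G c = ho G d \<or> ho G c \<in> elts (ho G d)"
      using ordinal_trichotomy[OF ordinal_ho[OF 1(1)] ordinal_ho[OF 1(3)]] 1(2) not_mem_self by blast
    then show ?thesis using 1 2 by blast
  qed
  have "ON G x" by (rule ON[OF HT_TC[OF le.prems(2)]]) (use * in blast)
  then show ?case using * elts_ho by blast
qed

lemma le_LN: "le G x y \<Longrightarrow> ON G y \<Longrightarrow> HT G x \<Longrightarrow> LN G x \<subseteq> LN G y"
  unfolding LN_def using le_O L_subset ordinal_ho by meson

definition kch :: "(nat \<Rightarrow> nat) \<Rightarrow> (nat \<Rightarrow> nat) \<Rightarrow> nat" where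
  "kch u v = kself (\<lambda>w. pfst (u w)) (\<lambda>w. <|psnd (u w), v w|>)"

lemma K_ch:
  assumes "ar (\<lambda>h. u)" "ar (\<lambda>h. v)" "TC G (u w)"
  shows "K G (kch u v) w (ch G (u w) (v w))"
  unfolding kch_def
proof (rule K_self)
  show "ar (\<lambda>h w. pfst (u w))" "ar (\<lambda>h w. <|psnd (u w), v w|>)" by (intro ar_intros assms)+
  show "K1 G (pfst (u w)) <|psnd (u w), v w|> (ch G (u w) (v w))" using assms(3) unfolding TC_def by blast
qed

definition "kLE = kall (kimp (knz (kch (\<lambda>w. pfst (psnd (psnd w))) pfst))
  (kE (kand (knz (kch (\<lambda>w. psnd (psnd (psnd (psnd w)))) pfst))
     (kcall (kar (\<lambda>w. pfst (psnd (psnd w)))) (kP (kar (\<lambda>w. pfst (psnd (psnd w))))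
        (kP (kPred (kch (\<lambda>w. pfst (psnd (psnd (psnd w)))) (\<lambda>w. pfst (psnd w))))
          (kPred (kch (\<lambda>w. psnd (psnd (psnd (psnd w)))) pfst))))))))"

lemma K_kLE: "ON G y \<Longrightarrow> HT G x \<Longrightarrow> K G kLE <|kLE, x, y|> (tv (le G x y))"
proof (induction arbitrary: x rule: ON.induct)
  case (ON y)
  let ?w = "<|kLE, x, y|>"
  have x: "K G (kch (\<lambda>w. pfst (psnd (psnd w))) pfst) <|n, ?w|> (ch G x n)" for n
    by (rule K_eq[OF K_ch]) (use HT_TC[OF ON.prems] in \<open>auto intro!: ar_intros\<close>)
  have x': "K G (kch (\<lambda>w. pfst (psnd (psnd (psnd w)))) (\<lambda>w. pfst (psnd w))) <|m, n, ?w|> (ch G x n)" for m n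
    by (rule K_eq[OF K_ch]) (use HT_TC[OF ON.prems] in \<open>auto intro!: ar_intros\<close>)
  have y: "K G (kch (\<lambda>w. psnd (psnd (psnd (psnd w)))) pfst) <|m, n, ?w|> (ch G y m)" for m n
    by (rule K_eq[OF K_ch]) (use ON.hyps(1) in \<open>auto intro!: ar_intros\<close>)
  have z: "K G (kar (\<lambda>w. pfst (psnd (psnd w)))) <|m, n, ?w|> kLE" for m n
    by (rule K_eq[OF K_kar]) (auto intro!: ar_intros)
  have rec: "K1 G kLE <|kLE, ch G x n - 1, ch G y m - 1|> (tv (le G (ch G x n - 1) (ch G y m - 1)))"
    if "ch G x n \<noteq> 0" "ch G y m \<noteq> 0" for n m
    by (rule K_K1[OF ON.IH[of m]]) (use that HT_ch[OF ON.prems, of n] in auto)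
  show ?case unfolding le_iff[of G x y]
    apply (subst kLE_def)
    apply (intro K_all K_imp K_nz[OF x] K_ex K_and K_nz[OF y])
    apply (rule K_kcall[OF z K_kP[OF z K_kP[OF K_kPred[OF x'] K_kPred[OF y]]]])
    by (rule rec)
qed

section \<open>Names\<close>

lemma goedel_inj [simp]: "goedel \<phi> = goedel \<psi> \<longleftrightarrow> \<phi> = \<psi>"
proof -
  have "goedel \<phi> = goedel \<psi> \<Longrightarrow> \<phi> = \<psi>"
    by (induction \<phi> arbitrary: \<psi>; case_tac \<psi>) auto
  then show ?thesis by blast
qed

text \<open>The second argument is a notation for the level whose elements are named.\<close>

inductive nm :: "type2 \<Rightarrow> nat \<Rightarrow> nat \<Rightarrow> hset \<Rightarrow> bool" for G where
  nm: "ch G b n = Suc c \<Longrightarrow> list_all2 (nm G c) ps xs \<Longrightarrow> defined_by G (LN G c) \<psi> xs x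
    \<Longrightarrow> nm G b <|c, goedel \<psi>, list_encode ps|> x"

definition NM :: "type2 \<Rightarrow> nat \<Rightarrow> nat \<Rightarrow> bool" where "NM G b z \<longleftrightarrow> (\<exists>x. nm G b z x)"
definition den :: "type2 \<Rightarrow> nat \<Rightarrow> hset" where "den G z = (THE x. \<exists>b. nm G b z x)"

lemma nm_unique: "nm G b z x \<Longrightarrow> nm G b' z x' \<Longrightarrow> x = x'"
proof (induction arbitrary: b' x' rule: nm.induct)
  case (nm b n c ps xs \<psi> x)
  from nm.prems obtain xs' where xs': "list_all2 (nm G c) ps xs'" "defined_by G (LN G c) \<psi> xs' x'"
    by (auto elim!: nm.cases[of G b'])
  have "xs = xs'"
  proof (rule nth_equalityI)
    show "length xs = length xs'" using nm.IH(1) xs'(1) by (auto dest!: list_all2_lengthD)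
    show "xs ! i = xs' ! i" if "i < length xs" for i
      using list_all2_nthD2[OF nm.IH(1) that] list_all2_nthD[OF xs'(1), of i] that list_all2_lengthD[OF nm.IH(1)]
      by auto
  qed
  then show ?case using nm.hyps xs'(2) by (intro hset_eqI) (auto simp: defined_by_def)
qed

lemma den: "nm G b z x \<Longrightarrow> den G z = x"
  unfolding den_def by (rule the_equality) (auto dest: nm_unique)

lemma nm_den: "NM G b z \<Longrightarrow> nm G b z (den G z)"
  unfolding NM_def using den by blast

lemma den_LN: "ON G b \<Longrightarrow> NM G b z \<Longrightarrow> den G z \<in> LN G b"
  using nm_den[of G b z] by (auto elim!: nm.cases simp: LN_eq Def_def)

lemma LN_den: "ON G b \<Longrightarrow> LN G b = den G ` {z. NM G b z}"
proof (induction rule: ON.induct)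
  case (ON b)
  have b: "ON G b" by (rule ON.ON) (use ON in blast)+
  have "x \<in> den G ` {z. NM G b z}" if x: "x \<in> LN G b" for x
  proof -
    obtain n c \<psi> xs where c: "ch G b n = Suc c" "defined_by G (LN G c) \<psi> xs x"
      using x unfolding LN_eq[OF b] Def_def by blast
    have "\<forall>y\<in>set xs. \<exists>z. NM G c z \<and> den G z = y"
    proof
      fix y assume "y \<in> set xs"
      then have "y \<in> LN G c" using c(2) unfolding defined_by_def by blast
      then show "\<exists>z. NM G c z \<and> den G z = y" using ON.IH[OF c(1)] by auto
    qed
    from bchoice[OF this] obtain f where f: "\<And>y. y \<in> set xs \<Longrightarrow> NM G c (f y) \<and> den G (f y) = y" by blast
    have "list_all2 (nm G c) (map f xs) xs"
      unfolding list_all2_conv_all_nth using f nm_den by (metis length_map nth_map nth_mem)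
    then have "nm G b <|c, goedel \<psi>, list_encode (map f xs)|> x" by (rule nm.nm[OF c(1) _ c(2)])
    then show ?thesis using den unfolding NM_def by blast
  qed
  then show ?case using den_LN[OF b] by blast
qed

lemma countable_LN: "ON G b \<Longrightarrow> countable (LN G b)"
  by (simp add: LN_den)

lemma NM_mk:
  assumes "ON G b" "ch G b n = Suc c" "\<And>p. p \<in> set ps \<Longrightarrow> NM G c p" "st_form_ok \<psi> (Suc (length ps))"
  shows "NM G b <|c, goedel \<psi>, list_encode ps|>"
    and "defined_by G (LN G c) \<psi> (map (den G) ps) (den G <|c, goedel \<psi>, list_encode ps|>)"
proof -
  let ?x = "hs {y \<in> LN G c. st_sat G (LN G c) \<psi> (y # map (den G) ps)}"
  have c: "ON G c" by (rule ON_ch[OF assms(1,2)])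
  have "defined_by G (LN G c) \<psi> (map (den G) ps) ?x"
    unfolding defined_by_def using assms(3,4) den_LN[OF c] countable_LN[OF c] by (auto simp: countable_Collect)
  moreover have "list_all2 (nm G c) ps (map (den G) ps)"
    using assms(3) nm_den by (auto simp: list_all2_conv_all_nth)
  ultimately have *: "nm G b <|c, goedel \<psi>, list_encode ps|> ?x" using nm.nm[OF assms(2)] by blast
  then show "NM G b <|c, goedel \<psi>, list_encode ps|>" unfolding NM_def by blast
  show "defined_by G (LN G c) \<psi> (map (den G) ps) (den G <|c, goedel \<psi>, list_encode ps|>)"
    unfolding den[OF *] by fact
qed

lemma NM_E:
  assumes "NM G b z"
  obtains n c \<psi> ps where "ch G b n = Suc c" "z = <|c, goedel \<psi>, list_encode ps|>" "\<And>p. p \<in> set ps \<Longrightarrow> NM G c p"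
    "st_form_ok \<psi> (Suc (length ps))" "elts (den G z) = {y \<in> LN G c. st_sat G (LN G c) \<psi> (y # map (den G) ps)}"
proof -
  from nm_den[OF assms] show thesis
  proof cases
    case (nm n c ps xs \<psi>)
    have "xs = map (den G) ps"
      using nm(3) den by (auto simp: list_all2_conv_all_nth intro!: nth_equalityI)
    moreover have "NM G c p" if "p \<in> set ps" for p
      using that nm(3) unfolding NM_def by (metis in_set_conv_nth list_all2_conv_all_nth)
    ultimately show ?thesis using nm that[of n c \<psi> ps] by (auto simp: defined_by_def)
  qed
qed

section \<open>Programs for the constructible hierarchy\<close>

definition "kor e f = kif e (kconst 0) f"
definition "keq e f = kcomp (karp (\<lambda>v. pfst v = psnd v)) (kP e f)"

lemma K_or:
  assumes e: "K G e x (tv P)" and f: "\<not> P \<Longrightarrow> K G f x (tv Q)"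
  shows "K G (kor e f) x (tv (P \<or> Q))"
  unfolding kor_def
  by (rule K_kif[OF e]) (use f in \<open>auto intro!: K_K1 K_eq[OF K_kconst] simp: tv_def[of "_ \<or> _"] tv_def[of True] dest: f\<close>)

lemma K_keq: "K G e x a \<Longrightarrow> K G f x b \<Longrightarrow> K G (keq e f) x (tv (a = b))"
  unfolding keq_def
  by (rule K_kcomp[OF K_kP], assumption, assumption, rule K_eq[OF K_karp]) (auto intro!: ar_intros)

lemma K_karp': "arp (\<lambda>h. P) \<Longrightarrow> P x = Q \<Longrightarrow> K G (karp P) x (tv Q)"
  using K_karp by blast

lemma K_at': "ar (\<lambda>h. f) \<Longrightarrow> f x = q \<Longrightarrow> K G e q y \<Longrightarrow> K G (kat e f) x y"
  using K_at by blast

lemma K_self': "ar (\<lambda>h. u) \<Longrightarrow> ar (\<lambda>h. f) \<Longrightarrow> u x = e \<Longrightarrow> f x = q \<Longrightarrow> K G e q y \<Longrightarrow> K G (kself u f) x y"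
  using K_self K_K1 by blast

lemma K_ch': "ar (\<lambda>h. u) \<Longrightarrow> ar (\<lambda>h. v) \<Longrightarrow> u w = x \<Longrightarrow> v w = n \<Longrightarrow> TC G x \<Longrightarrow> K G (kch u v) w (ch G x n)"
  using K_ch by blast

lemma member_less: "x \<in> set xs \<Longrightarrow> x < list_encode xs"
proof (induction xs)
  case (Cons y xs)
  then show ?case using le_prod_encode_1[of y "list_encode xs"] le_prod_encode_2[of "list_encode xs" y]
    by (auto simp: less_Suc_eq_le intro: order.trans)
qed simp

lemma lnth_less: "i < llen l \<Longrightarrow> lnth l i < l"
  using member_less[of "list_decode l ! i" "list_decode l"] by (simp add: lnth_eq llen_def)

definition fokp :: "nat \<Rightarrow> nat \<Rightarrow> bool" where
  "fokp n f \<longleftrightarrow> (\<exists>\<psi>. f = goedel \<psi> \<and> st_form_ok \<psi> n)"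

lemma llen2: "llen l = 2 \<Longrightarrow> l = list_encode [lnth l 0, lnth l (Suc 0)]"
  and llen3: "llen l = 3 \<Longrightarrow> l = list_encode [lnth l 0, lnth l (Suc 0), lnth l 2]"
proof -
  assume "llen l = 2"
  then have "[0..<llen l] = [0, Suc 0]" by (simp add: upt_rec)
  then show "l = list_encode [lnth l 0, lnth l (Suc 0)]" using list_encode_map_lnth[of l] by simp
next
  assume "llen l = 3"
  then have "[0..<llen l] = [0, Suc 0, 2]" by (simp add: upt_rec numeral_2_eq_2)
  then show "l = list_encode [lnth l 0, lnth l (Suc 0), lnth l 2]" using list_encode_map_lnth[of l] by simp
qed

lemma fokp_iff: "fokp n f \<longleftrightarrow> (llen f = 3 \<and> lnth f 0 \<le> 2 \<and> lnth f (Suc 0) < n \<and> lnth f 2 < n) \<or>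
  (llen f = 2 \<and> lnth f 0 = 3) \<and> fokp n (lnth f (Suc 0)) \<or>
  (llen f = 3 \<and> lnth f 0 = 4) \<and> fokp n (lnth f (Suc 0)) \<and> fokp n (lnth f 2) \<or>
  (llen f = 2 \<and> lnth f 0 = 5) \<and> fokp (Suc n) (lnth f (Suc 0))" (is "_ \<longleftrightarrow> ?R")
proof
  assume "fokp n f"
  then obtain \<psi> where "f = goedel \<psi>" "st_form_ok \<psi> n" unfolding fokp_def by blast
  then show ?R by (cases \<psi>) (auto simp: llen_list_encode lnth_list_encode fokp_def simp del: list_encode.simps)
next
  assume ?R
  then consider "llen f = 3" "lnth f 0 \<le> 2" "lnth f (Suc 0) < n" "lnth f 2 < n"
    | "llen f = 2" "lnth f 0 = 3" "fokp n (lnth f (Suc 0))"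
    | "llen f = 3" "lnth f 0 = 4" "fokp n (lnth f (Suc 0))" "fokp n (lnth f 2)"
    | "llen f = 2" "lnth f 0 = 5" "fokp (Suc n) (lnth f (Suc 0))" by blast
  then show "fokp n f"
  proof cases
    case 1
    let ?i = "lnth f (Suc 0)" and ?j = "lnth f 2"
    have "f = goedel (StMem ?i ?j) \<or> f = goedel (StEq ?i ?j) \<or> f = goedel (StG ?i ?j)"
      using llen3[OF 1(1)] 1(2) by (auto simp: numeral_2_eq_2 le_Suc_eq simp del: list_encode.simps)
    moreover have "st_form_ok (StMem ?i ?j) n" "st_form_ok (StEq ?i ?j) n" "st_form_ok (StG ?i ?j) n" using 1 by simp_all
    ultimately show ?thesis unfolding fokp_def by blast
  next
    case 2
    then obtain \<psi> where "lnth f (Suc 0) = goedel \<psi>" "st_form_ok \<psi> n" unfolding fokp_def by blast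
    then show ?thesis using llen2[OF 2(1)] 2(2) unfolding fokp_def by (intro exI[of _ "StNot \<psi>"]) simp
  next
    case 3
    then obtain \<psi> \<theta> where "lnth f (Suc 0) = goedel \<psi>" "st_form_ok \<psi> n" "lnth f 2 = goedel \<theta>" "st_form_ok \<theta> n"
      unfolding fokp_def by blast
    then show ?thesis using llen3[OF 3(1)] 3(2) unfolding fokp_def by (intro exI[of _ "StAnd \<psi> \<theta>"]) simp
  next
    case 4
    then obtain \<psi> where "lnth f (Suc 0) = goedel \<psi>" "st_form_ok \<psi> (Suc n)" unfolding fokp_def by blast
    then show ?thesis using llen2[OF 4(1)] 4(2) unfolding fokp_def by (intro exI[of _ "StAll \<psi>"]) simp
  qed
qed

definition "kFok = (let n = (\<lambda>w. pfst (psnd w)); f = (\<lambda>w. psnd (psnd w));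
    self = (\<lambda>d i. kself pfst (\<lambda>w. <|pfst w, d + pfst (psnd w), lnth (psnd (psnd w)) i|>)) in
  kor (karp (\<lambda>w. llen (f w) = 3 \<and> lnth (f w) 0 \<le> 2 \<and> lnth (f w) (Suc 0) < n w \<and> lnth (f w) 2 < n w))
  (kor (kand (karp (\<lambda>w. llen (f w) = 2 \<and> lnth (f w) 0 = 3)) (self 0 (Suc 0)))
  (kor (kand (karp (\<lambda>w. llen (f w) = 3 \<and> lnth (f w) 0 = 4)) (kand (self 0 (Suc 0)) (self 0 2)))
   (kand (karp (\<lambda>w. llen (f w) = 2 \<and> lnth (f w) 0 = 5)) (self (Suc 0) (Suc 0))))))"

lemma K_kFok: "K G kFok <|kFok, n, f|> (tv (fokp n f))"
proof (induction f arbitrary: n rule: less_induct)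
  case (less f)
  have self: "K G (kself pfst (\<lambda>w. <|pfst w, d + pfst (psnd w), lnth (psnd (psnd w)) i|>)) <|kFok, n, f|> (tv (fokp (d + n) (lnth f i)))"
    if "i < llen f" for d i
    by (rule K_self'[where e = kFok and q = "<|kFok, d + n, lnth f i|>"])
      (use less[OF lnth_less[OF that]] in \<open>auto intro!: ar_intros\<close>)
  show ?case
    apply (subst fokp_iff)
    apply (subst kFok_def)
    apply (unfold Let_def)
    apply (intro K_or K_and)
          apply (rule K_karp', (intro ar_intros), simp)
         apply (rule K_karp', (intro ar_intros), simp)
        apply (rule K_eq[OF self], simp, simp)
       apply (rule K_karp', (intro ar_intros), simp)
      apply (rule K_eq[OF self], simp, simp)
     apply (rule K_eq[OF self], simp, simp)
    apply (rule K_karp', (intro ar_intros), simp)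
    apply (rule K_eq[OF self], simp, simp)
    done
qed

lemma NM_iff:
  assumes "ON G b"
  shows "NM G b q \<longleftrightarrow> (\<exists>n. ch G b n = Suc (pfst q)) \<and> fokp (Suc (llen (psnd (psnd q)))) (pfst (psnd q)) \<and>
    (\<forall>i. i < llen (psnd (psnd q)) \<longrightarrow> NM G (pfst q) (lnth (psnd (psnd q)) i))" (is "_ \<longleftrightarrow> ?R")
proof
  assume "NM G b q"
  then show ?R by (rule NM_E) (auto simp: fokp_def llen_list_encode lnth_list_encode)
next
  assume R: ?R
  then obtain n \<psi> where n: "ch G b n = Suc (pfst q)" "pfst (psnd q) = goedel \<psi>" "st_form_ok \<psi> (Suc (llen (psnd (psnd q))))"
    unfolding fokp_def by blast
  let ?ps = "list_decode (psnd (psnd q))"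
  have "NM G b <|pfst q, goedel \<psi>, list_encode ?ps|>"
  proof (rule NM_mk(1)[OF assms n(1)])
    show "NM G (pfst q) p" if "p \<in> set ?ps" for p
    proof -
      obtain i where i: "i < length ?ps" "p = ?ps ! i" using \<open>p \<in> set ?ps\<close> by (auto simp: in_set_conv_nth)
      then have "i < llen (psnd (psnd q))" "lnth (psnd (psnd q)) i = p"
        using lnth_list_encode[of i ?ps] llen_list_encode[of ?ps] by simp_all
      then show ?thesis using R by blast
    qed
    show "st_form_ok \<psi> (Suc (length ?ps))" using n(3) llen_list_encode[of ?ps] by simp
  qed
  moreover have "<|pfst q, goedel \<psi>, list_encode ?ps|> = q" by (simp flip: n(2))
  ultimately show "NM G b q" by simp
qed

definition "kNM = kand (kE (keq (kch (\<lambda>w. pfst (psnd (psnd w))) pfst) (kar (\<lambda>w. Suc (pfst (psnd (psnd (psnd w))))))))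
  (kand (kat kFok (\<lambda>w. <|kFok, Suc (llen (psnd (psnd (psnd (psnd w))))), pfst (psnd (psnd (psnd w)))|>))
    (kall (kimp (karp (\<lambda>w. pfst w < llen (psnd (psnd (psnd (psnd (psnd w)))))))
      (kself (\<lambda>w. pfst (psnd w)) (\<lambda>w. <|pfst (psnd w), pfst (psnd (psnd (psnd w))), lnth (psnd (psnd (psnd (psnd (psnd w))))) (pfst w)|>)))))"

lemma K_kNM: "ON G b \<Longrightarrow> K G kNM <|kNM, b, q|> (tv (NM G b q))"
proof (induction arbitrary: q rule: ON.induct)
  case (ON b)
  have b: "ON G b" by (rule ON.ON) (use ON in blast)+
  show ?case
    apply (subst NM_iff[OF b])
    apply (subst kNM_def)
    apply (intro K_and K_ex K_all K_imp K_keq)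
        apply (rule K_ch', (intro ar_intros)+, simp, simp, rule ON.hyps(1))
       apply (rule K_eq[OF K_kar], (intro ar_intros), simp)
      apply (rule K_at'[OF _ _ K_kFok], (intro ar_intros), simp)
     apply (rule K_karp', (intro ar_intros), simp)
    apply (rule K_self'[where e = kNM], (intro ar_intros)+, simp, simp)
    using ON.IH by blast
qed

text \<open>Membership is restricted to names for the level \<open>pfst z\<close> over which
  \<open>z\<close> is defined; by \<open>elts_den\<close> these denote all elements. The restriction
  lets recursions on names descend to a lower level.\<close>

definition el :: "type2 \<Rightarrow> nat \<Rightarrow> nat \<Rightarrow> bool" where
  "el G z u \<longleftrightarrow> NM G (pfst z) u \<and> den G u \<in> elts (den G z)"

lemma elts_den:
  assumes "ON G b" "NM G b z"
  shows "elts (den G z) = den G ` {u. el G z u}" "\<exists>n. ch G b n = Suc (pfst z)"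
proof -
  from assms(2) obtain n c \<psi> ps where z: "ch G b n = Suc c" "z = <|c, goedel \<psi>, list_encode ps|>"
    "elts (den G z) = {y \<in> LN G c. st_sat G (LN G c) \<psi> (y # map (den G) ps)}" by (rule NM_E) blast
  then show "\<exists>n. ch G b n = Suc (pfst z)" by auto
  have "elts (den G z) \<subseteq> den G ` {u. NM G c u}" using z(3) LN_den[OF ON_ch[OF assms(1) z(1)]] by blast
  then show "elts (den G z) = den G ` {u. el G z u}" using z(2) unfolding el_def by auto
qed

text \<open>Hereditarily finite sets coded by nested lists. Numerals and pairs inside a denotation
  are recognised by comparison with such a set.\<close>

function hfc :: "nat \<Rightarrow> hset" where
  "hfc c = hs (hfc ` set (list_decode c))"
  by auto
termination
proof (relation "Wellfounded.measure id")
  show "wf (Wellfounded.measure id)" by simp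
  show "(z, c) \<in> Wellfounded.measure id" if "z \<in> set (list_decode c)" for z c :: nat
    using member_less[OF that] by simp
qed

declare hfc.simps [simp del]

lemma elts_hfc: "elts (hfc c) = hfc ` set (list_decode c)"
  by (subst hfc.simps) (simp add: countable_finite)

lemma hfc_list: "hfc (list_encode xs) = hs (hfc ` set xs)"
  by (subst hfc.simps) simp

definition hn :: "nat \<Rightarrow> nat" where "hn n = rec_nat 0 (\<lambda>i r. Suc <|r, r|>) n"
definition pc :: "nat \<Rightarrow> nat" where
  "pc p = Suc <|Suc <|hn (pfst p), 0|>, Suc <|Suc <|hn (pfst p), Suc <|hn (psnd p), 0|>|>, 0|>|>"

lemma ar_hn: "ar (\<lambda>h. hn)"
  unfolding hn_def[abs_def] by (intro ar_intros)

lemma ar_hn' [ar_intros]: "ar A \<Longrightarrow> ar (\<lambda>h x. hn (A h x))"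
  using ar.comp[OF ar_hn] by blast

lemma ar_pc [ar_intros]: "ar A \<Longrightarrow> ar (\<lambda>h x. pc (A h x))"
  unfolding pc_def by (intro ar_intros)

lemma hfc_hn [simp]: "hfc (hn n) = hnat n"
proof (induction n)
  case 0
  show ?case by (rule hset_eqI) (simp add: hn_def elts_hfc)
next
  case (Suc n)
  have "hn (Suc n) = Suc <|hn n, hn n|>" by (simp add: hn_def)
  then show ?case using Suc by (intro hset_eqI) (simp add: elts_hfc flip: elts_hfc[of "hn n"])
qed

lemma hfc_pc [simp]: "hfc (pc p) = hpair (hnat (pfst p)) (hnat (psnd p))"
proof -
  have "pc p = list_encode [list_encode [hn (pfst p)], list_encode [hn (pfst p), hn (psnd p)]]"
    by (simp add: pc_def)
  then have "hfc (pc p) = hs {hs {hnat (pfst p)}, hs {hnat (pfst p), hnat (psnd p)}}"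
    by (simp only: hfc_list) (simp add: hfc_list del: list_encode.simps)
  then show ?thesis by (intro hset_eqI) (simp add: elts_hpair countable_finite)
qed

definition kel :: "(nat \<Rightarrow> nat) \<Rightarrow> (nat \<Rightarrow> nat) \<Rightarrow> (nat \<Rightarrow> nat) \<Rightarrow> nat" where
  "kel Z z u = kand (kat kNM (\<lambda>w. <|kNM, pfst (z w), u w|>))
    (kself Z (\<lambda>w. <|Z w, 0, pfst (z w), pfst (psnd (z w)), Suc <|u w, psnd (psnd (z w))|>|>))"
definition keqs :: "(nat \<Rightarrow> nat) \<Rightarrow> (nat \<Rightarrow> nat) \<Rightarrow> (nat \<Rightarrow> nat) \<Rightarrow> nat" where
  "keqs Z z u = kself Z (\<lambda>w. <|Z w, Suc 0, z w, u w|>)"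
definition khf :: "(nat \<Rightarrow> nat) \<Rightarrow> (nat \<Rightarrow> nat) \<Rightarrow> (nat \<Rightarrow> nat) \<Rightarrow> nat" where
  "khf Z z c = kself Z (\<lambda>w. <|Z w, 2, z w, c w|>)"
definition kpm :: "(nat \<Rightarrow> nat) \<Rightarrow> (nat \<Rightarrow> nat) \<Rightarrow> (nat \<Rightarrow> nat) \<Rightarrow> nat" where
  "kpm Z z p = kself Z (\<lambda>w. <|Z w, 3, z w, p w|>)"
definition ksat :: "(nat \<Rightarrow> nat) \<Rightarrow> (nat \<Rightarrow> nat) \<Rightarrow> (nat \<Rightarrow> nat) \<Rightarrow> (nat \<Rightarrow> nat) \<Rightarrow> nat" where
  "ksat Z b f l = kself Z (\<lambda>w. <|Z w, 0, b w, f w, l w|>)"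

definition "p1 w = pfst (psnd (psnd w))"
definition "p2 w = psnd (psnd (psnd w))"
definition "pb = p1"
definition "pf w = pfst (p2 w)"
definition "pl w = psnd (p2 w)"
definition "arg i w = lnth (pl w) (lnth (pf w) i)"
definition "functional_graph h = (\<forall>n. \<exists>m. h <|n, m|> = 0 \<and> (\<forall>m'. h <|n, m'|> = (0::nat) \<longrightarrow> m' = m))"

lemma ar_p [ar_intros]: "ar A \<Longrightarrow> ar (\<lambda>h x. p1 (A h x))" "ar A \<Longrightarrow> ar (\<lambda>h x. p2 (A h x))"
  "ar A \<Longrightarrow> ar (\<lambda>h x. pb (A h x))" "ar A \<Longrightarrow> ar (\<lambda>h x. pf (A h x))" "ar A \<Longrightarrow> ar (\<lambda>h x. pl (A h x))"
  "ar A \<Longrightarrow> ar (\<lambda>h x. arg i (A h x))"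
  unfolding p1_def p2_def pb_def pf_def pl_def arg_def by (intro ar_intros, assumption?)+

definition kfun :: "(nat \<Rightarrow> nat) \<Rightarrow> (nat \<Rightarrow> nat) \<Rightarrow> nat" where
  "kfun Z z = kand (kall (kimp (kel (\<lambda>w. Z (psnd w)) (\<lambda>w. z (psnd w)) pfst)
        (kE (khf (\<lambda>w. Z (psnd (psnd w))) (\<lambda>w. pfst (psnd w)) (\<lambda>w. pc (pfst w))))))
      (korc (\<lambda>h w. tv (functional_graph h)) (kpm (\<lambda>w. Z (psnd w)) (\<lambda>w. z (psnd w)) pfst))"
definition kval :: "(nat \<Rightarrow> nat) \<Rightarrow> (nat \<Rightarrow> nat) \<Rightarrow> (nat \<Rightarrow> nat) \<Rightarrow> nat" where
  "kval Z z n = kmut (kpm (\<lambda>w. Z (psnd w)) (\<lambda>w. z (psnd w)) (\<lambda>w. <|n (psnd w), pfst w|>))"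

definition "kSats =
  [kE (kand (kel (\<lambda>w. pfst (psnd w)) (\<lambda>w. arg 2 (psnd w)) pfst) (keqs (\<lambda>w. pfst (psnd w)) pfst (\<lambda>w. arg (Suc 0) (psnd w)))),
   keqs pfst (arg (Suc 0)) (arg 2),
   kand (kfun pfst (arg (Suc 0)))
     (kcall (kar pfst) (kP (kar pfst) (kP (kconst 2) (kP (kar (arg 2)) (kcomp (kar hn)
        (kG (kval (\<lambda>w. pfst (psnd w)) (\<lambda>w. arg (Suc 0) (psnd w)) pfst))))))),
   knot (ksat pfst pb (\<lambda>w. lnth (pf w) (Suc 0)) pl),
   kand (ksat pfst pb (\<lambda>w. lnth (pf w) (Suc 0)) pl) (ksat pfst pb (\<lambda>w. lnth (pf w) 2) pl),
   kall (kimp (kat kNM (\<lambda>w. <|kNM, pb (psnd w), pfst w|>))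
     (ksat (\<lambda>w. pfst (psnd w)) (\<lambda>w. pb (psnd w)) (\<lambda>w. lnth (pf (psnd w)) (Suc 0)) (\<lambda>w. Suc <|pfst w, pl (psnd w)|>)))]"
definition "kSat = kcase (kar (\<lambda>w. lnth (pf w) 0)) kSats"

definition "kEq = kand
  (kall (kimp (kel (\<lambda>w. pfst (psnd w)) (\<lambda>w. p1 (psnd w)) pfst)
     (kE (kand (kel (\<lambda>w. pfst (psnd (psnd w))) (\<lambda>w. p2 (psnd (psnd w))) pfst) (keqs (\<lambda>w. pfst (psnd (psnd w))) (\<lambda>w. pfst (psnd w)) pfst)))))
  (kall (kimp (kel (\<lambda>w. pfst (psnd w)) (\<lambda>w. p2 (psnd w)) pfst)
     (kE (kand (kel (\<lambda>w. pfst (psnd (psnd w))) (\<lambda>w. p1 (psnd (psnd w))) pfst) (keqs (\<lambda>w. pfst (psnd (psnd w))) pfst (\<lambda>w. pfst (psnd w)))))))"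

definition "kHf = kand
  (kall (kimp (kel (\<lambda>w. pfst (psnd w)) (\<lambda>w. p1 (psnd w)) pfst)
     (kE (kand (karp (\<lambda>w. pfst w < llen (p2 (psnd (psnd w)))))
       (khf (\<lambda>w. pfst (psnd (psnd w))) (\<lambda>w. pfst (psnd w)) (\<lambda>w. lnth (p2 (psnd (psnd w))) (pfst w)))))))
  (kall (kimp (karp (\<lambda>w. pfst w < llen (p2 (psnd w))))
     (kE (kand (kel (\<lambda>w. pfst (psnd (psnd w))) (\<lambda>w. p1 (psnd (psnd w))) pfst)
       (khf (\<lambda>w. pfst (psnd (psnd w))) pfst (\<lambda>w. lnth (p2 (psnd (psnd w))) (pfst (psnd w))))))))"

definition "kPm = kE (kand (kel (\<lambda>w. pfst (psnd w)) (\<lambda>w. p1 (psnd w)) pfst)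
  (khf (\<lambda>w. pfst (psnd w)) pfst (\<lambda>w. pc (p2 (psnd w)))))"

text \<open>Truth, equality, comparison with a finite set and membership of a pair of numbers call
  each other and so form one program with a tag. Equality and comparison descend through levels;
  truth descends through formulas over a fixed level.\<close>

definition "kD = kcase (kar (\<lambda>w. pfst (psnd w))) [kSat, kEq, kHf, kPm]"

lemma K_kD:
  assumes "i < 4" "K G ([kSat, kEq, kHf, kPm] ! i) <|kD, i, q|> y"
  shows "K G kD <|kD, i, q|> y"
proof -
  have "K G (kcase (kar (\<lambda>w. pfst (psnd w))) [kSat, kEq, kHf, kPm]) <|kD, i, q|> y"
    by (rule K_kcase[OF K_eq[OF K_kar]]) (use assms in \<open>auto intro!: ar_intros K_K1\<close>)
  then show ?thesis by (simp only: kD_def[symmetric])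
qed

definition AA :: "type2 \<Rightarrow> nat \<Rightarrow> bool" where
  "AA G c \<longleftrightarrow> (\<forall>\<psi> as. st_form_ok \<psi> (length as) \<longrightarrow> (\<forall>p\<in>set as. NM G c p) \<longrightarrow>
     K G kD <|kD, 0, c, goedel \<psi>, list_encode as|> (tv (st_sat G (LN G c) \<psi> (map (den G) as))))"

text \<open>A well-founded notation with truth decided at all levels strictly below it. This is
  enough for membership, equality and pairs among names at \<open>b\<close>, and so separates the
  induction on levels from the one on formulas.\<close>

inductive OQ :: "type2 \<Rightarrow> nat \<Rightarrow> bool" for G where
  OQ: "ON G b \<Longrightarrow> (\<And>n c. ch G b n = Suc c \<Longrightarrow> OQ G c \<and> AA G c) \<Longrightarrow> OQ G b"

lemma OQ_ON: "OQ G b \<Longrightarrow> ON G b" and OQ_ch: "OQ G b \<Longrightarrow> ch G b n = Suc c \<Longrightarrow> OQ G c"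
  and OQ_AA: "OQ G b \<Longrightarrow> ch G b n = Suc c \<Longrightarrow> AA G c"
  by (auto elim: OQ.cases)

text \<open>Membership in the denotation of \<open>z\<close> is truth of the formula stored in
  \<open>z\<close>, with \<open>u\<close> put in front of the stored parameters, over the lower
  level \<open>pfst z\<close>.\<close>

lemma K_kel:
  assumes ar: "ar (\<lambda>h. Z)" "ar (\<lambda>h. zt)" "ar (\<lambda>h. ut)" and w: "Z w = kD" "zt w = z" "ut w = u"
    and b: "OQ G b" "NM G b z"
  shows "K G (kel Z zt ut) w (tv (el G z u))"
proof -
  from b(2) obtain n c \<psi> ps where z: "ch G b n = Suc c" "z = <|c, goedel \<psi>, list_encode ps|>" "\<And>p. p \<in> set ps \<Longrightarrow> NM G c p"
    "st_form_ok \<psi> (Suc (length ps))" "elts (den G z) = {y \<in> LN G c. st_sat G (LN G c) \<psi> (y # map (den G) ps)}"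
    by (rule NM_E) blast
  have c: "ON G c" using OQ_ON[OF OQ_ch[OF b(1) z(1)]] .
  have *: "el G z u \<longleftrightarrow> NM G c u \<and> st_sat G (LN G c) \<psi> (map (den G) (u # ps))"
    unfolding el_def using z(2,5) den_LN[OF c] by auto
  have "K G kD <|kD, 0, c, goedel \<psi>, list_encode (u # ps)|> (tv (st_sat G (LN G c) \<psi> (map (den G) (u # ps))))"
    if "NM G c u"
    using OQ_AA[OF b(1) z(1)] z(3,4) that unfolding AA_def by (auto simp del: list_encode.simps list.map)
  then show ?thesis unfolding kel_def *
    by (intro K_and K_at'[OF _ _ K_kNM[OF c]] K_self'[where e = kD])
      (auto intro!: ar_intros ar simp: w z(2))
qed

lemma K_keqs:
  assumes "ar (\<lambda>h. Z)" "ar (\<lambda>h. zt)" "ar (\<lambda>h. ut)" "Z w = kD" "zt w = z" "ut w = u"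
    "K G kD <|kD, 1, z, u|> y"
  shows "K G (keqs Z zt ut) w y"
  unfolding keqs_def by (rule K_self'[where e = kD]) (use assms in \<open>auto intro!: ar_intros\<close>)

lemma K_khf:
  assumes "ar (\<lambda>h. Z)" "ar (\<lambda>h. zt)" "ar (\<lambda>h. ut)" "Z w = kD" "zt w = z" "ut w = u"
    "K G kD <|kD, 2, z, u|> y"
  shows "K G (khf Z zt ut) w y"
  unfolding khf_def by (rule K_self'[where e = kD]) (use assms in \<open>auto intro!: ar_intros\<close>)

lemma K_kpm:
  assumes "ar (\<lambda>h. Z)" "ar (\<lambda>h. zt)" "ar (\<lambda>h. ut)" "Z w = kD" "zt w = z" "ut w = u"
    "K G kD <|kD, 3, z, u|> y"
  shows "K G (kpm Z zt ut) w y"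
  unfolding kpm_def by (rule K_self'[where e = kD]) (use assms in \<open>auto intro!: ar_intros\<close>)

lemma K_ksat:
  assumes "ar (\<lambda>h. Z)" "ar (\<lambda>h. bt)" "ar (\<lambda>h. ft)" "ar (\<lambda>h. lt)" "Z w = kD" "bt w = b" "ft w = f" "lt w = l"
    "K G kD <|kD, 0, b, f, l|> y"
  shows "K G (ksat Z bt ft lt) w y"
  unfolding ksat_def by (rule K_self'[where e = kD]) (use assms in \<open>auto intro!: ar_intros\<close>)

lemma ar_proj: "ar (\<lambda>h. pfst)" "ar (\<lambda>h. psnd)" "ar (\<lambda>h. p1)" "ar (\<lambda>h. p2)" "ar (\<lambda>h. pb)" "ar (\<lambda>h. pf)" "ar (\<lambda>h. pl)"
  "ar (\<lambda>h. arg i)"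
  by (intro ar_intros)+

lemma p_simps [simp]: "p1 <|z, t, q|> = pfst q" "p2 <|z, t, q|> = psnd q"
  by (simp_all add: p1_def p2_def)

lemma K_EQ: "OQ G b \<Longrightarrow> OQ G b' \<Longrightarrow> NM G b z \<Longrightarrow> NM G b' z' \<Longrightarrow> K G kD <|kD, 1, z, z'|> (tv (den G z = den G z'))"
proof (induction arbitrary: b' z z' rule: OQ.induct)
  case (OQ b)
  have b: "OQ G b" by (rule OQ.OQ) (use OQ in blast)+
  note e = elts_den[OF OQ_ON[OF b] OQ.prems(2)] elts_den[OF OQ_ON[OF OQ.prems(1)] OQ.prems(3)]
  have *: "den G z = den G z' \<longleftrightarrow> (\<forall>u. el G z u \<longrightarrow> (\<exists>u'. el G z' u' \<and> den G u = den G u')) \<and>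
     (\<forall>u'. el G z' u' \<longrightarrow> (\<exists>u. el G z u \<and> den G u = den G u'))"
  proof -
    have "den G z = den G z' \<longleftrightarrow> den G ` {u. el G z u} = den G ` {u. el G z' u}"
      unfolding e(1,3)[symmetric] using hset_eqI by metis
    then show ?thesis by (auto simp: set_eq_iff image_iff) metis+
  qed
  have IH: "K G kD <|kD, 1, u, u'|> (tv (den G u = den G u'))" if "el G z u" "el G z' u'" for u u'
    using OQ.IH e(2) OQ_ch[OF OQ.prems(1)] e(4) that unfolding el_def by blast
  have 1: "K G (kel Z zt ut) w (tv (el G z u))" if "ar (\<lambda>h. Z)" "ar (\<lambda>h. zt)" "ar (\<lambda>h. ut)" "Z w = kD" "zt w = z" "ut w = u" for Z zt ut w u
    by (rule K_kel[OF that b OQ.prems(2)])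
  have 2: "K G (kel Z zt ut) w (tv (el G z' u))" if "ar (\<lambda>h. Z)" "ar (\<lambda>h. zt)" "ar (\<lambda>h. ut)" "Z w = kD" "zt w = z'" "ut w = u" for Z zt ut w u
    by (rule K_kel[OF that OQ.prems(1,3)])
  show ?case
  proof (rule K_kD)
    have "K G kEq <|kD, 1, z, z'|> (tv (den G z = den G z'))"
      unfolding * kEq_def
      apply (intro K_and K_all K_imp K_ex)
           apply (rule 1, (intro ar_intros)+, simp, simp, simp)
          apply (rule 2, (intro ar_intros)+, simp, simp, simp)
         apply (rule K_keqs[OF _ _ _ _ _ _ IH], (intro ar_intros)+, simp, simp, simp, assumption+)
        apply (rule 2, (intro ar_intros)+, simp, simp, simp)
       apply (rule 1, (intro ar_intros)+, simp, simp, simp)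
      apply (rule K_keqs[OF _ _ _ _ _ _ IH], (intro ar_intros)+, simp, simp, simp, assumption+)
      done
    then show "K G ([kSat, kEq, kHf, kPm] ! 1) <|kD, 1, z, z'|> (tv (den G z = den G z'))" by simp
  qed simp
qed

lemma K_HF: "OQ G b \<Longrightarrow> NM G b z \<Longrightarrow> K G kD <|kD, 2, z, c|> (tv (den G z = hfc c))"
proof (induction arbitrary: z c rule: OQ.induct)
  case (OQ b)
  have b: "OQ G b" by (rule OQ.OQ) (use OQ in blast)+
  note e = elts_den[OF OQ_ON[OF b] OQ.prems]
  have *: "den G z = hfc c \<longleftrightarrow> (\<forall>u. el G z u \<longrightarrow> (\<exists>i. i < llen c \<and> den G u = hfc (lnth c i))) \<and>
     (\<forall>i. i < llen c \<longrightarrow> (\<exists>u. el G z u \<and> den G u = hfc (lnth c i)))"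
  proof -
    have l: "hfc ` set (list_decode c) = {hfc (lnth c i) |i. i < llen c}"
      unfolding list_decode_map_lnth by auto
    have "den G z = hfc c \<longleftrightarrow> den G ` {u. el G z u} = {hfc (lnth c i) |i. i < llen c}"
      unfolding e(1)[symmetric] l[symmetric] elts_hfc[symmetric] using hset_eqI by metis
    also have "\<dots> \<longleftrightarrow> (\<forall>u. el G z u \<longrightarrow> (\<exists>i. i < llen c \<and> den G u = hfc (lnth c i))) \<and>
     (\<forall>i. i < llen c \<longrightarrow> (\<exists>u. el G z u \<and> den G u = hfc (lnth c i)))"
      by (auto simp: set_eq_iff image_iff) metis+
    finally show ?thesis .
  qed
  have IH: "K G kD <|kD, 2, u, c|> (tv (den G u = hfc c))" if "el G z u" for u c
    using OQ.IH e(2) that unfolding el_def by blast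
  have 1: "K G (kel Z zt ut) w (tv (el G z u))" if "ar (\<lambda>h. Z)" "ar (\<lambda>h. zt)" "ar (\<lambda>h. ut)" "Z w = kD" "zt w = z" "ut w = u" for Z zt ut w u
    by (rule K_kel[OF that b OQ.prems])
  show ?case
  proof (rule K_kD)
    have "K G kHf <|kD, 2, z, c|> (tv (den G z = hfc c))"
      unfolding * kHf_def
      apply (intro K_and K_all K_imp K_ex)
           apply (rule 1, (intro ar_intros)+, simp, simp, simp)
          apply (rule K_karp', (intro ar_intros), simp)
         apply (rule K_khf[OF _ _ _ _ _ _ IH], (intro ar_intros)+, simp, simp, simp, assumption+)
        apply (rule K_karp', (intro ar_intros), simp)
       apply (rule 1, (intro ar_intros)+, simp, simp, simp)
      apply (rule K_khf[OF _ _ _ _ _ _ IH], (intro ar_intros)+, simp, simp, simp, assumption+)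
      done
    then show "K G ([kSat, kEq, kHf, kPm] ! 2) <|kD, 2, z, c|> (tv (den G z = hfc c))" by simp
  qed simp
qed

lemma K_PM:
  assumes "OQ G b" "NM G b z"
  shows "K G kD <|kD, 3, z, p|> (tv (hpair (hnat (pfst p)) (hnat (psnd p)) \<in> elts (den G z)))"
proof (rule K_kD)
  note e = elts_den[OF OQ_ON[OF assms(1)] assms(2)]
  have *: "hpair (hnat (pfst p)) (hnat (psnd p)) \<in> elts (den G z) \<longleftrightarrow> (\<exists>u. el G z u \<and> den G u = hfc (pc p))"
    unfolding e(1) by (auto simp: image_iff)
  obtain n where n: "ch G b n = Suc (pfst z)" using e(2) by blast
  have "K G kPm <|kD, 3, z, p|> (tv (hpair (hnat (pfst p)) (hnat (psnd p)) \<in> elts (den G z)))"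
    unfolding * kPm_def
    apply (intro K_and K_ex)
     apply (rule K_kel[OF _ _ _ _ _ _ assms], (intro ar_intros)+, simp, simp, simp)
    apply (rule K_khf[OF _ _ _ _ _ _ K_HF[OF OQ_ch[OF assms(1) n]]], (intro ar_intros)+, simp, simp, simp)
    apply (simp add: el_def)
    done
  then show "K G ([kSat, kEq, kHf, kPm] ! 3) <|kD, 3, z, p|> (tv (hpair (hnat (pfst p)) (hnat (psnd p)) \<in> elts (den G z)))"
    by simp
qed simp

text \<open>Once all elements are known to be pairs of numbers, being a function is arithmetical in
  the characteristic function \<open>h\<close> of these pairs.\<close>

lemma hfun_iff:
  fixes z :: hset
  assumes h: "\<And>p. h p = 0 \<longleftrightarrow> hpair (hnat (pfst p)) (hnat (psnd p)) \<in> elts z"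
  shows "(\<exists>f. z = hfun f) \<longleftrightarrow> (\<forall>x\<in>elts z. \<exists>p. x = hfc (pc p)) \<and> functional_graph h"
proof
  assume "\<exists>f. z = hfun f"
  then obtain f where f: "z = hfun f" by blast
  have "\<forall>x\<in>elts z. \<exists>p. x = hfc (pc p)"
  proof
    fix x assume "x \<in> elts z"
    then obtain n where "x = hpair (hnat n) (hnat (f n))" unfolding f elts_hfun by blast
    then have "x = hfc (pc <|n, f n|>)" by simp
    then show "\<exists>p. x = hfc (pc p)" by blast
  qed
  moreover have "h p = 0 \<longleftrightarrow> psnd p = f (pfst p)" for p
    unfolding h f elts_hfun by auto
  ultimately show "(\<forall>x\<in>elts z. \<exists>p. x = hfc (pc p)) \<and> functional_graph h"
    unfolding functional_graph_def by simp
next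
  assume r: "(\<forall>x\<in>elts z. \<exists>p. x = hfc (pc p)) \<and> functional_graph h"
  then have "\<forall>n. \<exists>m. h <|n, m|> = 0 \<and> (\<forall>m'. h <|n, m'|> = (0::nat) \<longrightarrow> m' = m)" unfolding functional_graph_def by blast
  from choice[OF this] obtain f where f: "\<And>n. h <|n, f n|> = 0" "\<And>n m. h <|n, m|> = 0 \<Longrightarrow> m = f n" by blast
  have "elts z = elts (hfun f)"
    unfolding elts_hfun
  proof (intro equalityI subsetI)
    fix x assume x: "x \<in> elts z"
    then obtain p where p: "x = hpair (hnat (pfst p)) (hnat (psnd p))" using r by auto
    then have "h p = 0" unfolding h using x by simp
    then have "psnd p = f (pfst p)" using f(2)[of "pfst p" "psnd p"] by simp
    then show "x \<in> range (\<lambda>n. hpair (hnat n) (hnat (f n)))" using p by auto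
  next
    fix x assume "x \<in> range (\<lambda>n. hpair (hnat n) (hnat (f n)))"
    then obtain n where n: "x = hpair (hnat n) (hnat (f n))" by blast
    have "hpair (hnat (pfst <|n, f n|>)) (hnat (psnd <|n, f n|>)) \<in> elts z" using f(1)[of n] unfolding h .
    then show "x \<in> elts z" using n by simp
  qed
  then show "\<exists>f. z = hfun f" using hset_eqI by blast
qed

lemma ar_psnd_comp: "ar (\<lambda>h. Z) \<Longrightarrow> ar A \<Longrightarrow> ar (\<lambda>h w. Z (A h w))"
  by (rule ar.comp)

lemma arp_functional_graph: "arp (\<lambda>h w. functional_graph h)"
  unfolding functional_graph_def by (intro ar_intros)

lemma K_kfun:
  assumes ar: "ar (\<lambda>h. Z)" "ar (\<lambda>h. zt)" and w: "Z w = kD" "zt w = z" and b: "OQ G b" "NM G b z"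
  shows "K G (kfun Z zt) w (tv (\<exists>f. den G z = hfun f))"
proof -
  note e = elts_den[OF OQ_ON[OF b(1)] b(2)]
  obtain n where n: "ch G b n = Suc (pfst z)" using e(2) by blast
  let ?h = "\<lambda>p. tv (hpair (hnat (pfst p)) (hnat (psnd p)) \<in> elts (den G z))"
  have "(\<exists>f. den G z = hfun f) \<longleftrightarrow> (\<forall>u. el G z u \<longrightarrow> (\<exists>p. den G u = hfc (pc p))) \<and> functional_graph ?h"
    unfolding hfun_iff[of ?h "den G z", OF tv_0] e(1) by auto
  then show ?thesis unfolding kfun_def
    apply (simp only:)
    apply (intro K_and K_all K_imp K_ex K_korcp arp_functional_graph)
      apply (rule K_kel[OF _ _ _ _ _ _ b], (intro ar_psnd_comp[OF ar(1)] ar_psnd_comp[OF ar(2)] ar_intros)+, simp add: w, simp add: w, simp)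
     apply (rule K_khf[OF _ _ _ _ _ _ K_HF[OF OQ_ch[OF b(1) n]]], (intro ar_psnd_comp[OF ar(1)] ar_psnd_comp[OF ar(2)] ar_intros)+, simp add: w, simp, simp, simp add: el_def)
    apply (rule K_kpm[OF _ _ _ _ _ _ K_PM[OF b]], (intro ar_psnd_comp[OF ar(1)] ar_psnd_comp[OF ar(2)] ar_intros)+, simp_all add: w)
    done
qed

lemma K_kval:
  assumes ar: "ar (\<lambda>h. Z)" "ar (\<lambda>h. zt)" "ar (\<lambda>h. nt)" and w: "Z w = kD" "zt w = z" "nt w = n"
    and b: "OQ G b" "NM G b z" and f: "den G z = hfun f"
  shows "K G (kval Z zt nt) w (f n)"
proof -
  have "K G (kpm (\<lambda>w. Z (psnd w)) (\<lambda>w. zt (psnd w)) (\<lambda>w. <|nt (psnd w), pfst w|>)) <|m, w|>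
      (tv (hpair (hnat (pfst <|n, m|>)) (hnat (psnd <|n, m|>)) \<in> elts (den G z)))" for m
    by (rule K_kpm[OF _ _ _ _ _ _ K_PM[OF b]], (intro ar_psnd_comp[OF ar(1)] ar_psnd_comp[OF ar(2)] ar_psnd_comp[OF ar(3)] ar_intros)+)
      (simp_all add: w)
  from K_kmut[OF this]
  have "K G (kval Z zt nt) w (mu (\<lambda>m. tv (hpair (hnat n) (hnat m) \<in> elts (den G z)) = 0))"
    unfolding kval_def by simp
  moreover have "(hpair (hnat n) (hnat m) \<in> elts (den G z)) = (m = f n)" for m unfolding f elts_hfun by auto
  moreover have "mu (\<lambda>m. m = f n) = f n" by (rule mu_eq) auto
  ultimately show ?thesis by simp
qed

lemma AA_OQ:
  assumes b: "OQ G b"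
  shows "AA G b"
  unfolding AA_def
proof (intro allI impI)
  note bO = OQ_ON[OF b]
  have sat: "K G kD w y"
    if "w = <|kD, 0, b, goedel \<psi>, q|>" "lnth (goedel \<psi>) 0 = i" "i < 6" "K G (kSats ! i) w y" for w \<psi> q i y
  proof -
    have "K G kSat w y"
      unfolding kSat_def by (rule K_kcase[OF K_kar], intro ar_intros) (use that in \<open>auto simp: pf_def kSats_def intro: K_K1\<close>)
    then show ?thesis unfolding that(1) by (intro K_kD) simp_all
  qed
  note goedel.simps [simp del] list_encode.simps [simp del]
  fix \<psi> as
  show "st_form_ok \<psi> (length as) \<Longrightarrow> \<forall>p\<in>set as. NM G b p \<Longrightarrow>
     K G kD <|kD, 0, b, goedel \<psi>, list_encode as|> (tv (st_sat G (LN G b) \<psi> (map (den G) as)))"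
  proof (induction \<psi> arbitrary: as)
    case (StMem i j)
    let ?w = "<|kD, 0, b, goedel (StMem i j), list_encode as|>"
    have w: "pf ?w = goedel (StMem i j)" "pl ?w = list_encode as" by (simp_all add: pf_def pl_def)
    have a: "arg (Suc 0) ?w = as ! i" "arg 2 ?w = as ! j" and ij: "NM G b (as ! i)" "NM G b (as ! j)" "i < length as" "j < length as"
      unfolding arg_def w using StMem by (simp_all add: goedel.simps)
    note e = elts_den[OF bO ij(2)]
    obtain n where n: "ch G b n = Suc (pfst (as ! j))" using e(2) by blast
    have "st_sat G (LN G b) (StMem i j) (map (den G) as) \<longleftrightarrow> (\<exists>u. el G (as ! j) u \<and> den G u = den G (as ! i))"
      using ij(3,4) by (simp add: e(1) image_iff) metis
    moreover have "K G (kE (kand (kel (\<lambda>w. pfst (psnd w)) (\<lambda>w. arg 2 (psnd w)) pfst) (keqs (\<lambda>w. pfst (psnd w)) pfst (\<lambda>w. arg (Suc 0) (psnd w)))))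
        ?w (tv (\<exists>u. el G (as ! j) u \<and> den G u = den G (as ! i)))"
      apply (intro K_ex K_and)
       apply (rule K_kel[OF _ _ _ _ _ _ b ij(2)], (intro ar_intros)+, simp, simp add: a, simp)
      apply (rule K_keqs[OF _ _ _ _ _ _ K_EQ[OF OQ_ch[OF b n] b]], (intro ar_intros)+, simp, simp, simp add: a)
       apply (simp add: el_def)
      by (rule ij(1))
    ultimately show ?case by (intro sat[OF refl, of _ 0]) (simp_all add: kSats_def goedel.simps)
  next
    case (StEq i j)
    let ?w = "<|kD, 0, b, goedel (StEq i j), list_encode as|>"
    have w: "pf ?w = goedel (StEq i j)" "pl ?w = list_encode as" by (simp_all add: pf_def pl_def)
    have a: "arg (Suc 0) ?w = as ! i" "arg 2 ?w = as ! j" and ij: "NM G b (as ! i)" "NM G b (as ! j)" "i < length as" "j < length as"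
      unfolding arg_def w using StEq by (simp_all add: goedel.simps)
    have "st_sat G (LN G b) (StEq i j) (map (den G) as) \<longleftrightarrow> den G (as ! i) = den G (as ! j)" using ij(3,4) by auto
    moreover have "K G (keqs pfst (arg (Suc 0)) (arg 2)) ?w (tv (den G (as ! i) = den G (as ! j)))"
      by (rule K_keqs[OF _ _ _ _ _ _ K_EQ[OF b b ij(1,2)]]) (simp_all add: ar_proj a)
    ultimately show ?case by (intro sat[OF refl, of _ 1]) (simp_all add: kSats_def goedel.simps)
  next
    case (StG i j)
    let ?w = "<|kD, 0, b, goedel (StG i j), list_encode as|>"
    have w: "pf ?w = goedel (StG i j)" "pl ?w = list_encode as" by (simp_all add: pf_def pl_def)
    have a: "arg (Suc 0) ?w = as ! i" "arg 2 ?w = as ! j" and ij: "NM G b (as ! i)" "NM G b (as ! j)" "i < length as" "j < length as"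
      unfolding arg_def w using StG by (simp_all add: goedel.simps)
    let ?P = "\<exists>f. den G (as ! i) = hfun f" and ?Q = "\<exists>f. den G (as ! i) = hfun f \<and> den G (as ! j) = hnat (G f)"
    let ?g = "kG (kval (\<lambda>w. pfst (psnd w)) (\<lambda>w. arg (Suc 0) (psnd w)) pfst)"
    \<comment> \<open>S8 evaluates its argument everywhere, so \<open>G\<close> may be called only
      after the denotation has been found to be a total function; \<open>kand\<close> runs this part
      only in that case.\<close>
    have g: "K G (kcall (kar pfst) (kP (kar pfst) (kP (kconst 2) (kP (kar (arg 2)) (kcomp (kar hn) ?g))))) ?w (tv ?Q)" if P: ?P
    proof -
      from P obtain f where f: "den G (as ! i) = hfun f" by blast
      have "K G (kval (\<lambda>w. pfst (psnd w)) (\<lambda>w. arg (Suc 0) (psnd w)) pfst) <|n, ?w|> (f n)" for n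
        by (rule K_kval[OF _ _ _ _ _ _ b ij(1) f]) (auto intro!: ar_intros simp: a)
      then have g: "K G ?g ?w (G f)" by (rule K_kG_value)
      have "K1 G (pfst ?w) <|pfst ?w, 2, arg 2 ?w, hn (G f)|> (tv (den G (as ! j) = hfc (hn (G f))))"
        unfolding a pfst_pr by (rule K_K1[OF K_HF[OF b ij(2)]])
      moreover have "(den G (as ! j) = hfc (hn (G f))) = ?Q" using f by auto
      ultimately show ?thesis
        using K_kcall[OF K_kar K_kP[OF K_kar K_kP[OF K_kconst K_kP[OF K_kar K_kcomp[OF g K_kar]]]], of pfst pfst "arg 2" hn]
        by (simp add: ar_proj ar_hn)
    qed
    have "st_sat G (LN G b) (StG i j) (map (den G) as) \<longleftrightarrow> ?P \<and> ?Q" using ij(3,4) by auto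
    moreover have "K G (kand (kfun pfst (arg (Suc 0))) (kcall (kar pfst) (kP (kar pfst) (kP (kconst 2) (kP (kar (arg 2)) (kcomp (kar hn) ?g)))))) ?w (tv (?P \<and> ?Q))"
      by (intro K_and g K_kfun[OF _ _ _ _ b ij(1)]) (simp_all add: ar_proj a)
    ultimately show ?case by (intro sat[OF refl, of _ 2]) (simp_all add: kSats_def goedel.simps)
  next
    case (StNot \<psi>)
    let ?w = "<|kD, 0, b, goedel (StNot \<psi>), list_encode as|>"
    have w: "pf ?w = goedel (StNot \<psi>)" "pl ?w = list_encode as" "pb ?w = b" "lnth (goedel (StNot \<psi>)) (Suc 0) = goedel \<psi>" by (simp_all add: pf_def pl_def pb_def goedel.simps)
    have IH: "K G kD <|kD, 0, b, goedel \<psi>, list_encode as|> (tv (st_sat G (LN G b) \<psi> (map (den G) as)))"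
      using StNot by simp
    have "K G (knot (ksat pfst pb (\<lambda>w. lnth (pf w) (Suc 0)) pl)) ?w (tv (\<not> st_sat G (LN G b) \<psi> (map (den G) as)))"
      by (intro K_not K_ksat[OF _ _ _ _ _ _ _ _ IH]) (auto intro!: ar_intros ar_proj simp: w)
    then show ?case by (intro sat[OF refl, of _ 3]) (simp_all add: kSats_def goedel.simps)
  next
    case (StAnd \<psi> \<theta>)
    let ?w = "<|kD, 0, b, goedel (StAnd \<psi> \<theta>), list_encode as|>"
    have w: "pf ?w = goedel (StAnd \<psi> \<theta>)" "pl ?w = list_encode as" "pb ?w = b" "lnth (goedel (StAnd \<psi> \<theta>)) (Suc 0) = goedel \<psi>" "lnth (goedel (StAnd \<psi> \<theta>)) 2 = goedel \<theta>" by (simp_all add: pf_def pl_def pb_def goedel.simps)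
    have IH: "K G kD <|kD, 0, b, goedel \<psi>, list_encode as|> (tv (st_sat G (LN G b) \<psi> (map (den G) as)))"
      "K G kD <|kD, 0, b, goedel \<theta>, list_encode as|> (tv (st_sat G (LN G b) \<theta> (map (den G) as)))"
      using StAnd by simp_all
    have "K G (kand (ksat pfst pb (\<lambda>w. lnth (pf w) (Suc 0)) pl) (ksat pfst pb (\<lambda>w. lnth (pf w) 2) pl)) ?w
        (tv (st_sat G (LN G b) \<psi> (map (den G) as) \<and> st_sat G (LN G b) \<theta> (map (den G) as)))"
      by (intro K_and K_ksat[OF _ _ _ _ _ _ _ _ IH(1)] K_ksat[OF _ _ _ _ _ _ _ _ IH(2)])
        (auto intro!: ar_intros ar_proj simp: w)
    then show ?case by (intro sat[OF refl, of _ 4]) (simp_all add: kSats_def goedel.simps)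
  next
    case (StAll \<psi>)
    let ?w = "<|kD, 0, b, goedel (StAll \<psi>), list_encode as|>"
    have w: "pf ?w = goedel (StAll \<psi>)" "pl ?w = list_encode as" "pb ?w = b" "lnth (goedel (StAll \<psi>)) (Suc 0) = goedel \<psi>" by (simp_all add: pf_def pl_def pb_def goedel.simps)
    have IH: "K G kD <|kD, 0, b, goedel \<psi>, Suc <|u, list_encode as|>|> (tv (st_sat G (LN G b) \<psi> (den G u # map (den G) as)))"
      if "NM G b u" for u
      using StAll.IH[of "u # as"] StAll.prems that by (simp add: list_encode.simps)
    have all: "(\<forall>x\<in>LN G b. P x) \<longleftrightarrow> (\<forall>u. NM G b u \<longrightarrow> P (den G u))" for P
      unfolding LN_den[OF bO] by blast
    have "st_sat G (LN G b) (StAll \<psi>) (map (den G) as) \<longleftrightarrow> (\<forall>u. NM G b u \<longrightarrow> st_sat G (LN G b) \<psi> (den G u # map (den G) as))"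
      unfolding st_sat.simps by (rule all)
    moreover have "K G (kall (kimp (kat kNM (\<lambda>w. <|kNM, pb (psnd w), pfst w|>))
       (ksat (\<lambda>w. pfst (psnd w)) (\<lambda>w. pb (psnd w)) (\<lambda>w. lnth (pf (psnd w)) (Suc 0)) (\<lambda>w. Suc <|pfst w, pl (psnd w)|>)))) ?w
        (tv (\<forall>u. NM G b u \<longrightarrow> st_sat G (LN G b) \<psi> (den G u # map (den G) as)))"
      apply (intro K_all K_imp)
       apply (rule K_at'[OF _ _ K_kNM[OF bO]], (intro ar_intros), simp add: w)
      apply (rule K_ksat[OF _ _ _ _ _ _ _ _ IH], (intro ar_intros)+)
      by (auto simp: w)
    ultimately show ?case by (intro sat[OF refl, of _ 5]) (simp_all add: kSats_def goedel.simps)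
  qed
qed

lemma ON_OQ: "ON G b \<Longrightarrow> OQ G b"
proof (induction rule: ON.induct)
  case (ON b)
  show ?case by (rule OQ.OQ) (use ON ON.ON AA_OQ in blast)+
qed

section \<open>Deciding largeness\<close>

text \<open>There are only countably many neighbourhoods. The measures of their finite unions
  converge to that of the whole union, and the inequality in \<open>large\<close> is strict.\<close>

lemma large_finite:
  assumes "large G k A"
  shows "\<exists>F. finite F \<and> F \<subseteq> A \<and> large G k F"
proof -
  let ?r = "1 - 1 / 2 ^ k :: real"
  have r: "0 \<le> ?r" by simp
  let ?S = "(\<lambda>f. initial f (G f)) ` A"
  have A: "measure coin_toss (covered G A) > ?r" using assms unfolding large_def .
  have "A \<noteq> {}"
  proof
    assume "A = {}"
    then have "measure coin_toss (covered G A) = 0" by (simp add: covered_def)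
    then show False using A r by simp
  qed
  then have S: "range (from_nat_into ?S) = ?S" by (intro range_from_nat_into) simp_all
  let ?U = "\<lambda>n. \<Union>i<n. cylinder (from_nat_into ?S i)"
  have "(\<Union>n. ?U n) = (\<Union>s\<in>range (from_nat_into ?S). cylinder s)" by auto
  then have U: "(\<Union>n. ?U n) = covered G A" unfolding S by (simp add: covered_def)
  have "(\<lambda>n. measure coin_toss (?U n)) \<longlonglongrightarrow> measure coin_toss (\<Union>n. ?U n)"
    by (rule coin.finite_Lim_measure_incseq) (use sets_cylinder in \<open>auto simp: incseq_def intro: less_le_trans\<close>)
  then have "\<forall>\<^sub>F n in sequentially. measure coin_toss (?U n) > ?r" unfolding U by (rule order_tendstoD(1)[OF _ A])
  then obtain n where n: "measure coin_toss (?U n) > ?r" by (metis (no_types, lifting) eventually_happens sequentially_bot)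
  have "\<forall>i. \<exists>f. f \<in> A \<and> initial f (G f) = from_nat_into ?S i"
  proof
    fix i
    have "from_nat_into ?S i \<in> ?S" using S by blast
    then show "\<exists>f. f \<in> A \<and> initial f (G f) = from_nat_into ?S i" by (metis (no_types, lifting) imageE)
  qed
  from choice[OF this] obtain f where f: "\<And>i. f i \<in> A" "\<And>i. initial (f i) (G (f i)) = from_nat_into ?S i" by blast
  have "covered G (f ` {..<n}) = ?U n" unfolding covered_def by (simp add: f(2))
  then have "large G k (f ` {..<n})" unfolding large_def using n by simp
  then show ?thesis using f(1) by (intro exI[of _ "f ` {..<n}"]) auto
qed

lemma cylinder_initial_eq: "cylinder (initial f n) = {g \<in> cantor. \<forall>i<n. g i = f i}"
proof -
  have "initial g n = initial f n \<longleftrightarrow> (\<forall>i<n. g i = f i)" for g unfolding initial_def by (auto simp: list_eq_iff_nth_eq)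
  moreover have "length (initial f n) = n" by (simp add: initial_def)
  ultimately show ?thesis unfolding cylinder_def by simp
qed

definition fv :: "type2 \<Rightarrow> nat \<Rightarrow> type1" where "fv G z = inv hfun (den G z)"
definition FN :: "type2 \<Rightarrow> nat \<Rightarrow> nat \<Rightarrow> bool" where
  "FN G b z \<longleftrightarrow> NM G b z \<and> (\<exists>f. den G z = hfun f) \<and> fv G z \<in> cantor"

lemma fv: "(\<exists>f. den G z = hfun f) \<Longrightarrow> den G z = hfun (fv G z)" "den G z = hfun f \<Longrightarrow> fv G z = f"
  unfolding fv_def by (auto simp: inj_def)

lemma binary_functions_fv:
  assumes "ON G b"
  shows "binary_functions G (ho G b) = fv G ` {z. FN G b z}"
proof (intro equalityI subsetI)
  fix f assume "f \<in> binary_functions G (ho G b)"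
  then have f: "f \<in> cantor" "hfun f \<in> LN G b" unfolding binary_functions_def LN_def by simp_all
  then obtain z where z: "NM G b z" "den G z = hfun f" unfolding LN_den[OF assms] by auto
  then have "fv G z = f" by (intro fv(2))
  then show "f \<in> fv G ` {z. FN G b z}" using z f(1) unfolding FN_def by blast
next
  fix f assume "f \<in> fv G ` {z. FN G b z}"
  then obtain z where z: "NM G b z" "\<exists>f. den G z = hfun f" "fv G z \<in> cantor" "f = fv G z" unfolding FN_def by blast
  then have "hfun f \<in> LN G b" using fv(1)[OF z(2)] den_LN[OF assms z(1)] by simp
  then show "f \<in> binary_functions G (ho G b)" using z unfolding binary_functions_def LN_def by simp
qed

text \<open>One oracle with all that largeness depends on: which names denote binary functions, the
  values of \<open>G\<close> at them, and their own values. Zero at the remaining arguments makes it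
  total.\<close>

definition Hq :: "type2 \<Rightarrow> nat \<Rightarrow> type1" where
  "Hq G b q = (if pfst q = 0 then tv (FN G b (psnd q)) else if pfst q = 1 then if FN G b (psnd q) then G (fv G (psnd q)) else 0
     else if pfst q = 2 then if FN G b (pfst (psnd q)) then fv G (pfst (psnd q)) (psnd (psnd q)) else 0 else 0)"

definition "kFN = kand (kat kNM (\<lambda>w. <|kNM, w|>)) (kand (kfun (\<lambda>w. kD) psnd)
  (kall (kor (kpm (\<lambda>w. kD) (\<lambda>w. psnd (psnd w)) (\<lambda>w. <|pfst w, 0|>)) (kpm (\<lambda>w. kD) (\<lambda>w. psnd (psnd w)) (\<lambda>w. <|pfst w, 1|>)))))"

lemma K_kFN:
  assumes "ON G b"
  shows "K G kFN <|b, z|> (tv (FN G b z))"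
proof -
  have "K G (kall (kor (kpm (\<lambda>w. kD) (\<lambda>w. psnd (psnd w)) (\<lambda>w. <|pfst w, 0|>)) (kpm (\<lambda>w. kD) (\<lambda>w. psnd (psnd w)) (\<lambda>w. <|pfst w, 1|>))))
      <|b, z|> (tv (fv G z \<in> cantor))" if z: "NM G b z" "\<exists>f. den G z = hfun f"
  proof -
    have mem: "(hpair (hnat (pfst p)) (hnat (psnd p)) \<in> elts (den G z)) = (fv G z (pfst p) = psnd p)" for p
      unfolding fv(1)[OF z(2)] elts_hfun by (auto simp: image_iff)
    have "fv G z \<in> cantor \<longleftrightarrow> (\<forall>n. hpair (hnat (pfst <|n, 0|>)) (hnat (psnd <|n, 0|>)) \<in> elts (den G z) \<or>
       hpair (hnat (pfst <|n, 1|>)) (hnat (psnd <|n, 1|>)) \<in> elts (den G z))"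
      unfolding mem cantor_def by simp
    then show ?thesis
      apply (simp only:)
      apply (intro K_all K_or)
       apply (rule K_kpm[OF _ _ _ _ _ _ K_PM[OF ON_OQ[OF assms] z(1)]], (intro ar_intros)+, simp, simp, simp)
      apply (rule K_kpm[OF _ _ _ _ _ _ K_PM[OF ON_OQ[OF assms] z(1)]], (intro ar_intros)+, simp, simp, simp)
      done
  qed
  then show ?thesis unfolding kFN_def FN_def
    by (intro K_and K_at'[OF _ _ K_kNM[OF assms]] K_kfun[OF _ _ _ _ ON_OQ[OF assms]]) (auto intro!: ar_intros ar_proj)
qed

definition kHq :: "(nat \<Rightarrow> nat) \<Rightarrow> nat" where
  "kHq bt = kcase (kar (\<lambda>w. pfst (pfst w)))
    [kat kFN (\<lambda>w. <|bt (psnd w), psnd (pfst w)|>),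
     kif (kat kFN (\<lambda>w. <|bt (psnd w), psnd (pfst w)|>)) (kG (kval (\<lambda>w. kD) (\<lambda>w. psnd (pfst (psnd w))) pfst)) (kconst 0),
     kif (kat kFN (\<lambda>w. <|bt (psnd w), pfst (psnd (pfst w))|>)) (kval (\<lambda>w. kD) (\<lambda>w. pfst (psnd (pfst w))) (\<lambda>w. psnd (psnd (pfst w)))) (kconst 0)]"

lemma K_kHq:
  assumes bt: "ar (\<lambda>h. bt)" "bt w = b" and b: "ON G b"
  shows "K G (kHq bt) <|q, w|> (Hq G b q)"
proof -
  let ?w = "<|q, w|>"
  note ar = ar_psnd_comp[OF bt(1)] ar_intros
  let ?t = "pfst q"
  let ?F = "kat kFN (\<lambda>w. <|bt (psnd w), psnd (pfst w)|>)" and ?F' = "kat kFN (\<lambda>w. <|bt (psnd w), pfst (psnd (pfst w))|>)"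
  let ?V = "kval (\<lambda>w. kD) (\<lambda>w. psnd (pfst (psnd w))) pfst" and ?V' = "kval (\<lambda>w. kD) (\<lambda>w. pfst (psnd (pfst w))) (\<lambda>w. psnd (psnd (pfst w)))"
  have F: "K G ?F ?w (tv (FN G b (psnd q)))"
    by (rule K_at'[OF _ _ K_kFN[OF b]], intro ar) (simp add: bt(2))
  have F': "K G ?F' ?w (tv (FN G b (pfst (psnd q))))"
    by (rule K_at'[OF _ _ K_kFN[OF b]], intro ar) (simp add: bt(2))
  have c1: "K G (kif ?F (kG ?V) (kconst 0))
     ?w (if FN G b (psnd q) then G (fv G (psnd q)) else 0)"
  proof (rule K_kif[OF F]; rule K_K1)
    assume "tv (FN G b (psnd q)) = 0"
    then have z: "FN G b (psnd q)" by simp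
    have "K G ?V <|n, ?w|> (fv G (psnd q) n)" for n
      by (rule K_kval[OF _ _ _ _ _ _ ON_OQ[OF b], of _ _ _ _ "psnd q"])
        (use z fv in \<open>auto intro!: ar_intros ar_proj simp: FN_def\<close>)
    then show "K G (kG ?V) ?w (if FN G b (psnd q) then G (fv G (psnd q)) else 0)"
      using z by (simp add: K_kG_value)
  qed (simp add: K_kconst)
  have c2: "K G (kif ?F' ?V' (kconst 0))
     ?w (if FN G b (pfst (psnd q)) then fv G (pfst (psnd q)) (psnd (psnd q)) else 0)"
  proof (rule K_kif[OF F']; rule K_K1)
    assume "tv (FN G b (pfst (psnd q))) = 0"
    then have z: "FN G b (pfst (psnd q))" by simp
    have "K G ?V' ?w (fv G (pfst (psnd q)) (psnd (psnd q)))"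
      by (rule K_kval[OF _ _ _ _ _ _ ON_OQ[OF b], of _ _ _ _ "pfst (psnd q)"])
        (use z fv in \<open>auto intro!: ar_intros ar_proj simp: FN_def\<close>)
    then show "K G ?V' ?w
      (if FN G b (pfst (psnd q)) then fv G (pfst (psnd q)) (psnd (psnd q)) else 0)" using z by simp
  qed (simp add: K_kconst)
  have t: "K G (kar (\<lambda>w. pfst (pfst w))) ?w ?t" by (rule K_eq[OF K_kar], intro ar_intros) simp
  show ?thesis unfolding kHq_def
  proof (rule K_kcase[OF t], goal_cases)
    case 1
    then have "?t = 0 \<or> ?t = 1 \<or> ?t = 2" by auto
    then show ?case using K_K1[OF F] K_K1[OF c1] K_K1[OF c2] by (elim disjE) (simp_all add: Hq_def)
  qed (simp add: Hq_def)
qed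

text \<open>The inequality of measures, multiplied out in natural numbers. The sum of the values of
  \<open>G\<close> serves as a common length for all neighbourhoods of the list.\<close>

definition suit :: "type1 \<Rightarrow> nat \<Rightarrow> nat \<Rightarrow> bool" where
  "suit h k s \<longleftrightarrow> (\<forall>i. i < llen s \<longrightarrow> h <|0, lnth s i|> = 0) \<and>
     2 ^ (\<Sum>i<llen s. h <|1, lnth s i|>) * 2 ^ k < 2 ^ k * card {t. t < 2 ^ (\<Sum>i<llen s. h <|1, lnth s i|>) \<and>
       (\<exists>i. i < llen s \<and> (\<forall>j. j < h <|1, lnth s i|> \<longrightarrow> bit_at t j = h <|2, lnth s i, j|>))}
     + 2 ^ (\<Sum>i<llen s. h <|1, lnth s i|>)"

lemma arp_suit: "ar A \<Longrightarrow> ar B \<Longrightarrow> arp (\<lambda>h x. suit h (A h x) (B h x))"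
proof -
  assume A: "ar A" and B: "ar B"
  have "arp (\<lambda>h x. suit h (pfst x) (psnd x))" unfolding suit_def by (intro ar_intros)
  from arp_comp[OF this ar_pr[OF A B]] show ?thesis by simp
qed

definition flist :: "type2 \<Rightarrow> nat \<Rightarrow> type1 list" where "flist G s = map (fv G) (list_decode s)"

lemma suit_iff: "suit (Hq G b) k s \<longleftrightarrow> (\<forall>z\<in>set (list_decode s). FN G b z) \<and> large G k (set (flist G s))"
proof -
  have 1: "(\<forall>i. i < llen s \<longrightarrow> Hq G b <|0, lnth s i|> = 0) \<longleftrightarrow> (\<forall>z\<in>set (list_decode s). FN G b z)"
    unfolding list_decode_map_lnth by (auto simp: Hq_def)
  show ?thesis
  proof (cases "\<forall>z\<in>set (list_decode s). FN G b z")
    case True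
    then have FN: "FN G b (lnth s i)" if "i < llen s" for i using that unfolding list_decode_map_lnth by simp
    let ?f = "\<lambda>i. fv G (lnth s i)"
    let ?N = "\<Sum>i<llen s. Hq G b <|1, lnth s i|>"
    have H1: "Hq G b <|1, lnth s i|> = G (?f i)" "Hq G b <|2, lnth s i, j|> = ?f i j" if "i < llen s" for i j
      using FN[OF that] by (simp_all add: Hq_def)
    have N: "G (?f i) \<le> ?N" if "i < llen s" for i
      using member_le_sum[of i "{..<llen s}" "\<lambda>i. Hq G b <|1, lnth s i|>"] that H1(1)[OF that] by simp
    let ?Q = "\<lambda>g. \<exists>i. i < llen s \<and> (\<forall>j. j < G (?f i) \<longrightarrow> g j = ?f i j)"
    have "covered G (set (flist G s)) = {g \<in> cantor. ?Q g}"
      unfolding covered_def flist_def list_decode_map_lnth cylinder_initial_eq by auto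
    moreover have "measure coin_toss {g \<in> cantor. ?Q g} = card {t. t < 2 ^ ?N \<and> ?Q (bit_at t)} / 2 ^ ?N"
    proof (rule measure_clopen(2))
      fix f g :: type1 assume fg: "\<And>i. i < ?N \<Longrightarrow> f i = g i"
      have "f j = g j" if "i < llen s" "j < G (?f i)" for i j using fg[of j] N[OF that(1)] that(2) by simp
      then show "?Q f = ?Q g" by (intro ex_cong1) auto
    qed
    moreover have "{t. t < 2 ^ ?N \<and> ?Q (bit_at t)} = {t. t < 2 ^ ?N \<and>
       (\<exists>i. i < llen s \<and> (\<forall>j. j < Hq G b <|1, lnth s i|> \<longrightarrow> bit_at t j = Hq G b <|2, lnth s i, j|>))}" (is "_ = ?T")
      using H1 by (intro Collect_cong conj_cong refl ex_cong1) auto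
    ultimately have "large G k (set (flist G s)) \<longleftrightarrow> real (card ?T) / 2 ^ ?N > 1 - 1 / 2 ^ k"
      unfolding large_def by simp
    also have "\<dots> \<longleftrightarrow> (2::real) ^ ?N * 2 ^ k < 2 ^ k * real (card ?T) + 2 ^ ?N"
      by (simp add: field_simps)
    also have "\<dots> \<longleftrightarrow> real (2 ^ ?N * 2 ^ k) < real (2 ^ k * card ?T + 2 ^ ?N)" by simp
    also have "\<dots> \<longleftrightarrow> 2 ^ ?N * 2 ^ k < 2 ^ k * card ?T + 2 ^ ?N" by (simp only: of_nat_less_iff)
    finally show ?thesis unfolding suit_def 1 by blast
  qed (auto simp: suit_def 1)
qed

definition "kLarge = korc (\<lambda>h w. tv (\<exists>s. suit h (pfst w) s)) (kHq psnd)"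

abbreviation "LG G k b \<equiv> large G k (binary_functions G (ho G b))"

lemma large_iff_suit:
  assumes "ON G b"
  shows "LG G k b \<longleftrightarrow> (\<exists>s. suit (Hq G b) k s)"
proof
  assume "LG G k b"
  then obtain F where F: "finite F" "F \<subseteq> fv G ` {z. FN G b z}" "large G k F"
    using large_finite binary_functions_fv[OF assms] by metis
  then obtain Z where Z: "finite Z" "Z \<subseteq> {z. FN G b z}" "F = fv G ` Z" by (meson finite_subset_image)
  then obtain zs where zs: "set zs = Z" using finite_list by blast
  then have "suit (Hq G b) k (list_encode zs)"
    unfolding suit_iff flist_def using Z F(3) by auto
  then show "\<exists>s. suit (Hq G b) k s" by blast
next
  assume "\<exists>s. suit (Hq G b) k s"
  then obtain s where s: "\<forall>z\<in>set (list_decode s). FN G b z" "large G k (set (flist G s))" unfolding suit_iff by blast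
  show "LG G k b" by (rule large_mono[OF s(2)]) (use s(1) in \<open>auto simp: flist_def binary_functions_fv[OF assms]\<close>)
qed

lemma K_kLarge:
  assumes "ON G b"
  shows "K G kLarge <|k, b|> (tv (LG G k b))"
proof -
  have "K G kLarge <|k, b|> (tv (\<exists>s. suit (Hq G b) (pfst <|k, b|>) s))"
    unfolding kLarge_def
    by (rule K_korcp) (intro ar_intros arp_suit, rule K_kHq[OF _ _ assms], simp_all add: ar_proj)
  then show ?thesis unfolding large_iff_suit[OF assms] by simp
qed

section \<open>The simultaneous search through all arithmetical trees\<close>

section \<open>Finding a large notation\<close>

definition "kT = kif (kat kU (\<lambda>w. <|kU, <|kconst 0, 0|>, pfst (psnd (pfst w)), psnd w, psnd (psnd (pfst w))|>))
  (kar (\<lambda>w. Suc <|pfst (pfst w), pfst (pfst w), pfst (psnd (pfst w)), psnd w|>)) (kconst 0)"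

text \<open>The number \<open><|c, s|>\<close> stands for the node \<open>s\<close> of the relation
  with code \<open>c\<close>, so each node of each arithmetical relation occurs as the root of some
  \<open>tree i\<close>.\<close>

definition tree :: "nat \<Rightarrow> nat" where "tree i = <|kT, kT, i|>"

lemma K_kT: "K G kT <|<|kT, c, s|>, n|> (if uar c (\<lambda>_. 0) <|n, s|> = 0 then Suc (tree <|c, n|>) else 0)" (is "K G kT ?w ?y")
proof -
  have 1: "K G (kat kU (\<lambda>w. <|kU, <|kconst 0, 0|>, pfst (psnd (pfst w)), psnd w, psnd (psnd (pfst w))|>)) ?w (uar c (\<lambda>_. 0) <|n, s|>)"
    by (rule K_at'[OF _ _ K_kU], intro ar_intros, simp, rule K_K1[OF K_kconst])
  have 2: "K G (kar (\<lambda>w. Suc <|pfst (pfst w), pfst (pfst w), pfst (psnd (pfst w)), psnd w|>)) ?w (Suc (tree <|c, n|>))"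
    by (rule K_eq[OF K_kar], intro ar_intros) (simp add: tree_def)
  show ?thesis
    by (subst kT_def, rule K_kif[OF 1]) (use 2 in \<open>auto intro: K_K1 K_kconst\<close>)
qed

lemma TC_tree: "TC G (tree i)" and ch_tree: "ch G (tree <|c, s|>) n = (if uar c (\<lambda>_. 0) <|n, s|> = 0 then Suc (tree <|c, n|>) else 0)"
proof -
  have *: "K1 G (pfst (tree <|c, s|>)) <|psnd (tree <|c, s|>), n|> (if uar c (\<lambda>_. 0) <|n, s|> = 0 then Suc (tree <|c, n|>) else 0)" for c s n
    using K_K1[OF K_kT] by (simp add: tree_def)
  show "TC G (tree i)" by (rule TC_I) (use *[of "pfst i" "psnd i"] in auto)
  show "ch G (tree <|c, s|>) n = (if uar c (\<lambda>_. 0) <|n, s|> = 0 then Suc (tree <|c, n|>) else 0)" by (rule ch_eq[OF *])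
qed

lemma HT_tree: "HT G (tree i)"
proof (coinduction arbitrary: i rule: HT.coinduct)
  case HT
  have "\<exists>i'. c = tree i'" if "ch G (tree i) n = Suc c" for n c
    using that ch_tree[of G "pfst i" "psnd i" n] by (auto split: if_splits)
  then show ?case using TC_tree by blast
qed

lemma tree_arp:
  assumes c: "\<And>x. uar c (\<lambda>_. 0) x = 0 \<longleftrightarrow> E (pfst x) (psnd x)" and r: "r \<in> acc {(x, y). E x y}"
  shows "ON G (tree <|c, r|>) \<and> ho G (tree <|c, r|>) = hrank {(x, y). E x y} r"
  using r
proof (induction rule: acc.induct)
  case (accI x)
  have x: "x \<in> acc {(x, y). E x y}" by (rule acc.accI) (use accI in blast)
  have ch: "ch G (tree <|c, x|>) n = (if E n x then Suc (tree <|c, n|>) else 0)" for n unfolding ch_tree using c by simp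
  have ON: "ON G (tree <|c, x|>)" by (rule ON.ON[OF TC_tree]) (use accI ch in \<open>auto split: if_splits\<close>)
  have "{d. \<exists>n. ch G (tree <|c, x|>) n = Suc d} = (\<lambda>y. tree <|c, y|>) ` {y. (y, x) \<in> {(x, y). E x y}}"
    unfolding ch by (auto split: if_splits)
  then have "elts (ho G (tree <|c, x|>)) = elts (hrank {(x, y). E x y} x)"
    unfolding elts_ho[OF ON] hrank[OF x] using accI by auto
  then show ?case using ON hset_eqI by blast
qed

text \<open>
  A number \<open>t\<close> codes a list whose \<open>j\<close>-th entry is \<open>0\<close> (dropped) or \<open>Suc x\<close> for a node \<open>x\<close> of the \<open>j\<close>-th
  tree.  The notation \<open>bn k t\<close> has as subtrees the results of the search for the tuples of children of the
  nodes in \<open>t\<close>, extended by the root of the next tree.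
\<close>

definition cv :: "type2 \<Rightarrow> nat \<Rightarrow> nat \<Rightarrow> nat \<Rightarrow> nat" where
  "cv G t n j = (if lnth t j = 0 then 0 else ch G (lnth t j - 1) (lnth n j))"
definition cvalid :: "type2 \<Rightarrow> nat \<Rightarrow> nat \<Rightarrow> bool" where
  "cvalid G t n \<longleftrightarrow> (\<forall>j. j < llen t \<longrightarrow> lnth t j = 0 \<or> cv G t n j \<noteq> 0)"
definition ctup :: "type2 \<Rightarrow> nat \<Rightarrow> nat \<Rightarrow> nat" where
  "ctup G t n = list_encode (map (\<lambda>j. if j < llen t then cv G t n j else Suc (tree j)) [0..<Suc (llen t)])"
definition "pk w = pfst (psnd (pfst w))"
definition "pt w = psnd (psnd (pfst w))"
definition "kcv = kif (kar (\<lambda>w. lnth (pt (psnd w)) (pfst w))) (kconst 0)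
  (kch (\<lambda>w. lnth (pt (psnd w)) (pfst w) - 1) (\<lambda>w. lnth (psnd (psnd w)) (pfst w)))"
definition "kvalid = korc (\<lambda>h w. tv (\<forall>j. j < llen (pt w) \<longrightarrow> lnth (pt w) j = 0 \<or> h j \<noteq> 0)) kcv"
definition "kctup = korc (\<lambda>h w. list_encode (map (\<lambda>j. if j < llen (pt w) then h j else Suc (tree j)) [0..<Suc (llen (pt w))])) kcv"
definition "kC = kif kvalid
  (kSuc (kcall (kar (\<lambda>w. pfst (pfst w))) (kP (kar (\<lambda>w. pfst (pfst w))) (kP (kar pk) kctup))))
  (kconst 0)"
definition "kprune = korc (\<lambda>h w. list_encode (map (\<lambda>j. if h j = 0 then 0 else lnth (psnd (psnd w)) j) [0..<llen (psnd (psnd w))]))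
  (kat kLE (\<lambda>w. <|kLE, tree (pfst w), kC, psnd w|>))"
definition "kVrec = kif (keq kprune (kar (\<lambda>w. psnd (psnd w)))) (kar (\<lambda>w. <|kC, w|>))
    (kcall (kar pfst) (kP (kar pfst) (kP (kar (\<lambda>w. pfst (psnd w))) kprune)))"
definition "kV = kif (kat kLarge (\<lambda>w. <|pfst (psnd w), kC, w|>)) (kar (\<lambda>w. <|kC, w|>)) kVrec"

definition bn :: "nat \<Rightarrow> nat \<Rightarrow> nat" where "bn k t = <|kC, kV, k, t|>"

definition VT :: "type2 \<Rightarrow> nat \<Rightarrow> bool" where
  "VT G t \<longleftrightarrow> (\<forall>j x. lnth t j = Suc x \<longrightarrow> HT G x)"
text \<open>The second alternative says that \<open>b\<close> has caught up with a live node
  \<open>x\<close> but not with the root of its tree. The empty tuple offers no such node, and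
  neither does a component just added, where \<open>x\<close> is the root itself.\<close>

definition VV :: "type2 \<Rightarrow> nat \<Rightarrow> nat \<Rightarrow> nat \<Rightarrow> bool" where
  "VV G k t b \<longleftrightarrow> K G kV <|kV, k, t|> b \<and> ON G b \<and>
     (LG G k b \<or> (\<exists>j x. j < llen t \<and> lnth t j = Suc x \<and> le G x b \<and> \<not> le G (tree j) b))"
definition prune :: "type2 \<Rightarrow> nat \<Rightarrow> nat \<Rightarrow> nat" where
  "prune G k t = list_encode (map (\<lambda>j. if le G (tree j) (bn k t) then 0 else lnth t j) [0..<llen t])"

lemma ar_tree [ar_intros]: "ar A \<Longrightarrow> ar (\<lambda>h x. tree (A h x))"
  unfolding tree_def by (intro ar_intros)

lemma ar_pkt [ar_intros]: "ar A \<Longrightarrow> ar (\<lambda>h x. pk (A h x))" "ar A \<Longrightarrow> ar (\<lambda>h x. pt (A h x))"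
  unfolding pk_def pt_def by (intro ar_intros, assumption?)+

lemma lnth_list_map [simp]: "lnth (list_encode (map f [0..<n])) j = (if j < n then f j else 0)"
  by (simp add: lnth_beyond)

lemma K_kcv:
  assumes "VT G t"
  shows "K G kcv <|j, <|z, k, t|>, n|> (cv G t n j)"
  unfolding kcv_def
proof (rule K_kif[OF K_eq[OF K_kar refl]]; (rule K_K1)?)
  let ?w = "<|j, <|z, k, t|>, n|>"
  show "ar (\<lambda>h w. lnth (pt (psnd w)) (pfst w))" by (intro ar_intros)
  show "K G (kconst 0) ?w (cv G t n j)" if "lnth (pt (psnd ?w)) (pfst ?w) = 0"
    using that by (intro K_eq[OF K_kconst]) (simp add: cv_def pt_def)
  show "K G (kch (\<lambda>w. lnth (pt (psnd w)) (pfst w) - 1) (\<lambda>w. lnth (psnd (psnd w)) (pfst w))) ?w (cv G t n j)"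
    if "lnth (pt (psnd ?w)) (pfst ?w) \<noteq> 0"
  proof -
    have nz: "lnth t j \<noteq> 0" using that by (simp add: pt_def)
    then have "TC G (lnth t j - 1)" using assms HT_TC unfolding VT_def by (metis Suc_pred' neq0_conv)
    then have "K G (kch (\<lambda>w. lnth (pt (psnd w)) (pfst w) - 1) (\<lambda>w. lnth (psnd (psnd w)) (pfst w))) ?w (ch G (lnth t j - 1) (lnth n j))"
      by (intro K_ch') (auto intro!: ar_intros simp: pt_def)
    then show ?thesis using nz by (simp add: cv_def)
  qed
qed

lemma VT_ctup:
  assumes t: "VT G t"
  shows "VT G (ctup G t n)"
  unfolding VT_def
proof (intro allI impI)
  fix j x assume x: "lnth (ctup G t n) j = Suc x"
  show "HT G x"
  proof (cases "j < llen t")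
    case True
    then have c: "cv G t n j = Suc x" using x by (simp add: ctup_def del: upt_Suc)
    then obtain y where "lnth t j = Suc y" "ch G y (lnth n j) = Suc x" by (cases "lnth t j") (auto simp: cv_def)
    then show ?thesis using t HT_ch unfolding VT_def by blast
  next
    case False
    then have "x = tree j" using x by (simp add: ctup_def del: upt_Suc split: if_splits)
    then show ?thesis by (simp add: HT_tree)
  qed
qed

lemma K_kprune:
  assumes "ON G (bn k t)"
  shows "K G kprune <|kV, k, t|> (prune G k t)"
proof -
  let ?w = "<|kV, k, t|>"
  have "K G (kat kLE (\<lambda>w. <|kLE, tree (pfst w), kC, psnd w|>)) <|j, ?w|> (tv (le G (tree j) (bn k t)))" for j
    by (rule K_at'[OF _ _ K_kLE[OF assms HT_tree]], intro ar_intros) (simp add: bn_def)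
  from K_korc[OF _ this, of "\<lambda>h w. list_encode (map (\<lambda>j. if h j = 0 then 0 else lnth (psnd (psnd w)) j) [0..<llen (psnd (psnd w))])"]
  show ?thesis unfolding kprune_def prune_def by (simp add: ar_intros cong: if_cong)
qed

lemma LG_ch: "ON G b \<Longrightarrow> ch G b n = Suc d \<Longrightarrow> LG G k d \<Longrightarrow> LG G k b"
  using LN_ch[of G b n d] by (elim large_mono) (auto simp: binary_functions_def LN_def)

text \<open>All results for tuples of children are well-founded notations, hence so is
  \<open>bn k t\<close>, and it can be tested for largeness and compared with the roots. If
  something is dropped, the result for the pruned tuple is returned and its invariant carries over.
  If nothing is dropped, the invariant for \<open>bn k t\<close> has to be derived from those of its
  subtrees.\<close>

lemma V_step:
  assumes t: "VT G t" and C: "\<And>n. cvalid G t n \<Longrightarrow> \<exists>d. VV G k (ctup G t n) d"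
    and D: "ON G (bn k t) \<Longrightarrow> \<not> LG G k (bn k t) \<Longrightarrow> prune G k t \<noteq> t \<Longrightarrow> \<exists>b. VV G k (prune G k t) b"
  shows "\<exists>b. VV G k t b"
proof -
  let ?b = "bn k t" and ?w = "<|kV, k, t|>"
  from C obtain d where d: "\<And>n. cvalid G t n \<Longrightarrow> VV G k (ctup G t n) (d n)" by metis
  have child: "K G kC <|?w, n|> (if cvalid G t n then Suc (d n) else 0)" for n
  proof -
    let ?v = "<|?w, n|>"
    have v: "pt ?v = t" "pk ?v = k" "pfst (pfst ?v) = kV" by (simp_all add: pt_def pk_def)
    have "K G kvalid ?v
       (tv (\<forall>j. j < llen (pt ?v) \<longrightarrow> lnth (pt ?v) j = 0 \<or> cv G t n j \<noteq> 0))"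
      unfolding kvalid_def by (rule K_korcp[OF _ K_kcv[OF t]]) (intro ar_intros)
    then have 1: "K G kvalid ?v (tv (cvalid G t n))"
      unfolding v cvalid_def .
    have "K G kctup ?v
      (list_encode (map (\<lambda>j. if j < llen (pt ?v) then cv G t n j else Suc (tree j)) [0..<Suc (llen (pt ?v))]))"
      unfolding kctup_def by (rule K_korc[OF _ K_kcv[OF t]]) (intro ar_intros)
    then have 2: "K G kctup ?v (ctup G t n)"
      unfolding v ctup_def .
    have z: "K G (kar (\<lambda>w. pfst (pfst w))) ?v kV" by (rule K_eq[OF K_kar], intro ar_intros) simp
    have k: "K G (kar pk) ?v k" by (rule K_eq[OF K_kar], intro ar_intros) (simp add: v)
    show ?thesis
    proof (subst kC_def, rule K_kif[OF 1]; rule K_K1)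
      assume "tv (cvalid G t n) = 0"
      then have n: "cvalid G t n" by simp
      have "K1 G kV <|kV, k, ctup G t n|> (d n)" using d[OF n] K_K1 unfolding VV_def by blast
      from K_kSuc[OF K_kcall[OF z K_kP[OF z K_kP[OF k 2]] this]] n
      show "K G (kSuc (kcall (kar (\<lambda>w. pfst (pfst w))) (kP (kar (\<lambda>w. pfst (pfst w))) (kP (kar pk) kctup)))) ?v
       (if cvalid G t n then Suc (d n) else 0)" by simp
    qed (simp add: K_kconst)
  qed
  have ch: "ch G ?b n = (if cvalid G t n then Suc (d n) else 0)" for n
    by (rule ch_eq) (use K_K1[OF child] in \<open>simp add: bn_def\<close>)
  have b: "ON G ?b"
  proof (rule ON.ON)
    show "TC G ?b" by (rule TC_I) (use K_K1[OF child] in \<open>auto simp: bn_def\<close>)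
    show "ON G c" if "ch G ?b n = Suc c" for n c using that d unfolding ch VV_def by (auto split: if_splits)
  qed
  have ret: "K G (kar (\<lambda>w. <|kC, w|>)) ?w ?b" by (rule K_eq[OF K_kar], intro ar_intros) (simp add: bn_def)
  have lg: "K G (kat kLarge (\<lambda>w. <|pfst (psnd w), kC, w|>)) ?w (tv (LG G k ?b))"
    by (rule K_at'[OF _ _ K_kLarge[OF b]], intro ar_intros) (simp add: bn_def)
  have tt: "K G (kar (\<lambda>w. psnd (psnd w))) ?w t" by (rule K_eq[OF K_kar], intro ar_intros) simp
  have ld: "lnth (prune G k t) j = (if j < llen t \<and> \<not> le G (tree j) ?b then lnth t j else 0)" "llen (prune G k t) = llen t" for j
    unfolding prune_def by simp_all
  consider "LG G k ?b" | "\<not> LG G k ?b" "prune G k t = t" | "\<not> LG G k ?b" "prune G k t \<noteq> t" by blast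
  then show ?thesis
  proof cases
    case 1
    then have "K G kV ?w ?b" by (subst kV_def, intro K_kif[OF lg]) (use ret in \<open>auto intro: K_K1\<close>)
    then show ?thesis unfolding VV_def using b 1 by blast
  next
    case 2
    have "K G kVrec ?w ?b"
      unfolding kVrec_def by (rule K_kif[OF K_keq[OF K_kprune[OF b] tt]]) (use ret 2 in \<open>auto intro: K_K1\<close>)
    then have V: "K G kV ?w ?b" by (subst kV_def, intro K_kif[OF lg]) (use 2 in \<open>auto intro: K_K1\<close>)
    \<comment> \<open>If \<open>bn k t\<close> had caught up with no live node, each live node would
      have a child \<open>m j\<close> bounded by no subtree of \<open>bn k t\<close>. But the result
      for the tuple of these children is such a subtree. It is not large, so by its invariant it
      bounds one of the children, or it both bounds and does not bound the root just added.\<close>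
    have "\<exists>j x. j < llen t \<and> lnth t j = Suc x \<and> le G x ?b"
    proof (rule ccontr)
      assume no: "\<nexists>j x. j < llen t \<and> lnth t j = Suc x \<and> le G x ?b"
      have "\<forall>j. \<exists>m. j < llen t \<longrightarrow> (\<forall>x. lnth t j = Suc x \<longrightarrow> (\<exists>c. ch G x m = Suc c \<and> (\<forall>n d. ch G ?b n = Suc d \<longrightarrow> \<not> le G c d)))"
      proof
        fix j
        show "\<exists>m. j < llen t \<longrightarrow> (\<forall>x. lnth t j = Suc x \<longrightarrow> (\<exists>c. ch G x m = Suc c \<and> (\<forall>n d. ch G ?b n = Suc d \<longrightarrow> \<not> le G c d)))"
        proof (cases "j < llen t \<and> (\<exists>x. lnth t j = Suc x)")
          case True
          then obtain x where x: "lnth t j = Suc x" "\<not> le G x ?b" using no by blast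
          have "\<exists>m c. ch G x m = Suc c \<and> (\<forall>n d. ch G ?b n = Suc d \<longrightarrow> \<not> le G c d)"
          proof (rule ccontr)
            assume "\<nexists>m c. ch G x m = Suc c \<and> (\<forall>n d. ch G ?b n = Suc d \<longrightarrow> \<not> le G c d)"
            then have "le G x ?b" by (intro le) blast
            then show False using x by blast
          qed
          then show ?thesis using x by auto
        qed auto
      qed
      from choice[OF this] obtain m where m: "\<And>j x. j < llen t \<Longrightarrow> lnth t j = Suc x \<Longrightarrow>
          (\<exists>c. ch G x (m j) = Suc c \<and> (\<forall>n d. ch G ?b n = Suc d \<longrightarrow> \<not> le G c d))" by blast
      define n where "n = list_encode (map m [0..<llen t])"
      have cvn: "cv G t n j = ch G x (m j)" if "j < llen t" "lnth t j = Suc x" for j x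
        using that by (simp add: cv_def n_def)
      have valid: "cvalid G t n" unfolding cvalid_def
      proof (intro allI impI)
        fix j assume j: "j < llen t"
        show "lnth t j = 0 \<or> cv G t n j \<noteq> 0"
        proof (cases "lnth t j")
          case (Suc x)
          then show ?thesis using m[OF j Suc] cvn[OF j Suc] by auto
        qed simp
      qed
      then have chn: "ch G ?b n = Suc (d n)" by (simp add: ch)
      have "\<not> LG G k (d n)" using LG_ch[OF b chn] 2 by blast
      then obtain j x where j: "j < llen (ctup G t n)" "lnth (ctup G t n) j = Suc x" "le G x (d n)" "\<not> le G (tree j) (d n)"
        using d[OF valid] unfolding VV_def by blast
      show False
      proof (cases "j < llen t")
        case True
        then have x: "cv G t n j = Suc x" using j(2) by (simp add: ctup_def del: upt_Suc)
        then obtain y where y: "lnth t j = Suc y" unfolding cv_def by (cases "lnth t j") auto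
        then show False using m[OF True y] x cvn[OF True y] chn j(3) by auto
      next
        case False
        then have "x = tree j" using j(1,2) by (simp add: ctup_def del: upt_Suc)
        then show False using j by blast
      qed
    qed
    then obtain j x where j: "j < llen t" "lnth t j = Suc x" "le G x ?b" by blast
    have "\<not> le G (tree j) ?b" using ld(1)[of j] j 2 by (auto split: if_splits)
    then show ?thesis unfolding VV_def using V b j by blast
  next
    case 3
    from D[OF b 3] obtain c where c: "VV G k (prune G k t) c" by blast
    have z: "K G (kar pfst) ?w kV" "K G (kar (\<lambda>w. pfst (psnd w))) ?w k" by (rule K_eq[OF K_kar], intro ar_intros, simp)+
    have "K1 G kV <|kV, k, prune G k t|> c" using c K_K1 unfolding VV_def by blast
    from K_kcall[OF z(1) K_kP[OF z(1) K_kP[OF z(2) K_kprune[OF b]]] this]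
    have "K G kVrec ?w c"
      unfolding kVrec_def by (intro K_kif[OF K_keq[OF K_kprune[OF b] tt]]) (use 3 in \<open>auto intro: K_K1\<close>)
    then have V: "K G kV ?w c" by (subst kV_def, intro K_kif[OF lg]) (use 3 in \<open>auto intro: K_K1\<close>)
    have "LG G k c \<or> (\<exists>j x. j < llen t \<and> lnth t j = Suc x \<and> le G x c \<and> \<not> le G (tree j) c)"
    proof -
      have "lnth t j = Suc x" if "lnth (prune G k t) j = Suc x" for j x using that unfolding ld by (auto split: if_splits)
      then show ?thesis using c ld(2) unfolding VV_def by metis
    qed
    then show ?thesis unfolding VV_def using V c VV_def by blast
  qed
qed

text \<open>The good tree \<open>j0\<close> is never dropped, since a notation that bounds it is
  large. Every repetition drops at least one live component, so their number decreases.\<close>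

lemma V_family:
  assumes good: "ON G (tree j0)" "LG G k (tree j0)"
    and X: "\<And>t. t \<in> X \<Longrightarrow> VT G t" "\<And>t n. t \<in> X \<Longrightarrow> cvalid G t n \<Longrightarrow> \<exists>d. VV G k (ctup G t n) d"
    and X': "\<And>t t'. t \<in> X \<Longrightarrow> llen t' = llen t \<Longrightarrow> lnth t' j0 = lnth t j0 \<Longrightarrow> (\<And>j. lnth t' j = lnth t j \<or> lnth t' j = 0) \<Longrightarrow> t' \<in> X"
    and t: "t \<in> X"
  shows "\<exists>b. VV G k t b"
  using t
proof (induction "card {j. j < llen t \<and> lnth t j \<noteq> 0}" arbitrary: t rule: less_induct)
  case less
  show ?case
  proof (rule V_step[OF X(1)[OF less.prems] X(2)[OF less.prems]])
    assume b: "ON G (bn k t)" "\<not> LG G k (bn k t)" "prune G k t \<noteq> t"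
    have ld: "lnth (prune G k t) j = (if j < llen t \<and> \<not> le G (tree j) (bn k t) then lnth t j else 0)" "llen (prune G k t) = llen t" for j
      unfolding prune_def by simp_all
    have "\<not> le G (tree j0) (bn k t)"
    proof
      assume "le G (tree j0) (bn k t)"
      from le_LN[OF this b(1) HT_tree] have "LG G k (bn k t)"
        by (intro large_mono[OF good(2)]) (auto simp: binary_functions_def LN_def)
      then show False using b(2) by blast
    qed
    then have in_X: "prune G k t \<in> X" by (intro X'[OF less.prems]) (auto simp: ld lnth_beyond)
    have "\<exists>j. j < llen t \<and> lnth (prune G k t) j \<noteq> lnth t j"
      using list_code_eqI[of "prune G k t" t] ld(2) b(3) by auto
    then obtain j where j: "j < llen t" "lnth (prune G k t) j \<noteq> lnth t j" by blast
    let ?S = "\<lambda>t. {j. j < llen t \<and> lnth t j \<noteq> 0}"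
    have "?S (prune G k t) \<subset> ?S t"
    proof
      show "?S (prune G k t) \<subseteq> ?S t"
        unfolding ld by (auto split: if_splits)
      show "?S (prune G k t) \<noteq> ?S t"
        using j unfolding ld by (auto split: if_splits)
    qed
    then have "card (?S (prune G k t)) < card (?S t)"
      by (intro psubset_card_mono) simp_all
    then show "\<exists>b. VV G k (prune G k t) b" using less.hyps in_X by blast
  qed
qed

text \<open>Once component \<open>j0\<close> is present, the tuples of children descend in a
  well-founded tree. Before that every step lengthens the tuple by one, so the component appears
  after \<open>j0 + 1\<close> steps.\<close>

lemma V_terminates:
  assumes good: "ON G (tree j0)" "LG G k (tree j0)"
  shows "\<exists>b. K G kV <|kV, k, 0|> b \<and> ON G b \<and> LG G k b"
proof -
  define X where "X x = {t. VT G t \<and> j0 < llen t \<and> lnth t j0 = Suc x}" for x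
  have VT': "VT G t'" if "VT G t" "\<And>j. lnth t' j = lnth t j \<or> lnth t' j = 0" for t t'
    unfolding VT_def by (metis VT_def nat.distinct(1) that)
  have Q: "\<forall>t\<in>X x. \<exists>b. VV G k t b" if "ON G x" for x
    using that
  proof (induction rule: ON.induct)
    case (ON x)
    show ?case
    proof
      fix t assume "t \<in> X x"
      then show "\<exists>b. VV G k t b"
      proof (rule V_family[OF good, rotated 3])
        fix t n assume t: "t \<in> X x" "cvalid G t n"
        then have l: "j0 < llen t" "lnth t j0 = Suc x" "VT G t" by (simp_all add: X_def)
        then have "cv G t n j0 \<noteq> 0" using t(2) unfolding cvalid_def by auto
        then obtain c where c: "ch G x (lnth n j0) = Suc c" "cv G t n j0 = Suc c" using l(2) by (cases "cv G t n j0") (auto simp: cv_def)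
        have "ctup G t n \<in> X c" using VT_ctup[OF l(3), of n] l(1) c(2) by (simp add: X_def) (simp add: ctup_def del: upt_Suc)
        then show "\<exists>d. VV G k (ctup G t n) d" using ON.IH[OF c(1)] by blast
      next
        fix t t' assume t: "t \<in> X x" "llen t' = llen t" "lnth t' j0 = lnth t j0" and l: "\<And>j. lnth t' j = lnth t j \<or> lnth t' j = 0"
        have "VT G t'" using t(1) by (intro VT'[OF _ l]) (simp add: X_def)
        then show "t' \<in> X x" using t by (simp add: X_def)
      qed (simp_all add: X_def)
    qed
  qed
  have R: "VT G t \<Longrightarrow> llen t + m = j0 \<Longrightarrow> \<exists>b. VV G k t b" for m t
  proof (induction m arbitrary: t)
    case 0
    show ?case
    proof (rule V_family[OF good, of "{t. VT G t \<and> llen t = j0}"])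
      fix t n assume t: "t \<in> {t. VT G t \<and> llen t = j0}" "cvalid G t n"
      then have "VT G (ctup G t n)" by (intro VT_ctup) simp
      then have "ctup G t n \<in> X (tree j0)" using t by (simp add: X_def) (simp add: ctup_def del: upt_Suc)
      then show "\<exists>d. VV G k (ctup G t n) d" using Q[OF good(1)] by blast
    next
      fix t t' assume t: "t \<in> {t. VT G t \<and> llen t = j0}" "llen t' = llen t" and l: "\<And>j. lnth t' j = lnth t j \<or> lnth t' j = 0"
      have "VT G t'" using t(1) by (intro VT'[OF _ l]) simp
      then show "t' \<in> {t. VT G t \<and> llen t = j0}" using t by simp
    qed (use 0 in simp_all)
  next
    case (Suc m)
    show ?case
    proof (rule V_family[OF good, of "{t. VT G t \<and> llen t + Suc m = j0}"])
      fix t n assume t: "t \<in> {t. VT G t \<and> llen t + Suc m = j0}" "cvalid G t n"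
      have "llen (ctup G t n) + m = j0" using t by (simp add: ctup_def del: upt_Suc)
      then show "\<exists>d. VV G k (ctup G t n) d" using t by (intro Suc.IH VT_ctup) simp_all
    next
      fix t t' assume t: "t \<in> {t. VT G t \<and> llen t + Suc m = j0}" "llen t' = llen t" and l: "\<And>j. lnth t' j = lnth t j \<or> lnth t' j = 0"
      have "VT G t'" using t(1) by (intro VT'[OF _ l]) simp
      then show "t' \<in> {t. VT G t \<and> llen t + Suc m = j0}" using t by simp
    qed (use Suc.prems in simp_all)
  qed
  have l0: "llen 0 = 0" "lnth 0 j = 0" for j by (simp_all add: llen_def lnth_beyond)
  then obtain b where "VV G k 0 b" using R[of 0 j0] by (auto simp: VT_def)
  then show ?thesis unfolding VV_def l0 by auto
qed

section \<open>The canonical well-ordering and the selected list\<close>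

section \<open>The canonical well-ordering\<close>

lemma lenlex_iff: "(xs, ys) \<in> lenlex r \<longleftrightarrow> length xs < length ys \<or>
  length xs = length ys \<and> (\<exists>i. i < length xs \<and> (\<forall>j. j < i \<longrightarrow> xs ! j = ys ! j) \<and> (xs ! i, ys ! i) \<in> r)"
proof -
  have "(xs, ys) \<in> lex r \<longleftrightarrow> (\<exists>i. i < length xs \<and> (\<forall>j. j < i \<longrightarrow> xs ! j = ys ! j) \<and> (xs ! i, ys ! i) \<in> r)"
    if len: "length xs = length ys"
  proof
    assume "(xs, ys) \<in> lex r"
    then obtain us x y xs' ys' where "xs = us @ x # xs'" "ys = us @ y # ys'" "(x, y) \<in> r" unfolding lex_conv by blast
    then show "\<exists>i. i < length xs \<and> (\<forall>j. j < i \<longrightarrow> xs ! j = ys ! j) \<and> (xs ! i, ys ! i) \<in> r"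
      by (intro exI[of _ "length us"]) (simp add: nth_append)
  next
    assume "\<exists>i. i < length xs \<and> (\<forall>j. j < i \<longrightarrow> xs ! j = ys ! j) \<and> (xs ! i, ys ! i) \<in> r"
    then obtain i where i: "i < length xs" "\<And>j. j < i \<Longrightarrow> xs ! j = ys ! j" "(xs ! i, ys ! i) \<in> r" by blast
    have "take i xs = take i ys" using i len by (intro nth_equalityI) auto
    then have "xs = take i xs @ xs ! i # drop (Suc i) xs" "ys = take i xs @ ys ! i # drop (Suc i) ys"
      using id_take_nth_drop[of i xs] id_take_nth_drop[of i ys] i(1) len by simp_all
    then show "(xs, ys) \<in> lex r" unfolding lex_conv using i(3) len by blast
  qed
  then show ?thesis unfolding lenlex_conv by auto
qed

lemma lenlex_total:
  assumes r: "\<And>x y. x \<in> A \<Longrightarrow> y \<in> A \<Longrightarrow> x \<noteq> y \<Longrightarrow> (x, y) \<in> r \<or> (y, x) \<in> r"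
    and "set xs \<subseteq> A" "set ys \<subseteq> A" "xs \<noteq> ys"
  shows "(xs, ys) \<in> lenlex r \<or> (ys, xs) \<in> lenlex r"
proof (cases "length xs = length ys")
  case True
  then have "\<exists>i. i < length xs \<and> xs ! i \<noteq> ys ! i" using assms(4) nth_equalityI by blast
  define i where "i = (LEAST i. i < length xs \<and> xs ! i \<noteq> ys ! i)"
  have i: "i < length xs" "xs ! i \<noteq> ys ! i"
    using LeastI_ex[OF \<open>\<exists>i. i < length xs \<and> xs ! i \<noteq> ys ! i\<close>] unfolding i_def by blast+
  have eq: "xs ! j = ys ! j" if "j < i" for j
    using not_less_Least[of j "\<lambda>i. i < length xs \<and> xs ! i \<noteq> ys ! i"] that i(1) unfolding i_def by auto
  have "(xs ! i, ys ! i) \<in> r \<or> (ys ! i, xs ! i) \<in> r"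
    using r i True assms(2,3) by (metis nth_mem subsetD)
  then show ?thesis unfolding lenlex_iff using i(1) eq True by auto
qed (auto simp: lenlex_iff)

lemma earlier_minimal:
  assumes r: "wf r" and Q: "x \<in> Q" "x \<in> Def G M"
  obtains z \<phi> ps where "z \<in> Q" "defined_by G M \<phi> ps z"
    "\<And>y \<psi> qs. y \<in> Q \<Longrightarrow> defined_by G M \<psi> qs y \<Longrightarrow> ((goedel \<psi>, qs), (goedel \<phi>, ps)) \<notin> less_than <*lex*> lenlex r"
proof -
  let ?D = "{(goedel \<phi>, ps) |\<phi> ps z. z \<in> Q \<and> defined_by G M \<phi> ps z}"
  have "wf (less_than <*lex*> lenlex r)" using r by (intro wf_lex_prod wf_less_than wf_lenlex)
  moreover have "?D \<noteq> {}" using Q unfolding Def_def by blast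
  ultimately obtain d where d: "d \<in> ?D" "\<And>d'. (d', d) \<in> less_than <*lex*> lenlex r \<Longrightarrow> d' \<notin> ?D"
    by (rule wfE_min') blast
  from d(1) obtain z \<phi> ps where z: "d = (goedel \<phi>, ps)" "z \<in> Q" "defined_by G M \<phi> ps z" by blast
  show thesis
  proof (rule that[OF z(2,3)])
    fix y \<psi> qs assume "y \<in> Q" "defined_by G M \<psi> qs y"
    then have "(goedel \<psi>, qs) \<in> ?D" by blast
    then show "((goedel \<psi>, qs), (goedel \<phi>, ps)) \<notin> less_than <*lex*> lenlex r" using d(2) z(1) by blast
  qed
qed

lemma L_least:
  assumes "ordinal \<alpha>" "x \<in> L G \<alpha>"
  obtains \<beta> where "\<beta> \<in> elts \<alpha>" "x \<in> Def G (L G \<beta>) - L G \<beta>"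
proof -
  have "\<exists>\<beta>\<in>elts \<alpha>. x \<in> Def G (L G \<beta>) - L G \<beta>" using assms
  proof (induction \<alpha> rule: elts_induct)
    case (1 \<alpha>)
    then obtain \<beta> where b: "\<beta> \<in> elts \<alpha>" "x \<in> Def G (L G \<beta>)" unfolding L_eq[of G \<alpha>] by blast
    show ?case
    proof (cases "x \<in> L G \<beta>")
      case True
      then show ?thesis using 1(1)[OF b(1) ordinal_elt[OF 1(2) b(1)]] 1(2) b(1) unfolding ordinal_def by blast
    qed (use b in blast)
  qed
  then show ?thesis using that by blast
qed

lemma stage_unique:
  assumes "ordinal \<beta>" "ordinal \<gamma>" "x \<in> Def G (L G \<beta>) - L G \<beta>" "x \<in> Def G (L G \<gamma>) - L G \<gamma>"
  shows "\<beta> = \<gamma>"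
  using ordinal_trichotomy[OF assms(1,2)] Def_L[of \<beta> \<gamma> G] Def_L[of \<gamma> \<beta> G] assms(3,4) by blast

lemma L_order_L: "ordinal \<alpha> \<Longrightarrow> (x, y) \<in> L_order G \<alpha> \<Longrightarrow> x \<in> L G \<alpha> \<and> y \<in> L G \<alpha>"
  unfolding L_order_eq[of G \<alpha>] next_order_def using Def_L[of _ \<alpha> G] L_mono[of \<alpha> _ G] by blast

text \<open>At the least stage where elements of \<open>Q\<close> become definable, all of these are
  new, and one with a least definition among them is minimal.\<close>

lemma wf_L_order: "ordinal \<alpha> \<Longrightarrow> wf (L_order G \<alpha>)"
proof (induction \<alpha> rule: elts_induct)
  case (1 \<alpha>)
  note ord = ordinal_elt[OF 1(2)]
  show ?case
  proof (rule wfI_min)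
    fix x Q assume x: "(x :: hset) \<in> Q"
    show "\<exists>z\<in>Q. \<forall>y. (y, z) \<in> L_order G \<alpha> \<longrightarrow> y \<notin> Q"
    proof (cases "\<exists>\<beta>. \<beta> \<in> elts \<alpha> \<and> Q \<inter> Def G (L G \<beta>) \<noteq> {}")
      case False
      then have "\<forall>y. (y, x) \<in> L_order G \<alpha> \<longrightarrow> y \<notin> Q" using x unfolding L_order_eq[of G \<alpha>] next_order_def by blast
      then show ?thesis using x by blast
    next
      case True
      have "\<exists>\<beta>. \<beta> \<in> elts \<alpha> \<and> Q \<inter> Def G (L G \<beta>) \<noteq> {} \<and> (\<forall>\<gamma>\<in>elts \<beta>. Q \<inter> Def G (L G \<gamma>) = {})"
      proof -
        have "\<beta> \<in> elts \<alpha> \<Longrightarrow> Q \<inter> Def G (L G \<beta>) \<noteq> {} \<Longrightarrow> ?thesis" for \<beta>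
        proof (induction \<beta> rule: elts_induct)
          case (1 \<beta>)
          then show ?case using \<open>ordinal \<alpha>\<close> unfolding ordinal_def by blast
        qed
        then show ?thesis using True by blast
      qed
      then obtain \<beta> where b: "\<beta> \<in> elts \<alpha>" "Q \<inter> Def G (L G \<beta>) \<noteq> {}" "\<And>\<gamma>. \<gamma> \<in> elts \<beta> \<Longrightarrow> Q \<inter> Def G (L G \<gamma>) = {}" by blast
      have QL: "Q \<inter> L G \<beta> = {}" unfolding L_eq[of G \<beta>] using b(3) by blast
      let ?r = "L_order G \<beta>"
      obtain z0 where "z0 \<in> Q" "z0 \<in> Def G (L G \<beta>)" using b(2) by blast
      from earlier_minimal[OF 1(1)[OF b(1) ord[OF b(1)]] this] obtain z \<phi> ps where z: "z \<in> Q" "defined_by G (L G \<beta>) \<phi> ps z"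
        "\<And>y \<psi> qs. y \<in> Q \<Longrightarrow> defined_by G (L G \<beta>) \<psi> qs y \<Longrightarrow> ((goedel \<psi>, qs), (goedel \<phi>, ps)) \<notin> less_than <*lex*> lenlex ?r" by blast
      have zD: "z \<in> Def G (L G \<beta>) - L G \<beta>" using z QL unfolding Def_def by blast
      have "y \<notin> Q" if y: "(y, z) \<in> L_order G \<alpha>" for y
      proof
        assume yQ: "y \<in> Q"
        from y obtain \<gamma> where g: "\<gamma> \<in> elts \<alpha>" "(y, z) \<in> next_order G (L G \<gamma>) (L_order G \<gamma>)" unfolding L_order_eq[of G \<alpha>] by blast
        then have "\<gamma> = \<beta>" using stage_unique[OF ord[OF g(1)] ord[OF b(1)] _ zD] unfolding next_order_def by blast
        then have "earlier_definition G (L G \<beta>) ?r y z" using g(2) yQ QL unfolding next_order_def by blast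
        then show False using z(2) z(3)[OF yQ] unfolding earlier_definition_def by blast
      qed
      then show ?thesis using z(1) by blast
    qed
  qed
qed

text \<open>Two elements new at the same stage are compared by their definitions. These cannot
  coincide, because a definition determines its set, and parameter lists are comparable by the
  induction hypothesis.\<close>

lemma total_L_order: "ordinal \<alpha> \<Longrightarrow> x \<in> L G \<alpha> \<Longrightarrow> y \<in> L G \<alpha> \<Longrightarrow> x \<noteq> y \<Longrightarrow> (x, y) \<in> L_order G \<alpha> \<or> (y, x) \<in> L_order G \<alpha>"
proof (induction \<alpha> arbitrary: x y rule: elts_induct)
  case (1 \<alpha>)
  note ord = ordinal_elt[OF 1(2)]
  obtain \<beta> where b: "\<beta> \<in> elts \<alpha>" "x \<in> Def G (L G \<beta>) - L G \<beta>" using L_least[OF 1(2,3)] by blast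
  obtain \<gamma> where g: "\<gamma> \<in> elts \<alpha>" "y \<in> Def G (L G \<gamma>) - L G \<gamma>" using L_least[OF 1(2,4)] by blast
  consider "\<beta> = \<gamma>" | "\<beta> \<in> elts \<gamma>" | "\<gamma> \<in> elts \<beta>" using ordinal_trichotomy[OF ord[OF b(1)] ord[OF g(1)]] by blast
  then show ?case
  proof cases
    case 1
    let ?M = "L G \<beta>" and ?r = "L_order G \<beta>"
    define S where "S = {x, y}"
    have *: "earlier_definition G ?M ?r u v" if "defined_by G ?M \<phi> ps u" "v \<in> S" "u \<noteq> v"
      "\<And>y' \<psi> qs. y' \<in> S \<Longrightarrow> defined_by G ?M \<psi> qs y' \<Longrightarrow> ((goedel \<psi>, qs), (goedel \<phi>, ps)) \<notin> less_than <*lex*> lenlex ?r" for u v \<phi> ps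
      unfolding earlier_definition_def
    proof (intro exI[of _ \<phi>] exI[of _ ps] conjI allI impI)
      fix \<psi> qs assume v: "defined_by G ?M \<psi> qs v"
      have n: "((goedel \<psi>, qs), (goedel \<phi>, ps)) \<notin> less_than <*lex*> lenlex ?r" by (rule that(4)[OF that(2) v])
      have "\<phi> \<noteq> \<psi> \<or> ps \<noteq> qs" using that(1,3) v unfolding defined_by_def by (metis hset_eqI)
      moreover have "(ps, qs) \<in> lenlex ?r \<or> (qs, ps) \<in> lenlex ?r" if "ps \<noteq> qs"
      proof (rule lenlex_total[OF _ _ _ that])
        show "(a, b) \<in> ?r \<or> (b, a) \<in> ?r" if "a \<in> ?M" "b \<in> ?M" "a \<noteq> b" for a b
          by (rule "1.IH"[OF b(1) ord[OF b(1)] that])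
        show "set ps \<subseteq> ?M" "set qs \<subseteq> ?M" using \<open>defined_by G ?M \<phi> ps u\<close> v unfolding defined_by_def by blast+
      qed
      moreover have "goedel \<phi> < goedel \<psi> \<or> goedel \<psi> < goedel \<phi>" if "\<phi> \<noteq> \<psi>" using that by (metis goedel_inj linorder_neqE_nat)
      ultimately show "((goedel \<phi>, ps), (goedel \<psi>, qs)) \<in> less_than <*lex*> lenlex ?r"
        using n by (cases "\<phi> = \<psi>") auto
    qed (rule that(1))
    have "x \<in> S" "x \<in> Def G ?M" using b unfolding S_def by blast+
    then obtain z \<phi> ps where z: "z \<in> S" "defined_by G ?M \<phi> ps z"
      "\<And>y' \<psi> qs. y' \<in> S \<Longrightarrow> defined_by G ?M \<psi> qs y' \<Longrightarrow> ((goedel \<psi>, qs), (goedel \<phi>, ps)) \<notin> less_than <*lex*> lenlex ?r"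
      by (rule earlier_minimal[OF wf_L_order[OF ord[OF b(1)]]]) (rule that)
    have e: "earlier_definition G ?M ?r z v" if "v \<in> S" "z \<noteq> v" for v
      by (rule *[OF z(2) that]) (rule z(3))
    have "z = x \<or> z = y" using z(1) unfolding S_def by blast
    then have "earlier_definition G ?M ?r x y \<or> earlier_definition G ?M ?r y x"
      using e[of x] e[of y] \<open>x \<noteq> y\<close> unfolding S_def by auto
    then have "(x, y) \<in> next_order G ?M ?r \<or> (y, x) \<in> next_order G ?M ?r" unfolding next_order_def using b g 1 by blast
    then show ?thesis unfolding L_order_eq[of G \<alpha>] using b(1) by blast
  next
    case 2
    then have "x \<in> L G \<gamma>" using Def_L[OF 2, of G] b(2) by blast
    then have "(x, y) \<in> next_order G (L G \<gamma>) (L_order G \<gamma>)" unfolding next_order_def using g(2) by blast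
    then show ?thesis unfolding L_order_eq[of G \<alpha>] using g(1) by blast
  next
    case 3
    then have "y \<in> L G \<beta>" using Def_L[OF 3, of G] g(2) by blast
    then have "(y, x) \<in> next_order G (L G \<beta>) (L_order G \<beta>)" unfolding next_order_def using b(2) by blast
    then show ?thesis unfolding L_order_eq[of G \<alpha>] using b(1) by blast
  qed
qed

lemma stage_eq:
  assumes "ordinal \<alpha>" "large G k (binary_functions G \<alpha>)" "\<And>\<beta>. \<beta> \<in> elts \<alpha> \<Longrightarrow> \<not> large G k (binary_functions G \<beta>)"
  shows "stage G k = \<alpha>"
  unfolding stage_def
proof (rule the_equality)
  fix \<beta> assume b: "ordinal \<beta> \<and> large G k (binary_functions G \<beta>) \<and> (\<forall>\<gamma>\<in>elts \<beta>. \<not> large G k (binary_functions G \<gamma>))"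
  then show "\<beta> = \<alpha>" using ordinal_trichotomy[of \<alpha> \<beta>] assms by blast
qed (use assms in blast)

lemma Lambda0_eq:
  assumes a: "ordinal (stage G k)" and fs: "suitable G k fs"
    and min: "\<And>gs. suitable G k gs \<Longrightarrow> (gs, fs) \<notin> lenlex (inv_image (L_order G (stage G k)) hfun)"
  shows "Lambda0 G k = fs"
proof -
  let ?r = "inv_image (L_order G (stage G k)) hfun"
  let ?A = "binary_functions G (stage G k)"
  have wf: "wf (lenlex ?r)" by (intro wf_lenlex wf_inv_image wf_L_order a)
  have tot: "(f, g) \<in> ?r \<or> (g, f) \<in> ?r" if "f \<in> ?A" "g \<in> ?A" "f \<noteq> g" for f g
    using total_L_order[OF a, of "hfun f" G "hfun g"] that by (simp add: binary_functions_def)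
  have cmp: "(xs, ys) \<in> lenlex ?r \<or> (ys, xs) \<in> lenlex ?r" if "suitable G k xs" "suitable G k ys" "xs \<noteq> ys" for xs ys
    by (rule lenlex_total[where A = ?A, OF tot]) (use that in \<open>auto simp: suitable_def\<close>)
  show ?thesis unfolding Lambda0_def
  proof (rule the_equality)
    show "suitable G k fs \<and> (\<forall>gs. suitable G k gs \<longrightarrow> gs = fs \<or> (fs, gs) \<in> lenlex ?r)" using fs min cmp by blast
    fix hs assume "suitable G k hs \<and> (\<forall>gs. suitable G k gs \<longrightarrow> gs = hs \<or> (hs, gs) \<in> lenlex ?r)"
    then show "hs = fs" using fs min by blast
  qed
qed

definition CH :: "type2 \<Rightarrow> nat \<Rightarrow> nat \<Rightarrow> bool" where "CH G b c \<longleftrightarrow> (\<exists>n. ch G b n = Suc c)"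
text \<open>Comparing definitions over the level of a child of \<open>b\<close> involves names for
  \<open>b\<close> as well as names for the child; equality is decided for both kinds
  together.\<close>

definition GN :: "type2 \<Rightarrow> nat \<Rightarrow> nat \<Rightarrow> bool" where
  "GN G b u \<longleftrightarrow> NM G b u \<or> (\<exists>n. ch G b n \<noteq> 0 \<and> NM G (ch G b n - 1) u)"

text \<open>The data from which the order at \<open>b\<close> is arithmetical. Entry 3 contains the
  orders at the children of \<open>b\<close>, which the recursion has already provided.\<close>

definition OH :: "type2 \<Rightarrow> nat \<Rightarrow> type1" where
  "OH G b q = (if pfst q = 0 then tv (NM G b (psnd q))
     else if pfst q = 1 then tv (CH G b (pfst (psnd q)) \<and> NM G (pfst (psnd q)) (psnd (psnd q)))
     else if pfst q = 2 then tv (GN G b (pfst (psnd q)) \<and> GN G b (psnd (psnd q)) \<and> den G (pfst (psnd q)) = den G (psnd (psnd q)))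
     else if pfst q = 3 then tv (CH G b (pfst (psnd q)) \<and> NM G (pfst (psnd q)) (pfst (psnd (psnd q))) \<and>
       NM G (pfst (psnd q)) (psnd (psnd (psnd q))) \<and>
       (den G (pfst (psnd (psnd q))), den G (psnd (psnd (psnd q)))) \<in> L_order G (ho G (pfst (psnd q))))
     else if pfst q = 4 then tv (CH G b (psnd q)) else 0)"

definition inL :: "type1 \<Rightarrow> nat \<Rightarrow> nat \<Rightarrow> bool" where
  "inL h c x \<longleftrightarrow> (\<exists>u. h <|1, c, u|> = 0 \<and> h <|2, u, x|> = 0)"
definition dn :: "type1 \<Rightarrow> nat \<Rightarrow> nat \<Rightarrow> nat \<Rightarrow> bool" where
  "dn h c q x \<longleftrightarrow> h <|0, q|> = 0 \<and> pfst q = c \<and> h <|2, q, x|> = 0"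
definition lx :: "type1 \<Rightarrow> nat \<Rightarrow> nat \<Rightarrow> nat \<Rightarrow> bool" where
  "lx h c p p' \<longleftrightarrow> llen p < llen p' \<or> llen p = llen p' \<and>
    (\<exists>i. i < llen p \<and> (\<forall>j. j < i \<longrightarrow> h <|2, lnth p j, lnth p' j|> = 0) \<and> h <|3, c, lnth p i, lnth p' i|> = 0)"
definition nxf :: "type1 \<Rightarrow> nat \<Rightarrow> nat \<Rightarrow> nat \<Rightarrow> bool" where
  "nxf h c x y \<longleftrightarrow> (\<exists>q. dn h c q y) \<and> \<not> inL h c y \<and> (inL h c x \<or> ((\<exists>q. dn h c q x) \<and> \<not> inL h c x) \<and>
     (\<exists>q. dn h c q x \<and> (\<forall>q'. dn h c q' y \<longrightarrow> pfst (psnd q) < pfst (psnd q') \<or>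
        pfst (psnd q) = pfst (psnd q') \<and> lx h c (psnd (psnd q)) (psnd (psnd q')))))"
definition ordf :: "type1 \<Rightarrow> nat \<Rightarrow> nat \<Rightarrow> bool" where
  "ordf h x y \<longleftrightarrow> (\<exists>c. h <|4, c|> = 0 \<and> ((\<exists>u v. h <|2, u, x|> = 0 \<and> h <|2, v, y|> = 0 \<and> h <|3, c, u, v|> = 0) \<or> nxf h c x y))"

lemma OH_simps [simp]:
  "OH G b <|0, q|> = tv (NM G b q)"
  "OH G b <|1, q|> = tv (CH G b (pfst q) \<and> NM G (pfst q) (psnd q))"
  "OH G b <|Suc 0, q|> = tv (CH G b (pfst q) \<and> NM G (pfst q) (psnd q))"
  "OH G b <|2, q|> = tv (GN G b (pfst q) \<and> GN G b (psnd q) \<and> den G (pfst q) = den G (psnd q))"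
  "OH G b <|3, q|> = tv (CH G b (pfst q) \<and> NM G (pfst q) (pfst (psnd q)) \<and> NM G (pfst q) (psnd (psnd q)) \<and>
       (den G (pfst (psnd q)), den G (psnd (psnd q))) \<in> L_order G (ho G (pfst q)))"
  "OH G b <|4, q|> = tv (CH G b q)"
  by (simp_all add: OH_def)

lemma CH_GN: "CH G b c \<Longrightarrow> NM G c u \<Longrightarrow> GN G b u"
  unfolding CH_def GN_def by (metis diff_Suc_1 nat.distinct(1))

text \<open>Replaces the union over all smaller ordinals by one over the children of
  \<open>b\<close>, which a program can enumerate.\<close>

lemma L_order_ho:
  assumes "ON G b"
  shows "L_order G (ho G b) = (\<Union>c\<in>{c. CH G b c}. L_order G (ho G c) \<union> next_order G (LN G c) (L_order G (ho G c)))"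
proof -
  have "L_order G (ho G b) = (\<Union>\<beta>\<in>(\<Union>c\<in>{c. CH G b c}. insert (ho G c) (elts (ho G c))). next_order G (L G \<beta>) (L_order G \<beta>))"
    unfolding L_order_eq[of G "ho G b"] elts_ho[OF assms] CH_def ..
  also have "\<dots> = (\<Union>c\<in>{c. CH G b c}. next_order G (LN G c) (L_order G (ho G c)) \<union> (\<Union>\<beta>\<in>elts (ho G c). next_order G (L G \<beta>) (L_order G \<beta>)))"
    unfolding LN_def by blast
  finally show ?thesis unfolding L_order_eq[of G "ho G _", symmetric] by blast
qed

context
  fixes G b c assumes b: "ON G b" and c: "CH G b c"
begin

lemma c_ON: "ON G c"
  using c ON_ch[OF b] unfolding CH_def by blast

lemma inL_iff: "GN G b x \<Longrightarrow> inL (OH G b) c x \<longleftrightarrow> den G x \<in> LN G c"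
proof -
  assume "GN G b x"
  then have "inL (OH G b) c x \<longleftrightarrow> (\<exists>u. NM G c u \<and> den G x = den G u)" using c CH_GN[OF c] by (auto simp: inL_def)
  then show ?thesis unfolding LN_den[OF c_ON] image_iff by simp
qed

lemma dn_iff:
  assumes x: "GN G b x"
  shows "dn (OH G b) c q x \<longleftrightarrow> (\<exists>\<psi> ps. q = <|c, goedel \<psi>, list_encode ps|> \<and> (\<forall>p\<in>set ps. NM G c p) \<and>
    defined_by G (LN G c) \<psi> (map (den G) ps) (den G x))" (is "?l = ?r")
proof
  assume ?l
  then have q: "NM G b q" "pfst q = c" "den G q = den G x" by (simp_all add: dn_def)
  from nm_den[OF q(1)] show ?r
  proof cases
    case (nm n c' ps xs \<psi>)
    then have cc: "c' = c" using q(2) by simp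
    have "xs = map (den G) ps" using nm(3) den by (auto simp: list_all2_conv_all_nth intro!: nth_equalityI)
    moreover have "\<forall>p\<in>set ps. NM G c p"
    proof
      fix p assume "p \<in> set ps"
      then obtain i where "i < length ps" "p = ps ! i" by (auto simp: in_set_conv_nth)
      then show "NM G c p" using list_all2_nthD[OF nm(3)] unfolding cc NM_def by blast
    qed
    ultimately show ?thesis using nm q(3) cc by auto
  qed
next
  assume ?r
  then obtain \<psi> ps where q: "q = <|c, goedel \<psi>, list_encode ps|>" "\<forall>p\<in>set ps. NM G c p"
    "defined_by G (LN G c) \<psi> (map (den G) ps) (den G x)" by blast
  obtain n where n: "ch G b n = Suc c" using c unfolding CH_def by blast
  have "list_all2 (nm G c) ps (map (den G) ps)" using q(2) nm_den by (auto simp: list_all2_conv_all_nth)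
  from nm.nm[OF n this q(3)] have "nm G b q (den G x)" unfolding q(1) .
  then show ?l using den x unfolding dn_def by (auto simp: NM_def GN_def q(1))
qed

text \<open>Every parameter has a name over the level, so quantifying over the names with level
  \<open>c\<close> amounts to quantifying over all definitions.\<close>

lemma Def_dn: "GN G b x \<Longrightarrow> defined_by G (LN G c) \<psi> xs (den G x) \<Longrightarrow>
   \<exists>q ps. dn (OH G b) c q x \<and> q = <|c, goedel \<psi>, list_encode ps|> \<and> xs = map (den G) ps \<and> (\<forall>p\<in>set ps. NM G c p)"
proof -
  assume x: "GN G b x" and d: "defined_by G (LN G c) \<psi> xs (den G x)"
  have "\<forall>y\<in>set xs. \<exists>p. NM G c p \<and> den G p = y"
  proof
    fix y assume "y \<in> set xs"
    then have "y \<in> LN G c" using d unfolding defined_by_def by blast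
    then show "\<exists>p. NM G c p \<and> den G p = y" unfolding LN_den[OF c_ON] by blast
  qed
  from bchoice[OF this] obtain f where f: "\<And>y. y \<in> set xs \<Longrightarrow> NM G c (f y) \<and> den G (f y) = y" by blast
  have xs: "xs = map (den G) (map f xs)" using f by (simp add: map_idI)
  have "dn (OH G b) c <|c, goedel \<psi>, list_encode (map f xs)|> x"
    unfolding dn_iff[OF x] using d f xs by (intro exI[of _ \<psi>] exI[of _ "map f xs"]) auto
  then show ?thesis using xs f by (intro exI[of _ "<|c, goedel \<psi>, list_encode (map f xs)|>"] exI[of _ "map f xs"]) auto
qed

lemma Def_iff: "GN G b x \<Longrightarrow> (\<exists>q. dn (OH G b) c q x) \<longleftrightarrow> den G x \<in> Def G (LN G c)"
  unfolding Def_def using dn_iff Def_dn by blast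

lemma lx_iff:
  assumes "\<forall>p\<in>set ps. NM G c p" "\<forall>p\<in>set qs. NM G c p"
  shows "lx (OH G b) c (list_encode ps) (list_encode qs) \<longleftrightarrow> (map (den G) ps, map (den G) qs) \<in> lenlex (L_order G (ho G c))"
proof -
  have *: "NM G c (ps ! i)" "NM G c (qs ! i)" "GN G b (ps ! i)" "GN G b (qs ! i)" if "i < length ps" "length ps = length qs" for i
    using assms that CH_GN[OF c] by simp_all
  show ?thesis unfolding lx_def lenlex_iff using * c
    by (auto simp del: list_encode.simps)
qed

lemma nxf_iff:
  assumes x: "GN G b x" and y: "GN G b y"
  shows "nxf (OH G b) c x y \<longleftrightarrow> (den G x, den G y) \<in> next_order G (LN G c) (L_order G (ho G c))"
proof -
  let ?h = "OH G b"
  have "(\<exists>q. dn ?h c q x \<and> (\<forall>q'. dn ?h c q' y \<longrightarrow> pfst (psnd q) < pfst (psnd q') \<or>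
        pfst (psnd q) = pfst (psnd q') \<and> lx ?h c (psnd (psnd q)) (psnd (psnd q'))))
    \<longleftrightarrow> earlier_definition G (LN G c) (L_order G (ho G c)) (den G x) (den G y)" (is "?l = ?r")
  proof
    assume ?l
    then obtain q where q: "dn ?h c q x" "\<And>q'. dn ?h c q' y \<Longrightarrow> pfst (psnd q) < pfst (psnd q') \<or>
        pfst (psnd q) = pfst (psnd q') \<and> lx ?h c (psnd (psnd q)) (psnd (psnd q'))" by blast
    then obtain \<psi> ps where p: "q = <|c, goedel \<psi>, list_encode ps|>" "\<forall>p\<in>set ps. NM G c p"
      "defined_by G (LN G c) \<psi> (map (den G) ps) (den G x)" unfolding dn_iff[OF x] by blast
    show ?r unfolding earlier_definition_def
    proof (intro exI[of _ \<psi>] exI[of _ "map (den G) ps"] conjI allI impI)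
      fix \<psi>' qs assume "defined_by G (LN G c) \<psi>' qs (den G y)"
      from Def_dn[OF y this] obtain q' ps' where q': "dn ?h c q' y" "q' = <|c, goedel \<psi>', list_encode ps'|>"
        "qs = map (den G) ps'" "\<forall>p\<in>set ps'. NM G c p" by blast
      show "((goedel \<psi>, map (den G) ps), (goedel \<psi>', qs)) \<in> less_than <*lex*> lenlex (L_order G (ho G c))"
        using q(2)[OF q'(1)] lx_iff[OF p(2) q'(4)] unfolding p(1) q'(2,3) by auto
    qed (rule p(3))
  next
    assume ?r
    then obtain \<psi> xs where d: "defined_by G (LN G c) \<psi> xs (den G x)"
      "\<And>\<psi>' qs. defined_by G (LN G c) \<psi>' qs (den G y) \<Longrightarrow> ((goedel \<psi>, xs), (goedel \<psi>', qs)) \<in> less_than <*lex*> lenlex (L_order G (ho G c))"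
      unfolding earlier_definition_def by blast
    from Def_dn[OF x d(1)] obtain q ps where q: "dn ?h c q x" "q = <|c, goedel \<psi>, list_encode ps|>"
        "xs = map (den G) ps" "\<forall>p\<in>set ps. NM G c p" by blast
    show ?l
    proof (intro exI[of _ q] conjI allI impI)
      fix q' assume "dn ?h c q' y"
      then obtain \<psi>' ps' where p: "q' = <|c, goedel \<psi>', list_encode ps'|>" "\<forall>p\<in>set ps'. NM G c p"
        "defined_by G (LN G c) \<psi>' (map (den G) ps') (den G y)" unfolding dn_iff[OF y] by blast
      show "pfst (psnd q) < pfst (psnd q') \<or> pfst (psnd q) = pfst (psnd q') \<and> lx ?h c (psnd (psnd q)) (psnd (psnd q'))"
        using d(2)[OF p(3)] lx_iff[OF q(4) p(2)] unfolding p(1) q(2,3) by auto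
    qed (rule q(1))
  qed
  then show ?thesis unfolding nxf_def next_order_def using inL_iff[OF x] inL_iff[OF y] Def_iff[OF x] Def_iff[OF y] by blast
qed

end

lemma ordf_iff:
  assumes b: "ON G b" and x: "NM G b x" and y: "NM G b y"
  shows "ordf (OH G b) x y \<longleftrightarrow> (den G x, den G y) \<in> L_order G (ho G b)"
proof -
  have g: "GN G b x" "GN G b y" using x y unfolding GN_def by blast+
  have 1: "(\<exists>u v. OH G b <|2, u, x|> = 0 \<and> OH G b <|2, v, y|> = 0 \<and> OH G b <|3, c, u, v|> = 0)
     \<longleftrightarrow> (den G x, den G y) \<in> L_order G (ho G c)" if c: "CH G b c" for c
  proof
    assume "(den G x, den G y) \<in> L_order G (ho G c)"
    moreover then have "den G x \<in> LN G c" "den G y \<in> LN G c"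
      using L_order_L[OF ordinal_ho[OF c_ON[OF b c]]] unfolding LN_def by blast+
    then obtain u v where "NM G c u" "den G u = den G x" "NM G c v" "den G v = den G y" unfolding LN_den[OF c_ON[OF b c]] by auto
    ultimately show "\<exists>u v. OH G b <|2, u, x|> = 0 \<and> OH G b <|2, v, y|> = 0 \<and> OH G b <|3, c, u, v|> = 0"
      using CH_GN[OF c] g c by (intro exI[of _ u] exI[of _ v]) auto
  qed auto
  show ?thesis unfolding ordf_def L_order_ho[OF b] using 1 nxf_iff[OF b _ g] by auto
qed

lemma arp_ordf: "arp (\<lambda>h w. ordf h (pfst (psnd (psnd w))) (psnd (psnd (psnd w))))"
  unfolding ordf_def nxf_def inL_def dn_def lx_def by (intro ar_intros)

definition kCH :: "(nat \<Rightarrow> nat) \<Rightarrow> (nat \<Rightarrow> nat) \<Rightarrow> nat" where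
  "kCH bt ct = kE (keq (kch (\<lambda>w. bt (psnd w)) pfst) (kar (\<lambda>w. Suc (ct (psnd w)))))"
definition kGN :: "(nat \<Rightarrow> nat) \<Rightarrow> (nat \<Rightarrow> nat) \<Rightarrow> nat" where
  "kGN bt ut = kor (kat kNM (\<lambda>w. <|kNM, bt w, ut w|>))
    (kE (kand (knz (kch (\<lambda>w. bt (psnd w)) pfst))
      (kcomp kNM (kP (kconst kNM) (kP (kPred (kch (\<lambda>w. bt (psnd w)) pfst)) (kar (\<lambda>w. ut (psnd w))))))))"

lemma K_kCH:
  assumes ar: "ar (\<lambda>h. bt)" "ar (\<lambda>h. ct)" and w: "bt w = b" "ct w = c" and b: "ON G b"
  shows "K G (kCH bt ct) w (tv (CH G b c))"
  unfolding kCH_def CH_def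
  apply (intro K_ex K_keq)
   apply (rule K_ch', (intro ar_psnd_comp[OF ar(1)] ar_intros)+, simp add: w, simp, rule ON_TC[OF b])
  apply (rule K_eq[OF K_kar], (intro ar_psnd_comp[OF ar(2)] ar_intros)+, simp add: w)
  done

lemma K_kGN:
  assumes ar: "ar (\<lambda>h. bt)" "ar (\<lambda>h. ut)" and w: "bt w = b" "ut w = u" and b: "ON G b"
  shows "K G (kGN bt ut) w (tv (GN G b u))"
proof -
  have c: "K G (kch (\<lambda>w. bt (psnd w)) pfst) <|n, w|> (ch G b n)" for n
    by (rule K_ch', (intro ar_psnd_comp[OF ar(1)] ar_intros)+) (use w ON_TC[OF b] in auto)
  have u: "K G (kar (\<lambda>w. ut (psnd w))) <|n, w|> u" for n
    by (rule K_eq[OF K_kar], intro ar_psnd_comp[OF ar(2)] ar_intros) (simp add: w)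
  show ?thesis unfolding kGN_def GN_def
    apply (intro K_or K_ex K_and K_nz[OF c])
     apply (rule K_at'[OF _ _ K_kNM[OF b]], (intro ar_psnd_comp[OF ar(1)] ar_psnd_comp[OF ar(2)] ar_intros), simp add: w)
    apply (rule K_kcomp[OF K_kP[OF K_kconst K_kP[OF K_kPred[OF c] u]]])
    apply (rule K_kNM)
    using ON_ch[OF b] by (metis Suc_pred' neq0_conv)
qed

definition "kOH = (let b = (\<lambda>w. pfst (psnd (psnd w))); q = (\<lambda>w. psnd (pfst w)); q1 = (\<lambda>w. pfst (psnd (pfst w))); q2 = (\<lambda>w. psnd (psnd (pfst w))) in
  kcase (kar (\<lambda>w. pfst (pfst w)))
    [kat kNM (\<lambda>w. <|kNM, b w, q w|>),
     kand (kCH b q1) (kat kNM (\<lambda>w. <|kNM, q1 w, q2 w|>)),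
     kand (kGN b q1) (kand (kGN b q2) (kat kD (\<lambda>w. <|kD, 1, q1 w, q2 w|>))),
     kand (kCH b q1) (kand (kat kNM (\<lambda>w. <|kNM, q1 w, pfst (q2 w)|>)) (kand (kat kNM (\<lambda>w. <|kNM, q1 w, psnd (q2 w)|>))
       (kself (\<lambda>w. pfst (psnd w)) (\<lambda>w. <|pfst (psnd w), q1 w, q2 w|>)))),
     kCH b q])"
definition "kO = korc (\<lambda>h w. tv (ordf h (pfst (psnd (psnd w))) (psnd (psnd (psnd w))))) kOH"

lemma K_kO: "ON G b \<Longrightarrow> NM G b x \<Longrightarrow> NM G b y \<Longrightarrow> K G kO <|kO, b, x, y|> (tv ((den G x, den G y) \<in> L_order G (ho G b)))"
proof (induction arbitrary: x y rule: ON.induct)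
  case (ON b)
  have b: "ON G b" by (rule ON.ON) (use ON in blast)+
  have GN: "\<exists>b'. OQ G b' \<and> NM G b' u" if "GN G b u" for u
    using that ON_OQ b ON_ch[OF b] unfolding GN_def by (metis Suc_pred' neq0_conv)
  let ?w0 = "<|kO, b, x, y|>"
  have "K G kOH <|q, ?w0|> (OH G b q)" for q
  proof -
    let ?w = "<|q, ?w0|>"
    let ?q = "psnd q" and ?q1 = "pfst (psnd q)" and ?q2 = "psnd (psnd q)"
    let ?b = "\<lambda>w. pfst (psnd (psnd w))" and ?a1 = "\<lambda>w. pfst (psnd (pfst w))" and ?a2 = "\<lambda>w. psnd (psnd (pfst w))"
    have c0: "K G (kat kNM (\<lambda>w. <|kNM, ?b w, psnd (pfst w)|>)) ?w (tv (NM G b ?q))"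
      by (rule K_at'[OF _ _ K_kNM[OF b]], intro ar_intros) simp
    have ch1: "K G (kCH ?b ?a1) ?w (tv (CH G b ?q1))"
      by (rule K_kCH[OF _ _ _ _ b], intro ar_intros, intro ar_intros) simp_all
    have nm1: "K G (kat kNM (\<lambda>w. <|kNM, ?a1 w, f (?a2 w)|>)) ?w (tv (NM G ?q1 (f ?q2)))" if "CH G b ?q1" "ar (\<lambda>h. f)" for f
      by (rule K_at'[OF _ _ K_kNM[OF c_ON[OF b that(1)]]], intro ar_psnd_comp[OF that(2)] ar_intros) simp
    have c1: "K G (kand (kCH ?b ?a1) (kat kNM (\<lambda>w. <|kNM, ?a1 w, ?a2 w|>))) ?w (tv (CH G b ?q1 \<and> NM G ?q1 ?q2))"
      by (rule K_and[OF ch1 nm1]) (auto intro: ar_intros)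
    have c2: "K G (kand (kGN ?b ?a1) (kand (kGN ?b ?a2) (kat kD (\<lambda>w. <|kD, 1, ?a1 w, ?a2 w|>)))) ?w
        (tv (GN G b ?q1 \<and> GN G b ?q2 \<and> den G ?q1 = den G ?q2))"
    proof (intro K_and)
      show "K G (kGN ?b ?a1) ?w (tv (GN G b ?q1))" "K G (kGN ?b ?a2) ?w (tv (GN G b ?q2))"
        by (rule K_kGN[OF _ _ _ _ b], intro ar_intros, intro ar_intros, simp, simp)+
      assume "GN G b ?q1" "GN G b ?q2"
      then obtain b1 b2 where "OQ G b1" "OQ G b2" "NM G b1 ?q1" "NM G b2 ?q2" using GN by blast
      from K_EQ[OF this] show "K G (kat kD (\<lambda>w. <|kD, 1, ?a1 w, ?a2 w|>)) ?w (tv (den G ?q1 = den G ?q2))"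
        by (intro K_at'[where e = kD]) (auto intro!: ar_intros)
    qed
    have c3: "K G (kand (kCH ?b ?a1) (kand (kat kNM (\<lambda>w. <|kNM, ?a1 w, pfst (?a2 w)|>)) (kand (kat kNM (\<lambda>w. <|kNM, ?a1 w, psnd (?a2 w)|>))
       (kself (\<lambda>w. pfst (psnd w)) (\<lambda>w. <|pfst (psnd w), ?a1 w, ?a2 w|>))))) ?w
       (tv (CH G b ?q1 \<and> NM G ?q1 (pfst ?q2) \<and> NM G ?q1 (psnd ?q2) \<and> (den G (pfst ?q2), den G (psnd ?q2)) \<in> L_order G (ho G ?q1)))"
    proof (rule K_and[OF ch1 K_and[OF nm1 K_and[OF nm1]]])
      assume c: "CH G b ?q1" "NM G ?q1 (pfst ?q2)" "NM G ?q1 (psnd ?q2)"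
      then obtain n where "ch G b n = Suc ?q1" unfolding CH_def by blast
      from ON.IH[OF this c(2,3)]
      show "K G (kself (\<lambda>w. pfst (psnd w)) (\<lambda>w. <|pfst (psnd w), ?a1 w, ?a2 w|>)) ?w
        (tv ((den G (pfst ?q2), den G (psnd ?q2)) \<in> L_order G (ho G ?q1)))"
        by (intro K_self'[where e = kO]) (auto intro!: ar_intros)
    qed (auto intro: ar_intros ar_proj)
    have c4: "K G (kCH ?b (\<lambda>w. psnd (pfst w))) ?w (tv (CH G b ?q))"
      by (rule K_kCH[OF _ _ _ _ b], intro ar_intros, intro ar_intros) simp_all
    have t: "K G (kar (\<lambda>w. pfst (pfst w))) ?w (pfst q)" by (rule K_eq[OF K_kar], intro ar_intros) simp
    have less_5: "n < 5 \<Longrightarrow> n = 0 \<or> n = 1 \<or> n = 2 \<or> n = 3 \<or> n = 4" for n :: nat by presburger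
    show ?thesis unfolding kOH_def Let_def
    proof (rule K_kcase[OF t], goal_cases)
      case 1
      then have "pfst q < 5" by simp
      from less_5[OF this] show ?case
        using K_K1[OF c0] K_K1[OF c1] K_K1[OF c2] K_K1[OF c3] K_K1[OF c4] by (elim disjE) (simp_all add: OH_def)
    qed (simp add: OH_def)
  qed
  from K_korcp[OF arp_ordf this]
  have "K G kO ?w0 (tv (ordf (OH G b) x y))" unfolding kO_def[symmetric] by simp
  then show ?case unfolding ordf_iff[OF b ON.prems] .
qed

section \<open>Selecting the list\<close>

definition SH :: "type2 \<Rightarrow> nat \<Rightarrow> type1" where
  "SH G b q = (if pfst q = 0 then Hq G b (psnd q)
     else if pfst q = 1 then tv (FN G b (pfst (psnd q)) \<and> FN G b (psnd (psnd q)) \<and> den G (pfst (psnd q)) = den G (psnd (psnd q)))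
     else if pfst q = 2 then tv (FN G b (pfst (psnd q)) \<and> FN G b (psnd (psnd q)) \<and>
        (den G (pfst (psnd q)), den G (psnd (psnd q))) \<in> L_order G (ho G b)) else 0)"

lemma SH_simps [simp]:
  "SH G b <|0, q|> = Hq G b q"
  "SH G b <|1, q|> = tv (FN G b (pfst q) \<and> FN G b (psnd q) \<and> den G (pfst q) = den G (psnd q))"
  "SH G b <|Suc 0, q|> = tv (FN G b (pfst q) \<and> FN G b (psnd q) \<and> den G (pfst q) = den G (psnd q))"
  "SH G b <|2, q|> = tv (FN G b (pfst q) \<and> FN G b (psnd q) \<and> (den G (pfst q), den G (psnd q)) \<in> L_order G (ho G b))"
  by (simp_all add: SH_def)

definition lxs :: "type1 \<Rightarrow> nat \<Rightarrow> nat \<Rightarrow> bool" where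
  "lxs h s s' \<longleftrightarrow> llen s < llen s' \<or> llen s = llen s' \<and>
    (\<exists>i. i < llen s \<and> (\<forall>j. j < i \<longrightarrow> h <|1, lnth s j, lnth s' j|> = 0) \<and> h <|2, lnth s i, lnth s' i|> = 0)"
definition good :: "type1 \<Rightarrow> nat \<Rightarrow> nat \<Rightarrow> bool" where
  "good h k s \<longleftrightarrow> suit (\<lambda>q. h <|0, q|>) k s \<and> (\<forall>s'. suit (\<lambda>q. h <|0, q|>) k s' \<longrightarrow> \<not> lxs h s' s)"
text \<open>Several codes may denote the minimal list; \<open>mu\<close> settles on one of them, the
  same for every \<open>n\<close>. The cases follow the layout of \<open>code_list\<close>.\<close>

definition outf :: "type1 \<Rightarrow> nat \<Rightarrow> nat \<Rightarrow> nat" where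
  "outf h k n = (if n = 0 then llen (mu (good h k))
     else if pfst (n - 1) < llen (mu (good h k)) then h <|0, 2, lnth (mu (good h k)) (pfst (n - 1)), psnd (n - 1)|> else 0)"

lemma ar_outf: "ar (\<lambda>h w. outf h (psnd (psnd w)) (pfst (psnd w)))"
proof -
  have s: "arp (\<lambda>h x. suit (\<lambda>q. h <|0, q|>) (pfst x) (psnd x))"
    by (rule arp_subst[OF arp_suit[OF ar_pfst[OF ar_id'] ar_psnd[OF ar_id']] _ ar_id']) (intro ar_intros)
  have s': "arp (\<lambda>h x. suit (\<lambda>q. h <|0, q|>) (A h x) (B h x))" if "ar A" "ar B" for A B
    using arp_comp[OF s ar_pr[OF that]] by simp
  have g: "arp (\<lambda>h x. good h (pfst x) (psnd x))" unfolding good_def lxs_def by (intro ar_intros s')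
  have g': "arp (\<lambda>h x. good h (A h x) (B h x))" if "ar A" "ar B" for A B
    using arp_comp[OF g ar_pr[OF that]] by simp
  have m: "ar (\<lambda>h x. mu (good h (A h x)))" if "ar A" for A
  proof -
    have "ar (\<lambda>h x. mu (\<lambda>s. good h (A h x) s))"
      by (rule ar_mu[OF g'[OF ar.comp[OF that ar.psnd] ar.pfst]])
    then show ?thesis by simp
  qed
  show ?thesis unfolding outf_def by (intro ar_intros m)
qed

lemma FN_den: "FN G b z \<Longrightarrow> den G z = hfun (fv G z)"
  using fv(1) unfolding FN_def by blast

lemma lxs_iff:
  assumes "\<forall>z\<in>set (list_decode s). FN G b z" "\<forall>z\<in>set (list_decode s'). FN G b z"
  shows "lxs (SH G b) s s' \<longleftrightarrow> (flist G s, flist G s') \<in> lenlex (inv_image (L_order G (ho G b)) hfun)"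
proof -
  have l: "length (flist G s) = llen s" "length (flist G s') = llen s'" by (simp_all add: flist_def llen_def)
  have n: "flist G s ! i = fv G (lnth s i)" "flist G s' ! i = fv G (lnth s' i)" if "i < llen s" "llen s = llen s'" for i
    using that by (simp_all add: flist_def list_decode_map_lnth)
  have f: "FN G b (lnth s i)" "FN G b (lnth s' i)" if "i < llen s" "llen s = llen s'" for i
    using assms that by (simp_all add: list_decode_map_lnth)
  have "(\<exists>i. i < llen s \<and> (\<forall>j. j < i \<longrightarrow> SH G b <|1, lnth s j, lnth s' j|> = 0) \<and> SH G b <|2, lnth s i, lnth s' i|> = 0)
    \<longleftrightarrow> (\<exists>i. i < llen s \<and> (\<forall>j. j < i \<longrightarrow> flist G s ! j = flist G s' ! j) \<and> (flist G s ! i, flist G s' ! i) \<in> inv_image (L_order G (ho G b)) hfun)"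
    if len: "llen s = llen s'"
  proof (intro ex_cong1 conj_cong refl)
    fix i assume i: "i < llen s"
    have 1: "SH G b <|1, lnth s j, lnth s' j|> = 0 \<longleftrightarrow> flist G s ! j = flist G s' ! j" if "j < i" for j
      using f[OF _ len, of j] n[OF _ len, of j] that i by (simp add: FN_den)
    then show "(\<forall>j. j < i \<longrightarrow> SH G b <|1, lnth s j, lnth s' j|> = 0) = (\<forall>j. j < i \<longrightarrow> flist G s ! j = flist G s' ! j)" by blast
    show "(SH G b <|2, lnth s i, lnth s' i|> = 0) = ((flist G s ! i, flist G s' ! i) \<in> inv_image (L_order G (ho G b)) hfun)"
      using f[OF i len] n[OF i len] by (simp add: FN_den)
  qed
  then show ?thesis unfolding lxs_def lenlex_iff l by blast
qed

lemma outf_code_list: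
  assumes b: "ON G b" and lg: "LG G k b" and st: "stage G k = ho G b"
  shows "outf (SH G b) k n = code_list (Lambda0 G k) n"
proof -
  let ?r = "inv_image (L_order G (ho G b)) hfun"
  have h0: "(\<lambda>q. SH G b <|0, q|>) = Hq G b" by auto
  let ?S = "{flist G s |s. suit (Hq G b) k s}"
  have "wf (lenlex ?r)" by (intro wf_lenlex wf_inv_image wf_L_order ordinal_ho b)
  moreover obtain s1 where "suit (Hq G b) k s1" using lg large_iff_suit[OF b] by blast
  then have "flist G s1 \<in> ?S" by blast
  ultimately obtain fs where fs: "fs \<in> ?S" "\<And>gs. (gs, fs) \<in> lenlex ?r \<Longrightarrow> gs \<notin> ?S" by (rule wfE_min) blast
  have good: "good (SH G b) k s \<longleftrightarrow> suit (Hq G b) k s \<and> (\<forall>s'. suit (Hq G b) k s' \<longrightarrow> (flist G s', flist G s) \<notin> lenlex ?r)" for s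
    unfolding good_def h0 using lxs_iff suit_iff by blast
  obtain s0 where "fs = flist G s0" "suit (Hq G b) k s0" using fs(1) by blast
  then have "good (SH G b) k s0" unfolding good using fs(2) by blast
  then have g: "good (SH G b) k (mu (good (SH G b) k))" by (rule mu_works)
  define s where "s = mu (good (SH G b) k)"
  have s: "suit (Hq G b) k s" "\<And>s'. suit (Hq G b) k s' \<Longrightarrow> (flist G s', flist G s) \<notin> lenlex ?r"
    using g unfolding good s_def by blast+
  have suitable: "suitable G k gs \<longleftrightarrow> (\<exists>s'. gs = flist G s' \<and> suit (Hq G b) k s')" for gs
  proof
    assume gs: "suitable G k gs"
    then have "\<forall>f\<in>set gs. \<exists>z. FN G b z \<and> fv G z = f" unfolding suitable_def st binary_functions_fv[OF b] by blast
    from bchoice[OF this] obtain z where z: "\<And>f. f \<in> set gs \<Longrightarrow> FN G b (z f) \<and> fv G (z f) = f" by blast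
    have "flist G (list_encode (map z gs)) = gs" unfolding flist_def using z by (simp add: map_idI)
    moreover have "suit (Hq G b) k (list_encode (map z gs))"
      unfolding suit_iff calculation using z gs by (auto simp: suitable_def)
    ultimately show "\<exists>s'. gs = flist G s' \<and> suit (Hq G b) k s'" by metis
  next
    assume "\<exists>s'. gs = flist G s' \<and> suit (Hq G b) k s'"
    then show "suitable G k gs" unfolding suitable_def st binary_functions_fv[OF b] suit_iff by (auto simp: flist_def)
  qed
  have L: "Lambda0 G k = flist G s"
    by (rule Lambda0_eq) (use s suitable in \<open>auto simp: st ordinal_ho[OF b]\<close>)
  have FN: "FN G b (lnth s i)" if "i < llen s" for i using s(1) that unfolding suit_iff by (simp add: list_decode_map_lnth)
  have len: "length (flist G s) = llen s" by (simp add: flist_def llen_def)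
  show ?thesis
  proof (cases n)
    case 0
    then show ?thesis unfolding L by (simp add: outf_def code_list_def len s_def[symmetric])
  next
    case (Suc m)
    have "prod_decode m = (pfst m, psnd m)" by (simp add: pfst_def psnd_def)
    then show ?thesis unfolding L using FN
      by (simp add: outf_def code_list_def len Suc s_def[symmetric] Hq_def) (simp add: flist_def list_decode_map_lnth)
  qed
qed

definition "kSH = (let b = (\<lambda>w. pfst (psnd w)); q1 = (\<lambda>w. pfst (psnd (pfst w))); q2 = (\<lambda>w. psnd (psnd (pfst w))) in
  kcase (kar (\<lambda>w. pfst (pfst w)))
   [kat (kHq pfst) (\<lambda>w. <|psnd (pfst w), psnd w|>),
    kand (kat kFN (\<lambda>w. <|b w, q1 w|>)) (kand (kat kFN (\<lambda>w. <|b w, q2 w|>)) (kat kD (\<lambda>w. <|kD, 1, q1 w, q2 w|>))),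
    kand (kat kFN (\<lambda>w. <|b w, q1 w|>)) (kand (kat kFN (\<lambda>w. <|b w, q2 w|>)) (kat kO (\<lambda>w. <|kO, b w, q1 w, q2 w|>)))])"
definition "kSel = korc (\<lambda>h w. outf h (psnd (psnd w)) (pfst (psnd w))) kSH"

lemma K_kSel:
  assumes b: "ON G b" and "LG G k b" "stage G k = ho G b"
  shows "K G kSel <|b, n, k|> (code_list (Lambda0 G k) n)"
proof -
  let ?v = "<|b, n, k|>"
  have "K G kSH <|q, ?v|> (SH G b q)" for q
  proof -
    let ?w = "<|q, ?v|>"
    let ?q1 = "pfst (psnd q)" and ?q2 = "psnd (psnd q)"
    have h: "K G (kHq pfst) <|psnd q, ?v|> (Hq G b (psnd q))" by (rule K_kHq[OF _ _ b]) (simp_all add: ar_proj)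
    have c0: "K G (kat (kHq pfst) (\<lambda>w. <|psnd (pfst w), psnd w|>)) ?w (Hq G b (psnd q))"
      by (rule K_at'[OF _ _ h], intro ar_intros) simp
    have f: "K G (kat kFN (\<lambda>w. <|pfst (psnd w), pfst (psnd (pfst w))|>)) ?w (tv (FN G b ?q1))"
      "K G (kat kFN (\<lambda>w. <|pfst (psnd w), psnd (psnd (pfst w))|>)) ?w (tv (FN G b ?q2))"
      by (rule K_at'[OF _ _ K_kFN[OF b]], intro ar_intros, simp)+
    have c1: "K G (kand (kat kFN (\<lambda>w. <|pfst (psnd w), pfst (psnd (pfst w))|>)) (kand (kat kFN (\<lambda>w. <|pfst (psnd w), psnd (psnd (pfst w))|>))
        (kat kD (\<lambda>w. <|kD, 1, pfst (psnd (pfst w)), psnd (psnd (pfst w))|>)))) ?w (tv (FN G b ?q1 \<and> FN G b ?q2 \<and> den G ?q1 = den G ?q2))"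
      by (intro K_and f K_at'[OF _ _ K_EQ[OF ON_OQ[OF b] ON_OQ[OF b]]]) (auto intro!: ar_intros simp: FN_def)
    have c2: "K G (kand (kat kFN (\<lambda>w. <|pfst (psnd w), pfst (psnd (pfst w))|>)) (kand (kat kFN (\<lambda>w. <|pfst (psnd w), psnd (psnd (pfst w))|>))
        (kat kO (\<lambda>w. <|kO, pfst (psnd w), pfst (psnd (pfst w)), psnd (psnd (pfst w))|>)))) ?w
        (tv (FN G b ?q1 \<and> FN G b ?q2 \<and> (den G ?q1, den G ?q2) \<in> L_order G (ho G b)))"
      by (intro K_and f K_at'[OF _ _ K_kO[OF b]]) (auto intro!: ar_intros simp: FN_def)
    have t: "K G (kar (\<lambda>w. pfst (pfst w))) ?w (pfst q)" by (rule K_eq[OF K_kar], intro ar_intros) simp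
    have less_3: "n < 3 \<Longrightarrow> n = 0 \<or> n = 1 \<or> n = 2" for n :: nat by presburger
    show ?thesis unfolding kSH_def Let_def
    proof (rule K_kcase[OF t], goal_cases)
      case 1
      then have "pfst q < 3" by simp
      from less_3[OF this] show ?case
        using K_K1[OF c0] K_K1[OF c1] K_K1[OF c2] by (elim disjE) (simp_all add: SH_def)
    qed (simp add: SH_def)
  qed
  from K_korc[OF ar_outf this] have "K G kSel ?v (outf (SH G b) k n)" unfolding kSel_def by simp
  then show ?thesis unfolding outf_code_list[OF assms] .
qed

section \<open>The least large stage\<close>

definition "kMin_test = kand (knz (kch (\<lambda>v. psnd (psnd (psnd v))) pfst))
  (kcomp kLarge (kP (kar (\<lambda>v. pfst (psnd (psnd v)))) (kPred (kch (\<lambda>v. psnd (psnd (psnd v))) pfst))))"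
definition "kMin = kif (kE kMin_test)
  (kcall (kar pfst) (kP (kar pfst) (kP (kar (\<lambda>w. pfst (psnd w)))
     (kPred (kcall (kar (\<lambda>w. pfst (psnd (psnd w)))) (kP (kar (\<lambda>w. psnd (psnd (psnd w)))) (kmut kMin_test)))))))
  (kar (\<lambda>w. psnd (psnd w)))"

text \<open>Descent through large subtrees ends, by well-foundedness, at a large notation without
  large subtrees. Every ordinal below its rank is at most the rank of a subtree, so the rank is the
  least large stage.\<close>

lemma K_kMin: "ON G b \<Longrightarrow> LG G k b \<Longrightarrow>
  \<exists>x. K G kMin <|kMin, k, b|> x \<and> ON G x \<and> LG G k x \<and> (\<forall>n c. ch G x n = Suc c \<longrightarrow> \<not> LG G k c)"
proof (induction rule: ON.induct)
  case (ON b)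
  have b: "ON G b" by (rule ON.ON) (use ON in blast)+
  let ?w = "<|kMin, k, b|>"
  let ?P = "\<lambda>n. ch G b n \<noteq> 0 \<and> LG G k (ch G b n - 1)"
  have c: "K G (kch (\<lambda>v. psnd (psnd (psnd v))) pfst) <|n, ?w|> (ch G b n)" for n
    by (rule K_ch', (intro ar_intros)+) (use ON_TC[OF b] in auto)
  have kk: "K G (kar (\<lambda>v. pfst (psnd (psnd v)))) <|n, ?w|> k" for n by (rule K_eq[OF K_kar], intro ar_intros) simp
  have P: "K G kMin_test <|n, ?w|> (tv (?P n))" for n
    unfolding kMin_test_def
    apply (intro K_and K_nz[OF c])
    apply (rule K_kcomp[OF K_kP[OF kk K_kPred[OF c]]])
    apply (rule K_kLarge)
    using ON_ch[OF b] by (metis Suc_pred' neq0_conv)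
  have E: "K G (kE kMin_test) ?w (tv (\<exists>n. ?P n))" by (rule K_ex[OF P])
  show ?case
  proof (cases "\<exists>n. ?P n")
    case False
    have "K G (kar (\<lambda>w. psnd (psnd w))) ?w b" by (rule K_eq[OF K_kar], intro ar_intros) simp
    then have "K G kMin ?w b" by (subst kMin_def, intro K_kif[OF E]) (use False in \<open>auto intro: K_K1\<close>)
    moreover have "\<not> LG G k c" if "ch G b n = Suc c" for n c using False that by (metis diff_Suc_1 nat.distinct(1))
    ultimately show ?thesis using b ON.prems by blast
  next
    case True
    define n where "n = mu (\<lambda>n. tv (?P n) = 0)"
    have n: "?P n" using True mu_works[of "\<lambda>n. tv (?P n) = 0"] unfolding n_def by auto
    then obtain d where d: "ch G b n = Suc d" by (cases "ch G b n") auto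
    from ON.IH[OF d] n d obtain x where x: "K G kMin <|kMin, k, d|> x" "ON G x" "LG G k x" "\<forall>n c. ch G x n = Suc c \<longrightarrow> \<not> LG G k c"
      by auto
    have a: "K G (kar pfst) ?w kMin" "K G (kar (\<lambda>w. pfst (psnd w))) ?w k" "K G (kar (\<lambda>w. pfst (psnd (psnd w)))) ?w (pfst b)"
      "K G (kar (\<lambda>w. psnd (psnd (psnd w)))) ?w (psnd b)" by (rule K_eq[OF K_kar], intro ar_intros, simp)+
    have "K1 G (pfst b) <|psnd b, n|> (Suc d)" using ON_TC[OF b] d unfolding TC_def by metis
    then have "K G (kcall (kar (\<lambda>w. pfst (psnd (psnd w)))) (kP (kar (\<lambda>w. psnd (psnd (psnd w)))) (kmut kMin_test))) ?w (Suc d)"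
      by (intro K_kcall[OF a(3) K_kP[OF a(4) K_kmut[OF P]]]) (simp add: n_def)
    from K_kPred[OF this] have "K G (kPred (kcall (kar (\<lambda>w. pfst (psnd (psnd w)))) (kP (kar (\<lambda>w. psnd (psnd (psnd w)))) (kmut kMin_test)))) ?w d"
      by simp
    note X = K_K1[OF K_kcall[OF a(1) K_kP[OF a(1) K_kP[OF a(2) this]] K_K1[OF x(1)]]]
    have "tv (\<exists>n. ?P n) = 0" unfolding tv_0 by (rule True)
    then have "K G kMin ?w x" by (subst kMin_def, intro K_kif[OF E]) (rule X, blast)
    then show ?thesis using x by blast
  qed
qed

definition "kFin = kcomp kSel (kP (kat kMin (\<lambda>w. <|kMin, psnd (psnd (psnd w)), pfst (psnd w)|>)) (kar (\<lambda>w. psnd (psnd w))))"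

lemma K_kFin:
  assumes "ON G b" "LG G k b"
  shows "K G kFin <|v, b, n, k|> (code_list (Lambda0 G k) n)"
proof -
  obtain x where x: "K G kMin <|kMin, k, b|> x" "ON G x" "LG G k x" "\<And>n c. ch G x n = Suc c \<Longrightarrow> \<not> LG G k c"
    using K_kMin[OF assms] by blast
  have "stage G k = ho G x"
  proof (rule stage_eq[OF ordinal_ho[OF x(2)] x(3)])
    fix \<beta> assume "\<beta> \<in> elts (ho G x)"
    then obtain c n where c: "ch G x n = Suc c" "\<beta> = ho G c \<or> \<beta> \<in> elts (ho G c)" unfolding elts_ho[OF x(2)] by blast
    have "L G \<beta> \<subseteq> LN G c" using c(2) L_mono[OF ordinal_ho[OF ON_ch[OF x(2) c(1)]]] unfolding LN_def by blast
    then have "large G k (binary_functions G \<beta>) \<Longrightarrow> LG G k c" by (elim large_mono) (auto simp: binary_functions_def LN_def)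
    then show "\<not> large G k (binary_functions G \<beta>)" using x(4)[OF c(1)] by blast
  qed
  note sel = K_kSel[OF x(2,3) this]
  have "K G (kat kMin (\<lambda>w. <|kMin, psnd (psnd (psnd w)), pfst (psnd w)|>)) <|v, b, n, k|> x"
    by (rule K_at'[OF _ _ x(1)], intro ar_intros) simp
  moreover have "K G (kar (\<lambda>w. psnd (psnd w))) <|v, b, n, k|> <|n, k|>" by (rule K_eq[OF K_kar], intro ar_intros) simp
  ultimately show ?thesis unfolding kFin_def by (intro K_kcomp[OF K_kP sel])
qed

section \<open>Correctness on every \<open>G\<close> for which the program converges\<close>

section \<open>Checking well-foundedness\<close>

text \<open>
  S8 evaluates its function argument everywhere, so \<open>kW\<close> converges at a notation only if it converges at
  all its subtrees.  Induction on the computation then shows that convergence implies well-foundedness.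
\<close>

definition "kW_arg = kcomp (kar (\<lambda>v. <|psnd (psnd (psnd v)), pfst v|>)) kpair"
definition "kW_idx = list_encode [6, 0, 2, kar (\<lambda>x. pfst (psnd x))]"
definition "kW_ch = kcomp (kcomp kapp kW_idx) kW_arg"
text \<open>An absent subtree is replaced by a call that converges trivially. Otherwise the result
  is the argument for the recursive check: the index of the checking program paired with the
  subtree.\<close>

definition "kW_res = list_encode [6, 0, 2,
  kcomp (kar (\<lambda>v. if psnd v = 0 then <|kconst 0, 0|> else <|pfst (pfst v), psnd v - 1|>)) kpair]"
definition "kW1 = kcomp (kcomp kapp (kar pfst)) (kcomp kW_res kW_ch)"
definition "kW = list_encode [8, kW1]"

lemma K_pair: "Kleene kpair (a # b # xs) [] [E2, G] <|a, b|>"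
  using K2_kpair unfolding K2_def by blast

lemma Kleene_kar: "ar (\<lambda>h. f) \<Longrightarrow> Kleene (kar f) (x # xs) [] [E2, G] (f x)"
  using K_kar unfolding K_def by blast

lemma Kleene_kW_arg: "Kleene kW_arg (n # x # xs) [] [E2, G] <|psnd (psnd x), n|>"
  unfolding kW_arg_def
  using Kleene_kcomp[OF K_pair Kleene_kar[of "\<lambda>v. <|psnd (psnd (psnd v)), pfst v|>"]] by (simp add: ar_intros)

lemma Kleene_kW_idx: "Kleene kW_idx (a # n # x # xs) [] [E2, G] (pfst (psnd x))"
proof -
  have "ar (\<lambda>h x. pfst (psnd x))" by (intro ar_intros)
  from Kleene_kar[OF this] show ?thesis unfolding kW_idx_def by - (rule Kleene.S6_0, simp_all del: list_encode.simps)
qed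

lemma Kleene_kW_res: "Kleene kW_res (r # n # x # xs) [] [E2, G] (if r = 0 then <|kconst 0, 0|> else <|pfst x, r - 1|>)"
  unfolding kW_res_def
proof (rule Kleene.S6_0)
  have "ar (\<lambda>h v. if psnd v = 0 then <|kconst 0, 0|> else <|pfst (pfst v), psnd v - 1|>)" by (intro ar_intros)
  from Kleene_kcomp[OF K_pair Kleene_kar[OF this]]
  show "Kleene (kcomp (kar (\<lambda>v. if psnd v = 0 then <|kconst 0, 0|> else <|pfst (pfst v), psnd v - 1|>)) kpair)
     ((r # n # x # xs) ! 2 # take 2 (r # n # x # xs) @ drop (Suc 2) (r # n # x # xs)) [] [E2, G]
     (if r = 0 then <|kconst 0, 0|> else <|pfst x, r - 1|>)" by (simp cong: if_cong)
qed simp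

lemma Kleene_S4_inv: "Kleene (kcomp p g) as fs Fs c \<Longrightarrow> \<exists>b. Kleene g as fs Fs b \<and> Kleene p (b # as) fs Fs c"
  unfolding kcomp_def by (erule Kleene.cases) auto

lemma Kleene_kapp_inv: "Kleene kapp (e # x # xs) [] [E2, G] c \<Longrightarrow> Kleene e [x] [] [E2, G] c"
  unfolding kapp_def by (erule Kleene.cases) auto

lemma Kleene_kswap_inv: "Kleene (kswap e) (a # b # xs) [] [E2, G] c \<Longrightarrow> Kleene e (b # a # xs) [] [E2, G] c"
  unfolding kswap_def by (erule Kleene.cases) auto

lemma Kleene_kW_ch_inv:
  assumes "Kleene kW_ch (n # x # xs) [] [E2, G] r"
  shows "K1 G (pfst (psnd x)) <|psnd (psnd x), n|> r"
proof -
  from Kleene_S4_inv[OF assms[unfolded kW_ch_def]] obtain a where a: "Kleene kW_arg (n # x # xs) [] [E2, G] a"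
    "Kleene (kcomp kapp kW_idx) (a # n # x # xs) [] [E2, G] r" by blast
  from Kleene_S4_inv[OF a(2)] obtain e where e: "Kleene kW_idx (a # n # x # xs) [] [E2, G] e"
    "Kleene kapp (e # a # n # x # xs) [] [E2, G] r" by blast
  have "a = <|psnd (psnd x), n|>" "e = pfst (psnd x)"
    using Kleene_deterministic[OF a(1) Kleene_kW_arg] Kleene_deterministic[OF e(1) Kleene_kW_idx] by simp_all
  then show ?thesis using Kleene_kapp_inv[OF e(2)] unfolding K1_def by simp
qed

lemma kW_shapes:
  "list_encode l = kW \<longleftrightarrow> l = [8, kW1]"
  "list_encode l = kW1 \<longleftrightarrow> l = [4, kcomp kapp (kar pfst), kcomp kW_res kW_ch]"
  "list_encode l = kcomp kapp (kar pfst) \<longleftrightarrow> l = [4, kapp, kar pfst]"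
  "list_encode l = kapp \<longleftrightarrow> l = [9, 1, 0, 2]"
proof -
  have *: "list_encode l = kcomp p g \<longleftrightarrow> l = [4, p, g]" for p g unfolding kcomp_def by (rule list_encode_eq_iff)
  show "list_encode l = kW \<longleftrightarrow> l = [8, kW1]" unfolding kW_def by (rule list_encode_eq_iff)
  show "list_encode l = kW1 \<longleftrightarrow> l = [4, kcomp kapp (kar pfst), kcomp kW_res kW_ch]" unfolding kW1_def by (rule *)
  show "list_encode l = kcomp kapp (kar pfst) \<longleftrightarrow> l = [4, kapp, kar pfst]" by (rule *)
  show "list_encode l = kapp \<longleftrightarrow> l = [9, 1, 0, 2]" unfolding kapp_def by (rule list_encode_eq_iff)
qed

text \<open>A recursive call of \<open>kW\<close> passes through the four indices listed, so these
  are treated simultaneously. The subcomputations of S8 for all \<open>n\<close> precede it in the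
  induction, which is what turns convergence into well-foundedness.\<close>

lemma kW_sound_aux:
  "Kleene e as fs Fs c \<Longrightarrow> fs = [] \<Longrightarrow> Fs = [E2, G] \<Longrightarrow>
    (\<forall>x xs. e = kW \<and> as = x # xs \<and> pfst x = kW \<longrightarrow> ON G (psnd x)) \<and>
    (\<forall>n x xs. e = kW1 \<and> as = n # x # xs \<and> pfst x = kW \<longrightarrow>
       (\<exists>r. K1 G (pfst (psnd x)) <|psnd (psnd x), n|> r \<and> (\<forall>c'. r = Suc c' \<longrightarrow> ON G c'))) \<and>
    (\<forall>a xs. e = kcomp kapp (kar pfst) \<and> as = a # xs \<and> pfst a = kW \<longrightarrow> ON G (psnd a)) \<and>
    (\<forall>a xs. e = kapp \<and> as = kW # a # xs \<and> pfst a = kW \<longrightarrow> ON G (psnd a))"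
proof (induction rule: Kleene.induct)
  case (S4 h as fs Fs b g c)
  show ?case
  proof (intro conjI allI impI)
    fix x xs assume "list_encode [4, g, h] = kW \<and> as = x # xs \<and> pfst x = kW"
    then show "ON G (psnd x)" by (simp only: kW_shapes) simp
  next
    fix n x xs assume e: "list_encode [4, g, h] = kW1 \<and> as = n # x # xs \<and> pfst x = kW"
    then have gh: "g = kcomp kapp (kar pfst)" "h = kcomp kW_res kW_ch" by (simp_all only: kW_shapes) simp_all
    from Kleene_S4_inv[OF S4.hyps(1)[unfolded gh]] obtain r where r: "Kleene kW_ch as fs Fs r" "Kleene kW_res (r # as) fs Fs b" by blast
    have b: "b = (if r = 0 then <|kconst 0, 0|> else <|pfst x, r - 1|>)"
      using Kleene_deterministic[OF _ Kleene_kW_res] r(2) e S4.prems by blast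
    have "K1 G (pfst (psnd x)) <|psnd (psnd x), n|> r" using Kleene_kW_ch_inv r(1) e S4.prems by blast
    moreover have "ON G c'" if "r = Suc c'" for c'
    proof -
      have "b = <|kW, c'|>" using b e that by simp
      then show ?thesis using S4.IH(2)[OF S4.prems] gh(1) by auto
    qed
    ultimately show "\<exists>r. K1 G (pfst (psnd x)) <|psnd (psnd x), n|> r \<and> (\<forall>c'. r = Suc c' \<longrightarrow> ON G c')" by blast
  next
    fix a xs assume e: "list_encode [4, g, h] = kcomp kapp (kar pfst) \<and> as = a # xs \<and> pfst a = kW"
    then have gh: "g = kapp" "h = kar pfst" by (simp_all only: kW_shapes) simp_all
    have "b = kW" using Kleene_deterministic[OF _ Kleene_kar[OF ar_proj(1)]] S4.hyps(1) e S4.prems gh(2) by metis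
    then show "ON G (psnd a)" using S4.IH(2)[OF S4.prems] gh(1) e by blast
  next
    fix a xs assume "list_encode [4, g, h] = kapp \<and> as = kW # a # xs \<and> pfst a = kW"
    then show "ON G (psnd a)" by (simp only: kW_shapes) simp
  qed
next
  case (S8 h as fs F Fs u)
  show ?case
  proof (intro conjI allI impI)
    fix x xs assume e: "list_encode [8, h] = kW \<and> as = x # xs \<and> pfst x = kW"
    then have h: "h = kW1" by (simp only: kW_shapes) simp
    have *: "\<exists>r. K1 G (pfst (psnd x)) <|psnd (psnd x), n|> r \<and> (\<forall>c'. r = Suc c' \<longrightarrow> ON G c')" for n
      using S8.IH[OF S8.prems, of n] e h by blast
    show "ON G (psnd x)"
    proof (rule ON.ON)
      show "TC G (psnd x)" by (rule TC_I) (use * in blast)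
      show "ON G c" if "ch G (psnd x) n = Suc c" for n c using *[of n] ch_eq that by metis
    qed
  qed (simp_all only: kW_shapes, simp_all)
next
  case (S9 p as q fs r Fs e c)
  show ?case
  proof (intro conjI allI impI)
    fix a xs assume e: "list_encode [9, p, q, r] = kapp \<and> e # as = kW # a # xs \<and> pfst a = kW"
    then have p: "p = 1" "r = 2" by (simp_all only: kW_shapes) simp_all
    have "take q fs = []" "take r Fs = [E2, G]" using S9.prems p by simp_all
    from S9.IH[OF this] show "ON G (psnd a)" using p e by simp
  qed (simp_all only: kW_shapes, simp_all)
qed (simp_all only: kW_shapes, simp_all)

lemma kW_sound: "Kleene kW (<|kW, y|> # xs) [] [E2, G] c \<Longrightarrow> ON G y"
  using kW_sound_aux[of kW "<|kW, y|> # xs" "[]" "[E2, G]" c G] by auto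

lemma kW_complete: "ON G y \<Longrightarrow> \<exists>v. K G kW <|kW, y|> v"
proof (induction rule: ON.induct)
  case (ON y)
  let ?x = "<|kW, y|>"
  have "\<exists>u. \<forall>xs. Kleene kW1 (n # ?x # xs) [] [E2, G] u" for n
  proof -
    let ?r = "ch G y n"
    let ?a = "if ?r = 0 then <|kconst 0, 0|> else <|pfst ?x, ?r - 1|>"
    have "Kleene (pfst (psnd ?x)) [<|psnd (psnd ?x), n|>] [] [E2, G] ?r" using ON.hyps(1) unfolding TC_def K1_def by simp
    then have ch: "Kleene kW_ch (n # ?x # xs) [] [E2, G] ?r" for xs
      unfolding kW_ch_def by (intro Kleene_kcomp[OF Kleene_kW_arg Kleene_kcomp[OF Kleene_kW_idx Kleene_kapp]])
    have "\<exists>u. Kleene (pfst ?a) [?a] [] [E2, G] u"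
    proof (cases ?r)
      case 0
      then show ?thesis using Kleene_kconst[of 0 "[<|kconst 0, 0|>]" "[]" "[E2, G]"] by (simp only: if_True pfst_pr simp_thms) blast
    next
      case (Suc c)
      from ON.IH[OF Suc] obtain v where "K G kW <|kW, c|> v" by blast
      then have "Kleene kW [<|kW, c|>] [] [E2, G] v" unfolding K_def by blast
      then show ?thesis using Suc by (intro exI[of _ v]) simp
    qed
    then obtain u where "Kleene (pfst ?a) [?a] [] [E2, G] u" by blast
    then have "Kleene kW1 (n # ?x # xs) [] [E2, G] u" for xs
      unfolding kW1_def
      by (rule Kleene_kcomp[OF Kleene_kcomp[OF ch Kleene_kW_res] Kleene_kcomp[OF Kleene_kar[OF ar_proj(1)] Kleene_kapp]])
    then show ?thesis by blast
  qed
  then obtain u where u: "\<And>n xs. Kleene kW1 (n # ?x # xs) [] [E2, G] (u n)" by metis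
  have "K G kW ?x (E2 u)" unfolding K_def by (subst kW_def) (intro allI Kleene.S8 u)
  then show ?case by blast
qed

text \<open>Makes \<open>yn k b\<close> well-founded exactly when \<open>b\<close> is well-founded
  and large: \<open>b\<close> is a subtree, and if \<open>b\<close> is not large then
  \<open>yn k b\<close> is also a subtree of itself. A single check by \<open>kW\<close> thus covers
  both conditions.\<close>

definition "kY = kif (kar psnd) (kif (kat kLarge (\<lambda>w. psnd (pfst w))) (kconst 0) (kar (\<lambda>w. Suc <|pfst (pfst w), pfst w|>)))
  (kar (\<lambda>w. Suc (psnd (psnd (pfst w)))))"
definition yn :: "nat \<Rightarrow> nat \<Rightarrow> nat" where "yn k b = <|kY, kY, k, b|>"

lemma ON_irrefl: "ON G x \<Longrightarrow> ch G x n \<noteq> Suc x"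
  by (induction rule: ON.induct) metis

lemma ON_yn: "ON G (yn k b) \<longleftrightarrow> ON G b \<and> LG G k b"
proof -
  let ?w = "\<lambda>n. <|<|kY, k, b|>, n|>"
  have s: "K G kY (?w (Suc n)) (Suc b)" for n
  proof -
    have 1: "K G (kar psnd) (?w (Suc n)) (Suc n)" by (rule K_eq[OF K_kar[OF ar_proj(2)]]) simp
    have "K G (kar (\<lambda>w. Suc (psnd (psnd (pfst w))))) (?w (Suc n)) (Suc b)" by (rule K_eq[OF K_kar], intro ar_intros) simp
    then show ?thesis by (subst kY_def, intro K_kif[OF 1]) (auto intro: K_K1)
  qed
  have z: "K G kY (?w 0) (if LG G k b then 0 else Suc (yn k b))" if b: "ON G b"
  proof -
    have 1: "K G (kar psnd) (?w 0) 0" by (rule K_eq[OF K_kar[OF ar_proj(2)]]) simp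
    have 2: "K G (kat kLarge (\<lambda>w. psnd (pfst w))) (?w 0) (tv (LG G k b))"
      by (rule K_at'[OF _ _ K_kLarge[OF b]], intro ar_intros) simp
    have 3: "K G (kar (\<lambda>w. Suc <|pfst (pfst w), pfst w|>)) (?w 0) (Suc (yn k b))"
      by (rule K_eq[OF K_kar], intro ar_intros) (simp add: yn_def)
    have "K G (kif (kat kLarge (\<lambda>w. psnd (pfst w))) (kconst 0) (kar (\<lambda>w. Suc <|pfst (pfst w), pfst w|>))) (?w 0)
        (if LG G k b then 0 else Suc (yn k b))"
      by (rule K_kif[OF 2]) (use 3 in \<open>auto intro: K_K1 K_kconst\<close>)
    then show ?thesis by (subst kY_def, intro K_kif[OF 1]) (auto intro: K_K1)
  qed
  have chs: "ch G (yn k b) (Suc n) = Suc b" for n by (rule ch_eq) (use K_K1[OF s] in \<open>simp add: yn_def\<close>)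
  have chz: "ch G (yn k b) 0 = (if LG G k b then 0 else Suc (yn k b))" if "ON G b"
    by (rule ch_eq) (use K_K1[OF z[OF that]] in \<open>simp add: yn_def\<close>)
  show ?thesis
  proof
    assume y: "ON G (yn k b)"
    have b: "ON G b" by (rule ON_ch[OF y chs])
    moreover have "LG G k b" using chz[OF b] ON_irrefl[OF y, of 0] by (auto split: if_splits)
    ultimately show "ON G b \<and> LG G k b" by blast
  next
    assume b: "ON G b \<and> LG G k b"
    show "ON G (yn k b)"
    proof (rule ON.ON)
      show "TC G (yn k b)"
      proof (rule TC_I)
        fix n show "\<exists>y. K1 G (pfst (yn k b)) <|psnd (yn k b), n|> y"
          using K_K1[OF s] K_K1[OF z] b by (cases n) (auto simp: yn_def)
      qed
      show "ON G c" if "ch G (yn k b) n = Suc c" for n c using that chs chz b by (cases n) auto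
    qed
  qed
qed

section \<open>The program\<close>

definition "kB = kcomp (kat kV (\<lambda>w. <|kV, psnd w, 0|>)) kpair"
definition "kArgs = kcomp (kar (\<lambda>v. <|<|kW, yn (pfst (pfst v)) (psnd v)|>, psnd v, psnd (pfst v), pfst (pfst v)|>))
  (kcomp kpair (list_encode [6, 0, 1, list_encode [6, 0, 2, kpair]]))"
text \<open>The value of \<open>kW\<close> is computed for the sake of its convergence only. It is
  then moved behind the argument of \<open>kFin\<close>, where it has no effect.\<close>

definition "kprog = kcomp (kcomp (kcomp (kswap kFin) (kcomp kW (kar pfst))) kArgs) kB"

lemma Kleene_kArgs: "Kleene kArgs [b, n, k] [] [E2, G] <|<|kW, yn k b|>, b, n, k|>"
proof -
  have "Kleene (list_encode [6, 0, 2, kpair]) [n, b, k] [] [E2, G] <|k, n|>"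
    by (rule Kleene.S6_0) (simp_all add: K_pair)
  then have 1: "Kleene (list_encode [6, 0, 1, list_encode [6, 0, 2, kpair]]) [b, n, k] [] [E2, G] <|k, n|>"
    by - (rule Kleene.S6_0, simp_all del: list_encode.simps)
  have ar: "ar (\<lambda>h v. <|<|kW, yn (pfst (pfst v)) (psnd v)|>, psnd v, psnd (pfst v), pfst (pfst v)|>)"
    unfolding yn_def by (intro ar_intros)
  from Kleene_kcomp[OF Kleene_kcomp[OF 1 K_pair] Kleene_kar[OF ar]] show ?thesis unfolding kArgs_def by simp
qed

lemma kprog_complete:
  assumes "hyperarithmetical2 G"
  shows "Kleene kprog [n, k] [] [E2, G] (code_list (Lambda0 G k) n)"
proof -
  obtain E and r :: nat where E: "arp (\<lambda>h x. E (pfst x) (psnd x))" "r \<in> acc {(x, y). E x y}"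
    "\<And>k. large G k (binary_functions G (hrank {(x, y). E x y} r))" using hyperarithmetical2_stage[OF assms] by blast
  from ar_uar[OF arp_ar[OF E(1)]] obtain c where c: "uar c = (\<lambda>h x. if E (pfst x) (psnd x) then 0 else 1)" by blast
  have "uar c (\<lambda>_. 0) x = 0 \<longleftrightarrow> E (pfst x) (psnd x)" for x by (simp add: c)
  from tree_arp[where E = E, OF this E(2)] have t: "ON G (tree <|c, r|>)" "LG G k (tree <|c, r|>)" using E(3) by simp_all
  from V_terminates[OF t] obtain b where b: "K G kV <|kV, k, 0|> b" "ON G b" "LG G k b" by blast
  have "K G (kat kV (\<lambda>w. <|kV, psnd w, 0|>)) <|n, k|> b" by (rule K_at'[OF _ _ b(1)], intro ar_intros) simp
  then have B: "Kleene kB [n, k] [] [E2, G] b" unfolding kB_def K_def by (blast intro: Kleene_kcomp K_pair)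
  have "ON G (yn k b)" using ON_yn b by blast
  from kW_complete[OF this] obtain v where v: "K G kW <|kW, yn k b|> v" by blast
  let ?x = "<|<|kW, yn k b|>, b, n, k|>"
  have W: "Kleene (kcomp kW (kar pfst)) [?x, b, n, k] [] [E2, G] v"
    using Kleene_kcomp[OF Kleene_kar[OF ar_proj(1)], of kW ?x "[b, n, k]" G v] v unfolding K_def by simp
  have "Kleene kFin (?x # [v, b, n, k]) [] [E2, G] (code_list (Lambda0 G k) n)" using K_kFin[OF b(2,3)] unfolding K_def by blast
  then have "Kleene (kcomp (kswap kFin) (kcomp kW (kar pfst))) [?x, b, n, k] [] [E2, G] (code_list (Lambda0 G k) n)"
    by (intro Kleene_kcomp[OF W] Kleene_kswap)
  then show ?thesis unfolding kprog_def by (intro Kleene_kcomp[OF B] Kleene_kcomp[OF Kleene_kArgs])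
qed

text \<open>For an arbitrary \<open>G\<close> nothing is known about the number \<open>b\<close>
  that the search returns. Convergence of the check supplies exactly the hypotheses of
  \<open>K_kFin\<close>.\<close>

lemma kprog_sound:
  assumes "Kleene kprog [n, k] [] [E2, G] c"
  shows "c = code_list (Lambda0 G k) n"
proof -
  from Kleene_S4_inv[OF assms[unfolded kprog_def]] obtain b where
    "Kleene (kcomp (kcomp (kswap kFin) (kcomp kW (kar pfst))) kArgs) [b, n, k] [] [E2, G] c" by blast
  from Kleene_S4_inv[OF this] obtain x where x: "Kleene kArgs [b, n, k] [] [E2, G] x"
    "Kleene (kcomp (kswap kFin) (kcomp kW (kar pfst))) [x, b, n, k] [] [E2, G] c" by blast
  have xe: "x = <|<|kW, yn k b|>, b, n, k|>" using Kleene_deterministic[OF x(1) Kleene_kArgs] .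
  from Kleene_S4_inv[OF x(2)] obtain v where v: "Kleene (kcomp kW (kar pfst)) [x, b, n, k] [] [E2, G] v"
    "Kleene (kswap kFin) [v, x, b, n, k] [] [E2, G] c" by blast
  from Kleene_S4_inv[OF v(1)] obtain y where y: "Kleene (kar pfst) [x, b, n, k] [] [E2, G] y" "Kleene kW [y, x, b, n, k] [] [E2, G] v" by blast
  have "y = <|kW, yn k b|>" using Kleene_deterministic[OF y(1) Kleene_kar[OF ar_proj(1)]] xe by simp
  then have "ON G (yn k b)" using kW_sound y(2) by blast
  then have "K G kFin x (code_list (Lambda0 G k) n)" unfolding ON_yn xe by (intro K_kFin) blast+
  then have "Kleene kFin [x, v, b, n, k] [] [E2, G] (code_list (Lambda0 G k) n)" unfolding K_def by blast
  then show ?thesis using Kleene_deterministic[OF Kleene_kswap_inv[OF v(2)]] by blast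
qed

lemma hyperarithmetical_Lambda0:
  assumes G: "hyperarithmetical2 G" and f: "f \<in> set (Lambda0 G k)"
  shows "hyperarithmetical f"
proof -
  from f obtain i where i: "i < length (Lambda0 G k)" "f = Lambda0 G k ! i" by (auto simp: in_set_conv_nth)
  have fj: "f j = code_list (Lambda0 G k) (Suc <|i, j|>)" for j using i by (simp add: code_list_def)
  \<comment> \<open>Feeds \<open>kprog\<close> the position at which \<open>code_list\<close> stores
    the value at \<open>j\<close> of the function with index \<open>i\<close>. The two permutations
    turn \<open>[position, j, k]\<close> into \<open>[position, k, j]\<close>, of which S9 passes on
    the first two.\<close>
  define e where "e = kcomp (list_encode [6, 0, 2, list_encode [6, 0, 1, kcomp (list_encode [9, 2, 0, 2]) (kconst kprog)]]) (kar (\<lambda>j. Suc <|i, j|>))"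
  have "Kleene e (j # [k]) [] [E2, G] (f j)" for j
  proof -
    let ?n = "Suc <|i, j|>"
    have "Kleene (list_encode [9, 2, 0, 2]) (kprog # [?n, k, j]) [] [E2, G] (f j)"
      unfolding fj by (rule Kleene.S9) (simp_all add: kprog_complete[OF G])
    from Kleene_kcomp[OF Kleene_kconst this]
    have "Kleene (list_encode [6, 0, 1, kcomp (list_encode [9, 2, 0, 2]) (kconst kprog)]) [k, ?n, j] [] [E2, G] (f j)"
      by - (rule Kleene.S6_0, simp_all del: list_encode.simps)
    then have 1: "Kleene (list_encode [6, 0, 2, list_encode [6, 0, 1, kcomp (list_encode [9, 2, 0, 2]) (kconst kprog)]]) [?n, j, k] [] [E2, G] (f j)"
      by - (rule Kleene.S6_0, simp_all del: list_encode.simps)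
    have "ar (\<lambda>h j. Suc <|i, j|>)" by (intro ar_intros)
    from Kleene_kcomp[OF Kleene_kar[OF this] 1] show ?thesis unfolding e_def .
  qed
  then show ?thesis by (rule hyperarithmetical_if_computable[OF G])
qed

theorem corollary5p11:
  shows "(\<forall>G. hyperarithmetical2 G \<longrightarrow> (\<forall>k. \<forall>f \<in> set (Lambda0 G k). hyperarithmetical f)) \<and>
    (\<exists>\<Lambda> :: type2 \<Rightarrow> nat \<Rightarrow> type1 list option.
       partial_computable_in_E2 \<Lambda> \<and>
       (\<forall>G k fs. \<Lambda> G k = Some fs \<longrightarrow> fs = Lambda0 G k) \<and>
       (\<forall>G. type2_computable_in_E2 G \<longrightarrow> (\<forall>k. \<Lambda> G k \<noteq> None)))"
proof (intro conjI allI impI ballI)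
  show "hyperarithmetical f" if "hyperarithmetical2 G" "f \<in> set (Lambda0 G k)" for G k f
    by (rule hyperarithmetical_Lambda0[OF that])
  \<comment> \<open>Defined where all values of \<open>kprog\<close> converge to the right numbers.
    By \<open>kprog_sound\<close> the only way to fail is divergence at some \<open>n\<close>, as
    \<open>partial_computable_in_E2\<close> demands.\<close>
  define \<Lambda> where "\<Lambda> G k = (if \<forall>n. Kleene kprog [n, k] [] [E2, G] (code_list (Lambda0 G k) n) then Some (Lambda0 G k) else None)" for G k
  have "partial_computable_in_E2 \<Lambda>"
    unfolding partial_computable_in_E2_def
  proof (intro exI[of _ kprog] allI)
    fix G k
    show "case \<Lambda> G k of None \<Rightarrow> \<exists>n. \<nexists>c. Kleene kprog [n, k] [] [E2, G] c
      | Some fs \<Rightarrow> \<forall>n. Kleene kprog [n, k] [] [E2, G] (code_list fs n)"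
    proof (cases "\<forall>n. Kleene kprog [n, k] [] [E2, G] (code_list (Lambda0 G k) n)")
      case False
      then have "\<exists>n. \<nexists>c. Kleene kprog [n, k] [] [E2, G] c" using kprog_sound by metis
      then show ?thesis using False by (simp add: \<Lambda>_def)
    qed (simp add: \<Lambda>_def)
  qed
  moreover have "\<Lambda> G k \<noteq> None" if "type2_computable_in_E2 G" for G k
    unfolding \<Lambda>_def using kprog_complete[OF hyperarithmetical2_if_computable[OF that]] by simp
  moreover have "fs = Lambda0 G k" if "\<Lambda> G k = Some fs" for G k fs
    using that unfolding \<Lambda>_def by (simp split: if_splits)
  ultimately show "\<exists>\<Lambda>. partial_computable_in_E2 \<Lambda> \<and> (\<forall>G k fs. \<Lambda> G k = Some fs \<longrightarrow> fs = Lambda0 G k) \<and>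
     (\<forall>G. type2_computable_in_E2 G \<longrightarrow> (\<forall>k. \<Lambda> G k \<noteq> None))" by blast
qed

end
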